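(* Consider the infinite-dimensional setting and the greedy subspace procedure described in the context, with $\ell>r$ and $$\widetilde\delta:=\min_{\mu\in\mathcal D}\lambda_{r+1}(\mu)-\max_{\mu\in\mathcal D}\lambda_r(\mu)>0 .$$ For every $\zeta>0$ there is a threshold $h_0>0$, depending only on the operators $A_m$, the functions $\theta_m$, $\mathcal D$, $\ell$, $r$ and $\zeta$, such that the following holds. Suppose the procedure is initialized with the points of a uniform grid for $\mathcal D$ of spacing at most $h_0$, and $\sigma_{\min}(\Theta^{(j)}(\mu))>\zeta$ for all $\mu\in\mathcal D$ and all $j\ge1$. Then there exists a real $\gamma>0$ independent of $j$ such that, for all $j\ge 1$, $$|H^{(j)}(\widetilde\mu)-H^{(j)}(\mu)|\le\gamma\|\widetilde\mu-\mu\|\quad\text{for all }\mu,\widetilde\mu\in\mathcal D.$$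
   Context: Setting. $\mathcal D\subset\mathbb R^p$ is compact; $A_1,\dots,A_\kappa:\ell^2(\mathbb N)\to\ell^2(\mathbb N)$ are compact self-adjoint operators; $\theta_1,\dots,\theta_\kappa:\mathbb R^p\to\mathbb R$ are real analytic; $\theta(\mu)=[\theta_1(\mu),\dots,\theta_\kappa(\mu)]^T$; $A(\mu)=\sum_{m=1}^\kappa\theta_m(\mu)A_m$. It is assumed that $A(\mu)$ has a negative eigenvalue for every $\mu$. $\lambda_k(\mu)$ denotes the $k$-th smallest eigenvalue of $A(\mu)$ counted with multiplicity (assumed to exist whenever it is used), and $\lambda_{\min}(\mu)=\lambda_1(\mu)$. Integers $1\le r\le\ell$ are fixed. $\|\cdot\|$ is the operator norm (Euclidean norm for vectors). Bounds from a finite point set. For $j\ge1$ let $P_j\subset\mathcal D$ be a finite set. For $\nu\in P_j$ let $v_1(\nu),\dots,v_\ell(\nu)$ be orthonormal eigenvectors of $A(\nu)$ for $\lambda_1(\nu),\dots,\lambda_\ell(\nu)$; $\Lambda^{(\nu)}=\mathrm{diag}(\lambda_1(\nu),\dots,\lambda_\ell(\nu))$; $V^{(\nu)}:\mathbb C^\ell\to\ell^2(\mathbb N)$, $V^{(\nu)}x=\sum_kx_kv_k(\nu)$. Put $\mathcal V_j=\mathrm{span}\{v_k(\nu):\nu\in P_j,1\le k\le\ell\}$, $d=\dim\mathcal V_j$, $V_j:\mathbb C^d\to\ell^2(\mathbb N)$ a linear isometry with range $\mathcal V_j$, $A^{V_j}(\mu)=V_j^*A(\mu)V_j$; $\lambda^{\mathcal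 V_j}_k(\mu)$ is the $k$-th smallest eigenvalue of $A^{V_j}(\mu)$, $\lambda^{\mathcal V_j}_{\min}=\lambda^{\mathcal V_j}_1$, and $w^{V_j}_1(\mu),\dots,w^{V_j}_r(\mu)$ are orthonormal eigenvectors for the $r$ smallest eigenvalues. Let $U_j(\mu):\mathbb C^r\to\ell^2(\mathbb N)$, $U_j(\mu)x=\sum_{k=1}^rx_kV_jw^{V_j}_k(\mu)$. Define - $\rho^{(j)}(\mu)=\|(I-U_j(\mu)U_j(\mu)^* )A(\mu)U_j(\mu)\|$; - for $\nu\in P_j$, $\beta^{(\nu,j)}(\mu)=\lambda_{\min}\big(\Lambda^{(\nu)}-\lambda_1(\nu)I_\ell-[V^{(\nu)}]^*U_j(\mu)U_j(\mu)^*V^{(\nu)}(\Lambda^{(\nu)}-\lambda_{\ell+1}(\nu)I_\ell)\big)$ (smallest eigenvalue of an $\ell\times\ell$ matrix with real eigenvalues); - $\mathcal B=\prod_{m=1}^\kappa[\lambda_{\min}(A_m),\lambda_{\max}(A_m)]$, the endpoints being the infimum and supremum of the Rayleigh quotients of $A_m$; - $\mathcal Y^{(j)}_{\mathrm{LB}}(\mu)=\{y\in\mathcal B:\theta(\nu)^Ty\ge\lambda_1(\nu)+\beta^{(\nu,j)}(\mu)\ \forall\nu\in P_j\}$; - $\eta^{(j)}_*(\mu)=\min\{\theta(\mu)^Ty:y\in\mathcal Y^{(j)}_{\mathrm{LB}}(\mu)\}$, with minimizer $y^{(j)}(\mu)$; - $$\lambda^{(j)}_{\mathrm{LB}}(\mu)=\min\{\lambda^{\mathcal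 V_j}_1(\mu),\eta^{(j)}_*(\mu)\}-\frac{2\rho^{(j)}(\mu)^2}{|\lambda^{\mathcal V_j}_1(\mu)-\eta^{(j)}_*(\mu)|+\sqrt{(\lambda^{\mathcal V_j}_1(\mu)-\eta^{(j)}_*(\mu))^2+4\rho^{(j)}(\mu)^2}}$$ (fraction equal to $0$ if it reads $0/0$); - $H^{(j)}(\mu)=\lambda^{\mathcal V_j}_{\min}(\mu)-\lambda^{(j)}_{\mathrm{LB}}(\mu)$. Matrix $\Theta^{(j)}(\mu)$. The minimizer $y^{(j)}(\mu)$ is taken to be one at which $\kappa$ linearly independent constraints of the linear program are active. The rows of $\Theta^{(j)}(\mu)\in\mathbb R^{\kappa\times\kappa}$ are the normals ($\theta(\nu)^T$ for a constraint of $\nu\in P_j$, $\mathbf e_m^T$ for a box constraint) of $\kappa$ linearly independent constraints active at $y^{(j)}(\mu)$; if several choices are possible, the one maximizing the smallest singular value $\sigma_{\min}(\Theta^{(j)}(\mu))$ is taken. Greedy subspace procedure. Choose initial points $\mu_{1,1},\dots,\mu_{1,N}\in\mathcal D$, $P_1=\{\mu_{1,1},\dots,\mu_{1,N}\}$. For $j=1,2,\dots$, let $\mu_{j+1}$ be a maximizer of $H^{(j)}$ over $\mathcal D$ and $P_{j+1}=P_j\cup\{\mu_{j+1}\}$. The procedure is run indefinitely (no termination). A uniform grid for $\mathcal D$ of spacing at most $h$ is a finite set of points of $\mathcal D$ lying on an axis-parallel uniform lattice with adjacent points at distance at most $h$, such that every point of $\mathcal D$ lies in a closed axis-parallel cube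 of side $h$ centred at a grid point. *)

theory Defs
  imports "HOL-Analysis.Analysis" "Jordan_Normal_Form.Char_Poly"
begin

no_notation Matrix.vec_index (infixl \<open>$\<close> 100)
no_notation Matrix.scalar_prod (infix \<open>\<bullet>\<close> 70)


section \<open>The complex Hilbert space of square summable sequences\<close>

typedef ell2 = "{x :: nat \<Rightarrow> complex. summable (\<lambda>n. (cmod (x n))\<^sup>2)}"
  morphisms seq Abs_ell2
  by (rule exI[of _ "\<lambda>_. 0"]) simp

setup_lifting type_definition_ell2

lemma summable_cmod_add:
  assumes "summable (\<lambda>n. (cmod (x n))\<^sup>2)" "summable (\<lambda>n. (cmod (y n))\<^sup>2)"
  shows "summable (\<lambda>n. (cmod (x n + y n))\<^sup>2)"
proof (rule summable_comparison_test')
  show "summable (\<lambda>n. 2 * (cmod (x n))\<^sup>2 + 2 * (cmod (y n))\<^sup>2)"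
    by (intro summable_add summable_mult assms)
  fix n
  have "(cmod (x n + y n))\<^sup>2 \<le> (cmod (x n) + cmod (y n))\<^sup>2"
    by (simp add: norm_triangle_ineq power_mono)
  also have "\<dots> \<le> 2 * (cmod (x n))\<^sup>2 + 2 * (cmod (y n))\<^sup>2"
    using sum_squares_bound[of "cmod (x n)" "cmod (y n)"] by (simp add: power2_sum)
  finally show "norm ((cmod (x n + y n))\<^sup>2) \<le> 2 * (cmod (x n))\<^sup>2 + 2 * (cmod (y n))\<^sup>2"
    by simp
qed

lemma summable_cmod_scale:
  assumes "summable (\<lambda>n. (cmod (x n))\<^sup>2)"
  shows "summable (\<lambda>n. (cmod (c * x n))\<^sup>2)"
  using summable_mult[OF assms, of "(cmod c)\<^sup>2"] by (simp add: norm_mult power_mult_distrib)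

lift_definition scaleC :: "complex \<Rightarrow> ell2 \<Rightarrow> ell2" (infixr "*\<^sub>C" 75)
  is "\<lambda>c x n. c * x n"
  by (rule summable_cmod_scale)

definition cinner :: "ell2 \<Rightarrow> ell2 \<Rightarrow> complex"
  where "cinner x y = (\<Sum>n. cnj (seq x n) * seq y n)"

lemma summable_seq: "summable (\<lambda>n. (cmod (seq x n))\<^sup>2)"
  using seq[of x] by simp

lemma summable_cinner: "summable (\<lambda>n. cnj (seq x n) * seq y n)"
proof (rule summable_comparison_test')
  show "summable (\<lambda>n. (cmod (seq x n))\<^sup>2 + (cmod (seq y n))\<^sup>2)"
    by (intro summable_add summable_seq)
  fix n
  have "2 * (cmod (seq x n) * cmod (seq y n)) \<le> (cmod (seq x n))\<^sup>2 + (cmod (seq y n))\<^sup>2"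
    using sum_squares_bound[of "cmod (seq x n)" "cmod (seq y n)"] by (simp only: mult.assoc)
  moreover have "0 \<le> cmod (seq x n) * cmod (seq y n)"
    by simp
  ultimately show "norm (cnj (seq x n) * seq y n) \<le> (cmod (seq x n))\<^sup>2 + (cmod (seq y n))\<^sup>2"
    unfolding norm_mult complex_mod_cnj real_norm_def by linarith
qed

instantiation ell2 :: real_vector
begin

lift_definition zero_ell2 :: ell2 is "\<lambda>_. 0" by simp

lift_definition plus_ell2 :: "ell2 \<Rightarrow> ell2 \<Rightarrow> ell2" is "\<lambda>x y n. x n + y n"
  by (rule summable_cmod_add)

lift_definition uminus_ell2 :: "ell2 \<Rightarrow> ell2" is "\<lambda>x n. - x n"
  by simp

lift_definition minus_ell2 :: "ell2 \<Rightarrow> ell2 \<Rightarrow> ell2" is "\<lambda>x y n. x n - y n"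
  using summable_cmod_add[of _ "\<lambda>n. - _ n"] by simp

lift_definition scaleR_ell2 :: "real \<Rightarrow> ell2 \<Rightarrow> ell2" is "\<lambda>c x n. of_real c * x n"
  by (rule summable_cmod_scale)

instance
  by standard (transfer; auto simp: algebra_simps)+

end

lemma seq_simps [simp]:
  "seq 0 n = 0" "seq (x + y) n = seq x n + seq y n" "seq (- x) n = - seq x n"
  "seq (x - y) n = seq x n - seq y n" "seq (a *\<^sub>R x) n = of_real a * seq x n"
  "seq (c *\<^sub>C x) n = c * seq x n"
  by (transfer; simp)+

lemma ell2_eqI: "(\<And>n. seq x n = seq y n) \<Longrightarrow> x = y"
  by transfer auto

global_interpretation ell2: vector_space scaleC
  by standard (auto intro!: ell2_eqI simp: algebra_simps)

instantiation ell2 :: real_inner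
begin

definition inner_ell2 :: "ell2 \<Rightarrow> ell2 \<Rightarrow> real" where "inner_ell2 x y = Re (cinner x y)"
definition norm_ell2 :: "ell2 \<Rightarrow> real" where "norm_ell2 x = sqrt (inner x x)"
definition dist_ell2 :: "ell2 \<Rightarrow> ell2 \<Rightarrow> real" where "dist_ell2 x y = norm (x - y)"
definition sgn_ell2 :: "ell2 \<Rightarrow> ell2" where "sgn_ell2 x = x /\<^sub>R norm x"
definition uniformity_ell2 :: "(ell2 \<times> ell2) filter"
  where "uniformity_ell2 = (INF e\<in>{0<..}. principal {(x, y). dist x y < e})"
definition open_ell2 :: "ell2 set \<Rightarrow> bool"
  where "open_ell2 U \<longleftrightarrow> (\<forall>x\<in>U. \<forall>\<^sub>F (x', y) in uniformity. x' = x \<longrightarrow> y \<in> U)"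

instance
proof
  fix x y z :: ell2 and r :: real
  have self: "inner x x = (\<Sum>n. (cmod (seq x n))\<^sup>2)" for x :: ell2
  proof -
    have "inner x x = (\<Sum>n. Re (cnj (seq x n) * seq x n))"
      unfolding inner_ell2_def cinner_def by (rule Re_suminf[OF summable_cinner])
    also have "(\<lambda>n. Re (cnj (seq x n) * seq x n)) = (\<lambda>n. (cmod (seq x n))\<^sup>2)"
      by (simp add: fun_eq_iff cmod_def power2_eq_square)
    finally show ?thesis .
  qed
  have expand: "inner x y = (\<Sum>n. Re (cnj (seq x n) * seq y n))" for x y :: ell2
    unfolding inner_ell2_def cinner_def by (rule Re_suminf[OF summable_cinner])
  have summ: "summable (\<lambda>n. Re (cnj (seq x n) * seq y n))" for x y :: ell2
    by (rule summable_Re[OF summable_cinner])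
  show "dist x y = norm (x - y)" by (rule dist_ell2_def)
  show "sgn x = x /\<^sub>R norm x" by (rule sgn_ell2_def)
  show "uniformity = (INF e\<in>{0<..}. principal {(x :: ell2, y). dist x y < e})"
    by (rule uniformity_ell2_def)
  show "open U \<longleftrightarrow> (\<forall>x\<in>U. \<forall>\<^sub>F (x', y) in uniformity. x' = x \<longrightarrow> y \<in> U)" for U :: "ell2 set"
    by (rule open_ell2_def)
  show "norm x = sqrt (inner x x)" by (rule norm_ell2_def)
  show "inner x y = inner y x"
    unfolding expand by (simp add: algebra_simps)
  show "inner (x + y) z = inner x z + inner y z"
    unfolding expand by (subst suminf_add[OF summ summ]) (simp add: algebra_simps)
  show "inner (r *\<^sub>R x) y = r * inner x y"
    unfolding expand by (subst suminf_mult[OF summ, symmetric]) (simp add: algebra_simps)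
  show "0 \<le> inner x x"
    unfolding self by (intro suminf_nonneg summable_seq) simp
  show "inner x x = 0 \<longleftrightarrow> x = 0"
    unfolding self by (subst suminf_eq_zero_iff[OF summable_seq]) (auto intro: ell2_eqI)
qed

end


section \<open>Operators on the sequence space and their smallest eigenvalues\<close>

definition compact_operator :: "(ell2 \<Rightarrow> ell2) \<Rightarrow> bool"
  where "compact_operator T \<longleftrightarrow>
    Vector_Spaces.linear scaleC scaleC T \<and> compact (closure (T ` cball 0 1))"

definition self_adjoint :: "(ell2 \<Rightarrow> ell2) \<Rightarrow> bool"
  where "self_adjoint T \<longleftrightarrow> (\<forall>x y. cinner (T x) y = cinner x (T y))"

definition orthonormal :: "nat \<Rightarrow> (nat \<Rightarrow> ell2) \<Rightarrow> bool"
  where "orthonormal n v \<longleftrightarrow> (\<forall>i<n. \<forall>j<n. cinner (v i) (v j) = (if i = j then 1 else 0))"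

definition is_eigenvalue :: "(ell2 \<Rightarrow> ell2) \<Rightarrow> real \<Rightarrow> bool"
  where "is_eigenvalue T t \<longleftrightarrow> (\<exists>x. x \<noteq> 0 \<and> T x = t *\<^sub>R x)"

text \<open>For self-adjoint \<^term>\<open>T\<close>: counted with multiplicity, at least \<^term>\<open>k\<close> eigenvalues
  do not exceed \<^term>\<open>t\<close>.\<close>

definition eigenvalues_le :: "(ell2 \<Rightarrow> ell2) \<Rightarrow> nat \<Rightarrow> real \<Rightarrow> bool"
  where "eigenvalues_le T k t \<longleftrightarrow>
    (\<exists>v. orthonormal k v \<and> (\<forall>i<k. \<exists>s\<le>t. T (v i) = s *\<^sub>R v i))"

text \<open>The numbering starts with \<^term>\<open>k = 1\<close>.  A smallest \<^term>\<open>t\<close> need not exist, for instance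
  if \<^term>\<open>T\<close> has fewer than \<^term>\<open>k\<close> eigenvalues below \<^term>\<open>0::real\<close> and its positive
  eigenvalues accumulate at \<^term>\<open>0::real\<close>.\<close>

definition is_kth_eigenvalue :: "(ell2 \<Rightarrow> ell2) \<Rightarrow> nat \<Rightarrow> real \<Rightarrow> bool"
  where "is_kth_eigenvalue T k t \<longleftrightarrow>
    k \<ge> 1 \<and> eigenvalues_le T k t \<and> (\<forall>s<t. \<not> eigenvalues_le T k s)"

definition kth_eigenvalue :: "(ell2 \<Rightarrow> ell2) \<Rightarrow> nat \<Rightarrow> real"
  where "kth_eigenvalue T k = (THE t. is_kth_eigenvalue T k t)"

definition rayleigh :: "(ell2 \<Rightarrow> ell2) \<Rightarrow> ell2 \<Rightarrow> real"
  where "rayleigh T x = Re (cinner x (T x)) / (norm x)\<^sup>2"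


section \<open>Finite families of vectors and matrices\<close>

text \<open>A family \<^term>\<open>v\<close> with indices below \<^term>\<open>n\<close> stands for the map from the \<^term>\<open>n\<close>-dimensional
  complex space that sends the unit vectors to the family; \<^term>\<open>analysis n v\<close> below is the adjoint
  of \<^term>\<open>synthesis n v\<close>.\<close>

definition synthesis :: "nat \<Rightarrow> (nat \<Rightarrow> ell2) \<Rightarrow> complex vec \<Rightarrow> ell2"
  where "synthesis n v x = (\<Sum>k<n. vec_index x k *\<^sub>C v k)"

definition analysis :: "nat \<Rightarrow> (nat \<Rightarrow> ell2) \<Rightarrow> ell2 \<Rightarrow> complex vec"
  where "analysis n v f = Matrix.vec n (\<lambda>k. cinner (v k) f)"

definition projection :: "nat \<Rightarrow> (nat \<Rightarrow> ell2) \<Rightarrow> ell2 \<Rightarrow> ell2"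
  where "projection n v f = synthesis n v (analysis n v f)"

text \<open>The matrix of the operator \<^term>\<open>\<lambda>x. analysis n v (T (synthesis n v x))\<close>.\<close>

definition compression :: "nat \<Rightarrow> (nat \<Rightarrow> ell2) \<Rightarrow> (ell2 \<Rightarrow> ell2) \<Rightarrow> complex mat"
  where "compression n v T = Matrix.mat n n (\<lambda>(i, j). cinner (v i) (T (v j)))"

definition vec_norm :: "complex vec \<Rightarrow> real"
  where "vec_norm x = sqrt (\<Sum>i<dim_vec x. (cmod (vec_index x i))\<^sup>2)"

definition operator_norm :: "nat \<Rightarrow> (complex vec \<Rightarrow> ell2) \<Rightarrow> real"
  where "operator_norm n T = (SUP x\<in>{x \<in> carrier_vec n. vec_norm x \<le> 1}. norm (T x))"

text \<open>For matrices with real eigenvalues; the numbering starts with \<^term>\<open>k = 1\<close>.\<close>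

definition mat_eigenvalue :: "complex mat \<Rightarrow> nat \<Rightarrow> real"
  where "mat_eigenvalue M k =
    sorted_list_of_multiset (image_mset Re (proots (char_poly M))) ! (k - 1)"

definition singular_value :: "real^'k^'k \<Rightarrow> real \<Rightarrow> bool"
  where "singular_value M s \<longleftrightarrow>
    s \<ge> 0 \<and> (\<exists>x. x \<noteq> 0 \<and> (Finite_Cartesian_Product.transpose M ** M) *v x = s\<^sup>2 *\<^sub>R x)"

definition sigma_min :: "real^'k^'k \<Rightarrow> real"
  where "sigma_min M = Min {s. singular_value M s}"


section \<open>Parameter dependence\<close>

definition real_analytic :: "(real^'p \<Rightarrow> real) \<Rightarrow> bool"
  where "real_analytic f \<longleftrightarrow>
    (\<forall>a. \<exists>e>0. \<exists>c :: ('p \<Rightarrow> nat) \<Rightarrow> real. \<forall>x\<in>ball a e.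
      ((\<lambda>\<alpha>. c \<alpha> * (\<Prod>i\<in>UNIV. (x $ i - a $ i) ^ \<alpha> i)) has_sum f x) UNIV)"

definition affine_family ::
    "('k::finite \<Rightarrow> ell2 \<Rightarrow> ell2) \<Rightarrow> (real^'p \<Rightarrow> real^'k) \<Rightarrow> real^'p \<Rightarrow> ell2 \<Rightarrow> ell2"
  where "affine_family Am \<theta> \<mu> x = (\<Sum>m\<in>UNIV. (\<theta> \<mu> $ m) *\<^sub>R Am m x)"

text \<open>The lattice may have a different spacing, at most \<^term>\<open>h\<close>, along each coordinate axis.\<close>

definition uniform_grid :: "(real^'p) set \<Rightarrow> real \<Rightarrow> (real^'p) set \<Rightarrow> bool"
  where "uniform_grid D h G \<longleftrightarrow>
    finite G \<and> G \<subseteq> D \<and>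
    (\<exists>a s. (\<forall>i. 0 < s $ i \<and> s $ i \<le> h) \<and>
      (\<forall>g\<in>G. \<forall>i. \<exists>n::int. g $ i = a $ i + of_int n * s $ i)) \<and>
    (\<forall>x\<in>D. \<exists>g\<in>G. \<forall>i. \<bar>x $ i - g $ i\<bar> \<le> h / 2)"


section \<open>Bounds from a finite set of points\<close>

text \<open>Throughout, \<^term>\<open>P\<close> is the finite point set; \<^term>\<open>v \<nu> i\<close> for \<^term>\<open>i < l\<close> is the
  eigenvector at \<^term>\<open>\<nu>\<close> for the eigenvalue number \<^term>\<open>i + 1\<close>; \<^term>\<open>V\<close> is an orthonormal
  basis of the trial space; \<^term>\<open>w \<mu> i\<close> for \<^term>\<open>i < r\<close> is the eigenvector of the projected
  matrix at \<^term>\<open>\<mu>\<close> for its eigenvalue number \<^term>\<open>i + 1\<close>.\<close>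

definition trial_space :: "nat \<Rightarrow> (real^'p) set \<Rightarrow> (real^'p \<Rightarrow> nat \<Rightarrow> ell2) \<Rightarrow> ell2 set"
  where "trial_space l P v = ell2.span {v \<nu> i | \<nu> i. \<nu> \<in> P \<and> i < l}"

definition trial_dim :: "nat \<Rightarrow> (real^'p) set \<Rightarrow> (real^'p \<Rightarrow> nat \<Rightarrow> ell2) \<Rightarrow> nat"
  where "trial_dim l P v = ell2.dim (trial_space l P v)"

definition eigenbasis :: "(ell2 \<Rightarrow> ell2) \<Rightarrow> nat \<Rightarrow> (nat \<Rightarrow> ell2) \<Rightarrow> bool"
  where "eigenbasis T l v \<longleftrightarrow>
    orthonormal l v \<and> (\<forall>i<l. T (v i) = kth_eigenvalue T (i + 1) *\<^sub>R v i)"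

definition trial_basis ::
    "nat \<Rightarrow> (real^'p) set \<Rightarrow> (real^'p \<Rightarrow> nat \<Rightarrow> ell2) \<Rightarrow> (nat \<Rightarrow> ell2) \<Rightarrow> bool"
  where "trial_basis l P v V \<longleftrightarrow>
    orthonormal (trial_dim l P v) V \<and> ell2.span (V ` {..<trial_dim l P v}) = trial_space l P v"

definition mat_eigenbasis :: "complex mat \<Rightarrow> nat \<Rightarrow> (nat \<Rightarrow> complex vec) \<Rightarrow> bool"
  where "mat_eigenbasis M r w \<longleftrightarrow>
    (\<forall>i<r. w i \<in> carrier_vec (dim_row M) \<and>
      M *\<^sub>v w i = of_real (mat_eigenvalue M (i + 1)) \<cdot>\<^sub>v w i) \<and>
    (\<forall>i<r. \<forall>j<r. w i \<bullet>c w j = (if i = j then 1 else 0))"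

definition ritz_family ::
    "nat \<Rightarrow> (real^'p) set \<Rightarrow> (real^'p \<Rightarrow> nat \<Rightarrow> ell2) \<Rightarrow> (nat \<Rightarrow> ell2) \<Rightarrow>
      (real^'p \<Rightarrow> nat \<Rightarrow> complex vec) \<Rightarrow> real^'p \<Rightarrow> nat \<Rightarrow> ell2"
  where "ritz_family l P v V w \<mu> i = synthesis (trial_dim l P v) V (w \<mu> i)"

definition residual :: "(ell2 \<Rightarrow> ell2) \<Rightarrow> nat \<Rightarrow> (nat \<Rightarrow> ell2) \<Rightarrow> real"
  where "residual T r u =
    operator_norm r (\<lambda>x. T (synthesis r u x) - projection r u (T (synthesis r u x)))"

definition beta :: "(ell2 \<Rightarrow> ell2) \<Rightarrow> nat \<Rightarrow> (nat \<Rightarrow> ell2) \<Rightarrow> nat \<Rightarrow> (nat \<Rightarrow> ell2) \<Rightarrow> real"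
  where "beta T l v r u =
    (let \<Lambda> = mat_diag l (\<lambda>i. complex_of_real (kth_eigenvalue T (i + 1)))
     in mat_eigenvalue
          (\<Lambda> - of_real (kth_eigenvalue T 1) \<cdot>\<^sub>m 1\<^sub>m l
            - compression l v (projection r u)
              * (\<Lambda> - of_real (kth_eigenvalue T (l + 1)) \<cdot>\<^sub>m 1\<^sub>m l)) 1)"

definition box_lower :: "('k \<Rightarrow> ell2 \<Rightarrow> ell2) \<Rightarrow> 'k \<Rightarrow> real"
  where "box_lower Am m = (INF x\<in>-{0}. rayleigh (Am m) x)"

definition box_upper :: "('k \<Rightarrow> ell2 \<Rightarrow> ell2) \<Rightarrow> 'k \<Rightarrow> real"
  where "box_upper Am m = (SUP x\<in>-{0}. rayleigh (Am m) x)"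

definition box :: "('k::finite \<Rightarrow> ell2 \<Rightarrow> ell2) \<Rightarrow> (real^'k) set"
  where "box Am = {y. \<forall>m. box_lower Am m \<le> y $ m \<and> y $ m \<le> box_upper Am m}"

context
  fixes Am :: "'k::finite \<Rightarrow> ell2 \<Rightarrow> ell2"
    and \<theta> :: "real^'p::finite \<Rightarrow> real^'k"
    and l r :: nat
    and P :: "(real^'p) set"
    and v :: "real^'p \<Rightarrow> nat \<Rightarrow> ell2"
    and V :: "nat \<Rightarrow> ell2"
    and w :: "real^'p \<Rightarrow> nat \<Rightarrow> complex vec"
begin

definition ritz_matrix :: "real^'p \<Rightarrow> complex mat"
  where "ritz_matrix \<mu> = compression (trial_dim l P v) V (affine_family Am \<theta> \<mu>)"

definition ritz_min :: "real^'p \<Rightarrow> real"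
  where "ritz_min \<mu> = mat_eigenvalue (ritz_matrix \<mu>) 1"

definition rho :: "real^'p \<Rightarrow> real"
  where "rho \<mu> = residual (affine_family Am \<theta> \<mu>) r (ritz_family l P v V w \<mu>)"

definition lp_bound :: "real^'p \<Rightarrow> real^'p \<Rightarrow> real"
  where "lp_bound \<mu> \<nu> = kth_eigenvalue (affine_family Am \<theta> \<nu>) 1 +
    beta (affine_family Am \<theta> \<nu>) l (v \<nu>) r (ritz_family l P v V w \<mu>)"

definition Y_LB :: "real^'p \<Rightarrow> (real^'k) set"
  where "Y_LB \<mu> = {y \<in> box Am. \<forall>\<nu>\<in>P. \<theta> \<nu> \<bullet> y \<ge> lp_bound \<mu> \<nu>}"

definition eta :: "real^'p \<Rightarrow> real"
  where "eta \<mu> = (INF y\<in>Y_LB \<mu>. \<theta> \<mu> \<bullet> y)"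

text \<open>Division by zero yields the intended value \<^term>\<open>0::real\<close> of the fraction.\<close>

definition lambda_LB :: "real^'p \<Rightarrow> real"
  where "lambda_LB \<mu> = min (ritz_min \<mu>) (eta \<mu>) -
    2 * (rho \<mu>)\<^sup>2 /
      (\<bar>ritz_min \<mu> - eta \<mu>\<bar> + sqrt ((ritz_min \<mu> - eta \<mu>)\<^sup>2 + 4 * (rho \<mu>)\<^sup>2))"

definition gap_H :: "real^'p \<Rightarrow> real"
  where "gap_H \<mu> = ritz_min \<mu> - lambda_LB \<mu>"

definition active_normals :: "real^'p \<Rightarrow> real^'k \<Rightarrow> (real^'k) set"
  where "active_normals \<mu> y =
    {\<theta> \<nu> | \<nu>. \<nu> \<in> P \<and> \<theta> \<nu> \<bullet> y = lp_bound \<mu> \<nu>} \<union>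
    {axis m 1 | m. y $ m = box_lower Am m \<or> y $ m = box_upper Am m}"

definition active_matrix :: "real^'p \<Rightarrow> real^'k \<Rightarrow> real^'k^'k \<Rightarrow> bool"
  where "active_matrix \<mu> y \<Theta> \<longleftrightarrow>
    (\<forall>i. \<Theta> $ i \<in> active_normals \<mu> y) \<and> inj (($) \<Theta>) \<and> independent (range (($) \<Theta>))"

definition lp_vertex :: "real^'p \<Rightarrow> real^'k \<Rightarrow> real^'k^'k \<Rightarrow> bool"
  where "lp_vertex \<mu> y \<Theta> \<longleftrightarrow>
    y \<in> Y_LB \<mu> \<and> (\<forall>z\<in>Y_LB \<mu>. \<theta> \<mu> \<bullet> y \<le> \<theta> \<mu> \<bullet> z) \<and>
    active_matrix \<mu> y \<Theta> \<and> (\<forall>\<Theta>'. active_matrix \<mu> y \<Theta>' \<longrightarrow> sigma_min \<Theta>' \<le> sigma_min \<Theta>)"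

end


section \<open>The greedy procedure\<close>

text \<open>The point sets are \<^term>\<open>P j\<close> for \<^term>\<open>j \<ge> 1\<close>; \<^term>\<open>v\<close>, \<^term>\<open>V\<close> and \<^term>\<open>w\<close> are any
  admissible choices of eigenvectors and bases.\<close>

definition greedy_run ::
    "('k::finite \<Rightarrow> ell2 \<Rightarrow> ell2) \<Rightarrow> (real^'p::finite \<Rightarrow> real^'k) \<Rightarrow> (real^'p) set \<Rightarrow> nat \<Rightarrow> nat \<Rightarrow>
      (nat \<Rightarrow> (real^'p) set) \<Rightarrow> (real^'p \<Rightarrow> nat \<Rightarrow> ell2) \<Rightarrow> (nat \<Rightarrow> nat \<Rightarrow> ell2) \<Rightarrow>
      (nat \<Rightarrow> real^'p \<Rightarrow> nat \<Rightarrow> complex vec) \<Rightarrow> bool"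
  where "greedy_run Am \<theta> D l r P v V w \<longleftrightarrow>
    finite (P 1) \<and> P 1 \<noteq> {} \<and> P 1 \<subseteq> D \<and>
    (\<forall>j\<ge>1. (\<forall>\<nu>\<in>P j. (\<exists>t. is_kth_eigenvalue (affine_family Am \<theta> \<nu>) (l + 1) t) \<and>
        eigenbasis (affine_family Am \<theta> \<nu>) l (v \<nu>)) \<and>
      trial_basis l (P j) v (V j) \<and>
      (\<forall>\<mu>\<in>D. mat_eigenbasis (ritz_matrix Am \<theta> l (P j) v (V j) \<mu>) r (w j \<mu>)) \<and>
      (\<exists>\<mu>'\<in>D.
        (\<forall>\<mu>\<in>D. gap_H Am \<theta> l r (P j) v (V j) (w j) \<mu> \<le> gap_H Am \<theta> l r (P j) v (V j) (w j) \<mu>') \<and>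
        P (Suc j) = insert \<mu>' (P j)))"

end

theory Submission
  imports Defs
begin

text \<open>Let \<open>\<alpha> < \<beta>\<close> be the endpoints of the spectral gap, \<open>\<rho>\<close> the residual and \<open>X\<close> the sum of the dual
  multipliers of the points of \<open>P j\<close> in the linear program at \<open>\<mu>\<close>.  By duality the optimal value varies
  with a Lipschitz constant of order \<open>1 + X\<close>.  On a fine grid it exceeds the smallest Ritz value by at least
  \<open>(\<beta> - \<alpha>) / 2\<close>, and then the gap function depends on it only with weight \<open>\<rho>\<^sup>2\<close>.  So it suffices to bound
  \<open>\<rho>\<^sup>2 X\<close> uniformly in \<open>j\<close> and \<open>\<mu>\<close>.

  Suppose that \<open>\<rho>\<^sup>2 X\<close> blows up along \<open>(j n, \<mu> n)\<close>.  The multipliers of a single level are bounded, so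
  \<open>j n\<close> tends to infinity, and we may assume \<open>\<mu> n \<longlonglongrightarrow> \<mu>\<^sub>0\<close>.  The greedy choice forces the eigenvectors at all
  points of \<open>D\<close> into the closure of the union of the trial spaces; let \<open>E\<close> be the spectral projection at
  \<open>\<mu>\<^sub>0\<close>.  The operator \<open>S = \<Sum>\<nu>. x \<nu> A \<nu>\<close> is at most \<open>\<alpha> X / 2\<close> on the range of \<open>E\<close>, where \<open>\<alpha> < 0\<close>, while by
  complementary slackness its form is bounded below on the complement of the Ritz space and its component
  orthogonal to the range of \<open>E\<close> is bounded.  Hence the Ritz projection is within \<open>O(1 / sqrt X)\<close> of \<open>E\<close>.
  The defects \<open>A (\<mu> n) e - E (A (\<mu> n) e)\<close>, for \<open>e\<close> in the range of \<open>E\<close>, belong to a fixed finite-dimensional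
  space, on which the trial projections converge uniformly.  Therefore the eigenvectors at \<open>\<mu> n\<close>, being in
  the closure of the trial spaces, also approach the range of \<open>E\<close> at the rate \<open>O(1 / sqrt X)\<close>.  This gives
  \<open>\<rho> = O(1 / sqrt X)\<close>, a contradiction.\<close>

section \<open>Operators and projections\<close>

text \<open>Duality bounds the multipliers only level by level: the constant comes from the finitely
  many cones of active normals, and each greedy step adds normals. The product with the squared
  residual stays bounded because all terms in the dual formula for the optimal value are
  nonpositive: heavily weighted constraints must have levels near 0, and the level of a sample is at
  most a negative multiple of the squared distance of its eigenvectors from the Ritz space. The
  obstacle is the residual. Closeness of the Ritz space to the range of \<open>E\<close> controls
  the part of \<open>A e\<close> inside the trial space, but not the part outside. The latter is
  tested against the exact eigenvectors at \<open>\<mu> n\<close>, which see it only through later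
  trial spaces; on a fixed finite-dimensional space these projections differ from the present one by
  a factor \<open>\<eta>\<close> tending to 0. The defect thus satisfies
  \<open>\<tau> \<le> c * (2 * K * d + \<eta> * \<tau>)\<close>, and the last term is absorbed. As
  \<open>\<eta>\<close> tends to 0 without a rate, the bound is reached by contradiction along a
  sequence.\<close>

lemma cinner_add_right: "cinner x (y + z) = cinner x y + cinner x z"
  using suminf_add[OF summable_cinner[of x y] summable_cinner[of x z]]
  unfolding cinner_def by (simp add: distrib_left)

lemma cinner_scaleC_right: "cinner x (c *\<^sub>C y) = c * cinner x y"
  unfolding cinner_def
  by (subst suminf_mult[OF summable_cinner, symmetric]) (simp add: algebra_simps)

lemma cinner_commute: "cinner x y = cnj (cinner y x)"
proof -
  have "(\<lambda>n. cnj (seq y n) * seq x n) sums cinner y x"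
    unfolding cinner_def by (rule summable_sums[OF summable_cinner])
  then have "(\<lambda>n. cnj (cnj (seq y n) * seq x n)) sums cnj (cinner y x)"
    by (subst sums_cnj)
  then show ?thesis
    unfolding cinner_def by (simp add: sums_iff mult.commute)
qed

lemma cinner_add_left: "cinner (x + y) z = cinner x z + cinner y z"
  by (metis cinner_add_right cinner_commute complex_cnj_add)

lemma cinner_scaleC_left: "cinner (c *\<^sub>C x) y = cnj c * cinner x y"
  by (metis cinner_scaleC_right cinner_commute complex_cnj_mult)

lemma scaleR_scaleC: "r *\<^sub>R (x::ell2) = of_real r *\<^sub>C x"
  by (rule ell2_eqI) simp

lemma cinner_scaleR_right: "cinner x (r *\<^sub>R y) = of_real r * cinner x y"
  and cinner_scaleR_left: "cinner (r *\<^sub>R x) y = of_real r * cinner x y"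
  by (simp_all add: scaleR_scaleC cinner_scaleC_right cinner_scaleC_left)

lemma cinner_zero [simp]: "cinner x 0 = 0" "cinner 0 x = 0"
  by (simp_all add: cinner_def)

lemma cinner_minus_right: "cinner x (- y) = - cinner x y"
  using cinner_scaleR_right[of x "-1" y] by simp

lemma cinner_diff_right: "cinner x (y - z) = cinner x y - cinner x z"
  using cinner_add_right[of x y "- z"] by (simp add: cinner_minus_right)

lemma cinner_diff_left: "cinner (x - y) z = cinner x z - cinner y z"
  by (metis cinner_diff_right cinner_commute complex_cnj_diff)

lemma cinner_sum_right: "cinner x (sum f A) = (\<Sum>i\<in>A. cinner x (f i))"
  by (induction A rule: infinite_finite_induct) (auto simp: cinner_add_right)

lemma cinner_sum_left: "cinner (sum f A) y = (\<Sum>i\<in>A. cinner (f i) y)"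
  by (induction A rule: infinite_finite_induct) (auto simp: cinner_add_left)

lemmas cinner_simps = cinner_add_right cinner_add_left cinner_diff_right cinner_diff_left
  cinner_scaleC_right cinner_scaleC_left cinner_scaleR_right cinner_scaleR_left

lemma inner_cinner: "inner x y = Re (cinner x y)"
  by (rule inner_ell2_def)

lemma cinner_self: "cinner x x = of_real ((norm x)\<^sup>2)"
proof -
  have "Im (cinner x x) = 0"
    using cinner_commute[of x x] by (metis Im_complex_of_real complex_cnj_cancel_iff complex_is_Real_iff Reals_cnj_iff)
  moreover have "Re (cinner x x) = (norm x)\<^sup>2"
    by (metis inner_cinner power2_norm_eq_inner)
  ultimately show ?thesis
    by (simp add: complex_eq_iff)
qed

lemma norm_scaleC: "norm (c *\<^sub>C x) = cmod c * norm (x::ell2)"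
proof -
  have "of_real ((norm (c *\<^sub>C x))\<^sup>2) = complex_of_real ((cmod c * norm x)\<^sup>2)"
    unfolding cinner_self[symmetric] cinner_scaleC_left cinner_scaleC_right
    by (simp add: cinner_self power_mult_distrib mult_ac complex_norm_square[of c, unfolded of_real_power])
  then show ?thesis
    by (simp only: of_real_eq_iff) (simp add: power2_eq_iff_nonneg)
qed

lemma cmod_cinner_le: "cmod (cinner x y) \<le> norm x * norm y"
proof (cases "cinner x y = 0")
  case False
  \<comment> \<open>A unimodular factor rotates the complex inner product to the positive real axis,
    which leaves the real Cauchy-Schwarz inequality.\<close>
  define c where "c = cinner x y / cmod (cinner x y)"
  have c: "cmod c = 1"
    using False by (simp add: c_def norm_divide)
  have "cnj c * cinner x y = of_real (cmod (cinner x y))"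
    using False unfolding c_def
    by (simp add: divide_simps) (metis complex_norm_square mult.commute of_real_mult power2_eq_square)
  then have "cmod (cinner x y) = inner (c *\<^sub>C x) y"
    by (simp add: inner_cinner cinner_scaleC_left)
  also have "\<dots> \<le> norm (c *\<^sub>C x) * norm y"
    by (rule norm_cauchy_schwarz)
  finally show ?thesis
    by (simp add: norm_scaleC c)
qed simp

abbreviation clinear :: "(ell2 \<Rightarrow> ell2) \<Rightarrow> bool"
  where "clinear \<equiv> Vector_Spaces.linear scaleC scaleC"

lemma clinearI:
  assumes "\<And>x y. T (x + y) = T x + T y" "\<And>c x. T (c *\<^sub>C x) = c *\<^sub>C T x"
  shows "clinear T"
  by unfold_locales (simp_all add: assms)

lemma
  assumes "clinear T"
  shows clinear_add: "T (x + y) = T x + T y"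
    and clinear_scaleC: "T (c *\<^sub>C x) = c *\<^sub>C T x"
    and clinear_scaleR: "T (r *\<^sub>R x) = r *\<^sub>R T x"
    and clinear_zero: "T 0 = 0"
    and clinear_diff: "T (x - y) = T x - T y"
    and clinear_sum: "T (sum f A) = (\<Sum>i\<in>A. T (f i))"
proof -
  interpret Vector_Spaces.linear scaleC scaleC T by fact
  show "T (x + y) = T x + T y" "T (c *\<^sub>C x) = c *\<^sub>C T x" "T 0 = 0" "T (x - y) = T x - T y"
    "T (sum f A) = (\<Sum>i\<in>A. T (f i))" "T (r *\<^sub>R x) = r *\<^sub>R T x"
    by (simp_all add: add scale zero diff sum scaleR_scaleC)
qed

lemma self_adjoint_inner: "self_adjoint T \<Longrightarrow> inner (T x) y = inner x (T y)"
  by (simp add: self_adjoint_def inner_cinner)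

lemma self_adjoint_cinner: "self_adjoint T \<Longrightarrow> cinner (T x) y = cinner x (T y)"
  by (simp add: self_adjoint_def)

lemma inner_commute_selfadj: "self_adjoint T \<Longrightarrow> inner x (T y) = inner y (T x)"
  by (metis inner_commute self_adjoint_inner)

section \<open>Orthogonal projections\<close>

definition ortho_proj :: "(ell2 \<Rightarrow> ell2) \<Rightarrow> bool"
  where "ortho_proj P \<longleftrightarrow> clinear P \<and> (\<forall>x. P (P x) = P x) \<and> self_adjoint P"

context
  fixes P assumes P: "ortho_proj P"
begin

lemma ortho_proj_linear: "clinear P" and ortho_proj_idem: "P (P x) = P x"
  and ortho_proj_selfadj: "self_adjoint P"
  using P by (auto simp: ortho_proj_def)

lemma ortho_proj_inner: "inner (P x) y = inner x (P y)"
  by (rule self_adjoint_inner[OF ortho_proj_selfadj])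

lemma ortho_proj_inner_self: "inner (P x) x = (norm (P x))\<^sup>2"
  by (metis ortho_proj_idem ortho_proj_inner inner_commute power2_norm_eq_inner)

lemma ortho_proj_orthogonal: "inner (P x) (y - P y) = 0"
  by (simp add: inner_diff_right ortho_proj_inner ortho_proj_idem)

lemma ortho_proj_pythagoras: "(norm x)\<^sup>2 = (norm (P x))\<^sup>2 + (norm (x - P x))\<^sup>2"
proof -
  have "(norm (P x + (x - P x)))\<^sup>2 = (norm (P x))\<^sup>2 + (norm (x - P x))\<^sup>2"
    by (rule norm_add_Pythagorean) (simp add: real_inner_class.orthogonal_def ortho_proj_orthogonal)
  then show ?thesis by simp
qed

lemma ortho_proj_norm_le: "norm (P x) \<le> norm x"
  using ortho_proj_pythagoras[of x] by (auto intro: power2_le_imp_le[OF _ norm_ge_zero])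

lemma ortho_proj_compl_norm_le: "norm (x - P x) \<le> norm x"
  using ortho_proj_pythagoras[of x] by (auto intro: power2_le_imp_le[OF _ norm_ge_zero])

lemma ortho_proj_compl: "ortho_proj (\<lambda>x. x - P x)"
  unfolding ortho_proj_def self_adjoint_def
  by (auto intro!: clinearI simp: clinear_add[OF ortho_proj_linear] clinear_diff[OF ortho_proj_linear]
      clinear_scaleC[OF ortho_proj_linear] ortho_proj_idem ell2.scale_right_diff_distrib cinner_diff_left
      cinner_diff_right self_adjoint_cinner[OF ortho_proj_selfadj])

end

section \<open>Finite orthonormal families, their projections and the gap between their
  spans\<close>

lemma orthonormalD: "orthonormal n v \<Longrightarrow> i < n \<Longrightarrow> j < n \<Longrightarrow> cinner (v i) (v j) = (if i = j then 1 else 0)"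
  by (simp add: orthonormal_def)

lemma orthonormal_norm: "orthonormal n v \<Longrightarrow> i < n \<Longrightarrow> norm (v i) = 1"
  using orthonormalD[of n v i i] arg_cong[OF cinner_self[of "v i"], of Re]
  by (simp add: power2_eq_1_iff norm_eq_square)

lemma orthonormal_mono: "orthonormal n v \<Longrightarrow> m \<le> n \<Longrightarrow> orthonormal m v"
  by (auto simp: orthonormal_def)

lemma projection_eq: "projection n v f = (\<Sum>k<n. cinner (v k) f *\<^sub>C v k)"
  by (simp add: projection_def synthesis_def analysis_def)

lemma projection_linear: "clinear (projection n v)"
  unfolding projection_eq
  by (rule clinearI) (simp_all add: cinner_simps ell2.scale_left_distrib sum.distrib ell2.scale_sum_right)

lemma cinner_lincomb:
  assumes "orthonormal n v" "i < n"
  shows "cinner (v i) (\<Sum>k<n. c k *\<^sub>C v k) = c i"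
proof -
  have "cinner (v i) (\<Sum>k<n. c k *\<^sub>C v k) = (\<Sum>k<n. c k * (if i = k then 1 else 0))"
    unfolding cinner_sum_right cinner_scaleC_right
    by (rule sum.cong) (use assms in \<open>auto simp: orthonormalD\<close>)
  also have "\<dots> = (\<Sum>k<n. if k = i then c i else 0)"
    by (rule sum.cong) auto
  finally show ?thesis using assms by simp
qed

lemma norm_lincomb:
  assumes "orthonormal n v"
  shows "(norm (\<Sum>k<n. c k *\<^sub>C v k))\<^sup>2 = (\<Sum>k<n. (cmod (c k))\<^sup>2)"
proof -
  have "complex_of_real ((norm (\<Sum>k<n. c k *\<^sub>C v k))\<^sup>2) = (\<Sum>i<n. cnj (c i) * cinner (v i) (\<Sum>k<n. c k *\<^sub>C v k))"
    unfolding cinner_self[symmetric] by (subst cinner_sum_left) (simp add: cinner_scaleC_left)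
  also have "\<dots> = (\<Sum>i<n. of_real ((cmod (c i))\<^sup>2))"
    by (rule sum.cong) (use assms in \<open>auto simp: cinner_lincomb complex_norm_square[unfolded of_real_power] mult.commute\<close>)
  finally show ?thesis
    by (simp only: of_real_sum[symmetric] of_real_eq_iff)
qed

lemma projection_basis: "orthonormal n v \<Longrightarrow> i < n \<Longrightarrow> projection n v (v i) = v i"
  unfolding projection_eq
  by (subst sum.cong[OF refl, of _ _ "\<lambda>k. if k = i then v i else 0"]) (auto simp: orthonormalD)

lemma cinner_projection: "orthonormal n v \<Longrightarrow> i < n \<Longrightarrow> cinner (v i) (projection n v x) = cinner (v i) x"
  unfolding projection_eq by (rule cinner_lincomb)

lemma ortho_proj_projection:
  assumes "orthonormal n v"
  shows "ortho_proj (projection n v)"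
proof -
  have "projection n v (projection n v x) = projection n v x" for x
    by (subst (1) projection_eq) (simp add: cinner_projection assms projection_eq[symmetric] cong: sum.cong_simp)
  moreover have "self_adjoint (projection n v)"
    unfolding self_adjoint_def projection_eq cinner_sum_left cinner_sum_right cinner_simps
    by (metis (no_types, lifting) cinner_commute mult.commute sum.cong)
  ultimately show ?thesis
    by (simp add: ortho_proj_def projection_linear)
qed

lemma projection_norm: "orthonormal n v \<Longrightarrow> (norm (projection n v x))\<^sup>2 = (\<Sum>k<n. (cmod (cinner (v k) x))\<^sup>2)"
  unfolding projection_eq by (rule norm_lincomb)

lemma projection_eq_0_iff: "orthonormal n v \<Longrightarrow> projection n v x = 0 \<longleftrightarrow> (\<forall>k<n. cinner (v k) x = 0)"
  using projection_norm[of n v x] by (auto simp: sum_nonneg_eq_0_iff projection_eq)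

lemma projection_eq_0_inner:
  assumes "orthonormal n v" "projection n v x = 0" "projection n v y = y"
  shows "inner x y = 0"
  by (metis assms ortho_proj_inner ortho_proj_projection inner_zero_left)

lemma projection_in_span: "projection n v x \<in> ell2.span (v ` {..<n})"
  unfolding projection_eq
  by (intro ell2.span_sum ell2.span_scale ell2.span_base) auto

lemma projection_fixes_iff:
  assumes "orthonormal n v"
  shows "projection n v x = x \<longleftrightarrow> x \<in> ell2.span (v ` {..<n})"
proof
  assume "x \<in> ell2.span (v ` {..<n})"
  then show "projection n v x = x"
  proof (induction rule: ell2.span_induct_alt)
    case base
    show ?case by (simp add: projection_eq)
  next
    case (step c x y)
    then show ?case
      using assms by (auto simp: clinear_add[OF projection_linear] clinear_scaleC[OF projection_linear]
          projection_basis)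
  qed
qed (metis projection_in_span)

text \<open>Both sides equal \<^term>\<open>n\<close> minus the squared Hilbert-Schmidt norm of the product of the
  projections.\<close>

lemma gap_symmetric:
  assumes v: "orthonormal n v" and e: "orthonormal n e"
  shows "(\<Sum>k<n. (norm (v k - projection n e (v k)))\<^sup>2) = (\<Sum>k<n. (norm (e k - projection n v (e k)))\<^sup>2)"
proof -
  have *: "(\<Sum>k<n. (norm (v k - projection n e (v k)))\<^sup>2)
      = real n - (\<Sum>k<n. \<Sum>i<n. (cmod (cinner (e i) (v k)))\<^sup>2)"
    if "orthonormal n v" "orthonormal n e" for v e
  proof -
    have "(norm (v k - projection n e (v k)))\<^sup>2 = 1 - (\<Sum>i<n. (cmod (cinner (e i) (v k)))\<^sup>2)" if "k < n" for k
      using ortho_proj_pythagoras[OF ortho_proj_projection[OF \<open>orthonormal n e\<close>], of "v k"]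
        orthonormal_norm[OF \<open>orthonormal n v\<close> that] projection_norm[OF \<open>orthonormal n e\<close>, of "v k"] by simp
    then show ?thesis by (simp add: sum_subtractf)
  qed
  have "(\<Sum>k<n. \<Sum>i<n. (cmod (cinner (e i) (v k)))\<^sup>2) = (\<Sum>k<n. \<Sum>i<n. (cmod (cinner (v i) (e k)))\<^sup>2)"
    by (subst sum.swap) (metis (no_types, lifting) cinner_commute complex_mod_cnj sum.cong)
  then show ?thesis
    by (simp add: *[OF v e] *[OF e v])
qed

lemma cmod_cinner_le_1: "orthonormal n v \<Longrightarrow> k < n \<Longrightarrow> cmod (cinner (v k) x) \<le> norm x"
  using cmod_cinner_le[of "v k" x] by (simp add: orthonormal_norm)

text \<open>The coefficients are estimated one by one, so the factor is \<open>n\<close> rather than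
  its square root; in the quantitative applications \<open>n = r\<close>, a fixed constant.\<close>

lemma norm_on_span_le:
  assumes v: "orthonormal n v" and T: "clinear T" and le: "\<And>k. k < n \<Longrightarrow> norm (T (v k)) \<le> \<epsilon>"
    and x: "projection n v x = x"
  shows "norm (T x) \<le> real n * \<epsilon> * norm x"
proof -
  have "T x = (\<Sum>k<n. cinner (v k) x *\<^sub>C T (v k))"
    by (subst x[symmetric], subst projection_eq) (simp add: clinear_sum[OF T] clinear_scaleC[OF T])
  also have "norm \<dots> \<le> (\<Sum>k<n. norm x * \<epsilon>)"
    by (rule sum_norm_le) (use le in \<open>auto simp: norm_scaleC intro!: mult_mono cmod_cinner_le_1[OF v]\<close>)
  finally show ?thesis by (simp add: algebra_simps)
qed

text \<open>\<open>gap_symmetric\<close> turns smallness on the basis \<open>v\<close> into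
  smallness on the basis \<open>e\<close>. With \<open>\<epsilon> = 0\<close> this is the fact that
  a subspace contained in another one of the same finite dimension equals it.\<close>

lemma gap_symmetric_le:
  assumes v: "orthonormal n v" and e: "orthonormal n e"
    and le: "\<And>k. k < n \<Longrightarrow> norm (v k - projection n e (v k)) \<le> \<epsilon>" and x: "projection n e x = x"
  shows "norm (x - projection n v x) \<le> (real n)\<^sup>2 * \<epsilon> * norm x"
proof -
  have "norm (e k - projection n v (e k)) \<le> real n * \<epsilon>" if k: "k < n" for k
  proof -
    have e0: "0 \<le> \<epsilon>" using le[OF k] norm_ge_zero by (rule order.trans[rotated])
    have "(norm (e k - projection n v (e k)))\<^sup>2 \<le> (\<Sum>k<n. (norm (e k - projection n v (e k)))\<^sup>2)"
      by (rule member_le_sum) (use k in auto)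
    also have "\<dots> = (\<Sum>k<n. (norm (v k - projection n e (v k)))\<^sup>2)"
      by (rule gap_symmetric[OF e v])
    also have "\<dots> \<le> (\<Sum>k<n. \<epsilon>\<^sup>2)"
      by (intro sum_mono power_mono) (use le in auto)
    also have "\<dots> \<le> (real n * \<epsilon>)\<^sup>2"
      using k mult_right_mono[of "real n" "(real n)\<^sup>2" "\<epsilon>\<^sup>2"]
      by (simp add: power_mult_distrib) (simp add: power2_eq_square)
    finally show ?thesis
      using e0 by (simp add: abs_le_square_iff[symmetric])
  qed
  from norm_on_span_le[OF e ortho_proj_linear[OF ortho_proj_compl[OF ortho_proj_projection[OF v]]] this x]
  show ?thesis by (simp add: power2_eq_square mult.assoc)
qed

text \<open>\<open>P - Q\<close> is the difference of \<open>P (I - Q)\<close> and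
  \<open>(I - P) Q\<close>. Hypothesis \<open>PQ\<close> bounds the latter; the former is the
  adjoint of \<open>(I - Q) P\<close>, which \<open>QP\<close> bounds.\<close>

lemma ortho_proj_diff_le:
  assumes P: "ortho_proj P" and Q: "ortho_proj Q"
    and PQ: "\<And>x. norm (Q x - P (Q x)) \<le> \<epsilon> * norm x" and QP: "\<And>x. norm (P x - Q (P x)) \<le> \<epsilon> * norm x"
  shows "norm (P x - Q x) \<le> 2 * \<epsilon> * norm x"
proof -
  define w where "w = P (x - Q x)"
  have "(norm w)\<^sup>2 = inner w (x - Q x)"
    unfolding w_def by (rule ortho_proj_inner_self[OF P, symmetric])
  also have "\<dots> = inner (w - Q w) x"
    by (simp add: inner_diff_left inner_diff_right ortho_proj_inner[OF Q])
  also have "\<dots> \<le> norm (w - Q w) * norm x"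
    by (rule norm_cauchy_schwarz)
  also have "\<dots> \<le> (\<epsilon> * norm w) * norm x"
    using QP[of w] by (intro mult_right_mono) (auto simp: w_def ortho_proj_idem[OF P])
  finally have "norm w * norm w \<le> norm w * (\<epsilon> * norm x)"
    by (simp add: power2_eq_square mult_ac)
  moreover have "0 \<le> \<epsilon> * norm x"
    using PQ[of x] norm_ge_zero by (rule order.trans[rotated])
  ultimately have w: "norm w \<le> \<epsilon> * norm x"
    by (metis mult_le_cancel_left norm_ge_zero le_less)
  have "P x - Q x = w - (Q x - P (Q x))"
    by (simp add: w_def clinear_diff[OF ortho_proj_linear[OF P]])
  then have "norm (P x - Q x) \<le> norm w + norm (Q x - P (Q x))"
    by (metis norm_triangle_ineq4)
  then show ?thesis
    using w PQ[of x] by simp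
qed

text \<open>The squared Hilbert-Schmidt norm of the product of the two projections is
  \<open>n\<close> when summed along \<open>v\<close>, and at most \<open>m\<close> when summed
  along \<open>u\<close>.\<close>

lemma orthonormal_card_le:
  assumes v: "orthonormal n v" and u: "orthonormal m u" and fixed: "\<And>k. k < n \<Longrightarrow> projection m u (v k) = v k"
  shows "n \<le> m"
proof -
  have "real n = (\<Sum>k<n. (norm (projection m u (v k)))\<^sup>2)"
    using orthonormal_norm[OF v] by (simp add: fixed)
  also have "\<dots> = (\<Sum>i<m. \<Sum>k<n. (cmod (cinner (u i) (v k)))\<^sup>2)"
    by (simp add: projection_norm[OF u] sum.swap[of _ "{..<n}"])
  also have "\<dots> = (\<Sum>i<m. (norm (projection n v (u i)))\<^sup>2)"
    unfolding projection_norm[OF v] by (metis (no_types, lifting) cinner_commute complex_mod_cnj sum.cong)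
  also have "\<dots> \<le> (\<Sum>i<m. 1)"
    by (intro sum_mono power_le_one)
      (use ortho_proj_norm_le[OF ortho_proj_projection[OF v]] orthonormal_norm[OF u] in \<open>auto, metis\<close>)
  finally show ?thesis by simp
qed

lemma orthonormal_extend:
  assumes v: "orthonormal n v" and x: "norm x = 1" "\<And>k. k < n \<Longrightarrow> cinner (v k) x = 0"
  shows "orthonormal (Suc n) (v(n := x))"
  unfolding orthonormal_def
proof (intro allI impI)
  fix i j assume ij: "i < Suc n" "j < Suc n"
  have "cinner x (v k) = 0" if "k < n" for k
    using x(2)[OF that] cinner_commute[of x "v k"] by simp
  moreover have "cinner x x = 1"
    by (simp add: cinner_self x)
  ultimately show "cinner ((v(n := x)) i) ((v(n := x)) j) = (if i = j then 1 else 0)"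
    using ij x orthonormalD[OF v] by (auto simp: less_Suc_eq)
qed

text \<open>A linear map from dimension \<open>n + 1\<close> to dimension \<open>n\<close> has a
  kernel; here the map is the projection onto the span of \<open>e\<close>. This is the dimension
  count behind both halves of the min-max principle for Ritz values.\<close>

lemma exists_orthogonal_in_span:
  assumes u: "orthonormal (Suc n) u" and e: "orthonormal n e"
  obtains x where "x \<noteq> 0" "projection (Suc n) u x = x" "projection n e x = 0"
proof (rule ccontr)
  assume "\<not> thesis"
  with that have inj: "x = 0" if "projection (Suc n) u x = x" "projection n e x = 0" for x
    using that by blast
  let ?P = "projection n e"
  have inj_u: "inj_on u {..<Suc n}"
    by (rule inj_onI) (metis lessThan_iff orthonormalD[OF u] zero_neq_one)
  have u0: "ell2.independent (u ` {..<Suc n})"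
  proof (rule ell2.independent_if_scalars_zero)
    fix f x assume s: "(\<Sum>x\<in>u ` {..<Suc n}. f x *\<^sub>C x) = 0" and "x \<in> u ` {..<Suc n}"
    then obtain i where i: "i < Suc n" "x = u i" by auto
    have "(\<Sum>k<Suc n. f (u k) *\<^sub>C u k) = 0"
      using s by (subst (asm) sum.reindex[OF inj_u]) (simp add: o_def)
    then show "f x = 0"
      using cinner_lincomb[OF u i(1), of "\<lambda>k. f (u k)"] i by (metis cinner_zero(1))
  qed simp
  interpret L: Vector_Spaces.linear scaleC scaleC ?P by (rule projection_linear)
  have injP: "inj_on ?P (ell2.span (u ` {..<Suc n}))"
    unfolding L.inj_on_iff_eq_0[OF ell2.subspace_span]
    using inj projection_fixes_iff[OF u] by blast
  have "ell2.independent (?P ` u ` {..<Suc n})"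
    by (rule L.independent_inj_on_image[OF u0 injP])
  moreover have "?P ` u ` {..<Suc n} \<subseteq> ell2.span (e ` {..<n})"
    using projection_in_span by blast
  ultimately have "card (?P ` u ` {..<Suc n}) \<le> card (e ` {..<n})"
    using ell2.independent_span_bound by blast
  moreover have "card (?P ` u ` {..<Suc n}) = Suc n"
    using inj_on_subset[OF injP ell2.span_superset] inj_u by (simp add: card_image)
  moreover have "card (e ` {..<n}) \<le> n"
    by (metis card_image_le card_lessThan finite_lessThan)
  ultimately show False by simp
qed

section \<open>Spectral theory of compact self-adjoint operators\<close>

lemma bounded_linear_cinner: "bounded_linear (cinner a)"
  by (rule bounded_linear_intro[where K = "norm a"])
    (auto simp: cinner_simps scaleR_conv_of_real, metis cmod_cinner_le mult.commute)

lemma compact_operator_linear: "compact_operator T \<Longrightarrow> clinear T"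
  by (simp add: compact_operator_def)

lemma compact_operatorI:
  assumes "clinear T" "compact C" "T ` cball 0 1 \<subseteq> C"
  shows "compact_operator T"
proof -
  have "closure (T ` cball 0 1) \<subseteq> C"
    using assms by (simp add: closure_minimal compact_imp_closed)
  then have "compact (closure (T ` cball 0 1))"
    by (metis assms(2) closed_closure compact_Int_closed inf.absorb_iff2)
  with assms(1) show ?thesis by (simp add: compact_operator_def)
qed

lemma compact_operator_bounded:
  assumes "compact_operator T"
  obtains K where "K > 0" "\<And>x. norm (T x) \<le> K * norm x"
proof -
  have "bounded (T ` cball 0 1)"
    by (rule bounded_subset[OF compact_imp_bounded closure_subset]) (use assms in \<open>simp add: compact_operator_def\<close>)
  then obtain K where K: "K > 0" "\<And>x. x \<in> cball 0 1 \<Longrightarrow> norm (T x) \<le> K"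
    by (auto simp: bounded_pos)
  have "norm (T x) \<le> K * norm x" for x
  proof (cases "x = 0")
    case False
    have "norm (T (inverse (norm x) *\<^sub>R x)) \<le> K"
      by (rule K) (use False in simp)
    then show ?thesis
      using False by (simp add: clinear_scaleR[OF compact_operator_linear[OF assms]] field_simps)
  qed (simp add: clinear_zero[OF compact_operator_linear[OF assms]])
  with K(1) show ?thesis by (rule that)
qed

lemma clinear_bounded_linear:
  assumes "clinear T" "\<And>x. norm (T x) \<le> K * norm x"
  shows "bounded_linear T"
  by (rule bounded_linear_intro[where K = K])
    (use assms in \<open>auto simp: clinear_add clinear_scaleR mult.commute\<close>)

lemma compact_operator_subseq:
  assumes "compact_operator T" "\<And>n::nat. norm (x n) \<le> 1"
  obtains s f where "strict_mono s" "(\<lambda>n. T (x (s n))) \<longlonglongrightarrow> f"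
proof -
  have "compact (closure (T ` cball 0 1))"
    using assms by (simp add: compact_operator_def)
  moreover have "T (x n) \<in> closure (T ` cball 0 1)" for n
    using assms(2) by (intro subsetD[OF closure_subset] imageI) simp
  ultimately obtain f s where "strict_mono s" "((\<lambda>n. T (x n)) \<circ> s) \<longlonglongrightarrow> f"
    unfolding compact_def by metis
  then show ?thesis using that by (simp add: o_def)
qed

lemma compact_operator_add:
  assumes "compact_operator S" "compact_operator T"
  shows "compact_operator (\<lambda>x. S x + T x)"
proof (rule compact_operatorI)
  show "clinear (\<lambda>x. S x + T x)"
    by (rule clinearI) (use assms[THEN compact_operator_linear] in
        \<open>auto simp: clinear_add clinear_scaleC ell2.scale_right_distrib\<close>)
  show "compact {x + y |x y. x \<in> closure (S ` cball 0 1) \<and> y \<in> closure (T ` cball 0 1)}"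
    by (rule compact_sums) (use assms in \<open>auto simp: compact_operator_def\<close>)
  show "(\<lambda>x. S x + T x) ` cball 0 1 \<subseteq> {x + y |x y. x \<in> closure (S ` cball 0 1) \<and> y \<in> closure (T ` cball 0 1)}"
    using closure_subset[of "S ` cball 0 1"] closure_subset[of "T ` cball 0 1"] by blast
qed

lemma compact_operator_scaleR:
  assumes "compact_operator T"
  shows "compact_operator (\<lambda>x. c *\<^sub>R T x)"
proof (rule compact_operatorI)
  show "clinear (\<lambda>x. c *\<^sub>R T x)"
    by (rule clinearI) (use compact_operator_linear[OF assms] in
        \<open>auto simp: clinear_add clinear_scaleC scaleR_right_distrib scaleR_scaleC mult.commute
          ell2.scale_right_distrib\<close>)
  show "compact ((*\<^sub>R) c ` closure (T ` cball 0 1))"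
    by (rule compact_scaling) (use assms in \<open>auto simp: compact_operator_def\<close>)
  show "(\<lambda>x. c *\<^sub>R T x) ` cball 0 1 \<subseteq> (*\<^sub>R) c ` closure (T ` cball 0 1)"
    using closure_subset[of "T ` cball 0 1"] by blast
qed

lemma compact_operator_zero: "compact_operator (\<lambda>x. 0)"
  by (rule compact_operatorI[where C = "{0}"]) (auto intro!: clinearI)

lemma compact_operator_sum:
  assumes "finite I" "\<And>i. i \<in> I \<Longrightarrow> compact_operator (T i)"
  shows "compact_operator (\<lambda>x. \<Sum>i\<in>I. T i x)"
  using assms by (induction I) (auto intro: compact_operator_zero compact_operator_add)

text \<open>The subspace matters for the construction of eigenvectors, where the form is known to be
  nonnegative only on the orthogonal complement of those already found.\<close>

lemma form_Cauchy_Schwarz: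
  assumes T: "clinear T" "self_adjoint T"
    and W: "subspace W" "\<And>x. x \<in> W \<Longrightarrow> 0 \<le> inner x (T x)" and x: "x \<in> W" and y: "y \<in> W"
  shows "(inner x (T y))\<^sup>2 \<le> inner x (T x) * inner y (T y)"
proof -
  define a b c where "a = inner x (T x)" and "b = inner x (T y)" and "c = inner y (T y)"
  have b: "inner y (T x) = b"
    by (simp add: b_def inner_commute_selfadj[OF T(2), of y x])
  have q: "0 \<le> a + 2 * t * b + t\<^sup>2 * c" for t
  proof -
    have "0 \<le> inner (x + t *\<^sub>R y) (T (x + t *\<^sub>R y))"
      by (intro W(2) subspace_add[OF W(1)] subspace_scale[OF W(1)] x y)
    also have "\<dots> = a + 2 * t * b + t\<^sup>2 * c"
      using b by (simp add: clinear_add[OF T(1)] clinear_scaleR[OF T(1)] inner_add_left inner_add_right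
          a_def b_def c_def power2_eq_square algebra_simps)
    finally show ?thesis .
  qed
  have "c \<ge> 0" "a \<ge> 0" using W(2) x y by (auto simp: a_def c_def)
  have "b\<^sup>2 \<le> a * c"
  proof (cases "c = 0")
    case True
    have "b = 0"
    proof (rule ccontr)
      assume "b \<noteq> 0"
      \<comment> \<open>With \<open>c = 0\<close> the polynomial is affine in \<open>t\<close>, and
        this \<open>t\<close> gives it the value -1. For \<open>c > 0\<close> the vertex is used
        instead.\<close>
      with q[of "- (a + 1) / (2 * b)"] True show False by (simp add: field_simps)
    qed
    then show ?thesis using True by simp
  next
    case False
    with q[of "- b / c"] \<open>c \<ge> 0\<close> show ?thesis
      by (simp add: power2_eq_square field_simps)
  qed
  then show ?thesis by (simp add: a_def b_def c_def)
qed

section \<open>Eigenvectors from minimizing the form on an orthogonal complement\<close>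

definition ortho_compl :: "nat \<Rightarrow> (nat \<Rightarrow> ell2) \<Rightarrow> ell2 set"
  where "ortho_compl n v = {x. \<forall>i<n. cinner (v i) x = 0}"

lemma subspace_ortho_compl: "subspace (ortho_compl n v)"
  by (auto simp: subspace_def ortho_compl_def cinner_simps)

lemma ortho_compl_projection: "orthonormal n v \<Longrightarrow> x \<in> ortho_compl n v \<longleftrightarrow> projection n v x = 0"
  by (simp add: ortho_compl_def projection_eq_0_iff)

lemma ortho_compl_minus_projection: "orthonormal n v \<Longrightarrow> x - projection n v x \<in> ortho_compl n v"
  by (simp add: ortho_compl_def cinner_diff_right cinner_projection)

lemma ortho_compl_invariant:
  assumes "self_adjoint T" "\<And>i. i < n \<Longrightarrow> T (v i) = s i *\<^sub>R v i" "x \<in> ortho_compl n v"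
  shows "T x \<in> ortho_compl n v"
  using assms unfolding ortho_compl_def
  by (auto simp: self_adjoint_cinner[OF assms(1), symmetric] cinner_scaleR_left)

text \<open>With \<open>m\<close> the infimum on the unit sphere of the complement, the shift
  \<open>S = T - m\<close> is nonnegative there, so Cauchy-Schwarz for its form gives
  \<open>S (x k) \<longlonglongrightarrow> 0\<close> along a minimizing sequence. Compactness makes
  \<open>T (x k)\<close> converge along a subsequence, and then \<open>x k\<close> itself converges
  because \<open>m\<close> is not 0; this is the role of the negative value at
  \<open>x0\<close>.\<close>

proposition negative_form_attains_min:
  assumes T: "compact_operator T" "self_adjoint T"
    and v: "\<And>i. i < n \<Longrightarrow> T (v i) = s i *\<^sub>R v i"
    and x0: "x0 \<in> ortho_compl n v" "inner x0 (T x0) < 0"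
  obtains u m where "norm u = 1" "u \<in> ortho_compl n v" "T u = m *\<^sub>R u" "m < 0"
    "\<And>x. x \<in> ortho_compl n v \<Longrightarrow> m * (norm x)\<^sup>2 \<le> inner x (T x)"
proof -
  let ?W = "ortho_compl n v"
  note lin = compact_operator_linear[OF T(1)]
  obtain K where K: "K > 0" "\<And>x. norm (T x) \<le> K * norm x"
    using compact_operator_bounded[OF T(1)] by blast
  define F where "F = (\<lambda>x. inner x (T x)) ` {x \<in> ?W. norm x = 1}"
  have form_scale: "inner (c *\<^sub>R x) (T (c *\<^sub>R x)) = c\<^sup>2 * inner x (T x)" for c x
    by (simp add: clinear_scaleR[OF lin] power2_eq_square)
  have abs_form: "\<bar>inner x (T x)\<bar> \<le> K * (norm x)\<^sup>2" for x
  proof -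
    have "\<bar>inner x (T x)\<bar> \<le> norm x * norm (T x)" by (rule Cauchy_Schwarz_ineq2)
    also have "\<dots> \<le> norm x * (K * norm x)" by (intro mult_left_mono K) simp
    finally show ?thesis by (simp add: power2_eq_square mult_ac)
  qed
  have "- K \<le> a" if "a \<in> F" for a
  proof -
    obtain x where "norm x = 1" "a = inner x (T x)" using \<open>a \<in> F\<close> by (auto simp: F_def)
    then show ?thesis using abs_form[of x] by simp
  qed
  then have bdd: "bdd_below F" by (rule bdd_belowI)
  define m where "m = Inf F"
  have "x0 \<noteq> 0" using x0 by (auto simp: clinear_zero[OF lin])
  define y0 where "y0 = inverse (norm x0) *\<^sub>R x0"
  have y0: "y0 \<in> ?W" "norm y0 = 1"
    using \<open>x0 \<noteq> 0\<close> x0 subspace_scale[OF subspace_ortho_compl] by (auto simp: y0_def)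
  then have y0F: "inner y0 (T y0) \<in> F" by (auto simp: F_def)
  have "inner y0 (T y0) < 0"
    unfolding y0_def form_scale using x0 \<open>x0 \<noteq> 0\<close> by (simp add: mult_pos_neg)
  then have m0: "m < 0"
    using cInf_lower[OF y0F bdd] by (simp add: m_def)
  have lower: "m * (norm x)\<^sup>2 \<le> inner x (T x)" if x: "x \<in> ?W" for x
  proof (cases "x = 0")
    case False
    have "inner (inverse (norm x) *\<^sub>R x) (T (inverse (norm x) *\<^sub>R x)) \<in> F"
      unfolding F_def by (intro imageI) (use False x subspace_scale[OF subspace_ortho_compl] in simp)
    then have "m \<le> inner (inverse (norm x) *\<^sub>R x) (T (inverse (norm x) *\<^sub>R x))"
      unfolding m_def using bdd by (rule cInf_lower)
    then show ?thesis
      unfolding form_scale using False by (simp add: field_simps)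
  qed simp
  define S where "S = (\<lambda>x. T x - m *\<^sub>R x)"
  have S: "clinear S" "self_adjoint S"
    unfolding S_def self_adjoint_def
    by (auto intro!: clinearI simp: clinear_add[OF lin] clinear_scaleC[OF lin] scaleR_scaleC
        ell2.scale_right_distrib ell2.scale_right_diff_distrib mult.commute cinner_simps
        self_adjoint_cinner[OF T(2)])
  have S_form: "inner x (S x) = inner x (T x) - m * (norm x)\<^sup>2" for x
    by (simp add: S_def inner_diff_right power2_norm_eq_inner)
  have S_W: "S x \<in> ?W" if "x \<in> ?W" for x
    unfolding S_def using that
    by (intro subspace_diff[OF subspace_ortho_compl] subspace_scale[OF subspace_ortho_compl]
        ortho_compl_invariant[OF T(2) v])
  have S_norm: "norm (S x) \<le> (K - m) * norm x" for x
    using K(2)[of x] norm_triangle_ineq4[of "T x" "m *\<^sub>R x"] m0 by (simp add: S_def algebra_simps)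
  have "\<exists>x. x \<in> ?W \<and> norm x = 1 \<and> inner x (T x) < m + 1 / real (Suc k)" for k
  proof -
    have "\<exists>a\<in>F. a < m + 1 / real (Suc k)"
      using cInf_lessD[of F "m + 1 / real (Suc k)"] y0F by (auto simp: m_def)
    then show ?thesis by (auto simp: F_def)
  qed
  then obtain x where x: "\<And>k. x k \<in> ?W" "\<And>k. norm (x k) = 1"
    "\<And>k. inner (x k) (T (x k)) < m + 1 / real (Suc k)" by metis
  \<comment> \<open>Cauchy-Schwarz for the pair \<open>S (x k)\<close>, \<open>x k\<close>: the
    first factor is bounded through the norm bound \<open>K - m\<close> of \<open>S\<close>, the
    second is the distance of the form from its infimum.\<close>
  have Sx: "(norm (S (x k)))\<^sup>2 ^ 2 \<le> (K - m) ^ 3 * (1 / real (Suc k))" for k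
  proof -
    have "(norm (S (x k)))\<^sup>2 ^ 2 = (inner (S (x k)) (S (x k)))\<^sup>2"
      by (simp add: power2_norm_eq_inner)
    also have "\<dots> \<le> inner (S (x k)) (S (S (x k))) * inner (x k) (S (x k))"
      by (rule form_Cauchy_Schwarz[OF S subspace_ortho_compl[of n v]]) (auto simp: S_form lower S_W x)
    also have "\<dots> \<le> (K - m) ^ 3 * (1 / real (Suc k))"
    proof (rule mult_mono)
      have "inner (S (x k)) (S (S (x k))) \<le> norm (S (x k)) * norm (S (S (x k)))"
        by (rule norm_cauchy_schwarz)
      also have "\<dots> \<le> (K - m) * ((K - m) * (K - m))"
        using S_norm[of "x k"] S_norm[of "S (x k)"] x(2)[of k] m0 K(1)
        by (intro mult_mono) (auto intro: order.trans mult_left_mono)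
      finally show "inner (S (x k)) (S (S (x k))) \<le> (K - m) ^ 3"
        by (simp add: power3_eq_cube mult_ac)
      show "inner (x k) (S (x k)) \<le> 1 / real (Suc k)"
        using x(2,3)[of k] by (simp add: S_form)
      show "0 \<le> inner (x k) (S (x k))"
        using lower[OF x(1)[of k]] by (simp add: S_form)
    qed (use m0 K in auto)
    finally show ?thesis .
  qed
  have "(\<lambda>k. (K - m) ^ 3 * (1 / real (Suc k))) \<longlonglongrightarrow> (K - m) ^ 3 * 0"
    by (intro tendsto_intros LIMSEQ_inverse_real_of_nat[unfolded inverse_eq_divide])
  then have "(\<lambda>k. (K - m) ^ 3 * (1 / real (Suc k))) \<longlonglongrightarrow> 0"
    by simp
  then have "(\<lambda>k. (norm (S (x k)))\<^sup>2 ^ 2) \<longlonglongrightarrow> 0"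
    by (rule Lim_null_comparison[rotated]) (use Sx in \<open>simp del: of_nat_Suc\<close>)
  from tendsto_real_sqrt[OF tendsto_real_sqrt[OF this]]
  have "(\<lambda>k. norm (S (x k))) \<longlonglongrightarrow> 0"
    by (simp only: real_sqrt_abs abs_power2 abs_norm_cancel real_sqrt_zero)
  then have S0: "(\<lambda>k. S (x k)) \<longlonglongrightarrow> 0"
    by (rule tendsto_norm_zero_cancel)
  obtain q f where q: "strict_mono q" and f: "(\<lambda>k. T (x (q k))) \<longlonglongrightarrow> f"
    using compact_operator_subseq[OF T(1), of x] x(2) by auto
  have S0q: "(\<lambda>k. S (x (q k))) \<longlonglongrightarrow> 0"
    using LIMSEQ_subseq_LIMSEQ[OF S0 q] by (simp add: o_def)
  \<comment> \<open>\<open>x = (T x - S x) / m\<close>, so the minimizing sequence converges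
    together with the two images.\<close>
  have "(\<lambda>k. inverse m *\<^sub>R (T (x (q k)) - S (x (q k)))) \<longlonglongrightarrow> inverse m *\<^sub>R (f - 0)"
    by (intro tendsto_intros f S0q)
  then have u: "(\<lambda>k. x (q k)) \<longlonglongrightarrow> inverse m *\<^sub>R f"
    using m0 by (simp add: S_def)
  define u where "u = inverse m *\<^sub>R f"
  note u = u[folded u_def]
  show thesis
  proof
    have "(\<lambda>k. norm (x (q k))) \<longlonglongrightarrow> norm u"
      by (intro tendsto_intros u)
    then show "norm u = 1"
      by (simp add: x LIMSEQ_const_iff)
    show "u \<in> ?W"
      unfolding ortho_compl_def
    proof (intro CollectI allI impI)
      fix i assume i: "i < n"
      have "(\<lambda>k. cinner (v i) (x (q k))) \<longlonglongrightarrow> cinner (v i) u"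
        by (rule bounded_linear.tendsto[OF bounded_linear_cinner u])
      moreover have "cinner (v i) (x (q k)) = 0" for k
        using x(1) i by (simp add: ortho_compl_def)
      ultimately show "cinner (v i) u = 0"
        by (simp add: LIMSEQ_const_iff)
    qed
    have "(\<lambda>k. S (x (q k))) \<longlonglongrightarrow> S u"
      by (rule bounded_linear.tendsto[OF clinear_bounded_linear[OF S(1) S_norm] u])
    with S0q have "S u = 0"
      using LIMSEQ_unique by blast
    then show "T u = m *\<^sub>R u"
      by (simp add: S_def)
  qed (use m0 lower in auto)
qed

section \<open>Unit sequences, and orthonormal systems of eigenvectors of any length\<close>

lift_definition unit_seq :: "nat \<Rightarrow> ell2" is "\<lambda>n k. if k = n then 1 else 0"
  by (rule summable_finite[of "{_}"]) auto

lemma seq_unit_seq: "seq (unit_seq n) k = (if k = n then 1 else 0)"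
  by transfer simp

lemma cinner_unit_seq: "cinner (unit_seq n) x = seq x n"
proof -
  have "cinner (unit_seq n) x = (\<Sum>k. if k = n then seq x n else 0)"
    unfolding cinner_def seq_unit_seq by (rule suminf_cong) auto
  also have "\<dots> = seq x n"
    by (subst suminf_finite[of "{n}"]) auto
  finally show ?thesis .
qed

lemma orthonormal_unit_seq: "orthonormal n unit_seq"
  by (simp add: orthonormal_def cinner_unit_seq seq_unit_seq)

lemma seq_tendsto_0: "(\<lambda>n. seq x n) \<longlonglongrightarrow> 0"
proof -
  have "(\<lambda>n. (cmod (seq x n))\<^sup>2) \<longlonglongrightarrow> 0"
    by (rule summable_LIMSEQ_zero[OF summable_seq])
  then have "(\<lambda>n. cmod (seq x n)) \<longlonglongrightarrow> 0"
    using tendsto_real_sqrt by fastforce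
  then show ?thesis by (rule tendsto_norm_zero_cancel)
qed

text \<open>Infinite dimension enters here: \<open>n + 1\<close> unit sequences cannot all lie in a
  span of dimension \<open>n\<close>.\<close>

lemma exists_in_ortho_compl:
  assumes "orthonormal n v"
  obtains x where "x \<in> ortho_compl n v" "norm x = 1"
proof -
  obtain i where "projection n v (unit_seq i) \<noteq> unit_seq i"
    using orthonormal_card_le[OF orthonormal_unit_seq[of "Suc n"] assms] by fastforce
  then have x: "unit_seq i - projection n v (unit_seq i) \<noteq> 0" by auto
  show thesis
  proof
    show "inverse (norm (unit_seq i - projection n v (unit_seq i))) *\<^sub>R (unit_seq i - projection n v (unit_seq i))
        \<in> ortho_compl n v"
      by (intro subspace_scale[OF subspace_ortho_compl] ortho_compl_minus_projection assms)
  qed (use x in simp)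
qed

lemma exists_eigenvector:
  assumes T: "compact_operator T" "self_adjoint T" and on: "orthonormal n v"
    and v: "\<And>i. i < n \<Longrightarrow> T (v i) = s i *\<^sub>R v i"
  obtains u m where "norm u = 1" "u \<in> ortho_compl n v" "T u = m *\<^sub>R u"
proof -
  let ?W = "ortho_compl n v"
  note lin = compact_operator_linear[OF T(1)]
  consider (neg) x where "x \<in> ?W" "inner x (T x) < 0" | (pos) x where "x \<in> ?W" "inner x (T x) > 0"
    | (zero) "\<And>x. x \<in> ?W \<Longrightarrow> inner x (T x) = 0"
    by (metis linorder_neqE_linordered_idom)
  then show thesis
  proof cases
    case neg
    then show ?thesis using negative_form_attains_min[OF T v neg] that by blast
  next
    case pos
    define T' where "T' = (\<lambda>x. (-1) *\<^sub>R T x)"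
    have "compact_operator T'"
      unfolding T'_def by (rule compact_operator_scaleR[OF T(1)])
    moreover have "self_adjoint T'"
      using T(2) unfolding T'_def self_adjoint_def by (simp add: cinner_scaleR_left cinner_scaleR_right del: scaleR_minus1_left scaleR_minus_left)
    moreover have "T' (v i) = (- s i) *\<^sub>R v i" if "i < n" for i
      by (simp add: T'_def v that)
    moreover have "inner x (T' x) < 0"
      using pos by (simp add: T'_def)
    ultimately obtain u m where um: "norm u = 1" "u \<in> ?W" "T' u = m *\<^sub>R u"
      using negative_form_attains_min[of T' n v "\<lambda>i. - s i" x] pos(1) by metis
    have "T u = (- m) *\<^sub>R u" using um(3) by (simp add: T'_def) (metis minus_minus)
    with um show ?thesis using that by blast
  next
    case zero
    obtain x where x: "x \<in> ?W" "norm x = 1"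
      using exists_in_ortho_compl[OF on] by blast
    \<comment> \<open>A form that vanishes identically on the complement is semidefinite there, and
      Cauchy-Schwarz forces \<open>T x = 0\<close>.\<close>
    have "(inner (T x) (T x))\<^sup>2 \<le> inner (T x) (T (T x)) * inner x (T x)"
      by (rule form_Cauchy_Schwarz[OF lin T(2) subspace_ortho_compl[of n v]])
        (use zero x ortho_compl_invariant[OF T(2) v] in auto)
    then have "T x = 0 *\<^sub>R x" using zero[OF x(1)] by simp
    with x show ?thesis using that by blast
  qed
qed

lemma exists_orthonormal_eigenvectors:
  assumes T: "compact_operator T" "self_adjoint T"
  shows "\<exists>v s. orthonormal n v \<and> (\<forall>i<n. T (v i) = s i *\<^sub>R v i)"
proof (induction n)
  case 0
  show ?case by (simp add: orthonormal_def)
next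
  case (Suc n)
  then obtain v s where v: "orthonormal n v" "\<And>i. i < n \<Longrightarrow> T (v i) = s i *\<^sub>R v i" by blast
  then obtain u m where u: "norm u = 1" "u \<in> ortho_compl n v" "T u = m *\<^sub>R u"
    using exists_eigenvector[OF T v] by metis
  have "orthonormal (Suc n) (v(n := u))"
    using orthonormal_extend[OF v(1) u(1)] u(2) by (simp add: ortho_compl_def)
  moreover have "T ((v(n := u)) i) = (s(n := m)) i *\<^sub>R (v(n := u)) i" if "i < Suc n" for i
    using that v(2) u(3) by (auto simp: less_Suc_eq)
  ultimately show ?case by blast
qed

text \<open>Orthonormal eigenvectors with eigenvalues above \<epsilon> have images more than
  \<epsilon> apart. The precompact image of the unit ball has room for finitely many such points
  only, so a long enough orthonormal system of eigenvectors contains \<open>k\<close> with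
  eigenvalue at most \<epsilon>.\<close>

lemma eigenvalues_le_pos:
  assumes T: "compact_operator T" "self_adjoint T" and \<epsilon>: "\<epsilon> > 0"
  shows "eigenvalues_le T k \<epsilon>"
proof -
  have "compact (closure (T ` cball 0 1))"
    using T by (simp add: compact_operator_def)
  then obtain C where C: "finite C" "closure (T ` cball 0 1) \<subseteq> (\<Union>x\<in>C. ball x (\<epsilon> / 2))"
    using seq_compact_imp_totally_bounded[of "closure (T ` cball 0 1)"] \<epsilon>
    unfolding compact_eq_seq_compact_metric by (meson half_gt_zero)
  \<comment> \<open>\<open>card C\<close> bounds the number of eigenvectors with eigenvalue above
    \<epsilon>, which leaves \<open>k\<close> of the others.\<close>
  define N where "N = card C + k"
  obtain v s where v: "orthonormal N v" "\<And>i. i < N \<Longrightarrow> T (v i) = s i *\<^sub>R v i"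
    using exists_orthonormal_eigenvectors[OF T] by metis
  define Bad where "Bad = {i. i < N \<and> s i > \<epsilon>}"
  have "\<exists>c. c \<in> C \<and> dist c (T (v i)) < \<epsilon> / 2" if "i < N" for i
  proof -
    have "T (v i) \<in> closure (T ` cball 0 1)"
      by (intro subsetD[OF closure_subset] imageI) (simp add: orthonormal_norm[OF v(1) that])
    then show ?thesis using C(2) by (meson UN_E mem_ball subsetD)
  qed
  then obtain c where c: "\<And>i. i < N \<Longrightarrow> c i \<in> C" "\<And>i. i < N \<Longrightarrow> dist (c i) (T (v i)) < \<epsilon> / 2"
    by metis
  have "inj_on c Bad"
  proof (rule inj_onI, rule ccontr)
    fix i j assume ij: "i \<in> Bad" "j \<in> Bad" "c i = c j" "i \<noteq> j"
    then have N: "i < N" "j < N" by (auto simp: Bad_def)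
    have "dist (T (v i)) (T (v j)) < \<epsilon>"
      using c(2)[OF N(1)] c(2)[OF N(2)] ij(3) dist_triangle_half_l[of "T (v i)" "c i" \<epsilon> "T (v j)"]
      by (metis dist_commute)
    then have lt: "(norm (s i *\<^sub>R v i - s j *\<^sub>R v j))\<^sup>2 < \<epsilon>\<^sup>2"
      using \<epsilon> by (intro power_strict_mono) (auto simp: dist_norm v(2) N)
    have "inner (v i) (v j) = 0"
      using orthonormalD[OF v(1) N] ij(4) by (simp add: inner_cinner)
    then have "(norm (s i *\<^sub>R v i - s j *\<^sub>R v j))\<^sup>2 = (s i)\<^sup>2 + (s j)\<^sup>2"
      using orthonormal_norm[OF v(1)] N
      by (simp add: power2_norm_eq_inner inner_diff_left inner_diff_right inner_commute[of "v j" "v i"])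
        (simp add: power2_norm_eq_inner[symmetric] power2_eq_square)
    moreover have "\<epsilon>\<^sup>2 < (s i)\<^sup>2" "0 \<le> (s j)\<^sup>2"
      using ij \<epsilon> by (auto simp: Bad_def intro!: power_strict_mono)
    ultimately show False using lt by simp
  qed
  then have "card Bad \<le> card C"
    by (rule card_inj_on_le) (use c C in \<open>auto simp: Bad_def\<close>)
  moreover have "card ({..<N} - Bad) = N - card Bad"
    by (subst card_Diff_subset) (auto simp: Bad_def)
  ultimately have "k \<le> card ({..<N} - Bad)" by (simp add: N_def)
  then obtain G where G: "G \<subseteq> {..<N} - Bad" "card G = k" "finite G"
    by (meson obtain_subset_with_card_n)
  obtain h where h: "bij_betw h {..<k} G"
    using G ex_bij_betw_nat_finite[of G] by (auto simp: lessThan_atLeast0)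
  have hG: "h i < N" "s (h i) \<le> \<epsilon>" if "i < k" for i
    using G(1) bij_betwE[OF h] that by (auto simp: Bad_def)
  have "orthonormal k (\<lambda>i. v (h i))"
    unfolding orthonormal_def
  proof (intro allI impI)
    fix i j assume ij: "i < k" "j < k"
    have "h i = h j \<longleftrightarrow> i = j"
      using h ij by (auto simp: bij_betw_def inj_on_def)
    then show "cinner (v (h i)) (v (h j)) = (if i = j then 1 else 0)"
      using orthonormalD[OF v(1)] hG ij by simp
  qed
  then show ?thesis
    unfolding eigenvalues_le_def using v(2) hG by blast
qed

section \<open>Ordered eigenvalues and their variational characterization\<close>

lemma kth_eigenvalue_nonpos:
  assumes "compact_operator T" "self_adjoint T" "is_kth_eigenvalue T k t"
  shows "t \<le> 0"
proof (rule ccontr)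
  assume "\<not> t \<le> 0"
  then show False
    using eigenvalues_le_pos[OF assms(1,2), of "t / 2" k] assms(3) by (auto simp: is_kth_eigenvalue_def)
qed

lemma eigenvalues_le_mono: "eigenvalues_le T k t \<Longrightarrow> i \<le> k \<Longrightarrow> eigenvalues_le T i t"
  unfolding eigenvalues_le_def by (meson less_le_trans orthonormal_mono)

lemma kth_eigenvalueI: "is_kth_eigenvalue T k t \<Longrightarrow> kth_eigenvalue T k = t"
  unfolding kth_eigenvalue_def is_kth_eigenvalue_def
  by (rule the_equality) (auto, metis linorder_neqE_linordered_idom)

lemma is_kth_eigenvalue_mono:
  "is_kth_eigenvalue T i s \<Longrightarrow> is_kth_eigenvalue T k t \<Longrightarrow> i \<le> k \<Longrightarrow> s \<le> t"
  unfolding is_kth_eigenvalue_def by (meson eigenvalues_le_mono not_le)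

text \<open>By symmetry the coefficient of \<open>w\<close> along \<open>u i\<close> vanishes unless
  \<open>m i = s\<close>, so the projection of \<open>w\<close> stays in the eigenspace of
  \<open>s\<close>.\<close>

lemma eigenvector_minus_projection:
  assumes T: "clinear T" "self_adjoint T" and u: "\<And>i. i < n \<Longrightarrow> T (u i) = m i *\<^sub>R u i"
    and w: "T w = s *\<^sub>R w"
  shows "T (w - projection n u w) = s *\<^sub>R (w - projection n u w)"
proof -
  have "cinner (u i) w *\<^sub>C (m i *\<^sub>R u i) = cinner (u i) w *\<^sub>C (s *\<^sub>R u i)" if "i < n" for i
  proof -
    have "m i * cinner (u i) w = s * cinner (u i) w"
      using self_adjoint_cinner[OF T(2), of "u i" w] u[OF that] w by (simp add: cinner_simps)
    then show ?thesis by (simp add: scaleR_scaleC mult.commute)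
  qed
  then have "T (projection n u w) = s *\<^sub>R projection n u w"
    unfolding projection_eq clinear_sum[OF T(1)] clinear_scaleC[OF T(1)]
    by (auto simp: u scaleR_scaleC mult.commute ell2.scale_sum_right intro!: sum.cong)
  then show ?thesis
    by (simp add: clinear_diff[OF T(1)] w scaleR_diff_right)
qed

text \<open>Minimizing the form on successive complements yields eigenvectors with increasing
  eigenvalues for as long as the form takes negative values. The hypotheses on \<open>t\<close>
  supply the remaining vectors, which belong to the eigenvalue 0.\<close>

lemma spectral_basis_exists:
  assumes T: "compact_operator T" "self_adjoint T" and le: "eigenvalues_le T K t" "t \<le> 0"
  shows "p \<le> K \<Longrightarrow> \<exists>u m. orthonormal p u \<and> (\<forall>i<p. T (u i) = m i *\<^sub>R u i \<and>
    (\<forall>x\<in>ortho_compl i u. m i * (norm x)\<^sup>2 \<le> inner x (T x)))"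
proof (induction p)
  case 0
  show ?case by (simp add: orthonormal_def)
next
  case (Suc p)
  note lin = compact_operator_linear[OF T(1)]
  obtain u m where u: "orthonormal p u" "\<And>i. i < p \<Longrightarrow> T (u i) = m i *\<^sub>R u i"
    and low: "\<And>i x. i < p \<Longrightarrow> x \<in> ortho_compl i u \<Longrightarrow> m i * (norm x)\<^sup>2 \<le> inner x (T x)"
    using Suc.IH[OF Suc_leD[OF Suc.prems]] by blast
  have "\<exists>y a. norm y = 1 \<and> y \<in> ortho_compl p u \<and> T y = a *\<^sub>R y \<and>
      (\<forall>x\<in>ortho_compl p u. a * (norm x)\<^sup>2 \<le> inner x (T x))"
  proof (cases "\<exists>x\<in>ortho_compl p u. inner x (T x) < 0")
    case True
    then obtain x where x: "x \<in> ortho_compl p u" "inner x (T x) < 0" by blast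
    show ?thesis by (rule negative_form_attains_min[OF T u(2) x]) blast+
  next
    case False
    obtain w where w: "orthonormal K w" "\<And>i. i < K \<Longrightarrow> \<exists>s\<le>t. T (w i) = s *\<^sub>R w i"
      using le(1) unfolding eigenvalues_le_def by blast
    \<comment> \<open>Fewer than \<open>K\<close> vectors have been found, so some
      \<open>w j\<close> is not in their span. Its component in the complement is an eigenvector for
      some \<open>s \<le> t \<le> 0\<close>, and nonnegativity of the form leaves only
      \<open>s = 0\<close>.\<close>
    obtain j where j: "j < K" "projection p u (w j) \<noteq> w j"
      using orthonormal_card_le[OF w(1) u(1)] Suc.prems by fastforce
    obtain s where s: "s \<le> t" "T (w j) = s *\<^sub>R w j" using w j by blast
    define x where "x = w j - projection p u (w j)"
    have x: "x \<noteq> 0" "x \<in> ortho_compl p u" "T x = s *\<^sub>R x"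
      using j ortho_compl_minus_projection[OF u(1)] eigenvector_minus_projection[OF lin T(2) u(2) s(2)]
      by (auto simp: x_def)
    have "0 \<le> inner x (T x)" using False x(2) by force
    then have "0 \<le> s * inner x x" by (simp add: x(3))
    moreover have "0 < inner x x" using x(1) by simp
    ultimately have "0 \<le> s" by (metis mult_neg_pos not_le)
    then have "s = 0" using s(1) le(2) by simp
    then have "norm (inverse (norm x) *\<^sub>R x) = 1" "inverse (norm x) *\<^sub>R x \<in> ortho_compl p u"
      "T (inverse (norm x) *\<^sub>R x) = 0 *\<^sub>R (inverse (norm x) *\<^sub>R x)"
      using x subspace_scale[OF subspace_ortho_compl] by (auto simp: clinear_scaleR[OF lin])
    then show ?thesis using False by (metis mult_zero_left not_le)
  qed
  then obtain y a where y: "norm y = 1" "y \<in> ortho_compl p u" "T y = a *\<^sub>R y"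
    "\<And>x. x \<in> ortho_compl p u \<Longrightarrow> a * (norm x)\<^sup>2 \<le> inner x (T x)" by blast
  have [simp]: "ortho_compl i (u(p := y)) = ortho_compl i u" if "i \<le> p" for i
    using that by (auto simp: ortho_compl_def)
  have "orthonormal (Suc p) (u(p := y))"
    using orthonormal_extend[OF u(1) y(1)] y(2) by (simp add: ortho_compl_def)
  moreover have "T ((u(p := y)) i) = (m(p := a)) i *\<^sub>R (u(p := y)) i \<and>
      (\<forall>x\<in>ortho_compl i (u(p := y)). (m(p := a)) i * (norm x)\<^sup>2 \<le> inner x (T x))" if "i < Suc p" for i
    using that u(2) y low by (auto simp: less_Suc_eq)
  ultimately show ?case by blast
qed

text \<open>An eigenvector for a value below \<open>m i\<close> has no component in the complement
  of the first \<open>i\<close> vectors, where the form is at least \<open>m i\<close>; and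
  \<open>Suc i\<close> orthonormal vectors do not fit into a span of dimension
  \<open>i\<close>.\<close>

lemma is_kth_eigenvalueI:
  assumes T: "clinear T" "self_adjoint T" and u: "orthonormal (Suc i) u"
    "\<And>k. k \<le> i \<Longrightarrow> T (u k) = m k *\<^sub>R u k"
    and low: "\<And>k x. k \<le> i \<Longrightarrow> x \<in> ortho_compl k u \<Longrightarrow> m k * (norm x)\<^sup>2 \<le> inner x (T x)"
  shows "is_kth_eigenvalue T (Suc i) (m i)"
  unfolding is_kth_eigenvalue_def
proof (intro conjI allI impI notI)
  have mono: "m k \<le> m i" if "k \<le> i" for k
  proof -
    have "u i \<in> ortho_compl k u"
      using u(1) that by (auto simp: ortho_compl_def orthonormal_def)
    from low[OF that this] show ?thesis
      using u(2)[of i] orthonormal_norm[OF u(1), of i]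
      by (simp add: power2_norm_eq_inner[symmetric])
  qed
  show "eigenvalues_le T (Suc i) (m i)"
    unfolding eigenvalues_le_def using u mono by (intro exI[of _ u]) (auto simp: less_Suc_eq_le)
next
  fix s assume s: "s < m i" and le: "eigenvalues_le T (Suc i) s"
  obtain w where w: "orthonormal (Suc i) w" "\<And>k. k < Suc i \<Longrightarrow> \<exists>a\<le>s. T (w k) = a *\<^sub>R w k"
    using le unfolding eigenvalues_le_def by blast
  have ui: "orthonormal i u" using u(1) by (rule orthonormal_mono) simp
  have "projection i u (w k) = w k" if k: "k < Suc i" for k
  proof (rule ccontr)
    assume ne: "projection i u (w k) \<noteq> w k"
    obtain a where a: "a \<le> s" "T (w k) = a *\<^sub>R w k" using w k by blast
    define x where "x = w k - projection i u (w k)"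
    have x: "x \<noteq> 0" "x \<in> ortho_compl i u" "T x = a *\<^sub>R x"
      using ne ortho_compl_minus_projection[OF ui] eigenvector_minus_projection[OF T, of i u m "w k" a] u(2) a(2)
      by (auto simp: x_def)
    from low[OF order_refl x(2)] have "(m i - a) * (norm x)\<^sup>2 \<le> 0"
      by (simp add: x(3) power2_norm_eq_inner algebra_simps)
    then show False
      using x(1) a(1) s by (simp add: mult_le_0_iff)
  qed
  from orthonormal_card_le[OF w(1) ui this] show False by simp
qed simp

theorem spectral_basis:
  assumes T: "compact_operator T" "self_adjoint T" and K: "is_kth_eigenvalue T K t"
  obtains u where "eigenbasis T K u"
    "\<And>i. i < K \<Longrightarrow> is_kth_eigenvalue T (Suc i) (kth_eigenvalue T (Suc i))"
proof -
  have t: "t \<le> 0" by (rule kth_eigenvalue_nonpos[OF assms])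
  have "eigenvalues_le T K t" using K by (simp add: is_kth_eigenvalue_def)
  from spectral_basis_exists[OF T this t order_refl]
  obtain u m where u: "orthonormal K u" "\<And>i. i < K \<Longrightarrow> T (u i) = m i *\<^sub>R u i"
    "\<And>i x. i < K \<Longrightarrow> x \<in> ortho_compl i u \<Longrightarrow> m i * (norm x)\<^sup>2 \<le> inner x (T x)" by blast
  have kth: "is_kth_eigenvalue T (Suc i) (m i)" if "i < K" for i
    by (rule is_kth_eigenvalueI[OF compact_operator_linear[OF T(1)] T(2), of i u])
      (use u that orthonormal_mono[OF u(1), of "Suc i"] in auto)
  note kth' = kth_eigenvalueI[OF kth]
  show thesis
    by (rule that[of u]) (use u kth kth' in \<open>auto simp: eigenbasis_def\<close>)
qed

lemma is_kth_eigenvalue_below: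
  assumes "compact_operator T" "self_adjoint T" "is_kth_eigenvalue T K t" "1 \<le> i" "i \<le> K"
  shows "is_kth_eigenvalue T i (kth_eigenvalue T i)"
  using spectral_basis[OF assms(1-3)] assms(4,5) by (metis Suc_le_eq Suc_pred' Suc_le_D One_nat_def)

text \<open>The basis \<open>v\<close> is an arbitrary admissible choice, not the one constructed by
  minimization. If the form fell below \<open>t\<close> on its complement, the minimum there would
  give a further eigenvector with value \<open>m < t\<close>; inserted at the first position whose
  eigenvalue exceeds \<open>m\<close>, it contradicts the minimality of that eigenvalue.\<close>

proposition form_ge_kth_eigenvalue:
  assumes T: "compact_operator T" "self_adjoint T" and t: "is_kth_eigenvalue T (Suc l) t"
    and v: "eigenbasis T l v" and x: "x \<in> ortho_compl l v"
  shows "t * (norm x)\<^sup>2 \<le> inner x (T x)"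
proof (rule ccontr)
  assume lt: "\<not> t * (norm x)\<^sup>2 \<le> inner x (T x)"
  have "t \<le> 0" by (rule kth_eigenvalue_nonpos[OF T t])
  then have neg: "inner x (T x) < 0"
    using lt mult_nonpos_nonneg[of t "(norm x)\<^sup>2"] by simp
  have on: "orthonormal l v" and ev: "\<And>i. i < l \<Longrightarrow> T (v i) = kth_eigenvalue T (Suc i) *\<^sub>R v i"
    using v by (auto simp: eigenbasis_def)
  obtain y m where y: "norm y = 1" "y \<in> ortho_compl l v" "T y = m *\<^sub>R y"
    and m: "\<And>x. x \<in> ortho_compl l v \<Longrightarrow> m * (norm x)\<^sup>2 \<le> inner x (T x)"
    by (rule negative_form_attains_min[OF T ev x neg]) blast+
  have "m * (norm x)\<^sup>2 < t * (norm x)\<^sup>2"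
    using m[OF x] lt by simp
  then have mt: "m < t"
    by (simp add: mult_less_cancel_right)
  have kth: "is_kth_eigenvalue T (Suc i) (kth_eigenvalue T (Suc i))" if "i \<le> l" for i
    using is_kth_eigenvalue_below[OF T t] that by simp
  define i0 where "i0 = (LEAST i. m < kth_eigenvalue T (Suc i))"
  have ex: "m < kth_eigenvalue T (Suc l)"
    using mt kth_eigenvalueI[OF t] by simp
  then have i0: "m < kth_eigenvalue T (Suc i0)" "i0 \<le> l"
    unfolding i0_def by (rule LeastI, rule Least_le)
  have below: "kth_eigenvalue T (Suc i) \<le> m" if "i < i0" for i
    using not_less_Least[OF that[unfolded i0_def]] by simp
  have "orthonormal (Suc i0) (v(i0 := y))"
    using orthonormal_extend[OF orthonormal_mono[OF on i0(2)] y(1)] y(2) i0(2) by (simp add: ortho_compl_def)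
  then have "eigenvalues_le T (Suc i0) m"
    unfolding eigenvalues_le_def using below ev y(3) i0(2)
    by (intro exI[of _ "v(i0 := y)"]) (auto simp: less_Suc_eq)
  then show False
    using kth[OF i0(2)] i0(1) by (simp add: is_kth_eigenvalue_def)
qed

section \<open>Compressions to finite-dimensional subspaces\<close>

lemma compact_lincombs:
  fixes n :: nat
  shows "compact {(\<Sum>k<n. c k *\<^sub>C v k) | c. \<forall>k<n. cmod (c k) \<le> K}"
proof (induction n)
  case 0
  show ?case by simp
next
  case (Suc n)
  have "bounded_linear (\<lambda>c. c *\<^sub>C v n)"
    by (rule bounded_linear_intro[where K = "norm (v n)"])
      (auto simp: ell2.scale_left_distrib scaleR_scaleC scaleR_conv_of_real norm_scaleC)
  then have "compact ((\<lambda>c. c *\<^sub>C v n) ` cball 0 K)"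
    by (intro compact_continuous_image linear_continuous_on) auto
  from compact_sums[OF Suc this]
  have "compact {x + y |x y. x \<in> {(\<Sum>k<n. c k *\<^sub>C v k) | c. \<forall>k<n. cmod (c k) \<le> K} \<and>
      y \<in> (\<lambda>c. c *\<^sub>C v n) ` cball 0 K}" .
  also have "\<dots> = {(\<Sum>k<Suc n. c k *\<^sub>C v k) | c. \<forall>k<Suc n. cmod (c k) \<le> K}" (is "?L = ?R")
  proof (intro equalityI subsetI)
    fix z assume "z \<in> ?L"
    then obtain c a where "z = (\<Sum>k<n. c k *\<^sub>C v k) + a *\<^sub>C v n" "\<forall>k<n. cmod (c k) \<le> K" "cmod a \<le> K"
      by auto
    then show "z \<in> ?R"
      by (intro CollectI exI[of _ "c(n := a)"]) (auto simp: less_Suc_eq)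
  next
    fix z assume "z \<in> ?R"
    then obtain c where "z = (\<Sum>k<n. c k *\<^sub>C v k) + c n *\<^sub>C v n" "\<forall>k<Suc n. cmod (c k) \<le> K"
      by auto
    then show "z \<in> ?L"
      by (intro CollectI exI[of _ "\<Sum>k<n. c k *\<^sub>C v k"] exI[of _ "c n *\<^sub>C v n"]) auto
  qed
  finally show ?case .
qed

text \<open>The two matrices are \<open>diag d + G * (diag t)^2\<close> and
  \<open>diag d + diag t * G * diag t\<close>. The second is Hermitian for Hermitian
  \<open>G\<close> and real \<open>d\<close>, \<open>t\<close>, which makes the matrix inside
  \<open>beta\<close> accessible to variational arguments.\<close>

lemma char_poly_diag_similar:
  fixes g :: "nat \<Rightarrow> nat \<Rightarrow> complex" and d t :: "nat \<Rightarrow> complex"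
  shows "char_poly (mat n n (\<lambda>(i, j). (if i = j then d i else 0) + g i j * t j * t j))
    = char_poly (mat n n (\<lambda>(i, j). (if i = j then d i else 0) + t i * g i j * t j))"
    (is "char_poly ?A = char_poly ?B")
proof (rule poly_ext)
  fix k
  \<comment> \<open>Conjugating with \<open>diag t\<close> needs \<open>t\<close> to be invertible; this is so over the polynomial ring
    once \<open>t\<close> is replaced by \<open>t + X\<close>, and evaluating at \<open>X = 0\<close> gives the claim.\<close>
  define T where "T i = [:t i, 1:]" for i
  define P where "P = mat n n (\<lambda>(i, j). [:if i = j then k - d i else 0:] - [:g i j:] * T j * T j)"
  define Q where "Q = mat n n (\<lambda>(i, j). [:if i = j then k - d i else 0:] - T i * [:g i j:] * T j)"
  have P: "P \<in> carrier_mat n n" and Q: "Q \<in> carrier_mat n n" and T: "mat_diag n T \<in> carrier_mat n n"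
    by (auto simp: P_def Q_def mat_diag_def)
  have "mat_diag n T * P = Q * mat_diag n T"
    unfolding mat_diag_mult_left[OF P] mat_diag_mult_right[OF Q]
    by (rule eq_matI) (auto simp: P_def Q_def algebra_simps)
  then have "det (mat_diag n T) * det P = det Q * det (mat_diag n T)"
    by (simp only: det_mult[OF T P, symmetric] det_mult[OF Q T, symmetric])
  moreover have "det (mat_diag n T) \<noteq> 0"
  proof -
    have "det (mat_diag n T) = prod_list (diag_mat (mat_diag n T))"
      by (rule det_upper_triangular[OF _ T]) (auto simp: upper_triangular_def mat_diag_def)
    also have "\<dots> \<noteq> 0"
      by (auto simp: prod_list_zero_iff diag_mat_def mat_diag_def T_def)
    finally show ?thesis .
  qed
  ultimately have PQ: "det P = det Q" by (auto simp: mult.commute)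
  have A: "?A \<in> carrier_mat n n" and B: "?B \<in> carrier_mat n n" by auto
  have "poly (char_poly ?A) k = poly (det P) 0"
    unfolding char_poly_matrix[OF A]
    by (rule poly_det_cong[OF _ P, symmetric]) (auto simp: P_def T_def char_matrix_def)
  also have "\<dots> = poly (char_poly ?B) k"
    unfolding char_poly_matrix[OF B] PQ
    by (rule poly_det_cong[OF _ Q]) (auto simp: Q_def T_def char_matrix_def)
  finally show "poly (char_poly ?A) k = poly (char_poly ?B) k" .
qed

lemma mat_eigenvalue_sorted:
  assumes A: "char_poly A = (\<Prod>a\<leftarrow>map (\<lambda>i. complex_of_real (m i)) [0..<n]. [:- a, 1:])"
    and m: "\<And>i j. i \<le> j \<Longrightarrow> j < n \<Longrightarrow> m i \<le> m j" and i: "i < n"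
  shows "mat_eigenvalue A (Suc i) = m i"
proof -
  have "proots (char_poly A) = mset (map (\<lambda>i. complex_of_real (m i)) [0..<n])"
  proof -
    have "proots (\<Prod>a\<leftarrow>as. [:- a, 1:]) = mset as" for as :: "complex list"
    proof (induction as)
      case (Cons a as)
      have "(\<Prod>a\<leftarrow>as. [:- a, 1:]) \<noteq> 0"
        by (auto simp: prod_list_zero_iff)
      then have "proots ([:- a, 1:] * (\<Prod>a\<leftarrow>as. [:- a, 1:])) = mset (a # as)"
        by (subst proots_mult) (simp_all add: Cons)
      then show ?case by simp
    qed simp
    then show ?thesis by (simp only: A)
  qed
  then have *: "image_mset Re (proots (char_poly A)) = mset (map m [0..<n])"
    by (simp add: image_mset.compositionality o_def)
  have "sorted (map m [0..<n])"
    by (auto simp: sorted_iff_nth_mono intro: m)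
  then have "sorted_list_of_multiset (mset (map m [0..<n])) = map m [0..<n]"
    by (simp only: sorted_list_of_multiset_mset sorted_sort_id)
  then show ?thesis
    unfolding mat_eigenvalue_def * using i by (simp del: mset_map mset_upt)
qed

section \<open>Ritz values of a compressed operator\<close>

locale compressed =
  fixes d :: nat and V :: "nat \<Rightarrow> ell2" and T :: "ell2 \<Rightarrow> ell2" and K :: real
  assumes V: "orthonormal d V" and lin: "clinear T" and sa: "self_adjoint T"
    and bdd: "\<And>x. norm (T x) \<le> K * norm x"
begin

abbreviation "P \<equiv> projection d V"

lemma P: "ortho_proj P"
  by (rule ortho_proj_projection[OF V])

lemmas P_lin = ortho_proj_linear[OF P] and P_idem = ortho_proj_idem[OF P]
  and P_sa = ortho_proj_selfadj[OF P]

lemma K_nonneg: "0 \<le> K"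
  using bdd[of "unit_seq 0"] orthonormal_norm[OF orthonormal_unit_seq[of 1], of 0]
  by (metis less_one mult.right_neutral norm_ge_zero order.trans)

lemma form_le: "inner x (T x) \<le> K * (norm x)\<^sup>2"
proof -
  have "inner x (T x) \<le> norm x * norm (T x)" by (rule norm_cauchy_schwarz)
  also have "\<dots> \<le> norm x * (K * norm x)" by (intro mult_left_mono bdd) simp
  finally show ?thesis by (simp add: power2_eq_square mult_ac)
qed

text \<open>The shift makes the form negative on the whole range of \<^term>\<open>P\<close>, so that all Ritz values are
  among the smallest eigenvalues of this finite rank operator.\<close>

definition shifted :: "ell2 \<Rightarrow> ell2"
  where "shifted x = P (T (P x)) - (K + 1) *\<^sub>R P x"

lemma shifted_linear: "clinear shifted"
  unfolding shifted_def
  by (rule clinearI) (simp_all add: clinear_add[OF P_lin] clinear_add[OF lin] clinear_scaleC[OF P_lin]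
      clinear_scaleC[OF lin] scaleR_right_distrib ell2.scale_right_diff_distrib scaleR_scaleC mult.commute
      ell2.scale_right_distrib)

lemma shifted_sa: "self_adjoint shifted"
  unfolding self_adjoint_def shifted_def
  by (simp add: cinner_simps self_adjoint_cinner[OF P_sa] self_adjoint_cinner[OF sa])

lemma P_shifted: "P (shifted x) = shifted x"
  by (simp add: shifted_def clinear_diff[OF P_lin] clinear_scaleR[OF P_lin] P_idem)

lemma shifted_on: "P x = x \<Longrightarrow> shifted x = P (T x) - (K + 1) *\<^sub>R x"
  by (simp add: shifted_def)

lemma form_P: "P x = x \<Longrightarrow> inner x (P (T x)) = inner x (T x)"
  by (metis ortho_proj_inner[OF P])

lemma form_shifted: "P x = x \<Longrightarrow> inner x (shifted x) = inner x (T x) - (K + 1) * (norm x)\<^sup>2"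
  by (simp add: shifted_on inner_diff_right form_P power2_norm_eq_inner)

lemma shifted_compact: "compact_operator shifted"
proof (rule compact_operatorI[OF shifted_linear compact_lincombs[where n = d and v = V and K = "K + (K + 1)"]])
  show "shifted ` cball 0 1 \<subseteq> {(\<Sum>k<d. c k *\<^sub>C V k) | c. \<forall>k<d. cmod (c k) \<le> K + (K + 1)}"
  proof (rule image_subsetI)
    fix x :: ell2 assume "x \<in> cball 0 1"
    then have x: "norm x \<le> 1" by simp
    have Px: "norm (P x) \<le> 1"
      using ortho_proj_norm_le[OF P, of x] x by simp
    have "norm (shifted x) \<le> norm (P (T (P x))) + norm ((K + 1) *\<^sub>R P x)"
      unfolding shifted_def by (rule norm_triangle_ineq4)
    also have "norm (P (T (P x))) \<le> K"
      using ortho_proj_norm_le[OF P, of "T (P x)"] bdd[of "P x"] mult_left_mono[OF Px K_nonneg] by simp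
    also have "norm ((K + 1) *\<^sub>R P x) \<le> K + 1"
      using Px K_nonneg mult_left_mono[OF Px, of "K + 1"] by simp
    finally have n: "norm (shifted x) \<le> K + (K + 1)" by simp
    have "shifted x = (\<Sum>k<d. cinner (V k) (shifted x) *\<^sub>C V k)"
      by (metis P_shifted projection_eq)
    moreover have "cmod (cinner (V k) (shifted x)) \<le> K + (K + 1)" if "k < d" for k
      using cmod_cinner_le_1[OF V that, of "shifted x"] n by simp
    ultimately show "shifted x \<in> {(\<Sum>k<d. c k *\<^sub>C V k) | c. \<forall>k<d. cmod (c k) \<le> K + (K + 1)}"
      by (intro CollectI exI[of _ "\<lambda>k. cinner (V k) (shifted x)"]) blast
  qed
qed

lemma shifted_neg: "P x = x \<Longrightarrow> x \<noteq> 0 \<Longrightarrow> inner x (shifted x) < 0"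
  using form_le[of x] by (simp add: form_shifted algebra_simps) (smt (verit) zero_less_norm_iff zero_less_power)

lemma shifted_basis:
  "p \<le> d \<Longrightarrow> \<exists>u m. orthonormal p u \<and> (\<forall>i<p. P (u i) = u i \<and> shifted (u i) = m i *\<^sub>R u i \<and>
    (\<forall>x\<in>ortho_compl i u. m i * (norm x)\<^sup>2 \<le> inner x (shifted x)))"
proof (induction p)
  case 0
  show ?case by (simp add: orthonormal_def)
next
  case (Suc p)
  obtain u m where u: "orthonormal p u" "\<And>i. i < p \<Longrightarrow> P (u i) = u i"
      "\<And>i. i < p \<Longrightarrow> shifted (u i) = m i *\<^sub>R u i"
    and low: "\<And>i x. i < p \<Longrightarrow> x \<in> ortho_compl i u \<Longrightarrow> m i * (norm x)\<^sup>2 \<le> inner x (shifted x)"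
    using Suc.IH[OF Suc_leD[OF Suc.prems]] by blast
  obtain j where j: "j < d" "projection p u (V j) \<noteq> V j"
    using orthonormal_card_le[OF V u(1)] Suc.prems by fastforce
  define x where "x = V j - projection p u (V j)"
  have "P (projection p u y) = projection p u y" for y
    unfolding projection_eq[of p u]
    by (simp add: clinear_sum[OF P_lin] clinear_scaleC[OF P_lin] u(2) cong: sum.cong_simp)
  then have "P x = x"
    by (simp add: x_def clinear_diff[OF P_lin] projection_basis[OF V j(1)])
  then have neg: "inner x (shifted x) < 0"
    by (rule shifted_neg) (use j in \<open>simp add: x_def\<close>)
  have x: "x \<in> ortho_compl p u"
    by (simp add: x_def ortho_compl_minus_projection[OF u(1)])
  obtain y a where y: "norm y = 1" "y \<in> ortho_compl p u" "shifted y = a *\<^sub>R y" "a < 0"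
    "\<And>x. x \<in> ortho_compl p u \<Longrightarrow> a * (norm x)\<^sup>2 \<le> inner x (shifted x)"
    by (rule negative_form_attains_min[OF shifted_compact shifted_sa u(3) x neg]) blast+
  \<comment> \<open>The eigenvalue is nonzero and \<open>shifted\<close> maps into the range of
    \<open>P\<close>, which puts \<open>y\<close> into that range.\<close>
  have "P (a *\<^sub>R y) = a *\<^sub>R y" using P_shifted[of y] y(3) by simp
  then have Py: "P y = y" using y(4) by (simp add: clinear_scaleR[OF P_lin])
  have [simp]: "ortho_compl i (u(p := y)) = ortho_compl i u" if "i \<le> p" for i
    using that by (auto simp: ortho_compl_def)
  have "orthonormal (Suc p) (u(p := y))"
    using orthonormal_extend[OF u(1) y(1)] y(2) by (simp add: ortho_compl_def)
  moreover have "P ((u(p := y)) i) = (u(p := y)) i \<and> shifted ((u(p := y)) i) = (m(p := a)) i *\<^sub>R (u(p := y)) i \<and>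
      (\<forall>x\<in>ortho_compl i (u(p := y)). (m(p := a)) i * (norm x)\<^sup>2 \<le> inner x (shifted x))" if "i < Suc p" for i
    using that u(2,3) y low Py by (auto simp: less_Suc_eq)
  ultimately show ?case by blast
qed

lemma parseval: "P y = y \<Longrightarrow> cinner x y = (\<Sum>k<d. cinner x (V k) * cinner (V k) y)"
proof -
  assume "P y = y"
  then have "cinner x y = cinner x (\<Sum>k<d. cinner (V k) y *\<^sub>C V k)"
    by (metis projection_eq)
  then show ?thesis by (simp add: cinner_sum_right cinner_scaleC_right mult.commute)
qed

abbreviation "M \<equiv> compression d V T"

abbreviation "ritz i \<equiv> mat_eigenvalue M (Suc i)"

lemma full_basis:
  assumes u: "orthonormal d u" "\<And>i. i < d \<Longrightarrow> P (u i) = u i" and x: "P x = x"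
  shows "projection d u x = x"
proof -
  have "norm (x - projection d u x) \<le> (real d)\<^sup>2 * 0 * norm x"
    by (rule gap_symmetric_le[OF u(1) V _ x]) (use u in simp)
  then show ?thesis by simp
qed

text \<open>This matches two descriptions of the Ritz values: \<open>mat_eigenvalue\<close> sorts
  the roots of a characteristic polynomial, while \<open>u\<close> comes from minimization and is
  ordered by construction.\<close>

theorem ritz_basis:
  obtains u where "orthonormal d u" "\<And>i. i < d \<Longrightarrow> P (u i) = u i"
    "\<And>i. i < d \<Longrightarrow> P (T (u i)) = ritz i *\<^sub>R u i"
    "\<And>i. i < d \<Longrightarrow> is_kth_eigenvalue shifted (Suc i) (ritz i - (K + 1))"
    "\<And>i x. i < d \<Longrightarrow> P x = x \<Longrightarrow> x \<in> ortho_compl i u \<Longrightarrow> ritz i * (norm x)\<^sup>2 \<le> inner x (T x)"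
proof -
  obtain u m' where u: "orthonormal d u" "\<And>i. i < d \<Longrightarrow> P (u i) = u i"
      "\<And>i. i < d \<Longrightarrow> shifted (u i) = m' i *\<^sub>R u i"
    and low: "\<And>i x. i < d \<Longrightarrow> x \<in> ortho_compl i u \<Longrightarrow> m' i * (norm x)\<^sup>2 \<le> inner x (shifted x)"
    using shifted_basis[OF order_refl] by blast
  define m where "m i = m' i + (K + 1)" for i
  have eig: "P (T (u i)) = m i *\<^sub>R u i" if "i < d" for i
    using u(3)[OF that] by (simp add: shifted_on u(2) that m_def algebra_simps)
  have kth: "is_kth_eigenvalue shifted (Suc i) (m' i)" if "i < d" for i
    by (rule is_kth_eigenvalueI[OF shifted_linear shifted_sa, of i u])
      (use u that low orthonormal_mono[OF u(1), of "Suc i"] in auto)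
  have mono: "m i \<le> m j" if "i \<le> j" "j < d" for i j
    using is_kth_eigenvalue_mono[OF kth kth, of i j] that by (simp add: m_def)
  have Pu: "x = (\<Sum>k<d. cinner (u k) x *\<^sub>C u k)" if "P x = x" for x
    using full_basis[OF u(1,2) that] by (simp add: projection_eq)
  \<comment> \<open>Transition matrices between the orthonormal bases \<open>V\<close> and
    \<open>u\<close> of the trial space; completeness of \<open>u\<close> makes them inverse to each
    other, and they diagonalize \<open>M\<close>.\<close>
  define U where "U = mat d d (\<lambda>(i, k). cinner (V i) (u k))"
  define U' where "U' = mat d d (\<lambda>(k, j). cinner (u k) (V j))"
  define D where "D = mat_diag d (\<lambda>i. complex_of_real (m i))"
  have dims: "U \<in> carrier_mat d d" "U' \<in> carrier_mat d d" "D \<in> carrier_mat d d" "M \<in> carrier_mat d d"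
    by (auto simp: U_def U'_def D_def mat_diag_def compression_def)
  have UU': "U * U' = 1\<^sub>m d"
  proof (rule eq_matI)
    fix i j assume ij: "i < dim_row (1\<^sub>m d :: complex mat)" "j < dim_col (1\<^sub>m d :: complex mat)"
    then have "(U * U') $$ (i, j) = (\<Sum>k<d. cinner (u k) (V j) * cinner (V i) (u k))"
      by (simp add: U_def U'_def scalar_prod_def lessThan_atLeast0 mult.commute)
    also have "\<dots> = cinner (V i) (\<Sum>k<d. cinner (u k) (V j) *\<^sub>C u k)"
      by (simp add: cinner_sum_right cinner_scaleC_right)
    also have "\<dots> = cinner (V i) (V j)"
      using ij by (subst Pu[symmetric]) (simp_all add: projection_basis[OF V])
    finally show "(U * U') $$ (i, j) = 1\<^sub>m d $$ (i, j)"
      using ij by (simp add: orthonormalD[OF V])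
  qed (auto simp: U_def U'_def)
  have U'U: "U' * U = 1\<^sub>m d"
    by (rule mat_mult_left_right_inverse[OF dims(1,2) UU'])
  have M: "M = U * D * U'"
  proof (rule eq_matI)
    fix i j assume ij': "i < dim_row (U * D * U')" "j < dim_col (U * D * U')"
    then have ij: "i < d" "j < d" by (auto simp: U_def U'_def)
    have "(U * D * U') $$ (i, j) = (\<Sum>k<d. cinner (u k) (V j) * (of_real (m k) * cinner (V i) (u k)))"
      unfolding D_def mat_diag_mult_right[OF dims(1)]
      using ij by (simp add: U_def U'_def scalar_prod_def lessThan_atLeast0 mult_ac)
    also have "\<dots> = cinner (V i) (P (T (\<Sum>k<d. cinner (u k) (V j) *\<^sub>C u k)))"
      by (simp add: clinear_sum[OF lin] clinear_sum[OF P_lin] clinear_scaleC[OF lin] clinear_scaleC[OF P_lin]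
          cinner_sum_right cinner_scaleC_right cinner_scaleR_right eig)
    also have "\<dots> = cinner (V i) (T (V j))"
      using ij by (subst Pu[symmetric]) (simp_all add: projection_basis[OF V] cinner_projection[OF V])
    finally show "M $$ (i, j) = (U * D * U') $$ (i, j)"
      using ij by (simp add: compression_def)
  qed (auto simp: U_def U'_def compression_def)
  have "similar_mat M D"
    by (rule similar_matI[of _ _ U U' d]) (use dims UU' U'U M in auto)
  then have "char_poly M = char_poly D"
    by (rule char_poly_similar)
  also have "\<dots> = (\<Prod>a\<leftarrow>diag_mat D. [:- a, 1:])"
    by (rule char_poly_upper_triangular[OF dims(3)]) (auto simp: upper_triangular_def D_def mat_diag_def)
  also have "diag_mat D = map (\<lambda>i. complex_of_real (m i)) [0..<d]"
    by (auto simp: diag_mat_def D_def mat_diag_def)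
  finally have ritz: "ritz i = m i" if "i < d" for i
    using mat_eigenvalue_sorted[OF _ mono that] by simp
  show thesis
  proof (rule that[OF u(1,2)])
    show "P (T (u i)) = ritz i *\<^sub>R u i" "is_kth_eigenvalue shifted (Suc i) (ritz i - (K + 1))" if "i < d" for i
      using that eig kth by (simp_all add: ritz m_def)
    show "ritz i * (norm x)\<^sup>2 \<le> inner x (T x)" if "i < d" "P x = x" "x \<in> ortho_compl i u" for i x
      using low[OF that(1,3)] that by (simp add: ritz m_def form_shifted algebra_simps)
  qed
qed

lemma ritz_mono:
  assumes "i \<le> j" "j < d"
  shows "ritz i \<le> ritz j"
proof -
  obtain u where "\<And>i. i < d \<Longrightarrow> is_kth_eigenvalue shifted (Suc i) (ritz i - (K + 1))"
    using ritz_basis by blast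
  from is_kth_eigenvalue_mono[OF this this, of i j] assms show ?thesis by simp
qed

lemma ritz_vectors:
  assumes w: "mat_eigenbasis M r w"
  defines "z \<equiv> \<lambda>i. synthesis d V (w i)"
  shows "orthonormal r z" and "\<And>i. P (z i) = z i"
    and "\<And>i. i < r \<Longrightarrow> P (T (z i)) = ritz i *\<^sub>R z i"
proof -
  have w_carrier: "w i \<in> carrier_vec (dim_row M)"
    and w_eig: "M *\<^sub>v w i = of_real (ritz i) \<cdot>\<^sub>v w i" if "i < r" for i
    using w that unfolding mat_eigenbasis_def by (simp_all only: Suc_eq_plus1)
  have w_orth: "w i \<bullet>c w j = (if i = j then 1 else 0)" if "i < r" "j < r" for i j
    using w that unfolding mat_eigenbasis_def by blast
  have wd: "dim_vec (w i) = d" if "i < r" for i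
    using carrier_vecD[OF w_carrier[OF that]] by (simp add: compression_def)
  have Vz: "cinner (V k) (z i) = vec_index (w i) k" if "k < d" for i k
    unfolding z_def synthesis_def using cinner_lincomb[OF V that] .
  show Pz: "P (z i) = z i" for i
    unfolding z_def synthesis_def
    by (simp add: clinear_sum[OF P_lin] clinear_scaleC[OF P_lin] projection_basis[OF V])
  show "orthonormal r z"
    unfolding orthonormal_def
  proof (intro allI impI)
    fix i j assume ij: "i < r" "j < r"
    have "cinner (z i) (z j) = (\<Sum>k<d. cinner (z i) (V k) * cinner (V k) (z j))"
      by (rule parseval[OF Pz])
    also have "\<dots> = (\<Sum>k<d. vec_index (w j) k * cnj (vec_index (w i) k))"
      by (rule sum.cong[OF refl]) (metis Vz cinner_commute lessThan_iff mult.commute)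
    also have "\<dots> = w j \<bullet>c w i"
      using wd ij by (simp add: scalar_prod_def lessThan_atLeast0)
    finally show "cinner (z i) (z j) = (if i = j then 1 else 0)"
      using w_orth[OF ij(2,1)] by auto
  qed
  show "P (T (z i)) = ritz i *\<^sub>R z i" if i: "i < r" for i
  proof -
    have "cinner (V k) (T (z i)) = of_real (ritz i) * vec_index (w i) k" if k: "k < d" for k
    proof -
      have "cinner (V k) (T (z i)) = (\<Sum>j<d. cinner (V k) (T (V j)) * vec_index (w i) j)"
        by (simp add: z_def synthesis_def clinear_sum[OF lin] clinear_scaleC[OF lin] cinner_sum_right
            cinner_scaleC_right mult.commute)
      also have "\<dots> = vec_index (M *\<^sub>v w i) k"
        using k wd[OF i] by (simp add: compression_def scalar_prod_def lessThan_atLeast0)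
      also have "M *\<^sub>v w i = of_real (ritz i) \<cdot>\<^sub>v w i"
        by (rule w_eig[OF i])
      finally show ?thesis using k wd[OF i] by simp
    qed
    then have "P (T (z i)) = (\<Sum>k<d. (of_real (ritz i) * vec_index (w i) k) *\<^sub>C V k)"
      by (simp add: projection_eq)
    also have "\<dots> = ritz i *\<^sub>R z i"
      by (simp add: z_def synthesis_def scaleR_scaleC ell2.scale_sum_right)
    finally show ?thesis .
  qed
qed

text \<open>The Ritz vectors \<open>z\<close> need not be those of \<open>ritz_basis\<close>. They
  are eigenvectors of \<open>shifted\<close>, whose smallest eigenvalues are the shifted Ritz
  values, so the statement for arbitrary eigenbases applies.\<close>

lemma form_ge_ritz:
  assumes z: "orthonormal r z" "\<And>i. i < r \<Longrightarrow> P (z i) = z i" "\<And>i. i < r \<Longrightarrow> P (T (z i)) = ritz i *\<^sub>R z i"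
    and r: "r < d" and x: "P x = x" "x \<in> ortho_compl r z"
  shows "ritz r * (norm x)\<^sup>2 \<le> inner x (T x)"
proof -
  have kth: "is_kth_eigenvalue shifted (Suc i) (ritz i - (K + 1))" if "i < d" for i
    by (rule ritz_basis) (use that in blast)
  have "eigenbasis shifted r z"
    unfolding eigenbasis_def using z r by (simp add: shifted_on kth_eigenvalueI[OF kth] scaleR_diff_left)
  from form_ge_kth_eigenvalue[OF shifted_compact shifted_sa kth[OF r] this x(2)]
  show ?thesis using x(1) by (simp add: form_shifted algebra_simps)
qed

text \<open>Upper half of the min-max principle: the span of \<open>y\<close> contains a nonzero
  vector orthogonal to the first \<open>i\<close> Ritz vectors.\<close>

lemma ritz_le:
  assumes y: "orthonormal (Suc i) y" "\<And>k. k \<le> i \<Longrightarrow> P (y k) = y k"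
    and a: "\<And>x. projection (Suc i) y x = x \<Longrightarrow> inner x (T x) \<le> a * (norm x)\<^sup>2" and i: "i < d"
  shows "ritz i \<le> a"
proof -
  obtain u where u: "orthonormal d u" and
    low: "\<And>i x. i < d \<Longrightarrow> P x = x \<Longrightarrow> x \<in> ortho_compl i u \<Longrightarrow> ritz i * (norm x)\<^sup>2 \<le> inner x (T x)"
    using ritz_basis by metis
  have ui: "orthonormal i u" using orthonormal_mono[OF u] i by simp
  obtain x where x: "x \<noteq> 0" "projection (Suc i) y x = x" "projection i u x = 0"
    using exists_orthogonal_in_span[OF y(1) ui] by blast
  have "P x = x"
    by (subst (1 2) x(2)[symmetric], subst (1 2) projection_eq)
      (simp add: clinear_add[OF P_lin] clinear_sum[OF P_lin] clinear_scaleC[OF P_lin] y(2) cong: sum.cong_simp)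
  then have "ritz i * (norm x)\<^sup>2 \<le> inner x (T x)"
    by (rule low[OF i]) (simp add: ortho_compl_projection[OF ui] x(3))
  also note a[OF x(2)]
  finally have "ritz i * (norm x)\<^sup>2 \<le> a * (norm x)\<^sup>2" .
  then show ?thesis using x(1) by simp
qed

text \<open>Lower half of the min-max principle: the span of the first \<open>Suc i\<close> Ritz
  vectors contains a nonzero vector orthogonal to \<open>e\<close>. The family \<open>e\<close> may
  leave the trial space; in the application it consists of eigenvectors of the full
  operator.\<close>

lemma ritz_ge:
  assumes e: "orthonormal i e" and b: "\<And>x. x \<in> ortho_compl i e \<Longrightarrow> b * (norm x)\<^sup>2 \<le> inner x (T x)"
    and i: "i < d"
  shows "b \<le> ritz i"
proof -
  obtain u where u: "orthonormal d u" "\<And>i. i < d \<Longrightarrow> P (u i) = u i"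
      "\<And>i. i < d \<Longrightarrow> P (T (u i)) = ritz i *\<^sub>R u i"
    using ritz_basis by metis
  have ui: "orthonormal (Suc i) u" using orthonormal_mono[OF u(1)] i by simp
  obtain x where x: "x \<noteq> 0" "projection (Suc i) u x = x" "projection i e x = 0"
    using exists_orthogonal_in_span[OF ui e] by blast
  define c where "c k = cinner (u k) x" for k
  have xc: "x = (\<Sum>k<Suc i. c k *\<^sub>C u k)"
    using x(2) unfolding c_def projection_eq by simp
  have "P x = x"
    unfolding xc using i by (simp add: clinear_add[OF P_lin] clinear_sum[OF P_lin] clinear_scaleC[OF P_lin] u(2))
  have PT: "P (T x) = (\<Sum>k<Suc i. (of_real (ritz k) * c k) *\<^sub>C u k)"
    unfolding xc clinear_sum[OF lin] clinear_sum[OF P_lin] clinear_scaleC[OF lin] clinear_scaleC[OF P_lin]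
    by (rule sum.cong) (use i u(3) in \<open>auto simp: scaleR_scaleC mult.commute\<close>)
  have "cinner x (P (T x)) = (\<Sum>k<Suc i. cnj (c k) * cinner (u k) (P (T x)))"
    by (subst (1) xc, subst cinner_sum_left) (simp add: cinner_scaleC_left)
  also have "\<dots> = (\<Sum>k<Suc i. cnj (c k) * (of_real (ritz k) * c k))"
    by (rule sum.cong[OF refl]) (simp add: PT cinner_lincomb[OF ui] del: sum.lessThan_Suc)
  also have "\<dots> = (\<Sum>k<Suc i. of_real (ritz k * (cmod (c k))\<^sup>2))"
    by (rule sum.cong[OF refl]) (simp add: complex_norm_square[unfolded of_real_power] mult_ac)
  finally have "inner x (P (T x)) = (\<Sum>k<Suc i. ritz k * (cmod (c k))\<^sup>2)"
    by (simp add: inner_cinner del: sum.lessThan_Suc)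
  then have "inner x (T x) = (\<Sum>k<Suc i. ritz k * (cmod (c k))\<^sup>2)"
    using form_P[OF \<open>P x = x\<close>] by simp
  also have "\<dots> \<le> (\<Sum>k<Suc i. ritz i * (cmod (c k))\<^sup>2)"
    by (intro sum_mono mult_right_mono ritz_mono) (use i in auto)
  also have "\<dots> = ritz i * (norm x)\<^sup>2"
    by (subst xc, subst norm_lincomb[OF ui]) (simp add: sum_distrib_left del: sum.lessThan_Suc)
  finally have "b * (norm x)\<^sup>2 \<le> ritz i * (norm x)\<^sup>2"
    using b[of x] x(3) by (simp add: ortho_compl_projection[OF e])
  then show ?thesis using x(1) by simp
qed

end

section \<open>Spectral gaps, residuals and the lower bounds of the linear program\<close>

text \<open>The common core of three sin-theta estimates: \<open>Q x\<close> is the component of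
  \<open>x\<close> beyond the gap, where the form is at least \<open>b\<close>, while an approximate
  eigenvalue equation with value \<open>m \<le> a\<close> bounds the form from above up to the error
  \<epsilon>.\<close>

lemma gap_estimate:
  assumes T: "clinear T" and form: "b * (norm (Q x))\<^sup>2 \<le> inner (Q x) (T (Q x))"
    and le: "inner (Q x) (T x) - inner (Q x) (T (x - Q x)) \<le> m * (norm (Q x))\<^sup>2 + \<epsilon> * norm (Q x)"
    and ab: "m \<le> a" "a < b" and \<epsilon>: "0 \<le> \<epsilon>"
  shows "norm (Q x) \<le> \<epsilon> / (b - a)"
proof (cases "Q x = 0")
  case False
  have "b * (norm (Q x))\<^sup>2 \<le> inner (Q x) (T x) - inner (Q x) (T (x - Q x))"
    using form by (simp add: clinear_diff[OF T] inner_diff_right)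
  also note le
  also have "m * (norm (Q x))\<^sup>2 + \<epsilon> * norm (Q x) \<le> a * (norm (Q x))\<^sup>2 + \<epsilon> * norm (Q x)"
    by (intro add_right_mono mult_right_mono ab) simp
  finally have "norm (Q x) * ((b - a) * norm (Q x)) \<le> norm (Q x) * \<epsilon>"
    by (simp add: power2_eq_square algebra_simps)
  then have "(b - a) * norm (Q x) \<le> \<epsilon>"
    using False by simp
  then show ?thesis
    using ab by (simp add: pos_le_divide_eq mult.commute)
qed (use ab \<epsilon> in simp)

lemma norm_synthesis:
  assumes u: "orthonormal r u" and x: "x \<in> carrier_vec r"
  shows "norm (synthesis r u x) = vec_norm x"
proof -
  have "(norm (synthesis r u x))\<^sup>2 = (vec_norm x)\<^sup>2"
    unfolding synthesis_def norm_lincomb[OF u] using carrier_vecD[OF x]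
    by (simp add: vec_norm_def sum_nonneg)
  then show ?thesis
    by (simp add: vec_norm_def sum_nonneg) (metis real_sqrt_unique norm_ge_zero)
qed

lemma projection_synthesis:
  assumes "orthonormal r u"
  shows "projection r u (synthesis r u x) = synthesis r u x"
  unfolding synthesis_def
  by (simp add: clinear_sum[OF projection_linear] clinear_scaleC[OF projection_linear]
      projection_basis[OF assms])

section \<open>The residual of an orthonormal family as an operator norm\<close>

context
  fixes T :: "ell2 \<Rightarrow> ell2" and r :: nat and u :: "nat \<Rightarrow> ell2" and K :: real
  assumes u: "orthonormal r u" and bdd: "\<And>x. norm (T x) \<le> K * norm x"
begin

private abbreviation "Pr \<equiv> projection r u"

private lemma K_nonneg: "0 \<le> K"
  using bdd[of "unit_seq 0"] orthonormal_norm[OF orthonormal_unit_seq[of 1], of 0]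
  by (metis less_one mult.right_neutral norm_ge_zero order.trans)

private lemma residual_bound: "norm (T x - Pr (T x)) \<le> K * norm x"
  using ortho_proj_compl_norm_le[OF ortho_proj_projection[OF u], of "T x"] bdd[of x] by simp

private lemma bdd_residual:
  "bdd_above ((\<lambda>x. norm (T (synthesis r u x) - Pr (T (synthesis r u x)))) ` {x \<in> carrier_vec r. vec_norm x \<le> 1})"
proof (rule bdd_aboveI2)
  fix x :: "complex vec" assume x: "x \<in> {x \<in> carrier_vec r. vec_norm x \<le> 1}"
  show "norm (T (synthesis r u x) - Pr (T (synthesis r u x))) \<le> K"
    using residual_bound[of "synthesis r u x"] x norm_synthesis[OF u, of x] mult_left_mono[OF _ K_nonneg, of "vec_norm x" 1]
    by auto
qed

lemma residual_le:
  assumes c: "0 \<le> c" and le: "\<And>x. Pr x = x \<Longrightarrow> norm (T x - Pr (T x)) \<le> c * norm x"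
  shows "residual T r u \<le> c"
  unfolding residual_def operator_norm_def
proof (rule cSUP_least)
  have "0\<^sub>v r \<in> {x \<in> carrier_vec r. vec_norm x \<le> 1}"
    by (simp add: vec_norm_def)
  then show "{x \<in> carrier_vec r. vec_norm x \<le> 1} \<noteq> {}" by blast
next
  fix x :: "complex vec" assume x: "x \<in> {x \<in> carrier_vec r. vec_norm x \<le> 1}"
  then show "norm (T (synthesis r u x) - Pr (T (synthesis r u x))) \<le> c"
    using le[OF projection_synthesis[OF u], of x] norm_synthesis[OF u, of x] mult_left_mono[OF _ c, of "vec_norm x" 1]
    by auto
qed

lemma residual_ge:
  assumes T: "clinear T" and x: "Pr x = x"
  shows "norm (T x - Pr (T x)) \<le> residual T r u * norm x"
proof (cases "x = 0")
  case False
  define y where "y = inverse (norm x) *\<^sub>R x"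
  have y: "Pr y = y" "norm y = 1"
    using False x by (simp_all add: y_def clinear_scaleR[OF projection_linear])
  have s: "synthesis r u (analysis r u y) = y"
    using y(1) by (simp add: projection_def)
  have car: "analysis r u y \<in> carrier_vec r"
    by (simp add: analysis_def)
  have "norm (T y - Pr (T y)) \<le> residual T r u"
    unfolding residual_def operator_norm_def
    by (rule cSUP_upper2[OF bdd_residual, of "analysis r u y"])
      (use car y norm_synthesis[OF u car] in \<open>auto simp: s\<close>)
  moreover have "T y - Pr (T y) = inverse (norm x) *\<^sub>R (T x - Pr (T x))"
    by (simp add: y_def clinear_scaleR[OF projection_linear] clinear_scaleR[OF T] scaleR_diff_right)
  then have "norm (T y - Pr (T y)) = norm (T x - Pr (T x)) / norm x"
    by (simp add: divide_inverse mult.commute)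
  ultimately show ?thesis
    using False by (simp add: pos_divide_le_eq)
qed (simp add: clinear_zero[OF T] clinear_zero[OF projection_linear])

lemma residual_nonneg:
  assumes T: "clinear T"
  shows "0 \<le> residual T r u"
proof (cases "r = 0")
  case True
  have "0\<^sub>v r \<in> {x \<in> carrier_vec r. vec_norm x \<le> 1}"
    by (simp add: vec_norm_def)
  from cSUP_upper[OF this bdd_residual] show ?thesis
    unfolding residual_def operator_norm_def by (rule order.trans[OF norm_ge_zero])
next
  case False
  then show ?thesis
    using residual_ge[OF T projection_basis[OF u, of 0]] orthonormal_norm[OF u, of 0]
    by (metis bot_nat_0.not_eq_extremum mult.right_neutral norm_ge_zero order.trans)
qed

lemma residual_le_bound: "residual T r u \<le> K"
  by (rule residual_le[OF K_nonneg residual_bound])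

end

section \<open>One sampled operator and the level of its constraint\<close>

locale eigen_data =
  fixes T :: "ell2 \<Rightarrow> ell2" and l :: nat and v :: "nat \<Rightarrow> ell2"
  assumes T: "compact_operator T" "self_adjoint T"
    and kth: "\<exists>t. is_kth_eigenvalue T (Suc l) t"
    and basis: "eigenbasis T l v" and l: "0 < l"
begin

text \<open>Indices start at 0, so \<open>ev l\<close> is eigenvalue number \<open>l + 1\<close>,
  the shift that enters \<open>beta\<close>.\<close>

abbreviation "ev k \<equiv> kth_eigenvalue T (Suc k)"

lemma is_kth: "k \<le> l \<Longrightarrow> is_kth_eigenvalue T (Suc k) (ev k)"
  using kth is_kth_eigenvalue_below[OF T] by auto

lemma ev_nonpos: "k \<le> l \<Longrightarrow> ev k \<le> 0"
  by (rule kth_eigenvalue_nonpos[OF T is_kth])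

lemma ev_mono: "i \<le> k \<Longrightarrow> k \<le> l \<Longrightarrow> ev i \<le> ev k"
  by (rule is_kth_eigenvalue_mono[OF is_kth is_kth]) auto

lemma v: "orthonormal l v" and v_eigen: "k < l \<Longrightarrow> T (v k) = ev k *\<^sub>R v k"
  using basis by (auto simp: eigenbasis_def)

definition t :: "nat \<Rightarrow> real" where "t k = sqrt (ev l - ev k)"

lemma t_square: "k < l \<Longrightarrow> (t k)\<^sup>2 = ev l - ev k"
  using ev_mono[of k l] by (simp add: t_def)

text \<open>\<open>R\<close> is the nonnegative square root of \<open>ev l - T\<close> on the span
  of \<open>v\<close>, and 0 on the orthogonal complement.\<close>

definition R :: "ell2 \<Rightarrow> ell2"
  where "R x = (\<Sum>k<l. (of_real (t k) * cinner (v k) x) *\<^sub>C v k)"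

lemma R_linear: "clinear R"
  unfolding R_def
  by (rule clinearI) (simp_all add: cinner_simps distrib_left ell2.scale_left_distrib sum.distrib
      ell2.scale_sum_right mult_ac)

lemma R_selfadj: "self_adjoint R"
  unfolding self_adjoint_def
proof (intro allI)
  fix x y
  have "cinner (R x) y = (\<Sum>k<l. cnj (cinner (v k) x) * of_real (t k) * cinner (v k) y)"
    by (simp add: R_def cinner_sum_left cinner_scaleC_left mult.commute)
  also have "\<dots> = (\<Sum>k<l. (of_real (t k) * cinner (v k) y) * cinner x (v k))"
    by (rule sum.cong[OF refl]) (simp add: cinner_commute[of x] mult_ac)
  also have "\<dots> = cinner x (R y)"
    by (simp add: R_def cinner_sum_right cinner_scaleC_right)
  finally show "cinner (R x) y = cinner x (R y)" .
qed

lemma R_v: "k < l \<Longrightarrow> R (v k) = t k *\<^sub>R v k"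
  unfolding R_def
  by (subst sum.cong[OF refl, of _ _ "\<lambda>i. if i = k then t k *\<^sub>R v k else 0"])
    (auto simp: orthonormalD[OF v] scaleR_scaleC)

lemma R_in_span: "projection l v (R x) = R x"
  unfolding R_def
  by (simp add: clinear_sum[OF projection_linear] clinear_scaleC[OF projection_linear]
      projection_basis[OF v])

lemma norm_R: "(norm (R x))\<^sup>2 = (\<Sum>k<l. (ev l - ev k) * (cmod (cinner (v k) x))\<^sup>2)"
  unfolding R_def norm_lincomb[OF v]
  by (rule sum.cong) (auto simp: norm_mult power_mult_distrib t_square)

lemma norm_R_le: "(norm (R x))\<^sup>2 \<le> (ev l - ev 0) * (norm x)\<^sup>2"
proof -
  have "(norm (R x))\<^sup>2 \<le> (\<Sum>k<l. (ev l - ev 0) * (cmod (cinner (v k) x))\<^sup>2)"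
    unfolding norm_R by (intro sum_mono mult_right_mono) (auto intro!: ev_mono)
  also have "\<dots> = (ev l - ev 0) * (norm (projection l v x))\<^sup>2"
    by (simp add: projection_norm[OF v] sum_distrib_left)
  also have "\<dots> \<le> (ev l - ev 0) * (norm x)\<^sup>2"
    using ortho_proj_norm_le[OF ortho_proj_projection[OF v], of x] ev_mono[of 0 l]
    by (intro mult_left_mono power_mono) auto
  finally show ?thesis .
qed

text \<open>On the span of \<open>v\<close> equality holds; on the complement \<open>R\<close>
  vanishes and the form of \<open>T\<close> is at least \<open>ev l\<close>; and there are no cross
  terms.\<close>

lemma form_ge: "ev l * (norm x)\<^sup>2 - (norm (R x))\<^sup>2 \<le> inner x (T x)"
proof -
  let ?P = "projection l v"
  note lin = compact_operator_linear[OF T(1)]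
  note P = ortho_proj_projection[OF v]
  have TP: "T (?P x) = (\<Sum>k<l. (of_real (ev k) * cinner (v k) x) *\<^sub>C v k)"
    by (simp add: projection_eq clinear_sum[OF lin] clinear_scaleC[OF lin] v_eigen scaleR_scaleC
        mult.commute)
  then have PTP: "?P (T (?P x)) = T (?P x)"
    by (simp add: clinear_sum[OF projection_linear] clinear_scaleC[OF projection_linear]
      projection_basis[OF v])
  have "cinner (v k) (T (?P x)) = of_real (ev k) * cinner (v k) x" if "k < l" for k
    unfolding TP by (rule cinner_lincomb[OF v that])
  then have "cinner (?P x) (T (?P x)) = (\<Sum>k<l. cnj (cinner (v k) x) * (of_real (ev k) * cinner (v k) x))"
    by (subst (1) projection_eq) (simp add: cinner_sum_left cinner_scaleC_left)
  also have "\<dots> = (\<Sum>k<l. of_real (ev k * (cmod (cinner (v k) x))\<^sup>2))"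
    by (rule sum.cong[OF refl]) (simp add: complex_norm_square[unfolded of_real_power] mult_ac)
  finally have diag: "inner (?P x) (T (?P x)) = (\<Sum>k<l. ev k * (cmod (cinner (v k) x))\<^sup>2)"
    by (simp add: inner_cinner)
  define y where "y = x - ?P x"
  have y: "y \<in> ortho_compl l v" unfolding y_def by (rule ortho_compl_minus_projection[OF v])
  have cross: "inner y (T (?P x)) = 0"
    by (metis PTP y_def inner_commute ortho_proj_orthogonal[OF P])
  then have cross': "inner (?P x) (T y) = 0"
    by (simp add: inner_commute_selfadj[OF T(2), of _ y])
  have "inner x (T x) = inner (?P x + y) (T (?P x + y))" by (simp add: y_def)
  also have "\<dots> = inner (?P x) (T (?P x)) + inner y (T y)"
    by (simp add: clinear_add[OF lin] inner_add_left inner_add_right cross cross')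
  also have "\<dots> \<ge> inner (?P x) (T (?P x)) + ev l * (norm y)\<^sup>2"
    using form_ge_kth_eigenvalue[OF T is_kth[OF order_refl] basis y] by simp
  also have "(norm y)\<^sup>2 = (norm x)\<^sup>2 - (\<Sum>k<l. (cmod (cinner (v k) x))\<^sup>2)"
    using ortho_proj_pythagoras[OF P, of x] projection_norm[OF v, of x] by (simp add: y_def)
  finally show ?thesis
    by (simp add: diag norm_R sum_subtractf sum_distrib_left left_diff_distrib right_diff_distrib)
qed

context
  fixes r u
  assumes u: "orthonormal r u"
begin

abbreviation "Pr \<equiv> projection r u"

definition bound :: real
  where "bound = kth_eigenvalue T 1 + beta T l v r u"

text \<open>On the span of \<open>v\<close> this is \<open>T - ev 0 + R Pr R\<close>. Written in
  this way, its form is a multiple of the squared norm minus the squared distance of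
  \<open>R x\<close> from the range of \<open>Pr\<close>.\<close>

definition reduced :: "ell2 \<Rightarrow> ell2"
  where "reduced x = (ev l - ev 0) *\<^sub>R x - R (R x - Pr (R x))"

lemma reduced_linear: "clinear reduced"
  unfolding reduced_def
  by (rule clinearI) (simp_all add: clinear_add[OF R_linear] clinear_scaleC[OF R_linear] clinear_diff[OF R_linear]
      clinear_add[OF projection_linear] clinear_scaleC[OF projection_linear] scaleR_scaleC
      ell2.scale_right_distrib ell2.scale_right_diff_distrib mult.commute)

lemma reduced_selfadj: "self_adjoint reduced"
  unfolding self_adjoint_def reduced_def
  by (simp add: cinner_simps clinear_diff[OF R_linear] self_adjoint_cinner[OF R_selfadj]
      self_adjoint_cinner[OF ortho_proj_selfadj[OF ortho_proj_projection[OF u]]])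

lemma reduced_form: "inner x (reduced x) = (ev l - ev 0) * (norm x)\<^sup>2 - (norm (R x - Pr (R x)))\<^sup>2"
proof -
  note Q = ortho_proj_compl[OF ortho_proj_projection[OF u]]
  have "inner x (R (R x - Pr (R x))) = inner (R x - Pr (R x)) (R x)"
    by (metis self_adjoint_inner[OF R_selfadj] inner_commute)
  also have "\<dots> = (norm (R x - Pr (R x)))\<^sup>2"
    by (rule ortho_proj_inner_self[OF Q])
  finally show ?thesis
    by (simp add: reduced_def inner_diff_right power2_norm_eq_inner)
qed

lemma reduced_bounded: "norm (reduced x) \<le> 2 * (ev l - ev 0) * norm x"
proof -
  define c where "c = ev l - ev 0"
  have c: "0 \<le> c" using ev_mono[of 0 l] by (simp add: c_def)
  have R: "norm (R y) \<le> sqrt c * norm y" for y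
    by (rule power2_le_imp_le) (use norm_R_le[of y] c in \<open>simp_all add: power_mult_distrib c_def\<close>)
  have "norm (R (R x - Pr (R x))) \<le> sqrt c * norm (R x - Pr (R x))" by (rule R)
  also have "\<dots> \<le> sqrt c * (sqrt c * norm x)"
    using ortho_proj_compl_norm_le[OF ortho_proj_projection[OF u], of "R x"] R[of x] c
    by (intro mult_left_mono) auto
  also have "\<dots> = c * norm x" using c by simp
  finally have "norm (R (R x - Pr (R x))) \<le> c * norm x" .
  moreover have "norm (reduced x) \<le> norm (c *\<^sub>R x) + norm (R (R x - Pr (R x)))"
    unfolding reduced_def c_def by (rule norm_triangle_ineq4)
  ultimately have "norm (reduced x) \<le> 2 * c * norm x"
    using c by simp
  then show ?thesis by (simp add: c_def)
qed

text \<open>In the matrix inside \<open>beta\<close> both factors \<open>t j\<close> stand on the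
  same side of the matrix of \<open>Pr\<close>. Distributing them symmetrically does not change the
  characteristic polynomial and yields the compression of \<open>reduced\<close>.\<close>

lemma beta_reduced: "beta T l v r u = mat_eigenvalue (compression l v reduced) 1"
proof -
  let ?g = "\<lambda>i j. cinner (v i) (Pr (v j))"
  let ?d = "\<lambda>i. complex_of_real (ev i - ev 0)" and ?t = "\<lambda>i. complex_of_real (t i)"
  have tt: "?t k * ?t k = of_real (ev l - ev k)" if "k < l" for k
    using t_square[OF that] by (simp add: power2_eq_square flip: of_real_mult)
  have 1: "mat_diag l (\<lambda>i. complex_of_real (kth_eigenvalue T (i + 1))) - of_real (kth_eigenvalue T 1) \<cdot>\<^sub>m 1\<^sub>m l
      - compression l v Pr * (mat_diag l (\<lambda>i. complex_of_real (kth_eigenvalue T (i + 1)))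
        - of_real (kth_eigenvalue T (l + 1)) \<cdot>\<^sub>m 1\<^sub>m l)
      = Matrix.mat l l (\<lambda>(i, j). (if i = j then ?d i else 0) + ?g i j * ?t j * ?t j)"
    (is "?X - ?C * ?Y = ?M")
  proof -
    have Y: "?Y = mat_diag l (\<lambda>j. - (?t j * ?t j))"
      by (rule eq_matI) (auto simp: mat_diag_def tt)
    have C: "?C \<in> carrier_mat l l" by (simp add: compression_def)
    show ?thesis
      unfolding Y mat_diag_mult_right[OF C]
      by (rule eq_matI) (auto simp: mat_diag_def compression_def mult.assoc)
  qed
  have 2: "compression l v reduced = Matrix.mat l l (\<lambda>(i, j). (if i = j then ?d i else 0) + ?t i * ?g i j * ?t j)"
  proof (rule eq_matI)
    fix i j
    assume "i < dim_row (Matrix.mat l l (\<lambda>(i, j). (if i = j then ?d i else 0) + ?t i * ?g i j * ?t j))"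
      "j < dim_col (Matrix.mat l l (\<lambda>(i, j). (if i = j then ?d i else 0) + ?t i * ?g i j * ?t j))"
    then have ij: "i < l" "j < l" by auto
    have "cinner (v i) (R x) = ?t i * cinner (v i) x" for x
      using self_adjoint_cinner[OF R_selfadj, of "v i" x] by (simp add: R_v[OF ij(1)] cinner_scaleR_left)
    then have "cinner (v i) (reduced (v j)) = of_real (ev l - ev 0) * cinner (v i) (v j)
        - ?t i * (?t j * cinner (v i) (v j) - ?t j * ?g i j)"
      unfolding reduced_def R_v[OF ij(2)]
      by (simp add: cinner_diff_right cinner_scaleR_right clinear_scaleR[OF projection_linear])
    also have "\<dots> = (if i = j then ?d i else 0) + ?t i * ?g i j * ?t j"
      using tt[OF ij(1)] ij by (auto simp: orthonormalD[OF v] algebra_simps)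
    finally show "compression l v reduced $$ (i, j) =
        Matrix.mat l l (\<lambda>(i, j). (if i = j then ?d i else 0) + ?t i * ?g i j * ?t j) $$ (i, j)"
      using ij by (simp add: compression_def)
  qed (auto simp: compression_def)
  show ?thesis
    unfolding beta_def Let_def 1 mat_eigenvalue_def 2 char_poly_diag_similar ..
qed

text \<open>Together: \<open>bound\<close> is \<open>ev l\<close> minus the squared norm of
  \<open>(I - Pr) R\<close> on the span of \<open>v\<close>. The further properties of the
  constraint levels are read off from this formula.\<close>

lemma
  shows bound_le: "projection l v x = x \<Longrightarrow> bound * (norm x)\<^sup>2 \<le> ev l * (norm x)\<^sup>2 - (norm (R x - Pr (R x)))\<^sup>2"
    and bound_attained: "\<exists>x. projection l v x = x \<and> norm x = 1 \<and> bound = ev l - (norm (R x - Pr (R x)))\<^sup>2"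
proof -
  interpret compressed l v reduced "2 * (ev l - ev 0)"
    by (rule compressed.intro) (rule v reduced_linear reduced_selfadj reduced_bounded)+
  have bound: "bound = ev 0 + ritz 0"
    by (simp add: bound_def beta_reduced)
  obtain q where q: "orthonormal l q" "\<And>i. i < l \<Longrightarrow> projection l v (q i) = q i"
    "\<And>i. i < l \<Longrightarrow> projection l v (reduced (q i)) = ritz i *\<^sub>R q i"
    and low: "\<And>i x. i < l \<Longrightarrow> projection l v x = x \<Longrightarrow> x \<in> ortho_compl i q \<Longrightarrow> ritz i * (norm x)\<^sup>2 \<le> inner x (reduced x)"
    using ritz_basis by metis
  show "bound * (norm x)\<^sup>2 \<le> ev l * (norm x)\<^sup>2 - (norm (R x - Pr (R x)))\<^sup>2" if "projection l v x = x"
    using low[OF l that] by (simp add: ortho_compl_def bound reduced_form algebra_simps)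
  have n: "norm (q 0) = 1" using orthonormal_norm[OF q(1) l] .
  have "inner (q 0) (reduced (q 0)) = inner (q 0) (ritz 0 *\<^sub>R q 0)"
    using form_P[OF q(2)[OF l]] q(3)[OF l] by metis
  then have "ritz 0 = (ev l - ev 0) - (norm (R (q 0) - Pr (R (q 0))))\<^sup>2"
    using n by (simp add: reduced_form power2_norm_eq_inner[symmetric])
  then have "bound = ev l - (norm (R (q 0) - Pr (R (q 0))))\<^sup>2"
    by (simp add: bound)
  with q(2)[OF l] n show "\<exists>x. projection l v x = x \<and> norm x = 1 \<and> bound = ev l - (norm (R x - Pr (R x)))\<^sup>2"
    by blast
qed

text \<open>By passing to the adjoint \<open>R (I - Pr)\<close>, the norm that determines
  \<open>bound\<close> also controls \<open>R f\<close> for \<open>f\<close> orthogonal to the range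
  of \<open>Pr\<close>; and by \<open>form_ge\<close> the form of \<open>T\<close> is at least that
  of \<open>ev l - R^2\<close>.\<close>

lemma bound_le_form:
  assumes f: "Pr f = 0"
  shows "bound * (norm f)\<^sup>2 \<le> inner f (T f)"
proof -
  note Q = ortho_proj_compl[OF ortho_proj_projection[OF u]]
  have "bound * (norm f)\<^sup>2 \<le> ev l * (norm f)\<^sup>2 - (norm (R f))\<^sup>2"
  proof (cases "R f = 0")
    case True
    have "bound \<le> ev l"
      using bound_attained by auto
    then show ?thesis using True by (simp add: mult_right_mono)
  next
    case False
    have pos: "norm (R f) > 0" using False by simp
    have "(norm (R f))\<^sup>2 = inner (R (R f)) f"
      by (simp add: power2_norm_eq_inner self_adjoint_inner[OF R_selfadj])
    also have "\<dots> = inner (R (R f) - Pr (R (R f))) f"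
      by (simp add: inner_diff_left ortho_proj_inner[OF ortho_proj_projection[OF u]] f)
    also have "\<dots> \<le> norm (R (R f) - Pr (R (R f))) * norm f"
      by (rule norm_cauchy_schwarz)
    finally have "((norm (R f))\<^sup>2)\<^sup>2 \<le> (norm (R (R f) - Pr (R (R f))) * norm f)\<^sup>2"
      by (rule power_mono) simp
    also have "\<dots> \<le> ((ev l - bound) * (norm (R f))\<^sup>2) * (norm f)\<^sup>2"
      unfolding power_mult_distrib
      using bound_le[OF R_in_span[of f]] by (intro mult_right_mono) (auto simp: algebra_simps)
    finally have "(norm (R f))\<^sup>2 * (norm (R f))\<^sup>2 \<le> (norm (R f))\<^sup>2 * ((ev l - bound) * (norm f)\<^sup>2)"
      by (simp add: power2_eq_square mult_ac)
    then have "(norm (R f))\<^sup>2 \<le> (ev l - bound) * (norm f)\<^sup>2"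
      by (rule mult_left_le_imp_le) (use pos in simp)
    then show ?thesis by (simp add: algebra_simps)
  qed
  also have "\<dots> \<le> inner f (T f)" by (rule form_ge)
  finally show ?thesis .
qed

text \<open>Test vector \<open>v k\<close>: an eigenvector below \<open>ev l\<close> that is far
  from the range of \<open>Pr\<close> pushes the level down.\<close>

lemma bound_le_distance:
  assumes k: "k < l"
  shows "bound \<le> ev l - (ev l - ev k) * (norm (v k - Pr (v k)))\<^sup>2"
proof -
  have "R (v k) - Pr (R (v k)) = t k *\<^sub>R (v k - Pr (v k))"
    by (simp add: R_v[OF k] clinear_scaleR[OF projection_linear] scaleR_diff_right)
  then have "(norm (R (v k) - Pr (R (v k))))\<^sup>2 = (ev l - ev k) * (norm (v k - Pr (v k)))\<^sup>2"
    by (simp add: power_mult_distrib t_square[OF k])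
  then show ?thesis
    using bound_le[OF projection_basis[OF v k]] orthonormal_norm[OF v k] by simp
qed

text \<open>The first \<open>r\<close> eigenvectors contribute nothing to
  \<open>(I - Pr) R x\<close>, and on the span of the others the squared norm of \<open>R\<close> is
  at most \<open>ev l - ev r\<close>.\<close>

lemma bound_ge:
  assumes r: "r \<le> l" and fixed: "\<And>k. k < r \<Longrightarrow> Pr (v k) = v k"
  shows "ev r \<le> bound"
proof -
  obtain x where x: "projection l v x = x" "norm x = 1" "bound = ev l - (norm (R x - Pr (R x)))\<^sup>2"
    using bound_attained by blast
  define c where "c k = of_real (t k) * cinner (v k) x" for k
  define y where "y = (\<Sum>k<l. (if k < r then 0 else c k) *\<^sub>C v k)"
  have "R x - y = (\<Sum>k<l. (if k < r then c k else 0) *\<^sub>C v k)"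
    unfolding R_def y_def c_def sum_subtractf[symmetric]
    by (rule sum.cong) auto
  then have "Pr (R x - y) = R x - y"
    by (simp add: clinear_sum[OF projection_linear] clinear_scaleC[OF projection_linear])
      (rule sum.cong, auto simp: fixed)
  then have "R x - Pr (R x) = y - Pr y"
    by (simp add: clinear_diff[OF projection_linear] algebra_simps)
  then have "(norm (R x - Pr (R x)))\<^sup>2 \<le> (norm y)\<^sup>2"
    using ortho_proj_compl_norm_le[OF ortho_proj_projection[OF u], of y] by (simp add: power_mono)
  also have "\<dots> = (\<Sum>k<l. (cmod (if k < r then 0 else c k))\<^sup>2)"
    unfolding y_def by (rule norm_lincomb[OF v])
  also have "\<dots> \<le> (\<Sum>k<l. (ev l - ev r) * (cmod (cinner (v k) x))\<^sup>2)"
  proof (rule sum_mono)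
    fix k assume "k \<in> {..<l}"
    then show "(cmod (if k < r then 0 else c k))\<^sup>2 \<le> (ev l - ev r) * (cmod (cinner (v k) x))\<^sup>2"
      using ev_mono[of r l] ev_mono[of r k] r
      by (auto simp: c_def norm_mult power_mult_distrib t_square intro!: mult_right_mono)
  qed
  also have "\<dots> = ev l - ev r"
    using x(1,2) projection_norm[OF v, of x] by (simp add: sum_distrib_left[symmetric])
  finally show ?thesis using x(3) by simp
qed

end

lemma bound_lipschitz:
  assumes u: "orthonormal r u" and u': "orthonormal r' u'"
    and le: "\<And>x. norm (projection r u x - projection r' u' x) \<le> \<epsilon> * norm x"
  shows "bound r u - bound r' u' \<le> \<epsilon> * (ev l - ev 0)"
proof -
  let ?P = "projection r u" and ?P' = "projection r' u'"
  \<comment> \<open>The vector that attains the level for \<open>u'\<close> serves as test vector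
    for \<open>u\<close>.\<close>
  obtain x where x: "projection l v x = x" "norm x = 1" "bound r' u' = ev l - (norm (R x - ?P' (R x)))\<^sup>2"
    using bound_attained[OF u'] by blast
  have "bound r u \<le> ev l - (norm (R x - ?P (R x)))\<^sup>2"
    using bound_le[OF u x(1)] x(2) by simp
  moreover have "(norm (y - ?P y))\<^sup>2 = (norm y)\<^sup>2 - inner (?P y) y"
    "(norm (y - ?P' y))\<^sup>2 = (norm y)\<^sup>2 - inner (?P' y) y" for y
    using ortho_proj_pythagoras[OF ortho_proj_projection[OF u], of y]
      ortho_proj_pythagoras[OF ortho_proj_projection[OF u'], of y]
    by (simp_all add: ortho_proj_inner_self[OF ortho_proj_projection[OF u]]
        ortho_proj_inner_self[OF ortho_proj_projection[OF u']])
  ultimately have "bound r u - bound r' u' \<le> inner (?P (R x) - ?P' (R x)) (R x)"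
    using x(3) by (simp add: inner_diff_left)
  also have "\<dots> \<le> norm (?P (R x) - ?P' (R x)) * norm (R x)"
    by (rule norm_cauchy_schwarz)
  also have "\<dots> \<le> \<epsilon> * norm (R x) * norm (R x)"
    by (intro mult_right_mono le) simp
  also have "\<dots> = \<epsilon> * (norm (R x))\<^sup>2" by (simp add: power2_eq_square)
  also have "\<dots> \<le> \<epsilon> * (ev l - ev 0)"
  proof (rule mult_left_mono)
    show "(norm (R x))\<^sup>2 \<le> ev l - ev 0" using norm_R_le[of x] x(2) by simp
    show "0 \<le> \<epsilon>" using order.trans[OF norm_ge_zero le[of x]] x(2) by simp
  qed
  finally show ?thesis .
qed

end

section \<open>The trial spaces\<close>

lemma norm_add_diff_diff_le:
  fixes a b c e :: "'a::real_normed_vector"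
  shows "norm (a + (b - c - e)) \<le> norm a + norm b + norm c + norm e"
  using norm_triangle_ineq[of a "b - c - e"] norm_triangle_ineq4[of "b - c" e]
    norm_triangle_ineq4[of b c] by linarith

locale setting =
  fixes Am :: "'k::finite \<Rightarrow> ell2 \<Rightarrow> ell2"
    and \<theta> :: "real^'p::finite \<Rightarrow> real^'k"
    and D :: "(real^'p) set"
    and l r :: nat
    and K L \<alpha> \<beta> :: real
  assumes compact_Am: "\<And>m. compact_operator (Am m)" and selfadj_Am: "\<And>m. self_adjoint (Am m)"
    and r_pos: "0 < r" and r_less: "r < l"
    and A_bounded: "\<And>\<mu> x. \<mu> \<in> D \<Longrightarrow> norm (affine_family Am \<theta> \<mu> x) \<le> K * norm x"
    and A_lipschitz: "\<And>\<mu> \<mu>' x. \<mu> \<in> D \<Longrightarrow> \<mu>' \<in> D \<Longrightarrow>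
      norm (affine_family Am \<theta> \<mu> x - affine_family Am \<theta> \<mu>' x) \<le> L * norm (\<mu> - \<mu>') * norm x"
    and kth_exists: "\<And>\<mu>. \<mu> \<in> D \<Longrightarrow> \<exists>t. is_kth_eigenvalue (affine_family Am \<theta> \<mu>) (Suc r) t"
    and gap: "\<alpha> < \<beta>"
    and below_gap: "\<And>\<mu>. \<mu> \<in> D \<Longrightarrow> kth_eigenvalue (affine_family Am \<theta> \<mu>) r \<le> \<alpha>"
    and above_gap: "\<And>\<mu>. \<mu> \<in> D \<Longrightarrow> \<beta> \<le> kth_eigenvalue (affine_family Am \<theta> \<mu>) (Suc r)"
    and K_nonneg: "0 \<le> K" and L_nonneg: "0 \<le> L"
begin

abbreviation "A \<equiv> affine_family Am \<theta>"

lemma A_compact: "compact_operator (A \<mu>)"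
proof -
  have "A \<mu> = (\<lambda>x. \<Sum>m\<in>UNIV. (\<theta> \<mu> $ m) *\<^sub>R Am m x)"
    by (rule ext) (simp add: affine_family_def)
  then show ?thesis
    by (auto intro!: compact_operator_sum compact_operator_scaleR compact_Am)
qed

lemma A_linear: "clinear (A \<mu>)"
  by (rule compact_operator_linear[OF A_compact])

lemma A_selfadj: "self_adjoint (A \<mu>)"
  unfolding self_adjoint_def affine_family_def
  by (simp add: cinner_sum_left cinner_sum_right cinner_scaleR_left cinner_scaleR_right
      self_adjoint_cinner[OF selfadj_Am])

lemma A_form_le: "\<mu> \<in> D \<Longrightarrow> \<bar>inner x (A \<mu> x)\<bar> \<le> K * (norm x)\<^sup>2"
proof -
  assume "\<mu> \<in> D"
  have "\<bar>inner x (A \<mu> x)\<bar> \<le> norm x * norm (A \<mu> x)" by (rule Cauchy_Schwarz_ineq2)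
  also have "\<dots> \<le> norm x * (K * norm x)" by (intro mult_left_mono A_bounded \<open>\<mu> \<in> D\<close>) simp
  finally show ?thesis by (simp add: power2_eq_square mult_ac)
qed

lemma is_kth: "\<mu> \<in> D \<Longrightarrow> k \<le> r \<Longrightarrow> is_kth_eigenvalue (A \<mu>) (Suc k) (kth_eigenvalue (A \<mu>) (Suc k))"
  using kth_exists is_kth_eigenvalue_below[OF A_compact A_selfadj] by fastforce

lemma eigenvalue_le: "\<mu> \<in> D \<Longrightarrow> k < r \<Longrightarrow> kth_eigenvalue (A \<mu>) (Suc k) \<le> \<alpha>"
  using is_kth_eigenvalue_mono[OF is_kth is_kth, of \<mu> k "r - 1"] below_gap[of \<mu>] r_pos by simp

lemma \<beta>_nonpos: "\<mu> \<in> D \<Longrightarrow> \<beta> \<le> 0"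
  by (rule order.trans[OF above_gap kth_eigenvalue_nonpos[OF A_compact A_selfadj is_kth[OF _ order_refl]]])

lemma eigenbasis_exists:
  assumes \<mu>: "\<mu> \<in> D"
  shows "\<exists>e. eigenbasis (A \<mu>) r e"
proof -
  have "is_kth_eigenvalue (A \<mu>) r (kth_eigenvalue (A \<mu>) r)"
    using is_kth[OF \<mu>, of "r - 1"] r_pos by simp
  from spectral_basis[OF A_compact A_selfadj this] show ?thesis by blast
qed

lemma eigenbasis_orthonormal: "eigenbasis T r e \<Longrightarrow> orthonormal r e"
  by (simp add: eigenbasis_def)

lemma eigenbasis_eigen:
  assumes "\<mu> \<in> D" "eigenbasis (A \<mu>) r e" "k < r"
  obtains a where "a \<le> \<alpha>" "A \<mu> (e k) = a *\<^sub>R e k"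
  using assms eigenvalue_le by (auto simp: eigenbasis_def)

lemma form_above_gap:
  assumes \<mu>: "\<mu> \<in> D" and e: "eigenbasis (A \<mu>) r e" and x: "x \<in> ortho_compl r e"
  shows "\<beta> * (norm x)\<^sup>2 \<le> inner x (A \<mu> x)"
proof -
  have "\<beta> * (norm x)\<^sup>2 \<le> kth_eigenvalue (A \<mu>) (Suc r) * (norm x)\<^sup>2"
    by (intro mult_right_mono above_gap \<mu>) simp
  also have "\<dots> \<le> inner x (A \<mu> x)"
    by (rule form_ge_kth_eigenvalue[OF A_compact A_selfadj is_kth[OF \<mu> order_refl] e x])
  finally show ?thesis .
qed

lemma eigenspace_invariant:
  assumes e: "eigenbasis T n e" and T: "clinear T" and x: "projection n e x = x"
  shows "projection n e (T x) = T x"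
proof -
  have on: "orthonormal n e" and ev: "\<And>k. k < n \<Longrightarrow> T (e k) = kth_eigenvalue T (k + 1) *\<^sub>R e k"
    using e by (auto simp: eigenbasis_def)
  have "T x = T (\<Sum>k<n. cinner (e k) x *\<^sub>C e k)" using x by (simp add: projection_eq)
  also have "\<dots> = (\<Sum>k<n. cinner (e k) x *\<^sub>C kth_eigenvalue T (k + 1) *\<^sub>R e k)"
    by (simp add: clinear_sum[OF T] clinear_scaleC[OF T] ev)
  also have "projection n e \<dots> = \<dots>"
    by (simp add: clinear_sum[OF projection_linear] clinear_scaleC[OF projection_linear]
        clinear_scaleR[OF projection_linear] projection_basis[OF on])
  finally show ?thesis .
qed

text \<open>Lipschitz constant of the Ritz projections: a factor 2 from
  \<open>ortho_proj_diff_le\<close>, a factor \<open>r\<close> from the basis vectors, and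
  \<open>2 * L / (\<beta> - \<alpha>)\<close> from \<open>ritz_close\<close>, where only half of the
  gap is available.\<close>

definition "CP = 4 * real r * L / (\<beta> - \<alpha>)"

lemma CP_nonneg: "0 \<le> CP"
  using gap L_nonneg by (simp add: CP_def)

text \<open>From \<open>rho_lipschitz\<close>: moving \<open>x\<close> into the other Ritz space and
  changing the parameter alters \<open>A x\<close> by \<open>L + K * CP\<close>, counted twice
  because the difference is also projected; changing the projection adds
  \<open>K * CP\<close>.\<close>

definition "Crho = 2 * L + 3 * K * CP"

lemma Crho_nonneg: "0 \<le> Crho"
  using CP_nonneg L_nonneg K_nonneg by (simp add: Crho_def)

end

section \<open>Ritz projections of one level\<close>

locale level = setting Am \<theta> D l r K L \<alpha> \<beta>
  for Am :: "'k::finite \<Rightarrow> ell2 \<Rightarrow> ell2" and \<theta> :: "real^'p::finite \<Rightarrow> real^'k"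
    and D :: "(real^'p) set" and l r K L \<alpha> \<beta> +
  fixes P :: "(real^'p) set" and v :: "real^'p \<Rightarrow> nat \<Rightarrow> ell2" and V :: "nat \<Rightarrow> ell2"
    and w :: "real^'p \<Rightarrow> nat \<Rightarrow> complex vec"
  assumes finite_P: "finite P" and P_subset: "P \<subseteq> D"
    and sample_kth: "\<And>\<nu>. \<nu> \<in> P \<Longrightarrow> \<exists>t. is_kth_eigenvalue (A \<nu>) (Suc l) t"
    and sample_basis: "\<And>\<nu>. \<nu> \<in> P \<Longrightarrow> eigenbasis (A \<nu>) l (v \<nu>)"
    and trial: "trial_basis l P v V"
    and ritz_basis: "\<And>\<mu>. \<mu> \<in> D \<Longrightarrow> mat_eigenbasis (ritz_matrix Am \<theta> l P v V \<mu>) r (w \<mu>)"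
    and dense: "\<And>\<mu>. \<mu> \<in> D \<Longrightarrow> \<exists>\<nu>\<in>P. L * norm (\<mu> - \<nu>) \<le> (\<beta> - \<alpha>) / 2"
begin

abbreviation "d \<equiv> trial_dim l P v"

abbreviation "PV \<equiv> projection d V"

abbreviation "z \<equiv> ritz_family l P v V w"

definition "PR \<mu> = projection r (z \<mu>)"

abbreviation "ritz \<mu> i \<equiv> mat_eigenvalue (ritz_matrix Am \<theta> l P v V \<mu>) (Suc i)"

lemma V: "orthonormal d V" and V_span: "ell2.span (V ` {..<d}) = trial_space l P v"
  using trial by (auto simp: trial_basis_def)

lemma PV_ortho: "ortho_proj PV"
  by (rule ortho_proj_projection[OF V])

lemma PV_fixes: "PV x = x \<longleftrightarrow> x \<in> trial_space l P v"
  by (simp add: projection_fixes_iff[OF V] V_span)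

lemma PV_sample: "\<nu> \<in> P \<Longrightarrow> k < l \<Longrightarrow> PV (v \<nu> k) = v \<nu> k"
  unfolding PV_fixes trial_space_def by (rule ell2.span_base) auto

lemma sample_orthonormal: "\<nu> \<in> P \<Longrightarrow> orthonormal l (v \<nu>)"
  using sample_basis by (simp add: eigenbasis_def)

lemma sample_basis_r: "\<nu> \<in> P \<Longrightarrow> eigenbasis (A \<nu>) r (v \<nu>)"
  using sample_basis[of \<nu>] r_less by (auto simp: eigenbasis_def intro: orthonormal_mono)

lemma r_less_d: "\<mu> \<in> D \<Longrightarrow> r < d"
  using dense[of \<mu>] orthonormal_card_le[OF sample_orthonormal V] PV_sample r_less by fastforce

lemma compressed: "\<mu> \<in> D \<Longrightarrow> compressed d V (A \<mu>) K"
  by (rule compressed.intro[OF V A_linear A_selfadj A_bounded])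

lemma
  assumes \<mu>: "\<mu> \<in> D"
  shows z: "orthonormal r (z \<mu>)" and PV_z: "PV (z \<mu> i) = z \<mu> i"
    and z_ritz: "i < r \<Longrightarrow> PV (A \<mu> (z \<mu> i)) = ritz \<mu> i *\<^sub>R z \<mu> i"
proof -
  interpret C: compressed d V "A \<mu>" K by (rule compressed[OF \<mu>])
  have zz: "z \<mu> = (\<lambda>i. synthesis d V (w \<mu> i))"
    by (rule ext) (simp add: ritz_family_def)
  note * = C.ritz_vectors[OF ritz_basis[OF \<mu>, unfolded ritz_matrix_def], folded ritz_matrix_def zz]
  show "orthonormal r (z \<mu>)" "PV (z \<mu> i) = z \<mu> i" "i < r \<Longrightarrow> PV (A \<mu> (z \<mu> i)) = ritz \<mu> i *\<^sub>R z \<mu> i"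
    using *(1) *(2)[of i] *(3)[of i] by (simp_all add: ritz_family_def)
qed

lemma PR_ortho: "\<mu> \<in> D \<Longrightarrow> ortho_proj (PR \<mu>)"
  unfolding PR_def by (rule ortho_proj_projection[OF z])

lemma PR_linear: "clinear (PR \<mu>)"
  unfolding PR_def by (rule projection_linear)

lemma PR_z: "\<mu> \<in> D \<Longrightarrow> i < r \<Longrightarrow> PR \<mu> (z \<mu> i) = z \<mu> i"
  unfolding PR_def by (rule projection_basis[OF z])

lemma PV_PR: "\<mu> \<in> D \<Longrightarrow> PV (PR \<mu> x) = PR \<mu> x"
  unfolding PR_def projection_eq[of r]
  by (simp add: clinear_sum[OF projection_linear] clinear_scaleC[OF projection_linear] PV_z)

lemma PR_PV: "\<mu> \<in> D \<Longrightarrow> PR \<mu> (PV x) = PR \<mu> x"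
proof -
  assume \<mu>: "\<mu> \<in> D"
  have "cinner (z \<mu> i) (PV x) = cinner (z \<mu> i) x" for i
    by (metis PV_z[OF \<mu>] self_adjoint_cinner[OF ortho_proj_selfadj[OF PV_ortho]])
  then show ?thesis by (simp add: PR_def projection_eq[of r])
qed

text \<open>The test space is spanned by eigenvectors of the sample \<nu>, where the form at \<nu>
  is at most \<alpha>.\<close>

lemma ritz_le: 
  assumes \<mu>: "\<mu> \<in> D" and \<nu>: "\<nu> \<in> P" and i: "i < r"
  shows "ritz \<mu> i \<le> \<alpha> + L * norm (\<mu> - \<nu>)"
proof -
  interpret C: compressed d V "A \<mu>" K by (rule compressed[OF \<mu>])
  have \<nu>D: "\<nu> \<in> D" using \<nu> P_subset by auto
  have on: "orthonormal (Suc i) (v \<nu>)"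
    using sample_orthonormal[OF \<nu>] by (rule orthonormal_mono) (use i r_less in simp)
  have eig: "A \<nu> (v \<nu> k) = kth_eigenvalue (A \<nu>) (Suc k) *\<^sub>R v \<nu> k" if "k < r" for k
    using sample_basis_r[OF \<nu>] that by (simp add: eigenbasis_def)
  have "C.ritz i \<le> \<alpha> + L * norm (\<mu> - \<nu>)"
  proof (rule C.ritz_le[OF on])
    show "PV (v \<nu> k) = v \<nu> k" if "k \<le> i" for k
      using PV_sample[OF \<nu>] that i r_less by simp
    show "i < d" using r_less_d[OF \<mu>] i by simp
    fix x assume x: "projection (Suc i) (v \<nu>) x = x"
    define c where "c k = cinner (v \<nu> k) x" for k
    have xc: "x = (\<Sum>k<Suc i. c k *\<^sub>C v \<nu> k)"
      using x unfolding c_def projection_eq by simp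
    have "A \<nu> x = (\<Sum>k<Suc i. (of_real (kth_eigenvalue (A \<nu>) (Suc k)) * c k) *\<^sub>C v \<nu> k)"
      unfolding xc clinear_sum[OF A_linear] clinear_scaleC[OF A_linear]
      by (rule sum.cong) (use i eig in \<open>auto simp: scaleR_scaleC mult.commute\<close>)
    then have "cinner x (A \<nu> x) = (\<Sum>k<Suc i. cnj (c k) * (of_real (kth_eigenvalue (A \<nu>) (Suc k)) * c k))"
      by (subst (1) xc) (simp add: cinner_sum_left cinner_scaleC_left cinner_lincomb[OF on] del: sum.lessThan_Suc)
    also have "\<dots> = (\<Sum>k<Suc i. of_real (kth_eigenvalue (A \<nu>) (Suc k) * (cmod (c k))\<^sup>2))"
      by (rule sum.cong[OF refl]) (simp add: complex_norm_square[unfolded of_real_power] mult_ac)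
    finally have "inner x (A \<nu> x) = (\<Sum>k<Suc i. kth_eigenvalue (A \<nu>) (Suc k) * (cmod (c k))\<^sup>2)"
      by (simp add: inner_cinner del: sum.lessThan_Suc)
    also have "\<dots> \<le> (\<Sum>k<Suc i. \<alpha> * (cmod (c k))\<^sup>2)"
      by (intro sum_mono mult_right_mono eigenvalue_le[OF \<nu>D]) (use i in auto)
    also have "\<dots> = \<alpha> * (norm x)\<^sup>2"
      by (subst xc, subst norm_lincomb[OF on]) (simp add: sum_distrib_left del: sum.lessThan_Suc)
    finally have 1: "inner x (A \<nu> x) \<le> \<alpha> * (norm x)\<^sup>2" .
    have "inner x (A \<mu> x - A \<nu> x) \<le> norm x * norm (A \<mu> x - A \<nu> x)"
      by (rule norm_cauchy_schwarz)
    also have "\<dots> \<le> norm x * (L * norm (\<mu> - \<nu>) * norm x)"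
      by (intro mult_left_mono A_lipschitz \<mu> \<nu>D) simp
    finally show "inner x (A \<mu> x) \<le> (\<alpha> + L * norm (\<mu> - \<nu>)) * (norm x)\<^sup>2"
      using 1 by (simp add: inner_diff_right power2_eq_square algebra_simps)
  qed
  then show ?thesis by (simp add: ritz_matrix_def)
qed

text \<open>The density of the samples enters here: with the lowest \<open>r\<close> Ritz values
  below the middle of the gap, half of the gap remains for the separation arguments, at every
  level.\<close>

lemma ritz_le_mid: "\<mu> \<in> D \<Longrightarrow> i < r \<Longrightarrow> ritz \<mu> i \<le> (\<alpha> + \<beta>) / 2"
  using dense[of \<mu>] ritz_le[of \<mu> _ i] by (fastforce simp: field_simps)

text \<open>Compression can only raise eigenvalues, so Ritz value number \<open>r + 1\<close> is
  still at least \<beta>.\<close>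

lemma form_above_ritz:
  assumes \<mu>: "\<mu> \<in> D" and x: "PV x = x" "PR \<mu> x = 0"
  shows "\<beta> * (norm x)\<^sup>2 \<le> inner x (A \<mu> x)"
proof -
  interpret C: compressed d V "A \<mu>" K by (rule compressed[OF \<mu>])
  obtain e where e: "eigenbasis (A \<mu>) r e" using eigenbasis_exists[OF \<mu>] by blast
  have "\<beta> \<le> C.ritz r"
    by (rule C.ritz_ge[OF eigenbasis_orthonormal[OF e] form_above_gap[OF \<mu> e] r_less_d[OF \<mu>]])
  then have "\<beta> * (norm x)\<^sup>2 \<le> C.ritz r * (norm x)\<^sup>2"
    by (rule mult_right_mono) simp
  also have "\<dots> \<le> inner x (A \<mu> x)"
    by (rule C.form_ge_ritz[OF z[OF \<mu>] PV_z[OF \<mu>] z_ritz[OF \<mu>, unfolded ritz_matrix_def] r_less_d[OF \<mu>] x(1)])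
      (use x(2) in \<open>simp_all add: ortho_compl_projection[OF z[OF \<mu>]] PR_def\<close>)
  finally show ?thesis .
qed

lemma PR_invariant:
  assumes \<mu>: "\<mu> \<in> D"
  shows "PR \<mu> (PV (A \<mu> (PR \<mu> x))) = PV (A \<mu> (PR \<mu> x))"
proof -
  have "PV (A \<mu> (PR \<mu> x)) = (\<Sum>i<r. cinner (z \<mu> i) x *\<^sub>C ritz \<mu> i *\<^sub>R z \<mu> i)"
    by (simp add: PR_def projection_eq[of r] clinear_sum[OF A_linear] clinear_scaleC[OF A_linear]
        clinear_sum[OF projection_linear] clinear_scaleC[OF projection_linear] z_ritz[OF \<mu>])
  also have "PR \<mu> \<dots> = \<dots>"
    by (simp add: clinear_sum[OF PR_linear] clinear_scaleC[OF PR_linear] clinear_scaleR[OF PR_linear] PR_z[OF \<mu>])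
  finally show ?thesis .
qed

text \<open>\<open>gap_estimate\<close> inside the trial space. The Ritz space is invariant under
  the compressed operator, so the cross term vanishes; the separation is that between \<beta> and
  the middle of the gap.\<close>

lemma ritz_close:
  assumes \<mu>: "\<mu> \<in> D" and x: "PV x = x" and le: "norm (PV (A \<mu> x) - a *\<^sub>R x) \<le> \<epsilon>" and a: "a \<le> (\<alpha> + \<beta>) / 2"
  shows "norm (x - PR \<mu> x) \<le> 2 * \<epsilon> / (\<beta> - \<alpha>)"
proof -
  note R = PR_ortho[OF \<mu>]
  define y where "y = x - PR \<mu> x"
  have y: "PV y = y" "PR \<mu> y = 0"
    by (simp_all add: y_def clinear_diff[OF projection_linear] PV_PR[OF \<mu>] x clinear_diff[OF PR_linear]
        ortho_proj_idem[OF R])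
  have PVy: "inner y u = inner y (PV u)" for u
    by (metis y(1) ortho_proj_inner[OF PV_ortho])
  have "inner y (A \<mu> (x - (x - PR \<mu> x))) = inner y (PR \<mu> (PV (A \<mu> (PR \<mu> x))))"
    unfolding PR_invariant[OF \<mu>] by (simp add: PVy[of "A \<mu> (PR \<mu> x)"])
  also have "\<dots> = 0"
    by (metis ortho_proj_inner[OF R] y(2) inner_zero_left)
  finally have 1: "inner y (A \<mu> (x - (x - PR \<mu> x))) = 0" .
  have "inner y (A \<mu> x) = inner y (PV (A \<mu> x) - a *\<^sub>R x) + a * inner y x"
    by (simp add: PVy[of "A \<mu> x"] inner_diff_right)
  also have "inner y x = (norm y)\<^sup>2"
    unfolding y_def by (rule ortho_proj_inner_self[OF ortho_proj_compl[OF R]])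
  also have "inner y (PV (A \<mu> x) - a *\<^sub>R x) \<le> norm y * \<epsilon>"
    using norm_cauchy_schwarz[of y "PV (A \<mu> x) - a *\<^sub>R x"] mult_left_mono[OF le, of "norm y"] by simp
  finally have 2: "inner y (A \<mu> x) \<le> a * (norm y)\<^sup>2 + \<epsilon> * norm y" by (simp add: mult.commute)
  have "norm (x - PR \<mu> x) \<le> \<epsilon> / (\<beta> - (\<alpha> + \<beta>) / 2)"
  proof (rule gap_estimate[OF A_linear[of \<mu>], where Q = "\<lambda>x. x - PR \<mu> x" and m = a])
    show "\<beta> * (norm (x - PR \<mu> x))\<^sup>2 \<le> inner (x - PR \<mu> x) (A \<mu> (x - PR \<mu> x))"
      using form_above_ritz[OF \<mu> y] by (simp add: y_def)
    show "inner (x - PR \<mu> x) (A \<mu> x) - inner (x - PR \<mu> x) (A \<mu> (x - (x - PR \<mu> x)))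
        \<le> a * (norm (x - PR \<mu> x))\<^sup>2 + \<epsilon> * norm (x - PR \<mu> x)"
      using 1 2 by (simp add: y_def)
    show "0 \<le> \<epsilon>" using le norm_ge_zero order.trans by blast
  qed (use a gap in auto)
  also have "\<epsilon> / (\<beta> - (\<alpha> + \<beta>) / 2) = 2 * \<epsilon> / (\<beta> - \<alpha>)"
    by (simp add: field_simps)
  finally show ?thesis .
qed

text \<open>The Ritz vectors at \<open>\<mu>'\<close> solve the compressed eigenvalue equation at
  \<mu> up to the change of the operator.\<close>

lemma PR_near:
  assumes \<mu>: "\<mu> \<in> D" and \<mu>': "\<mu>' \<in> D"
  shows "norm (PR \<mu>' x - PR \<mu> (PR \<mu>' x)) \<le> CP / 2 * norm (\<mu> - \<mu>') * norm x"
proof -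
  have "norm (z \<mu>' i - PR \<mu> (z \<mu>' i)) \<le> 2 * (L * norm (\<mu> - \<mu>')) / (\<beta> - \<alpha>)" if i: "i < r" for i
  proof (rule ritz_close[OF \<mu> PV_z[OF \<mu>'] _ ritz_le_mid[OF \<mu>' i]])
    have "PV (A \<mu> (z \<mu>' i)) - ritz \<mu>' i *\<^sub>R z \<mu>' i = PV (A \<mu> (z \<mu>' i) - A \<mu>' (z \<mu>' i))"
      by (simp add: clinear_diff[OF projection_linear] z_ritz[OF \<mu>' i])
    also have "norm \<dots> \<le> norm (A \<mu> (z \<mu>' i) - A \<mu>' (z \<mu>' i))"
      by (rule ortho_proj_norm_le[OF PV_ortho])
    also have "\<dots> \<le> L * norm (\<mu> - \<mu>')"
      using A_lipschitz[OF \<mu> \<mu>', of "z \<mu>' i"] orthonormal_norm[OF z[OF \<mu>'] i] by simp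
    finally show "norm (PV (A \<mu> (z \<mu>' i)) - ritz \<mu>' i *\<^sub>R z \<mu>' i) \<le> L * norm (\<mu> - \<mu>')" .
  qed
  from norm_on_span_le[OF z[OF \<mu>'] ortho_proj_linear[OF ortho_proj_compl[OF PR_ortho[OF \<mu>]]] this, of "PR \<mu>' x"]
  have "norm (PR \<mu>' x - PR \<mu> (PR \<mu>' x)) \<le> real r * (2 * (L * norm (\<mu> - \<mu>')) / (\<beta> - \<alpha>)) * norm (PR \<mu>' x)"
    using ortho_proj_idem[OF PR_ortho[OF \<mu>']] by (simp add: PR_def)
  also have "\<dots> \<le> real r * (2 * (L * norm (\<mu> - \<mu>')) / (\<beta> - \<alpha>)) * norm x"
    using ortho_proj_norm_le[OF PR_ortho[OF \<mu>']] gap L_nonneg by (intro mult_left_mono) auto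
  also have "\<dots> = CP / 2 * norm (\<mu> - \<mu>') * norm x"
    using gap by (simp add: CP_def field_simps)
  finally show ?thesis .
qed

lemma PR_lipschitz:
  assumes \<mu>: "\<mu> \<in> D" and \<mu>': "\<mu>' \<in> D"
  shows "norm (PR \<mu> x - PR \<mu>' x) \<le> CP * norm (\<mu> - \<mu>') * norm x"
  using ortho_proj_diff_le[OF PR_ortho[OF \<mu>] PR_ortho[OF \<mu>'] PR_near[OF \<mu> \<mu>']
      PR_near[OF \<mu>' \<mu>, unfolded norm_minus_commute[of \<mu>' \<mu>]], of x] by simp

text \<open>The eigenvectors of a sample lie in the trial space and solve the compressed equation
  without error.\<close>

lemma PR_sample:
  assumes \<nu>: "\<nu> \<in> P" and k: "k < r"
  shows "PR \<nu> (v \<nu> k) = v \<nu> k"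
proof -
  have \<nu>D: "\<nu> \<in> D" using \<nu> P_subset by auto
  obtain a where a: "a \<le> \<alpha>" "A \<nu> (v \<nu> k) = a *\<^sub>R v \<nu> k"
    using eigenbasis_eigen[OF \<nu>D sample_basis_r[OF \<nu>] k] by blast
  have PVv: "PV (v \<nu> k) = v \<nu> k" using PV_sample[OF \<nu>] k r_less by simp
  have "norm (v \<nu> k - PR \<nu> (v \<nu> k)) \<le> 2 * 0 / (\<beta> - \<alpha>)"
    by (rule ritz_close[OF \<nu>D PVv, of a]) (use a gap in \<open>simp_all add: clinear_scaleR[OF projection_linear] PVv\<close>)
  then show ?thesis by simp
qed

text \<open>The projection of \<open>e k\<close> to the trial space is an approximate eigenvector of
  the compressed operator.\<close>

lemma eigenvector_near_ritz:
  assumes \<mu>: "\<mu> \<in> D" and e: "eigenbasis (A \<mu>) r e" and k: "k < r"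
  shows "norm (e k - PR \<mu> (e k)) \<le> (1 + 2 * K / (\<beta> - \<alpha>)) * norm (e k - PV (e k))"
proof -
  obtain a where a: "a \<le> \<alpha>" "A \<mu> (e k) = a *\<^sub>R e k"
    using eigenbasis_eigen[OF \<mu> e k] by blast
  define x where "x = PV (e k)"
  have x: "PV x = x" by (simp add: x_def ortho_proj_idem[OF PV_ortho])
  have "PV (A \<mu> x) - a *\<^sub>R x = PV (A \<mu> (x - e k))"
    by (simp add: clinear_diff[OF A_linear] clinear_diff[OF projection_linear] a
        clinear_scaleR[OF projection_linear] x_def)
  also have "norm \<dots> \<le> norm (A \<mu> (x - e k))" by (rule ortho_proj_norm_le[OF PV_ortho])
  also have "\<dots> \<le> K * norm (e k - PV (e k))"
    using A_bounded[OF \<mu>, of "x - e k"] by (simp add: x_def norm_minus_commute)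
  finally have "norm (x - PR \<mu> x) \<le> 2 * (K * norm (e k - PV (e k))) / (\<beta> - \<alpha>)"
    by (rule ritz_close[OF \<mu> x]) (use a gap in auto)
  moreover have "norm (e k - PR \<mu> (e k)) \<le> norm (e k - PV (e k)) + norm (x - PR \<mu> x)"
    using norm_triangle_ineq[of "e k - PV (e k)" "x - PR \<mu> x"]
    by (simp add: x_def PR_PV[OF \<mu>])
  ultimately show ?thesis by (simp add: algebra_simps)
qed

section \<open>Residuals of one level\<close>

abbreviation "rho' \<equiv> rho Am \<theta> l r P v V w"

lemma rho_eq: "rho' \<mu> = residual (A \<mu>) r (z \<mu>)"
  by (simp add: rho_def)

lemma rho_nonneg: "\<mu> \<in> D \<Longrightarrow> 0 \<le> rho' \<mu>"
  unfolding rho_eq by (rule residual_nonneg[OF z A_bounded A_linear])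

lemma rho_le_K: "\<mu> \<in> D \<Longrightarrow> rho' \<mu> \<le> K"
  unfolding rho_eq by (rule residual_le_bound[OF z A_bounded])

lemma rho_ge: "\<mu> \<in> D \<Longrightarrow> norm (A \<mu> (PR \<mu> x) - PR \<mu> (A \<mu> (PR \<mu> x))) \<le> rho' \<mu> * norm (PR \<mu> x)"
  unfolding rho_eq PR_def
  by (rule residual_ge[OF z A_bounded A_linear])
    (auto simp: ortho_proj_idem[OF ortho_proj_projection[OF z]])

lemma rho_le: "\<mu> \<in> D \<Longrightarrow> 0 \<le> c \<Longrightarrow> (\<And>x. PR \<mu> x = x \<Longrightarrow> norm (A \<mu> x - PR \<mu> (A \<mu> x)) \<le> c * norm x) \<Longrightarrow> rho' \<mu> \<le> c"
  unfolding rho_eq PR_def by (rule residual_le[OF z A_bounded]) auto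

lemma rho_lipschitz:
  assumes \<mu>: "\<mu> \<in> D" and \<mu>': "\<mu>' \<in> D"
  shows "rho' \<mu>' \<le> rho' \<mu> + Crho * norm (\<mu> - \<mu>')"
proof (rule rho_le[OF \<mu>'])
  show "0 \<le> rho' \<mu> + Crho * norm (\<mu> - \<mu>')"
    using rho_nonneg[OF \<mu>] Crho_nonneg by simp
  fix x assume x: "PR \<mu>' x = x"
  define \<delta> where "\<delta> = norm (\<mu> - \<mu>') * norm x"
  define y where "y = PR \<mu> x"
  have yx: "norm (x - y) \<le> CP * \<delta>"
    using PR_lipschitz[OF \<mu> \<mu>', of x] by (simp add: y_def x norm_minus_commute \<delta>_def mult.assoc)
  have ny: "norm y \<le> norm x"
    unfolding y_def by (rule ortho_proj_norm_le[OF PR_ortho[OF \<mu>]])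
  have "norm (A \<mu>' x - A \<mu> y) \<le> norm (A \<mu>' x - A \<mu> x) + norm (A \<mu> (x - y))"
    using norm_triangle_ineq[of "A \<mu>' x - A \<mu> x" "A \<mu> (x - y)"] by (simp add: clinear_diff[OF A_linear])
  also have "norm (A \<mu>' x - A \<mu> x) \<le> L * \<delta>"
    using A_lipschitz[OF \<mu> \<mu>', of x] by (simp add: norm_minus_commute \<delta>_def mult.assoc)
  also have "norm (A \<mu> (x - y)) \<le> K * (CP * \<delta>)"
    using A_bounded[OF \<mu>, of "x - y"] mult_left_mono[OF yx K_nonneg] by simp
  finally have d: "norm (A \<mu>' x - A \<mu> y) \<le> (L + K * CP) * \<delta>" by (simp add: algebra_simps)
  have "norm (PR \<mu>' (A \<mu> y) - PR \<mu> (A \<mu> y)) \<le> CP * norm (\<mu> - \<mu>') * norm (A \<mu> y)"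
    using PR_lipschitz[OF \<mu>' \<mu>, of "A \<mu> y"] by (simp add: norm_minus_commute)
  also have "\<dots> \<le> CP * norm (\<mu> - \<mu>') * (K * norm x)"
    using A_bounded[OF \<mu>, of y] mult_left_mono[OF ny K_nonneg] CP_nonneg by (intro mult_left_mono) auto
  finally have p: "norm (PR \<mu>' (A \<mu> y) - PR \<mu> (A \<mu> y)) \<le> K * CP * \<delta>"
    by (simp add: \<delta>_def mult_ac)
  \<comment> \<open>Telescoping from \<open>\<mu>'\<close> and \<open>x\<close> to \<mu> and
    \<open>y\<close>: the change of the image, its projection, and the change of the
    projection.\<close>
  have "A \<mu>' x - PR \<mu>' (A \<mu>' x) = (A \<mu> y - PR \<mu> (A \<mu> y)) + ((A \<mu>' x - A \<mu> y)
      - PR \<mu>' (A \<mu>' x - A \<mu> y) - (PR \<mu>' (A \<mu> y) - PR \<mu> (A \<mu> y)))"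
    by (simp add: clinear_diff[OF PR_linear])
  then have "norm (A \<mu>' x - PR \<mu>' (A \<mu>' x)) \<le> norm (A \<mu> y - PR \<mu> (A \<mu> y)) + norm (A \<mu>' x - A \<mu> y)
      + norm (PR \<mu>' (A \<mu>' x - A \<mu> y)) + norm (PR \<mu>' (A \<mu> y) - PR \<mu> (A \<mu> y))"
    by (simp only: norm_add_diff_diff_le)
  moreover have "norm (PR \<mu>' (A \<mu>' x - A \<mu> y)) \<le> norm (A \<mu>' x - A \<mu> y)"
    by (rule ortho_proj_norm_le[OF PR_ortho[OF \<mu>']])
  moreover have "norm (A \<mu> y - PR \<mu> (A \<mu> y)) \<le> rho' \<mu> * norm x"
    using rho_ge[OF \<mu>, of x] mult_left_mono[OF ny rho_nonneg[OF \<mu>]] by (simp add: y_def)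
  ultimately have "norm (A \<mu>' x - PR \<mu>' (A \<mu>' x)) \<le> rho' \<mu> * norm x + 2 * ((L + K * CP) * \<delta>) + K * CP * \<delta>"
    using d p by linarith
  then show "norm (A \<mu>' x - PR \<mu>' (A \<mu>' x)) \<le> (rho' \<mu> + Crho * norm (\<mu> - \<mu>')) * norm x"
    by (simp add: Crho_def \<delta>_def algebra_simps)
qed

text \<open>At a sample the Ritz space coincides with an eigenspace and is therefore
  invariant.\<close>

lemma rho_sample:
  assumes \<nu>: "\<nu> \<in> P"
  shows "rho' \<nu> = 0"
proof -
  have \<nu>D: "\<nu> \<in> D" using \<nu> P_subset by auto
  note e = sample_basis_r[OF \<nu>]
  note on = eigenbasis_orthonormal[OF e]
  have "rho' \<nu> \<le> 0"
  proof (rule rho_le[OF \<nu>D])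
    fix x assume x: "PR \<nu> x = x"
    have "norm (x - projection r (v \<nu>) x) \<le> (real r)\<^sup>2 * 0 * norm x"
      by (rule gap_symmetric_le[OF on z[OF \<nu>D]]) (use x PR_sample[OF \<nu>] in \<open>simp_all add: PR_def\<close>)
    then have "projection r (v \<nu>) x = x" by simp
    from eigenspace_invariant[OF e A_linear this]
    have Ax: "A \<nu> x = (\<Sum>k<r. cinner (v \<nu> k) (A \<nu> x) *\<^sub>C v \<nu> k)" by (simp add: projection_eq)
    then have "PR \<nu> (A \<nu> x) = PR \<nu> (\<Sum>k<r. cinner (v \<nu> k) (A \<nu> x) *\<^sub>C v \<nu> k)" by simp
    also have "\<dots> = (\<Sum>k<r. cinner (v \<nu> k) (A \<nu> x) *\<^sub>C v \<nu> k)"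
      by (simp add: clinear_sum[OF PR_linear] clinear_scaleC[OF PR_linear] PR_sample[OF \<nu>])
    also have "\<dots> = A \<nu> x" using Ax by (rule sym)
    finally show "norm (A \<nu> x - PR \<nu> (A \<nu> x)) \<le> 0 * norm x" by simp
  qed simp
  then show ?thesis using rho_nonneg[OF \<nu>D] by simp
qed

text \<open>A converse to \<open>eigenvector_near_ritz\<close>: a small residual makes the Ritz
  vectors approximate eigenvectors of the full operator, hence close to the eigenspace, and equal
  dimensions reverse the comparison. Through this estimate, small residuals put exact eigenvectors
  into the closure of the trial spaces.\<close>

lemma eigenvector_near_trial:
  assumes \<mu>: "\<mu> \<in> D" and e: "eigenbasis (A \<mu>) r e" and k: "k < r"
  shows "norm (e k - PV (e k)) \<le> (real r)\<^sup>2 * (2 / (\<beta> - \<alpha>)) * rho' \<mu>"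
proof -
  note on = eigenbasis_orthonormal[OF e]
  note E = ortho_proj_projection[OF on]
  let ?E = "projection r e"
  have "norm (z \<mu> i - ?E (z \<mu> i)) \<le> rho' \<mu> / (\<beta> - (\<alpha> + \<beta>) / 2)" if i: "i < r" for i
  proof (rule gap_estimate[OF A_linear[of \<mu>], where Q = "\<lambda>x. x - ?E x" and m = "ritz \<mu> i"])
    define y where "y = z \<mu> i - ?E (z \<mu> i)"
    have y: "?E y = 0" by (simp add: y_def clinear_diff[OF projection_linear] ortho_proj_idem[OF E])
    show "\<beta> * (norm (z \<mu> i - ?E (z \<mu> i)))\<^sup>2 \<le> inner (z \<mu> i - ?E (z \<mu> i)) (A \<mu> (z \<mu> i - ?E (z \<mu> i)))"
      using form_above_gap[OF \<mu> e, of y] y by (simp add: ortho_compl_projection[OF on] y_def)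
    have "?E (A \<mu> (?E (z \<mu> i))) = A \<mu> (?E (z \<mu> i))"
      by (rule eigenspace_invariant[OF e A_linear]) (rule ortho_proj_idem[OF E])
    then have 1: "inner y (A \<mu> (?E (z \<mu> i))) = 0"
      by (rule projection_eq_0_inner[OF on y])
    have "PR \<mu> (A \<mu> (z \<mu> i)) = PR \<mu> (PV (A \<mu> (z \<mu> i)))" by (simp add: PR_PV[OF \<mu>])
    also have "\<dots> = ritz \<mu> i *\<^sub>R z \<mu> i"
      by (simp add: z_ritz[OF \<mu> i] clinear_scaleR[OF PR_linear] PR_z[OF \<mu> i])
    finally have "norm (A \<mu> (z \<mu> i) - ritz \<mu> i *\<^sub>R z \<mu> i) \<le> rho' \<mu>"
      using rho_ge[OF \<mu>, of "z \<mu> i"] orthonormal_norm[OF z[OF \<mu>] i] by (simp add: PR_z[OF \<mu> i])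
    then have "inner y (A \<mu> (z \<mu> i) - ritz \<mu> i *\<^sub>R z \<mu> i) \<le> norm y * rho' \<mu>"
      using norm_cauchy_schwarz[of y "A \<mu> (z \<mu> i) - ritz \<mu> i *\<^sub>R z \<mu> i"] mult_left_mono[of _ "rho' \<mu>" "norm y"]
      by fastforce
    moreover have "inner y (z \<mu> i) = (norm y)\<^sup>2"
      unfolding y_def by (rule ortho_proj_inner_self[OF ortho_proj_compl[OF E]])
    ultimately have "inner y (A \<mu> (z \<mu> i)) \<le> ritz \<mu> i * (norm y)\<^sup>2 + rho' \<mu> * norm y"
      by (simp add: inner_diff_right mult.commute)
    with 1 show "inner (z \<mu> i - ?E (z \<mu> i)) (A \<mu> (z \<mu> i)) -
        inner (z \<mu> i - ?E (z \<mu> i)) (A \<mu> (z \<mu> i - (z \<mu> i - ?E (z \<mu> i))))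
        \<le> ritz \<mu> i * (norm (z \<mu> i - ?E (z \<mu> i)))\<^sup>2 + rho' \<mu> * norm (z \<mu> i - ?E (z \<mu> i))"
      by (simp add: y_def)
  qed (use ritz_le_mid[OF \<mu> i] gap rho_nonneg[OF \<mu>] in auto)
  from gap_symmetric_le[OF z[OF \<mu>] on this projection_basis[OF on k]]
  have "norm (e k - PR \<mu> (e k)) \<le> (real r)\<^sup>2 * (rho' \<mu> / (\<beta> - (\<alpha> + \<beta>) / 2))"
    using orthonormal_norm[OF on k] by (simp add: PR_def)
  also have "\<dots> = (real r)\<^sup>2 * (2 / (\<beta> - \<alpha>)) * rho' \<mu>"
    by (simp add: field_simps)
  finally have "norm (e k - PR \<mu> (e k)) \<le> (real r)\<^sup>2 * (2 / (\<beta> - \<alpha>)) * rho' \<mu>" .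
  moreover have "e k - PV (e k) = (e k - PR \<mu> (e k)) - PV (e k - PR \<mu> (e k))"
    by (simp add: clinear_diff[OF projection_linear] PV_PR[OF \<mu>])
  then have "norm (e k - PV (e k)) \<le> norm (e k - PR \<mu> (e k))"
    by (metis ortho_proj_compl_norm_le[OF PV_ortho])
  ultimately show ?thesis by simp
qed

section \<open>Levels of the sampled constraints\<close>

abbreviation "bnd \<equiv> lp_bound Am \<theta> l r P v V w"

lemma eigen_data: "\<nu> \<in> P \<Longrightarrow> eigen_data (A \<nu>) l (v \<nu>)"
  by (rule eigen_data.intro[OF A_compact A_selfadj sample_kth sample_basis]) (use r_less in auto)

lemma bnd_eq:
  assumes "\<mu> \<in> D" "\<nu> \<in> P"
  shows "bnd \<mu> \<nu> = eigen_data.bound (A \<nu>) l (v \<nu>) r (z \<mu>)"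
  unfolding lp_bound_def eigen_data.bound_def[OF eigen_data[OF assms(2)] z[OF assms(1)]] ..

lemma bnd_le_form:
  assumes "\<mu> \<in> D" "\<nu> \<in> P" "PR \<mu> f = 0"
  shows "bnd \<mu> \<nu> * (norm f)\<^sup>2 \<le> inner f (A \<nu> f)"
  unfolding bnd_eq[OF assms(1,2)]
  by (rule eigen_data.bound_le_form[OF eigen_data[OF assms(2)] z[OF assms(1)] assms(3)[unfolded PR_def]])

lemma bnd_le_distance:
  assumes \<mu>: "\<mu> \<in> D" and \<nu>: "\<nu> \<in> P" and k: "k < r"
  shows "bnd \<mu> \<nu> \<le> - (\<beta> - \<alpha>) * (norm (v \<nu> k - PR \<mu> (v \<nu> k)))\<^sup>2"
proof -
  interpret E: eigen_data "A \<nu>" l "v \<nu>" by (rule eigen_data[OF \<nu>])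
  have \<nu>D: "\<nu> \<in> D" using \<nu> P_subset by auto
  have "bnd \<mu> \<nu> \<le> E.ev l - (E.ev l - E.ev k) * (norm (v \<nu> k - PR \<mu> (v \<nu> k)))\<^sup>2"
    unfolding bnd_eq[OF \<mu> \<nu>] PR_def by (rule E.bound_le_distance[OF z[OF \<mu>]]) (use k r_less in simp)
  also have "\<dots> \<le> 0 - (\<beta> - \<alpha>) * (norm (v \<nu> k - PR \<mu> (v \<nu> k)))\<^sup>2"
  proof (rule diff_mono[OF E.ev_nonpos mult_right_mono])
    \<comment> \<open>As \<open>r < l\<close>, the sampled eigenvalue number \<open>l + 1\<close>
      also lies above the gap.\<close>
    have "E.ev r \<le> E.ev l" by (rule E.ev_mono) (use r_less in auto)
    then show "\<beta> - \<alpha> \<le> E.ev l - E.ev k"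
      using above_gap[OF \<nu>D] eigenvalue_le[OF \<nu>D k] by simp
  qed auto
  finally show ?thesis by (simp add: algebra_simps)
qed

lemma bnd_nonpos: "\<mu> \<in> D \<Longrightarrow> \<nu> \<in> P \<Longrightarrow> bnd \<mu> \<nu> \<le> 0"
  using bnd_le_distance[of \<mu> \<nu> 0] r_pos gap
    mult_nonneg_nonneg[of "\<beta> - \<alpha>" "(norm (v \<nu> 0 - PR \<mu> (v \<nu> 0)))\<^sup>2"] by (simp add: algebra_simps)

lemma bnd_lipschitz:
  assumes \<mu>: "\<mu> \<in> D" and \<mu>': "\<mu>' \<in> D" and \<nu>: "\<nu> \<in> P"
  shows "bnd \<mu> \<nu> - bnd \<mu>' \<nu> \<le> CP * K * norm (\<mu> - \<mu>')"
proof -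
  interpret E: eigen_data "A \<nu>" l "v \<nu>" by (rule eigen_data[OF \<nu>])
  have \<nu>D: "\<nu> \<in> D" using \<nu> P_subset by auto
  have "bnd \<mu> \<nu> - bnd \<mu>' \<nu> \<le> CP * norm (\<mu> - \<mu>') * (E.ev l - E.ev 0)"
    unfolding bnd_eq[OF \<mu> \<nu>] bnd_eq[OF \<mu>' \<nu>]
    by (rule E.bound_lipschitz[OF z[OF \<mu>] z[OF \<mu>']]) (use PR_lipschitz[OF \<mu> \<mu>'] in \<open>simp add: PR_def\<close>)
  also have "\<dots> \<le> CP * norm (\<mu> - \<mu>') * K"
  proof (rule mult_left_mono)
    have "E.ev 0 = inner (v \<nu> 0) (A \<nu> (v \<nu> 0))"
      using E.v_eigen[OF E.l] orthonormal_norm[OF E.v E.l] by (simp add: power2_norm_eq_inner[symmetric])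
    then have "- K \<le> E.ev 0"
      using A_form_le[OF \<nu>D, of "v \<nu> 0"] orthonormal_norm[OF E.v E.l] by simp
    then show "E.ev l - E.ev 0 \<le> K" using E.ev_nonpos[of l] by simp
  qed (use CP_nonneg in simp)
  finally show ?thesis by (simp add: mult_ac)
qed

text \<open>At its own sample the Ritz space contains the first \<open>r\<close> eigenvectors, so
  \<open>bound_ge\<close> applies with eigenvalue number \<open>r + 1\<close>.\<close>

lemma bnd_sample:
  assumes \<nu>: "\<nu> \<in> P"
  shows "\<beta> \<le> bnd \<nu> \<nu>"
proof -
  interpret E: eigen_data "A \<nu>" l "v \<nu>" by (rule eigen_data[OF \<nu>])
  have \<nu>D: "\<nu> \<in> D" using \<nu> P_subset by auto
  have "E.ev r \<le> bnd \<nu> \<nu>"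
    unfolding bnd_eq[OF \<nu>D \<nu>]
    by (rule E.bound_ge[OF z[OF \<nu>D]]) (use PR_sample[OF \<nu>] r_less in \<open>auto simp: PR_def\<close>)
  with above_gap[OF \<nu>D] show ?thesis by simp
qed

section \<open>The smallest Ritz value\<close>

abbreviation "rmin \<equiv> ritz_min Am \<theta> l P v V"

lemma rmin_eq: "rmin \<mu> = ritz \<mu> 0"
  by (simp add: ritz_min_def)

lemma rmin_le_form:
  assumes \<mu>: "\<mu> \<in> D" and x: "PV x = x"
  shows "rmin \<mu> * (norm x)\<^sup>2 \<le> inner x (A \<mu> x)"
proof -
  interpret C: compressed d V "A \<mu>" K by (rule compressed[OF \<mu>])
  obtain u where "\<And>i x. i < d \<Longrightarrow> PV x = x \<Longrightarrow> x \<in> ortho_compl i u \<Longrightarrow> C.ritz i * (norm x)\<^sup>2 \<le> inner x (A \<mu> x)"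
    by (rule C.ritz_basis) blast
  from this[of 0 x] show ?thesis
    using r_less_d[OF \<mu>] x by (simp add: rmin_eq ritz_matrix_def ortho_compl_def)
qed

lemma rmin_form: "\<mu> \<in> D \<Longrightarrow> rmin \<mu> = inner (z \<mu> 0) (A \<mu> (z \<mu> 0))"
proof -
  assume \<mu>: "\<mu> \<in> D"
  have "inner (z \<mu> 0) (A \<mu> (z \<mu> 0)) = inner (z \<mu> 0) (PV (A \<mu> (z \<mu> 0)))"
    by (metis PV_z[OF \<mu>] ortho_proj_inner[OF PV_ortho])
  also have "\<dots> = rmin \<mu>"
    using orthonormal_norm[OF z[OF \<mu>] r_pos]
    by (simp add: z_ritz[OF \<mu> r_pos] rmin_eq power2_norm_eq_inner[symmetric])
  finally show ?thesis by simp
qed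

lemma rmin_abs_le: "\<mu> \<in> D \<Longrightarrow> \<bar>rmin \<mu>\<bar> \<le> K"
  using A_form_le[of \<mu> "z \<mu> 0"] orthonormal_norm[OF z r_pos, of \<mu>] by (simp add: rmin_form)

lemma rmin_lipschitz:
  assumes \<mu>: "\<mu> \<in> D" and \<mu>': "\<mu>' \<in> D"
  shows "rmin \<mu> - rmin \<mu>' \<le> L * norm (\<mu> - \<mu>')"
proof -
  let ?z = "z \<mu>' 0"
  have n: "norm ?z = 1" by (rule orthonormal_norm[OF z[OF \<mu>'] r_pos])
  have "rmin \<mu> - rmin \<mu>' \<le> inner ?z (A \<mu> ?z) - inner ?z (A \<mu>' ?z)"
    using rmin_le_form[OF \<mu> PV_z[OF \<mu>', of 0]] n by (simp add: rmin_form[OF \<mu>'])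
  also have "\<dots> = inner ?z (A \<mu> ?z - A \<mu>' ?z)" by (simp add: inner_diff_right)
  also have "\<dots> \<le> norm ?z * norm (A \<mu> ?z - A \<mu>' ?z)" by (rule norm_cauchy_schwarz)
  also have "\<dots> \<le> L * norm (\<mu> - \<mu>')" using A_lipschitz[OF \<mu> \<mu>', of ?z] n by simp
  finally show ?thesis .
qed

end

section \<open>Linear programming duality\<close>

text \<open>The coordinate functionals of independent vectors extend to the whole space, where they
  are bounded.\<close>

lemma independent_family_coefficients_bounded:
  fixes n :: "'i \<Rightarrow> 'a::euclidean_space"
  assumes I: "finite I" and ind: "\<And>c. (\<Sum>i\<in>I. c i *\<^sub>R n i) = 0 \<Longrightarrow> \<forall>i\<in>I. c i = 0"
  shows "\<exists>K\<ge>0. \<forall>x. (\<Sum>i\<in>I. \<bar>x i\<bar>) \<le> K * norm (\<Sum>i\<in>I. x i *\<^sub>R n i)"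
proof -
  have inj: "inj_on n I"
  proof (rule inj_onI, rule ccontr)
    fix i j assume ij: "i \<in> I" "j \<in> I" "n i = n j" "i \<noteq> j"
    \<comment> \<open>Equal vectors at two indices would satisfy this nontrivial relation.\<close>
    have "(\<Sum>k\<in>I. ((if k = i then 1 else 0) - (if k = j then 1 else 0)) *\<^sub>R n k)
        = (\<Sum>k\<in>I. (if k = i then n k else 0)) - (\<Sum>k\<in>I. (if k = j then n k else 0))"
      unfolding sum_subtractf[symmetric] by (rule sum.cong) auto
    also have "\<dots> = 0" using I ij by simp
    finally have "\<forall>k\<in>I. (if k = i then 1 else 0) - (if k = j then 1 else 0) = (0::real)"
      by (rule ind)
    from bspec[OF this ij(1)] ij(4) show False by simp
  qed
  have indep: "independent (n ` I)"
  proof (rule independent_if_scalars_zero)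
    fix f x assume "(\<Sum>x\<in>n ` I. f x *\<^sub>R x) = 0" "x \<in> n ` I"
    then show "f x = 0"
      using ind[of "\<lambda>i. f (n i)"] by (auto simp: sum.reindex[OF inj])
  qed (use I in simp)
  have "\<exists>B>0. \<forall>x. \<bar>x i\<bar> \<le> B * norm (\<Sum>i\<in>I. x i *\<^sub>R n i)" if i: "i \<in> I" for i
  proof -
    obtain g :: "'a \<Rightarrow> real" where g: "linear g" "\<And>x. x \<in> n ` I \<Longrightarrow> g x = (if x = n i then 1 else 0)"
      using linear_independent_extend[OF indep, of "\<lambda>x. if x = n i then 1 else 0"] by blast
    obtain B where B: "B > 0" "\<And>x. norm (g x) \<le> B * norm x"
      using linear_bounded_pos[OF g(1)] by blast
    have "g (\<Sum>j\<in>I. x j *\<^sub>R n j) = x i" for x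
    proof -
      have "g (\<Sum>j\<in>I. x j *\<^sub>R n j) = (\<Sum>j\<in>I. x j * g (n j))"
        by (simp add: linear_sum[OF g(1)] linear_cmul[OF g(1)])
      also have "\<dots> = (\<Sum>j\<in>I. if j = i then x i else 0)"
        by (rule sum.cong) (use g(2) i in \<open>auto simp: inj_on_eq_iff[OF inj]\<close>)
      finally show ?thesis using I i by simp
    qed
    then show ?thesis using B by (metis real_norm_def)
  qed
  then obtain B where B: "\<And>i. i \<in> I \<Longrightarrow> B i > 0"
    "\<And>i x. i \<in> I \<Longrightarrow> \<bar>x i\<bar> \<le> B i * norm (\<Sum>i\<in>I. x i *\<^sub>R n i)" by metis
  show ?thesis
  proof (intro exI[of _ "sum B I"] conjI allI)
    show "0 \<le> sum B I" using B(1) by (intro sum_nonneg) (simp add: less_imp_le)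
    show "(\<Sum>i\<in>I. \<bar>x i\<bar>) \<le> sum B I * norm (\<Sum>i\<in>I. x i *\<^sub>R n i)" for x
      unfolding sum_distrib_right by (rule sum_mono) (rule B(2))
  qed
qed

text \<open>The bound concerns some representation of the vector: with dependent generators, a given
  family of nonnegative coefficients may be arbitrarily large.\<close>

definition cone_bound :: "('i \<Rightarrow> 'a::euclidean_space) \<Rightarrow> 'i set \<Rightarrow> real \<Rightarrow> bool"
  where "cone_bound n I K \<longleftrightarrow> 0 \<le> K \<and> (\<forall>x. (\<forall>i\<in>I. 0 \<le> x i) \<longrightarrow> (\<exists>x'. (\<forall>i\<in>I. 0 \<le> x' i) \<and>
    (\<Sum>i\<in>I. x' i *\<^sub>R n i) = (\<Sum>i\<in>I. x i *\<^sub>R n i) \<and> (\<Sum>i\<in>I. x' i) \<le> K * norm (\<Sum>i\<in>I. x i *\<^sub>R n i)))"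

lemma cone_boundD:
  assumes "cone_bound n I K" "\<forall>i\<in>I. 0 \<le> x i"
  obtains x' where "\<forall>i\<in>I. 0 \<le> x' i" "(\<Sum>i\<in>I. x' i *\<^sub>R n i) = (\<Sum>i\<in>I. x i *\<^sub>R n i)"
    "(\<Sum>i\<in>I. x' i) \<le> K * norm (\<Sum>i\<in>I. x i *\<^sub>R n i)"
  using assms unfolding cone_bound_def by blast

lemma cone_bound_exists:
  assumes "finite I"
  shows "\<exists>K. cone_bound n I K"
  using assms
proof (induction "card I" arbitrary: I rule: less_induct)
  case less
  show ?case
  proof (cases "\<forall>c. (\<Sum>i\<in>I. c i *\<^sub>R n i) = 0 \<longrightarrow> (\<forall>i\<in>I. c i = 0)")
    case True
    then obtain K where K: "K \<ge> 0" "\<And>x. (\<Sum>i\<in>I. \<bar>x i\<bar>) \<le> K * norm (\<Sum>i\<in>I. x i *\<^sub>R n i)"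
      using independent_family_coefficients_bounded[OF less.prems, of n] by blast
    show ?thesis
      unfolding cone_bound_def
    proof (intro exI[of _ K] conjI K(1) allI impI)
      fix x :: "_ \<Rightarrow> real" assume x: "\<forall>i\<in>I. 0 \<le> x i"
      have "(\<Sum>i\<in>I. x i) = (\<Sum>i\<in>I. \<bar>x i\<bar>)" by (rule sum.cong) (use x in auto)
      also note K(2)[of x]
      finally show "\<exists>x'. (\<forall>i\<in>I. 0 \<le> x' i) \<and>
        (\<Sum>i\<in>I. x' i *\<^sub>R n i) = (\<Sum>i\<in>I. x i *\<^sub>R n i) \<and> (\<Sum>i\<in>I. x' i) \<le> K * norm (\<Sum>i\<in>I. x i *\<^sub>R n i)"
        using x by blast
    qed
  next
    case False
    then obtain c0 i0 where c0: "(\<Sum>i\<in>I. c0 i *\<^sub>R n i) = 0" "i0 \<in> I" "c0 i0 \<noteq> 0" by blast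
    \<comment> \<open>The sign is normalized so that the relation has a positive coefficient and the
      ratio test below has a nonempty index set.\<close>
    define c where "c i = sgn (c0 i0) * c0 i" for i
    have c: "(\<Sum>i\<in>I. c i *\<^sub>R n i) = 0" "c i0 > 0"
    proof -
      have "(\<Sum>i\<in>I. c i *\<^sub>R n i) = sgn (c0 i0) *\<^sub>R (\<Sum>i\<in>I. c0 i *\<^sub>R n i)"
        by (simp add: c_def scaleR_sum_right)
      then show "(\<Sum>i\<in>I. c i *\<^sub>R n i) = 0" by (simp add: c0)
      show "c i0 > 0" using c0(3) by (auto simp: c_def sgn_if)
    qed
    have "\<exists>K. cone_bound n (I - {k}) K" if "k \<in> I" for k
      by (rule less.hyps) (use that less.prems card_Diff1_less[of I k] in auto)
    then obtain K where K: "\<And>k. k \<in> I \<Longrightarrow> cone_bound n (I - {k}) (K k)" by metis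
    then have K0: "\<And>k. k \<in> I \<Longrightarrow> 0 \<le> K k" by (auto simp: cone_bound_def)
    show ?thesis
      unfolding cone_bound_def
    proof (intro exI[of _ "sum K I"] conjI allI impI)
      show "0 \<le> sum K I" by (intro sum_nonneg K0)
      fix x :: "_ \<Rightarrow> real" assume x: "\<forall>i\<in>I. 0 \<le> x i"
      define J where "J = {i \<in> I. c i > 0}"
      have J: "finite J" "J \<noteq> {}" using less.prems c(2) c0(2) by (auto simp: J_def)
      \<comment> \<open>The largest multiple of the relation that can be subtracted with all
        coefficients staying nonnegative; at a minimizing index the coefficient becomes 0.\<close>
      define s where "s = Min ((\<lambda>i. x i / c i) ` J)"
      have "s \<in> (\<lambda>i. x i / c i) ` J" unfolding s_def using J by (intro Min_in) auto
      then obtain k where k: "k \<in> J" "s = x k / c k" by blast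
      have s: "s \<le> x i / c i" if "i \<in> J" for i unfolding s_def using J that by (intro Min_le) auto
      have s0: "0 \<le> s" using k x by (auto simp: J_def)
      have pos: "0 \<le> x i - s * c i" if "i \<in> I" for i
      proof (cases "c i > 0")
        case True
        then show ?thesis using s[of i] that by (auto simp: J_def field_simps)
      next
        case False
        then show ?thesis using s0 x that mult_nonneg_nonpos[of s "c i"] by (auto simp: not_less)
      qed
      have k0: "x k - s * c k = 0" using k by (auto simp: J_def)
      have kI: "k \<in> I" using k by (auto simp: J_def)
      have "(\<Sum>i\<in>I. x i *\<^sub>R n i) = (\<Sum>i\<in>I. (x i - s * c i) *\<^sub>R n i) + s *\<^sub>R (\<Sum>i\<in>I. c i *\<^sub>R n i)"
        unfolding scaleR_sum_right sum.distrib[symmetric] by (rule sum.cong) (auto simp: algebra_simps)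
      also have "\<dots> = (\<Sum>i\<in>I - {k}. (x i - s * c i) *\<^sub>R n i)"
        using c(1) by (simp add: sum.remove[OF less.prems kI] k0)
      finally have eq: "(\<Sum>i\<in>I. x i *\<^sub>R n i) = (\<Sum>i\<in>I - {k}. (x i - s * c i) *\<^sub>R n i)" .
      obtain x' where x': "\<forall>i\<in>I - {k}. 0 \<le> x' i"
        "(\<Sum>i\<in>I - {k}. x' i *\<^sub>R n i) = (\<Sum>i\<in>I. x i *\<^sub>R n i)"
        "(\<Sum>i\<in>I - {k}. x' i) \<le> K k * norm (\<Sum>i\<in>I. x i *\<^sub>R n i)"
        unfolding eq by (rule cone_boundD[OF K[OF kI], of "\<lambda>i. x i - s * c i"]) (use pos in auto)
      have "(\<Sum>i\<in>I - {k}. x' i) \<le> sum K I * norm (\<Sum>i\<in>I. x i *\<^sub>R n i)"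
        by (rule order.trans[OF x'(3) mult_right_mono])
          (use member_le_sum[OF kI, of K] K0 less.prems in auto)
      then show "\<exists>x'. (\<forall>i\<in>I. 0 \<le> x' i) \<and>
        (\<Sum>i\<in>I. x' i *\<^sub>R n i) = (\<Sum>i\<in>I. x i *\<^sub>R n i) \<and> (\<Sum>i\<in>I. x' i) \<le> sum K I * norm (\<Sum>i\<in>I. x i *\<^sub>R n i)"
        using x'(1,2) by (intro exI[of _ "x'(k := 0)"]) (simp add: sum.remove[OF less.prems kI])
    qed
  qed
qed

text \<open>If \<open>c\<close> were outside the closed cone of active normals, a separating vector
  \<open>a\<close> would be a feasible direction along which the objective decreases.\<close>

lemma lp_duality:
  fixes n :: "'i \<Rightarrow> 'a::euclidean_space"
  assumes I: "finite I" and feas: "\<And>i. i \<in> I \<Longrightarrow> b i \<le> n i \<bullet> y"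
    and opt: "\<And>z. (\<And>i. i \<in> I \<Longrightarrow> b i \<le> n i \<bullet> z) \<Longrightarrow> c \<bullet> y \<le> c \<bullet> z"
  defines "S \<equiv> {i \<in> I. n i \<bullet> y = b i}"
  shows "\<exists>x. (\<forall>i\<in>S. 0 \<le> x i) \<and> c = (\<Sum>i\<in>S. x i *\<^sub>R n i)"
proof -
  have S: "finite S" "S \<subseteq> I" using I by (auto simp: S_def)
  define C where "C = convex_cone hull (n ` S)"
  have cone: "convex_cone C" unfolding C_def by (rule convex_cone_convex_cone_hull)
  have "c \<in> C"
  proof (rule ccontr)
    assume c: "c \<notin> C"
    have "closed C" unfolding C_def by (rule closed_convex_cone_hull) (use S in simp)
    moreover have "convex C" using cone by (simp add: convex_cone_def)
    ultimately obtain a t where "a \<bullet> c < t \<and> (\<forall>x\<in>C. t < a \<bullet> x)"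
      using separating_hyperplane_closed_point[OF _ _ c] by blast
    then have a: "a \<bullet> c < t" "\<And>x. x \<in> C \<Longrightarrow> a \<bullet> x > t" by auto
    have "0 \<in> C" using cone by (simp add: convex_cone_contains_0)
    then have t: "t < 0" using a(2) by fastforce
    \<comment> \<open>The functional \<open>a\<close> is bounded below on the cone. If it were
      negative on a generator, the multiple on which it takes exactly the value \<open>t\<close>
      would violate the separation.\<close>
    have an: "0 \<le> n i \<bullet> a" if i: "i \<in> S" for i
    proof (rule ccontr)
      assume neg: "\<not> 0 \<le> n i \<bullet> a"
      define q where "q = t / (n i \<bullet> a)"
      have q: "0 \<le> q" using neg t by (simp add: q_def divide_nonpos_nonpos)
      have "n i \<in> C" unfolding C_def by (rule hull_inc) (use i in simp)
      then have "q *\<^sub>R n i \<in> C"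
        using cone q by (simp add: convex_cone_def conic_def)
      from a(2)[OF this] have "t < q * (n i \<bullet> a)" by (simp add: inner_commute)
      then show False using neg by (simp add: q_def)
    qed
    \<comment> \<open>Active constraints do not decrease along \<open>a\<close>, and inactive ones
      tolerate a small step.\<close>
    have "\<exists>e>0. \<forall>i\<in>I. b i \<le> n i \<bullet> (y + e *\<^sub>R a)"
    proof -
      have "\<exists>e>0. \<forall>e'. 0 < e' \<longrightarrow> e' \<le> e \<longrightarrow> b i \<le> n i \<bullet> (y + e' *\<^sub>R a)" if i: "i \<in> I" for i
      proof (cases "0 \<le> n i \<bullet> a")
        case True
        then show ?thesis using feas[OF i]
          by (intro exI[of _ 1]) (auto simp: inner_add_right intro: add_increasing2)
      next
        case False
        then have "n i \<bullet> y > b i" using an feas[OF i] i by (force simp: S_def)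
        then show ?thesis using False
          by (intro exI[of _ "(n i \<bullet> y - b i) / - (n i \<bullet> a)"])
            (auto simp: inner_add_right field_simps divide_pos_neg)
      qed
      then obtain e where e: "\<And>i. i \<in> I \<Longrightarrow> e i > 0"
        "\<And>i e'. i \<in> I \<Longrightarrow> 0 < e' \<Longrightarrow> e' \<le> e i \<Longrightarrow> b i \<le> n i \<bullet> (y + e' *\<^sub>R a)" by metis
      have "Min (insert 1 (e ` I)) > 0" using I e(1) by auto
      moreover have "Min (insert 1 (e ` I)) \<le> e i" if "i \<in> I" for i using I that by auto
      ultimately show ?thesis using e(2) by blast
    qed
    then obtain e where e: "e > 0" "\<And>i. i \<in> I \<Longrightarrow> b i \<le> n i \<bullet> (y + e *\<^sub>R a)" by blast
    have "0 \<le> e * (c \<bullet> a)" using opt[OF e(2)] by (simp add: inner_add_right)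
    then show False using e(1) a(1) t by (simp add: zero_le_mult_iff inner_commute)
  qed
  \<comment> \<open>Closedness is available for the hull, while the coefficients are visible in this
    explicit set; the inclusion of the hull in it connects the two.\<close>
  define R where "R = {\<Sum>i\<in>S. x i *\<^sub>R n i | x. \<forall>i\<in>S. 0 \<le> x i}"
  have RI: "(\<Sum>i\<in>S. x i *\<^sub>R n i) \<in> R" if "\<And>i. i \<in> S \<Longrightarrow> 0 \<le> x i" for x
    using that by (auto simp: R_def)
  have RE: "\<exists>f. x = (\<Sum>i\<in>S. f i *\<^sub>R n i) \<and> (\<forall>i\<in>S. 0 \<le> f i)" if "x \<in> R" for x
    using that by (auto simp: R_def)
  have "C \<subseteq> R"
    unfolding C_def
  proof (rule hull_minimal)
    show "n ` S \<subseteq> R"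
    proof (rule image_subsetI)
      fix k assume "k \<in> S"
      then have "(\<Sum>i\<in>S. (if i = k then 1 else 0) *\<^sub>R n i) = (\<Sum>i\<in>S. if i = k then n k else 0)"
        by (intro sum.cong) auto
      also have "\<dots> = n k" using S \<open>k \<in> S\<close> by simp
      finally show "n k \<in> R"
        using RI[of "\<lambda>i. if i = k then 1 else 0"] by simp
    qed
    have zero: "0 \<in> R" using RI[of "\<lambda>_. 0"] by simp
    have add: "x + z \<in> R" if xz: "x \<in> R" "z \<in> R" for x z
    proof -
      obtain f g where fg: "x = (\<Sum>i\<in>S. f i *\<^sub>R n i)" "\<forall>i\<in>S. 0 \<le> f i"
        "z = (\<Sum>i\<in>S. g i *\<^sub>R n i)" "\<forall>i\<in>S. 0 \<le> g i" using RE[OF xz(1)] RE[OF xz(2)] by blast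
      have "x + z = (\<Sum>i\<in>S. (f i + g i) *\<^sub>R n i)"
        by (simp add: fg(1,3) scaleR_left_distrib sum.distrib)
      then show ?thesis using RI[of "\<lambda>i. f i + g i"] fg(2,4) by simp
    qed
    have scale: "a *\<^sub>R x \<in> R" if x: "x \<in> R" and "0 \<le> a" for x and a :: real
    proof -
      obtain f where f: "x = (\<Sum>i\<in>S. f i *\<^sub>R n i)" "\<forall>i\<in>S. 0 \<le> f i" using RE[OF x] by blast
      have "a *\<^sub>R x = (\<Sum>i\<in>S. (a * f i) *\<^sub>R n i)"
        by (simp add: f(1) scaleR_sum_right)
      then show ?thesis using RI[of "\<lambda>i. a * f i"] f(2) \<open>0 \<le> a\<close> by simp
    qed
    show "convex_cone R"
      unfolding convex_cone_iff using zero add scale by simp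
  qed
  with \<open>c \<in> C\<close> show ?thesis using RE by blast
qed

text \<open>There are only finitely many active sets, and the cone spanned by the normals of each of them admits
  multipliers bounded by the norm of the represented vector.\<close>

proposition lp_multipliers_bounded:
  fixes n :: "'i \<Rightarrow> 'a::euclidean_space"
  assumes I: "finite I"
  obtains K where "K \<ge> 0"
    "\<And>b c y. (\<And>i. i \<in> I \<Longrightarrow> b i \<le> n i \<bullet> y) \<Longrightarrow>
      (\<And>z. (\<And>i. i \<in> I \<Longrightarrow> b i \<le> n i \<bullet> z) \<Longrightarrow> c \<bullet> y \<le> c \<bullet> z) \<Longrightarrow>
      \<exists>x. (\<forall>i\<in>I. 0 \<le> x i) \<and> c = (\<Sum>i\<in>I. x i *\<^sub>R n i) \<and> c \<bullet> y = (\<Sum>i\<in>I. x i * b i) \<and>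
        (\<Sum>i\<in>I. x i) \<le> K * norm c"
proof -
  have "\<exists>K. cone_bound n S K" if "S \<in> Pow I" for S
    by (rule cone_bound_exists) (use that I finite_subset in auto)
  then obtain K where K: "\<And>S. S \<in> Pow I \<Longrightarrow> cone_bound n S (K S)" by metis
  then have K0: "\<And>S. S \<in> Pow I \<Longrightarrow> 0 \<le> K S" by (auto simp: cone_bound_def)
  show thesis
  proof (rule that[of "sum K (Pow I)"])
    show "0 \<le> sum K (Pow I)" by (intro sum_nonneg K0)
    fix b c y
    assume feas: "\<And>i. i \<in> I \<Longrightarrow> b i \<le> n i \<bullet> y"
      and opt: "\<And>z. (\<And>i. i \<in> I \<Longrightarrow> b i \<le> n i \<bullet> z) \<Longrightarrow> c \<bullet> y \<le> c \<bullet> z"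
    define S where "S = {i \<in> I. n i \<bullet> y = b i}"
    have S: "S \<in> Pow I" by (auto simp: S_def)
    have "\<exists>x. (\<forall>i\<in>S. 0 \<le> x i) \<and> c = (\<Sum>i\<in>S. x i *\<^sub>R n i)"
      unfolding S_def
    proof (rule lp_duality[OF I])
      show "c \<bullet> y \<le> c \<bullet> z" if "\<And>i. i \<in> I \<Longrightarrow> b i \<le> n i \<bullet> z" for z
        by (rule opt[OF that])
    qed (rule feas)
    then obtain x0 where x0: "\<forall>i\<in>S. 0 \<le> x0 i" "c = (\<Sum>i\<in>S. x0 i *\<^sub>R n i)"
      by blast
    obtain x where x: "\<forall>i\<in>S. 0 \<le> x i" "(\<Sum>i\<in>S. x i *\<^sub>R n i) = c" "(\<Sum>i\<in>S. x i) \<le> K S * norm c"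
      by (rule cone_boundD[OF K[OF S] x0(1), folded x0(2)])
    \<comment> \<open>Extension by 0 to the inactive constraints; on the active ones complementary
      slackness gives the dual value.\<close>
    define x' where "x' i = (if i \<in> S then x i else 0)" for i
    have 0: "(\<Sum>i\<in>I. x' i *\<^sub>R n i) = (\<Sum>i\<in>S. x i *\<^sub>R n i)"
      and 1: "(\<Sum>i\<in>I. x' i) = (\<Sum>i\<in>S. x i)"
      and 2: "(\<Sum>i\<in>I. x' i * b i) = (\<Sum>i\<in>S. x i * b i)"
      using I S by (auto simp: x'_def intro!: sum.mono_neutral_cong_right)
    have "c \<bullet> y = (\<Sum>i\<in>S. x i * (n i \<bullet> y))"
      by (simp add: x(2)[symmetric] inner_sum_left)
    also have "\<dots> = (\<Sum>i\<in>S. x i * b i)" by (rule sum.cong) (auto simp: S_def)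
    finally have 2: "c \<bullet> y = (\<Sum>i\<in>I. x' i * b i)" by (simp only: 2)
    have "K S * norm c \<le> sum K (Pow I) * norm c"
      by (rule mult_right_mono) (use member_le_sum[OF S, of K] I K0 in auto)
    then have 3: "(\<Sum>i\<in>I. x' i) \<le> sum K (Pow I) * norm c" using x(3) 1 by simp
    have 4: "\<forall>i\<in>I. 0 \<le> x' i" using x(1) by (simp add: x'_def)
    show "\<exists>x. (\<forall>i\<in>I. 0 \<le> x i) \<and> c = (\<Sum>i\<in>I. x i *\<^sub>R n i) \<and> c \<bullet> y = (\<Sum>i\<in>I. x i * b i) \<and>
        (\<Sum>i\<in>I. x i) \<le> sum K (Pow I) * norm c"
      using 2 3 4 0 x(2) by (intro exI[of _ x']) simp
  qed
qed

section \<open>The lower bound and the error estimate\<close>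

text \<open>The signs of the two endpoints come from infinite dimension: the unit sequences tend
  weakly to 0, so by compactness their Rayleigh quotients tend to 0 along a subsequence. Hence 0
  belongs to the box, and the box terms of the dual formula have a sign.\<close>

lemma box_bounds:
  assumes T: "compact_operator (Am m)" "self_adjoint (Am m)"
  shows "box_lower Am m * (norm x)\<^sup>2 \<le> inner x (Am m x)"
    and "inner x (Am m x) \<le> box_upper Am m * (norm x)\<^sup>2"
    and "box_lower Am m \<le> 0" and "0 \<le> box_upper Am m"
proof -
  let ?R = "rayleigh (Am m)"
  obtain K where K: "K > 0" "\<And>x. norm (Am m x) \<le> K * norm x"
    using compact_operator_bounded[OF T(1)] by blast
  have R: "?R x * (norm x)\<^sup>2 = inner x (Am m x)" if "x \<noteq> 0" for x
    using that by (simp add: rayleigh_def inner_cinner)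
  have bound: "\<bar>?R x\<bar> \<le> K" if x: "x \<in> - {0}" for x
  proof -
    have "\<bar>inner x (Am m x)\<bar> \<le> norm x * norm (Am m x)" by (rule Cauchy_Schwarz_ineq2)
    also have "\<dots> \<le> norm x * (K * norm x)" by (intro mult_left_mono K) simp
    finally have "\<bar>inner x (Am m x)\<bar> \<le> K * (norm x)\<^sup>2" by (simp add: power2_eq_square mult_ac)
    then show ?thesis using x by (simp add: rayleigh_def inner_cinner abs_divide divide_le_eq)
  qed
  have bdd: "bdd_below (?R ` (- {0}))" "bdd_above (?R ` (- {0}))"
    using bound by (auto intro!: bdd_belowI2[where m = "- K"] bdd_aboveI2[where M = K] simp: abs_le_iff minus_le_iff)
  have low: "box_lower Am m \<le> ?R x" and up: "?R x \<le> box_upper Am m" if "x \<noteq> 0" for x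
    unfolding box_lower_def box_upper_def using bdd that by (auto intro: cINF_lower cSUP_upper)
  show "box_lower Am m * (norm x)\<^sup>2 \<le> inner x (Am m x)"
    using low[of x] R[of x] by (cases "x = 0") (auto simp: clinear_zero[OF compact_operator_linear[OF T(1)]]
        simp flip: R intro: mult_right_mono)
  show "inner x (Am m x) \<le> box_upper Am m * (norm x)\<^sup>2"
    using up[of x] R[of x] by (cases "x = 0") (auto simp: clinear_zero[OF compact_operator_linear[OF T(1)]]
        simp flip: R intro: mult_right_mono)
  have n: "norm (unit_seq k) = 1" for k using orthonormal_norm[OF orthonormal_unit_seq, of k "Suc k"] by simp
  obtain q f where q: "strict_mono q" "(\<lambda>k. Am m (unit_seq (q k))) \<longlonglongrightarrow> f"
    by (rule compact_operator_subseq[OF T(1), of unit_seq]) (use n in auto)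
  have "(\<lambda>k. Re (seq f (q k))) \<longlonglongrightarrow> 0"
    using tendsto_Re[OF LIMSEQ_subseq_LIMSEQ[OF seq_tendsto_0[of f] q(1)]] by (simp add: o_def)
  moreover have "(\<lambda>k. inner (unit_seq (q k)) (Am m (unit_seq (q k)) - f)) \<longlonglongrightarrow> 0"
  proof (rule Lim_null_comparison)
    show "\<forall>\<^sub>F k in sequentially. norm (inner (unit_seq (q k)) (Am m (unit_seq (q k)) - f))
        \<le> norm (Am m (unit_seq (q k)) - f)"
    proof (rule always_eventually, rule allI)
      fix k
      show "norm (inner (unit_seq (q k)) (Am m (unit_seq (q k)) - f)) \<le> norm (Am m (unit_seq (q k)) - f)"
        using Cauchy_Schwarz_ineq2[of "unit_seq (q k)" "Am m (unit_seq (q k)) - f"] by (simp add: n)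
    qed
    show "(\<lambda>k. norm (Am m (unit_seq (q k)) - f)) \<longlonglongrightarrow> 0"
      using q(2) by (simp add: LIM_zero tendsto_norm_zero)
  qed
  ultimately have "(\<lambda>k. Re (seq f (q k)) + inner (unit_seq (q k)) (Am m (unit_seq (q k)) - f)) \<longlonglongrightarrow> 0"
    using tendsto_add by fastforce
  moreover have "Re (seq f (q k)) = inner (unit_seq (q k)) f" for k
    by (simp add: inner_cinner cinner_unit_seq)
  moreover have ne: "unit_seq k \<noteq> 0" for k using n[of k] by auto
  have "inner (unit_seq (q k)) f + inner (unit_seq (q k)) (Am m (unit_seq (q k)) - f) = ?R (unit_seq (q k))" for k
    using R[OF ne, of "q k"] n[of "q k"] by (simp add: inner_diff_right)
  ultimately have lim: "(\<lambda>k. ?R (unit_seq (q k))) \<longlonglongrightarrow> 0" by simp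
  show "box_lower Am m \<le> 0"
    by (rule LIMSEQ_le_const[OF lim]) (use low ne in blast)
  show "0 \<le> box_upper Am m"
    by (rule LIMSEQ_le_const2[OF lim]) (use up ne in blast)
qed

lemma sqrt_sum_squares_diff_le:
  fixes a b a' b' :: real
  shows "\<bar>sqrt (a\<^sup>2 + b\<^sup>2) - sqrt (a'\<^sup>2 + b'\<^sup>2)\<bar> \<le> \<bar>a - a'\<bar> + \<bar>b - b'\<bar>"
proof -
  have "\<bar>norm (a, b) - norm (a', b')\<bar> \<le> norm ((a, b) - (a', b'))"
    by (rule norm_triangle_ineq3)
  also have "\<dots> \<le> \<bar>a - a'\<bar> + \<bar>b - b'\<bar>"
    by (simp add: norm_Pair sqrt_sum_squares_le_sum_abs)
  finally show ?thesis by (simp add: norm_Pair)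
qed

text \<open>Rationalizing gives \<open>h x y = (sqrt (x^2 + 4 * y^2) - x) / 2\<close> for positive
  \<open>x\<close>, which is Lipschitz in \<open>y\<close> with constant 1. In \<open>x\<close> the
  quotient is kept instead, because it exhibits the factor \<open>y^2\<close> that later pays for
  the multipliers.\<close>

lemma gap_function_lipschitz:
  fixes x y x' y' c :: real
  defines "h \<equiv> \<lambda>x y. 2 * y\<^sup>2 / (x + sqrt (x\<^sup>2 + 4 * y\<^sup>2))"
  assumes c: "0 < c" "c \<le> x" "c \<le> x'"
  shows "\<bar>h x y - h x' y'\<bar> \<le> y\<^sup>2 / c\<^sup>2 * \<bar>x - x'\<bar> + \<bar>y - y'\<bar>"
proof -
  define s where "s = (\<lambda>x y. sqrt (x\<^sup>2 + 4 * y\<^sup>2) :: real)"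
  have s_eq: "s x y = sqrt (x\<^sup>2 + (2 * y)\<^sup>2)" for x y by (simp add: s_def power_mult_distrib)
  have s_ge: "x \<le> s x y" for x y
    unfolding s_def by (rule real_le_rsqrt) simp
  have h_eq: "h x y = (s x y - x) / 2" if "0 < x" for x y
  proof -
    have "(s x y)\<^sup>2 = x\<^sup>2 + 4 * y\<^sup>2" by (simp add: s_def)
    then have "(s x y - x) * (x + s x y) = 4 * y\<^sup>2" by (simp add: power2_eq_square algebra_simps)
    then have "2 * y\<^sup>2 = (s x y - x) / 2 * (x + s x y)" by simp
    moreover have "x + s x y \<noteq> 0" using s_ge[of x y] that by simp
    ultimately have "2 * y\<^sup>2 / (x + s x y) = (s x y - x) / 2" by (metis nonzero_mult_div_cancel_right)
    then show ?thesis by (simp add: h_def s_def)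
  qed
  have "h x' y - h x' y' = (s x' y - s x' y') / 2"
    using h_eq[of x' y] h_eq[of x' y'] c by (simp add: diff_divide_distrib)
  then have "\<bar>h x' y - h x' y'\<bar> = \<bar>s x' y - s x' y'\<bar> / 2"
    by (simp only: abs_divide abs_numeral)
  also have "\<dots> \<le> \<bar>y - y'\<bar>"
  proof -
    have "\<bar>s x' y - s x' y'\<bar> \<le> \<bar>2 * y - 2 * y'\<bar>"
      unfolding s_eq using sqrt_sum_squares_diff_le[of x' "2 * y" x' "2 * y'"] by simp
    moreover have "\<bar>2 * y - 2 * y'\<bar> = 2 * \<bar>y - y'\<bar>" by (auto simp: abs_if)
    ultimately show ?thesis by simp
  qed
  finally have 1: "\<bar>h x' y - h x' y'\<bar> \<le> \<bar>y - y'\<bar>" .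
  let ?p = "x + s x y" and ?q = "x' + s x' y"
  have pq: "2 * c \<le> ?p" "2 * c \<le> ?q" using s_ge[of x y] s_ge[of x' y] c by auto
  have "\<bar>s x' y - s x y\<bar> \<le> \<bar>x - x'\<bar>"
    using sqrt_sum_squares_diff_le[of x' "2 * y" x "2 * y"] by (simp add: s_eq)
  then have d: "\<bar>?q - ?p\<bar> \<le> 2 * \<bar>x - x'\<bar>" by (smt (verit))
  have *: "\<bar>a / p - a / q\<bar> = a * \<bar>q - p\<bar> / (p * q)" if "0 \<le> a" "0 < p" "0 < q" for a p q :: real
  proof -
    have "a / p - a / q = a * (q - p) / (p * q)"
      using that by (simp add: diff_frac_eq right_diff_distrib)
    then show ?thesis using that by (simp add: abs_mult)
  qed
  have "h x y = 2 * y\<^sup>2 / ?p" "h x' y = 2 * y\<^sup>2 / ?q" by (simp_all add: h_def s_def)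
  then have "\<bar>h x y - h x' y\<bar> = 2 * y\<^sup>2 * \<bar>?q - ?p\<bar> / (?p * ?q)"
    using pq c by (simp only:) (rule *, simp_all)
  also have "\<dots> \<le> 2 * y\<^sup>2 * (2 * \<bar>x - x'\<bar>) / ((2 * c) * (2 * c))"
    using pq c d by (intro frac_le mult_left_mono mult_mono) auto
  also have "\<dots> = y\<^sup>2 / c\<^sup>2 * \<bar>x - x'\<bar>"
    using c by (simp add: power2_eq_square field_simps)
  finally show ?thesis using 1 by linarith
qed

section \<open>The linear program of one level\<close>

locale lp_level = level Am \<theta> D l r K L \<alpha> \<beta> P v V w
  for Am :: "'k::finite \<Rightarrow> ell2 \<Rightarrow> ell2" and \<theta> :: "real^'p::finite \<Rightarrow> real^'k"
    and D :: "(real^'p) set" and l r K L \<alpha> \<beta> P v V w +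
  fixes Lt Kt Kb :: real
  assumes \<theta>_lipschitz: "\<And>\<mu> \<mu>'. \<mu> \<in> D \<Longrightarrow> \<mu>' \<in> D \<Longrightarrow> norm (\<theta> \<mu> - \<theta> \<mu>') \<le> Lt * norm (\<mu> - \<mu>')"
    and \<theta>_bounded: "\<And>\<mu>. \<mu> \<in> D \<Longrightarrow> norm (\<theta> \<mu>) \<le> Kt"
    and box_bounded: "\<And>y. y \<in> box Am \<Longrightarrow> norm y \<le> Kb"
    and Lt_nonneg: "0 \<le> Lt"
    and lp_solution: "\<And>\<mu>. \<mu> \<in> D \<Longrightarrow> \<exists>y\<in>Y_LB Am \<theta> l r P v V w \<mu>. \<forall>y'\<in>Y_LB Am \<theta> l r P v V w \<mu>. \<theta> \<mu> \<bullet> y \<le> \<theta> \<mu> \<bullet> y'"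
    and fine: "\<And>\<mu>. \<mu> \<in> D \<Longrightarrow> \<exists>\<nu>\<in>P. (L + Lt * Kb + CP * K) * norm (\<mu> - \<nu>) \<le> (\<beta> - \<alpha>) / 2"
begin

abbreviation "Y \<equiv> Y_LB Am \<theta> l r P v V w"
abbreviation "et \<equiv> eta Am \<theta> l r P v V w"
abbreviation "lo \<equiv> box_lower Am"
abbreviation "up \<equiv> box_upper Am"

lemma zero_in_box: "0 \<in> box Am"
  using box_bounds(3,4)[of Am, OF compact_Am selfadj_Am] by (simp add: box_def)

lemma Kb_nonneg: "0 \<le> Kb"
  using box_bounded[OF zero_in_box] by simp

lemma Kt_nonneg: "\<mu> \<in> D \<Longrightarrow> 0 \<le> Kt"
  using \<theta>_bounded[of \<mu>] norm_ge_zero order.trans by blast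

lemma inner_box_le: "\<mu> \<in> D \<Longrightarrow> y \<in> box Am \<Longrightarrow> \<bar>\<theta> \<mu> \<bullet> y\<bar> \<le> Kt * Kb"
  using Cauchy_Schwarz_ineq2[of "\<theta> \<mu>" y] mult_mono[OF \<theta>_bounded box_bounded, of \<mu> y] Kt_nonneg by fastforce

lemma inner_\<theta>_diff_le:
  assumes \<mu>: "\<mu> \<in> D" "\<mu>' \<in> D" and y: "y \<in> box Am"
  shows "(\<theta> \<mu> - \<theta> \<mu>') \<bullet> y \<le> Lt * norm (\<mu> - \<mu>') * Kb"
proof -
  have "(\<theta> \<mu> - \<theta> \<mu>') \<bullet> y \<le> norm (\<theta> \<mu> - \<theta> \<mu>') * norm y" by (rule norm_cauchy_schwarz)
  also have "\<dots> \<le> Lt * norm (\<mu> - \<mu>') * Kb"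
    by (intro mult_mono \<theta>_lipschitz \<mu> box_bounded y) (use Lt_nonneg in auto)
  finally show ?thesis .
qed

lemma et_attained:
  assumes \<mu>: "\<mu> \<in> D"
  obtains y where "y \<in> Y \<mu>" "et \<mu> = \<theta> \<mu> \<bullet> y" "\<And>y'. y' \<in> Y \<mu> \<Longrightarrow> \<theta> \<mu> \<bullet> y \<le> \<theta> \<mu> \<bullet> y'"
proof -
  obtain y where y: "y \<in> Y \<mu>" "\<And>y'. y' \<in> Y \<mu> \<Longrightarrow> \<theta> \<mu> \<bullet> y \<le> \<theta> \<mu> \<bullet> y'"
    using lp_solution[OF \<mu>] by blast
  have "et \<mu> = \<theta> \<mu> \<bullet> y"
    unfolding eta_def by (rule cInf_eq_minimum) (use y in auto)
  with y show ?thesis using that by blast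
qed

lemma et_abs_le:
  assumes \<mu>: "\<mu> \<in> D"
  shows "\<bar>et \<mu>\<bar> \<le> Kt * Kb"
proof -
  obtain y where "y \<in> Y \<mu>" "et \<mu> = \<theta> \<mu> \<bullet> y" using et_attained[OF \<mu>] by blast
  then show ?thesis using inner_box_le[OF \<mu>, of y] by (simp add: Y_LB_def)
qed

text \<open>At a nearby sample \<nu> the constraint starts from a level of at least \<beta>.
  Returning to \<mu> costs \<open>CP * K\<close> in the level, \<open>Lt * Kb\<close> in the
  objective and \<open>L\<close> in the Ritz value, which is the constant in \<open>fine\<close>. In
  particular the minimum in the lower bound is the Ritz value.\<close>

lemma gap_lower:
  assumes \<mu>: "\<mu> \<in> D"
  shows "(\<beta> - \<alpha>) / 2 \<le> et \<mu> - rmin \<mu>"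
proof -
  obtain \<nu> where \<nu>: "\<nu> \<in> P" and h: "(L + Lt * Kb + CP * K) * norm (\<mu> - \<nu>) \<le> (\<beta> - \<alpha>) / 2"
    using fine[OF \<mu>] by blast
  have \<nu>D: "\<nu> \<in> D" using \<nu> P_subset by auto
  obtain y where y: "y \<in> Y \<mu>" "et \<mu> = \<theta> \<mu> \<bullet> y" using et_attained[OF \<mu>] by blast
  have "\<beta> \<le> bnd \<nu> \<nu>" by (rule bnd_sample[OF \<nu>])
  moreover have "bnd \<nu> \<nu> \<le> bnd \<mu> \<nu> + CP * K * norm (\<mu> - \<nu>)"
    using bnd_lipschitz[OF \<nu>D \<mu> \<nu>] by (simp add: norm_minus_commute)
  moreover have "bnd \<mu> \<nu> \<le> \<theta> \<nu> \<bullet> y" using y(1) \<nu> by (simp add: Y_LB_def)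
  moreover have "\<theta> \<nu> \<bullet> y = et \<mu> + (\<theta> \<nu> - \<theta> \<mu>) \<bullet> y" by (simp add: inner_diff_left y(2))
  moreover have "(\<theta> \<nu> - \<theta> \<mu>) \<bullet> y \<le> Lt * norm (\<mu> - \<nu>) * Kb"
    using y(1) by (intro inner_\<theta>_diff_le[OF \<nu>D \<mu>, unfolded norm_minus_commute[of \<nu> \<mu>]]) (simp add: Y_LB_def)
  ultimately have 1: "\<beta> \<le> et \<mu> + Lt * norm (\<mu> - \<nu>) * Kb + CP * K * norm (\<mu> - \<nu>)" by linarith
  have "rmin \<mu> \<le> \<alpha> + L * norm (\<mu> - \<nu>)"
    unfolding rmin_eq by (rule ritz_le[OF \<mu> \<nu> r_pos])
  with 1 have "\<beta> - \<alpha> - (L + Lt * Kb + CP * K) * norm (\<mu> - \<nu>) \<le> et \<mu> - rmin \<mu>"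
    by (simp add: algebra_simps)
  with h show ?thesis by (simp add: field_simps)
qed

lemma gap_pos: "\<mu> \<in> D \<Longrightarrow> 0 < et \<mu> - rmin \<mu>"
  by (rule less_le_trans[OF _ gap_lower]) (use gap in simp_all)

abbreviation "H \<equiv> gap_H Am \<theta> l r P v V w"

lemma H_eq:
  assumes \<mu>: "\<mu> \<in> D"
  defines "x \<equiv> et \<mu> - rmin \<mu>"
  shows "H \<mu> = 2 * (rho' \<mu>)\<^sup>2 / (x + sqrt (x\<^sup>2 + 4 * (rho' \<mu>)\<^sup>2))"
proof -
  have "0 < x" using gap_pos[OF \<mu>] by (simp add: x_def)
  then have "min (rmin \<mu>) (et \<mu>) = rmin \<mu>" "\<bar>rmin \<mu> - et \<mu>\<bar> = x" by (auto simp: x_def)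
  moreover have "(rmin \<mu> - et \<mu>)\<^sup>2 = x\<^sup>2" by (simp add: x_def power2_commute)
  ultimately show ?thesis by (simp add: gap_H_def lambda_LB_def)
qed

lemma H_le: "\<mu> \<in> D \<Longrightarrow> H \<mu> \<le> 2 * (rho' \<mu>)\<^sup>2 / (\<beta> - \<alpha>)"
proof -
  assume \<mu>: "\<mu> \<in> D"
  have x: "(\<beta> - \<alpha>) / 2 \<le> et \<mu> - rmin \<mu>" by (rule gap_lower[OF \<mu>])
  have x0: "0 < et \<mu> - rmin \<mu>" by (rule gap_pos[OF \<mu>])
  have "et \<mu> - rmin \<mu> \<le> sqrt ((et \<mu> - rmin \<mu>)\<^sup>2 + 4 * (rho' \<mu>)\<^sup>2)"
    by (rule real_le_rsqrt) simp
  moreover have "\<beta> - \<alpha> \<le> (et \<mu> - rmin \<mu>) + (et \<mu> - rmin \<mu>)" using x by (simp add: field_simps)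
  ultimately have "\<beta> - \<alpha> \<le> (et \<mu> - rmin \<mu>) + sqrt ((et \<mu> - rmin \<mu>)\<^sup>2 + 4 * (rho' \<mu>)\<^sup>2)"
    by linarith
  then show ?thesis
    unfolding H_eq[OF \<mu>] using gap by (intro divide_left_mono) (auto intro!: mult_pos_pos)
qed

text \<open>With \<open>H_le\<close> this makes \<open>H\<close> and the squared residual
  comparable, with constants independent of the level; a point that maximizes \<open>H\<close>
  therefore controls all residuals.\<close>

lemma H_ge: "\<mu> \<in> D \<Longrightarrow> (rho' \<mu>)\<^sup>2 / (Kt * Kb + 2 * K + 1) \<le> H \<mu>"
proof -
  assume \<mu>: "\<mu> \<in> D"
  define x where "x = et \<mu> - rmin \<mu>"
  have x: "(\<beta> - \<alpha>) / 2 \<le> x" unfolding x_def by (rule gap_lower[OF \<mu>])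
  have x0: "0 < x" unfolding x_def by (rule gap_pos[OF \<mu>])
  have xle: "x \<le> Kt * Kb + K"
    using et_abs_le[OF \<mu>] rmin_abs_le[OF \<mu>] by (simp add: x_def)
  have "sqrt (x\<^sup>2 + (2 * rho' \<mu>)\<^sup>2) \<le> \<bar>x\<bar> + \<bar>2 * rho' \<mu>\<bar>" by (rule sqrt_sum_squares_le_sum_abs)
  then have s: "sqrt (x\<^sup>2 + 4 * (rho' \<mu>)\<^sup>2) \<le> x + 2 * K"
    using rho_nonneg[OF \<mu>] rho_le_K[OF \<mu>] x0 by (simp add: power_mult_distrib)
  have "2 * (rho' \<mu>)\<^sup>2 / (2 * (Kt * Kb + 2 * K + 1)) \<le> 2 * (rho' \<mu>)\<^sup>2 / (x + sqrt (x\<^sup>2 + 4 * (rho' \<mu>)\<^sup>2))"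
  proof (rule divide_left_mono)
    have "0 \<le> Kt * Kb" using Kt_nonneg[OF \<mu>] Kb_nonneg by simp
    then have "0 < Kt * Kb + 2 * K + 1" using K_nonneg by linarith
    moreover have "0 < x + sqrt (x\<^sup>2 + 4 * (rho' \<mu>)\<^sup>2)" using x0 by (simp add: add_pos_nonneg)
    ultimately show "0 < 2 * (Kt * Kb + 2 * K + 1) * (x + sqrt (x\<^sup>2 + 4 * (rho' \<mu>)\<^sup>2))" by simp
  qed (use xle s in auto)
  moreover have "2 * (rho' \<mu>)\<^sup>2 / (2 * (Kt * Kb + 2 * K + 1)) = (rho' \<mu>)\<^sup>2 / (Kt * Kb + 2 * K + 1)"
    by (rule mult_divide_mult_cancel_left) simp
  ultimately show ?thesis unfolding H_eq[OF \<mu>] x_def[symmetric] by simp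
qed

text \<open>Dual feasibility together with equality of the optimal values; \<open>x\<close> belongs
  to the samples, \<open>xl\<close> and \<open>xu\<close> to the lower and upper faces of the
  box.\<close>

definition dual :: "real^'p \<Rightarrow> (real^'p \<Rightarrow> real) \<Rightarrow> ('k \<Rightarrow> real) \<Rightarrow> ('k \<Rightarrow> real) \<Rightarrow> bool"
  where "dual \<mu> x xl xu \<longleftrightarrow> (\<forall>\<nu>\<in>P. 0 \<le> x \<nu>) \<and> (\<forall>m. 0 \<le> xl m) \<and> (\<forall>m. 0 \<le> xu m) \<and>
    \<theta> \<mu> = (\<Sum>\<nu>\<in>P. x \<nu> *\<^sub>R \<theta> \<nu>) + (\<Sum>m\<in>UNIV. (xl m - xu m) *\<^sub>R axis m 1) \<and>
    et \<mu> = (\<Sum>\<nu>\<in>P. x \<nu> * bnd \<mu> \<nu>) + (\<Sum>m\<in>UNIV. xl m * lo m - xu m * up m)"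

text \<open>The constant depends on the level through \<open>P\<close>. It serves to exclude a
  blow-up along bounded levels.\<close>

lemma dual_exists:
  obtains C where "\<And>\<mu>. \<mu> \<in> D \<Longrightarrow> \<exists>x xl xu. dual \<mu> x xl xu \<and> sum x P \<le> C"
proof -
  define I :: "(real^'p + 'k + 'k) set" where "I = P <+> (UNIV <+> UNIV)"
  define n :: "real^'p + 'k + 'k \<Rightarrow> real^'k"
    where "n = case_sum \<theta> (case_sum (\<lambda>m. axis m 1) (\<lambda>m. - axis m 1))"
  have I: "finite I" by (simp add: I_def finite_P)
  have I_sum: "(\<Sum>i\<in>I. f i) = (\<Sum>\<nu>\<in>P. f (Inl \<nu>)) + ((\<Sum>m\<in>UNIV. f (Inr (Inl m))) + (\<Sum>m\<in>UNIV. f (Inr (Inr m))))"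
    for f :: "real^'p + 'k + 'k \<Rightarrow> 'x::comm_monoid_add"
    unfolding I_def by (simp add: sum.Plus finite_P o_def del: UNIV_Plus_UNIV)
  have I_ball: "(\<forall>i\<in>I. Q i) \<longleftrightarrow>
      (\<forall>\<nu>\<in>P. Q (Inl \<nu>)) \<and> (\<forall>m. Q (Inr (Inl m))) \<and> (\<forall>m. Q (Inr (Inr m)))" for Q
    unfolding I_def by (auto simp del: UNIV_Plus_UNIV)
  obtain C where C: "C \<ge> 0"
    "\<And>b c y. (\<And>i. i \<in> I \<Longrightarrow> b i \<le> n i \<bullet> y) \<Longrightarrow>
      (\<And>z. (\<And>i. i \<in> I \<Longrightarrow> b i \<le> n i \<bullet> z) \<Longrightarrow> c \<bullet> y \<le> c \<bullet> z) \<Longrightarrow>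
      \<exists>x. (\<forall>i\<in>I. 0 \<le> x i) \<and> c = (\<Sum>i\<in>I. x i *\<^sub>R n i) \<and> c \<bullet> y = (\<Sum>i\<in>I. x i * b i) \<and>
        (\<Sum>i\<in>I. x i) \<le> C * norm c"
    by (rule lp_multipliers_bounded[OF I, of n]) blast
  show thesis
  proof (rule that[of "C * Kt"])
    fix \<mu> assume \<mu>: "\<mu> \<in> D"
    obtain y where y: "y \<in> Y \<mu>" "et \<mu> = \<theta> \<mu> \<bullet> y" "\<And>y'. y' \<in> Y \<mu> \<Longrightarrow> \<theta> \<mu> \<bullet> y \<le> \<theta> \<mu> \<bullet> y'"
      using et_attained[OF \<mu>] by blast
    define b where "b = case_sum (bnd \<mu>) (case_sum lo (\<lambda>m. - up m))"
    have Y_iff: "z \<in> Y \<mu> \<longleftrightarrow> (\<forall>i\<in>I. b i \<le> n i \<bullet> z)" for z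
      unfolding I_ball by (auto simp: Y_LB_def box_def b_def n_def inner_axis')
    obtain x where x: "\<forall>i\<in>I. 0 \<le> x i" "\<theta> \<mu> = (\<Sum>i\<in>I. x i *\<^sub>R n i)" "\<theta> \<mu> \<bullet> y = (\<Sum>i\<in>I. x i * b i)"
        "(\<Sum>i\<in>I. x i) \<le> C * norm (\<theta> \<mu>)"
      using C(2)[of b y "\<theta> \<mu>"] y(1,3) unfolding Y_iff by blast
    have pos: "0 \<le> x (Inl \<nu>)" if "\<nu> \<in> P" for \<nu> using x(1) that unfolding I_ball by blast
    have pos': "0 \<le> x (Inr (Inl m))" "0 \<le> x (Inr (Inr m))" for m using x(1) unfolding I_ball by blast+
    have "dual \<mu> (\<lambda>\<nu>. x (Inl \<nu>)) (\<lambda>m. x (Inr (Inl m))) (\<lambda>m. x (Inr (Inr m)))"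
      unfolding dual_def
    proof (intro conjI ballI allI pos pos')
      show "\<theta> \<mu> = (\<Sum>\<nu>\<in>P. x (Inl \<nu>) *\<^sub>R \<theta> \<nu>) + (\<Sum>m\<in>UNIV. (x (Inr (Inl m)) - x (Inr (Inr m))) *\<^sub>R axis m 1)"
        unfolding x(2) I_sum by (simp add: n_def scaleR_diff_left sum_subtractf sum_negf)
      show "et \<mu> = (\<Sum>\<nu>\<in>P. x (Inl \<nu>) * bnd \<mu> \<nu>) + (\<Sum>m\<in>UNIV. x (Inr (Inl m)) * lo m - x (Inr (Inr m)) * up m)"
        unfolding y(2) x(3) I_sum by (simp add: b_def sum_subtractf sum_negf)
    qed
    moreover have "(\<Sum>\<nu>\<in>P. x (Inl \<nu>)) \<le> (\<Sum>i\<in>I. x i)"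
      unfolding I_sum by (simp add: sum_nonneg pos')
    then have "(\<Sum>\<nu>\<in>P. x (Inl \<nu>)) \<le> C * Kt"
      using x(4) mult_left_mono[OF \<theta>_bounded[OF \<mu>] C(1)] by linarith
    ultimately show "\<exists>x xl xu. dual \<mu> x xl xu \<and> sum x P \<le> C * Kt" by blast
  qed
qed

text \<open>Weak duality: the multipliers at \<mu> are tested with an optimal point of the program
  at \<open>\<mu>'\<close>, whose levels differ by at most
  \<open>CP * K * norm (\<mu> - \<mu>')\<close>. Only the multipliers of one of the two points
  enter.\<close>

lemma et_diff_le:
  assumes \<mu>: "\<mu> \<in> D" and \<mu>': "\<mu>' \<in> D" and x: "dual \<mu> x xl xu"
  shows "et \<mu> - et \<mu>' \<le> (Lt * Kb + sum x P * (CP * K)) * norm (\<mu> - \<mu>')"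
proof -
  obtain y where y: "y \<in> Y \<mu>'" "et \<mu>' = \<theta> \<mu>' \<bullet> y" using et_attained[OF \<mu>'] by blast
  have pos: "\<And>\<nu>. \<nu> \<in> P \<Longrightarrow> 0 \<le> x \<nu>" "\<And>m. 0 \<le> xl m" "\<And>m. 0 \<le> xu m"
    and th: "\<theta> \<mu> = (\<Sum>\<nu>\<in>P. x \<nu> *\<^sub>R \<theta> \<nu>) + (\<Sum>m\<in>UNIV. (xl m - xu m) *\<^sub>R axis m 1)"
    and et: "et \<mu> = (\<Sum>\<nu>\<in>P. x \<nu> * bnd \<mu> \<nu>) + (\<Sum>m\<in>UNIV. xl m * lo m - xu m * up m)"
    using x by (auto simp: dual_def)
  have yb: "\<And>m. lo m \<le> y $ m" "\<And>m. y $ m \<le> up m" "\<And>\<nu>. \<nu> \<in> P \<Longrightarrow> bnd \<mu>' \<nu> \<le> \<theta> \<nu> \<bullet> y"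
    using y(1) by (auto simp: Y_LB_def box_def)
  have "et \<mu> \<le> (\<Sum>\<nu>\<in>P. x \<nu> * (\<theta> \<nu> \<bullet> y + CP * K * norm (\<mu> - \<mu>'))) + (\<Sum>m\<in>UNIV. (xl m - xu m) * (y $ m))"
    unfolding et
  proof (intro add_mono sum_mono)
    show "x \<nu> * bnd \<mu> \<nu> \<le> x \<nu> * (\<theta> \<nu> \<bullet> y + CP * K * norm (\<mu> - \<mu>'))" if "\<nu> \<in> P" for \<nu>
      using bnd_lipschitz[OF \<mu> \<mu>' that] yb(3)[OF that] by (intro mult_left_mono pos that) linarith
    show "xl m * lo m - xu m * up m \<le> (xl m - xu m) * (y $ m)" for m
      using mult_left_mono[OF yb(1) pos(2), of m m] mult_left_mono[OF yb(2) pos(3), of m m]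
      by (simp add: algebra_simps)
  qed
  also have "(\<Sum>\<nu>\<in>P. x \<nu> * (\<theta> \<nu> \<bullet> y + CP * K * norm (\<mu> - \<mu>')))
      = (\<Sum>\<nu>\<in>P. x \<nu> * (\<theta> \<nu> \<bullet> y)) + sum x P * (CP * K * norm (\<mu> - \<mu>'))"
    by (simp only: distrib_left sum.distrib sum_distrib_right)
  also have "(\<Sum>\<nu>\<in>P. x \<nu> * (\<theta> \<nu> \<bullet> y)) + sum x P * (CP * K * norm (\<mu> - \<mu>')) + (\<Sum>m\<in>UNIV. (xl m - xu m) * (y $ m))
      = \<theta> \<mu> \<bullet> y + sum x P * (CP * K) * norm (\<mu> - \<mu>')"
    by (subst th) (simp add: inner_add_left inner_sum_left inner_axis')
  finally have "et \<mu> \<le> \<theta> \<mu> \<bullet> y + sum x P * (CP * K) * norm (\<mu> - \<mu>')" .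
  moreover have "\<theta> \<mu> \<bullet> y - et \<mu>' \<le> Lt * norm (\<mu> - \<mu>') * Kb"
    using y(1) inner_\<theta>_diff_le[OF \<mu> \<mu>', of y] by (simp add: Y_LB_def y(2) inner_diff_left)
  ultimately have "et \<mu> - et \<mu>' \<le> Lt * norm (\<mu> - \<mu>') * Kb + sum x P * (CP * K) * norm (\<mu> - \<mu>')"
    by linarith
  then show ?thesis by (simp add: algebra_simps)
qed

text \<open>The error estimate is insensitive to the linear program where the residual is small, so large
  multipliers do no harm as long as they are compensated by the square of the residual.\<close>

lemma H_diff_le:
  assumes \<mu>: "\<mu> \<in> D" and \<mu>': "\<mu>' \<in> D" and x: "dual \<mu> x xl xu" and le: "et \<mu>' \<le> et \<mu>"
    and C: "(rho' \<mu>)\<^sup>2 * sum x P \<le> C"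
  shows "\<bar>H \<mu> - H \<mu>'\<bar> \<le> (4 / (\<beta> - \<alpha>)\<^sup>2 * (K\<^sup>2 * (Lt * Kb + L) + C * (CP * K)) + Crho) * norm (\<mu> - \<mu>')"
proof -
  define \<delta> where "\<delta> = norm (\<mu> - \<mu>')"
  have \<delta>: "0 \<le> \<delta>" by (simp add: \<delta>_def)
  let ?x = "et \<mu> - rmin \<mu>" and ?x' = "et \<mu>' - rmin \<mu>'"
  have c: "0 < (\<beta> - \<alpha>) / 2" using gap by simp
  have 1: "\<bar>H \<mu> - H \<mu>'\<bar> \<le> (rho' \<mu>)\<^sup>2 / ((\<beta> - \<alpha>) / 2)\<^sup>2 * \<bar>?x - ?x'\<bar> + \<bar>rho' \<mu> - rho' \<mu>'\<bar>"
    unfolding H_eq[OF \<mu>] H_eq[OF \<mu>'] by (rule gap_function_lipschitz[OF c gap_lower[OF \<mu>] gap_lower[OF \<mu>']])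
  have 2: "\<bar>rho' \<mu> - rho' \<mu>'\<bar> \<le> Crho * \<delta>"
    using rho_lipschitz[OF \<mu> \<mu>'] rho_lipschitz[OF \<mu>' \<mu>] by (simp add: \<delta>_def norm_minus_commute abs_le_iff)
  let ?L = "Lt * Kb + sum x P * (CP * K)"
  have "0 \<le> L * \<delta>" using L_nonneg \<delta> by simp
  moreover have "0 \<le> ?L * \<delta>"
    using order.trans[OF _ et_diff_le[OF \<mu> \<mu>' x]] le by (simp add: \<delta>_def)
  ultimately have "\<bar>?x - ?x'\<bar> \<le> ?L * \<delta> + L * \<delta>"
    using et_diff_le[OF \<mu> \<mu>' x] le rmin_lipschitz[OF \<mu> \<mu>'] rmin_lipschitz[OF \<mu>' \<mu>]
    by (simp add: \<delta>_def norm_minus_commute abs_le_iff)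
  then have "(rho' \<mu>)\<^sup>2 / ((\<beta> - \<alpha>) / 2)\<^sup>2 * \<bar>?x - ?x'\<bar>
      \<le> (rho' \<mu>)\<^sup>2 / ((\<beta> - \<alpha>) / 2)\<^sup>2 * (?L * \<delta> + L * \<delta>)"
    by (rule mult_left_mono) simp
  also have E: "(rho' \<mu>)\<^sup>2 / ((\<beta> - \<alpha>) / 2)\<^sup>2 = 4 / (\<beta> - \<alpha>)\<^sup>2 * (rho' \<mu>)\<^sup>2"
    by (simp add: power_divide)
  also have "4 / (\<beta> - \<alpha>)\<^sup>2 * (rho' \<mu>)\<^sup>2 * (?L * \<delta> + L * \<delta>)
      = 4 / (\<beta> - \<alpha>)\<^sup>2 * ((rho' \<mu>)\<^sup>2 * (Lt * Kb + L) + (rho' \<mu>)\<^sup>2 * sum x P * (CP * K)) * \<delta>"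
  proof -
    have "q * a * ((s + t) * \<delta> + L * \<delta>) = q * (a * (s + L) + a * t) * \<delta>" for q a s t
      by (simp add: algebra_simps)
    from this[of _ _ "Lt * Kb" "sum x P * (CP * K)"] show ?thesis by (simp only: mult.assoc)
  qed
  also have "\<dots> \<le> 4 / (\<beta> - \<alpha>)\<^sup>2 * (K\<^sup>2 * (Lt * Kb + L) + C * (CP * K)) * \<delta>"
  proof (intro mult_right_mono mult_left_mono add_mono)
    show "(rho' \<mu>)\<^sup>2 \<le> K\<^sup>2" by (rule power_mono[OF rho_le_K[OF \<mu>] rho_nonneg[OF \<mu>]])
  qed (use Lt_nonneg Kb_nonneg L_nonneg CP_nonneg K_nonneg \<delta> C in auto)
  finally have "\<bar>H \<mu> - H \<mu>'\<bar> \<le> 4 / (\<beta> - \<alpha>)\<^sup>2 * (K\<^sup>2 * (Lt * Kb + L) + C * (CP * K)) * \<delta> + Crho * \<delta>"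
    using 1[unfolded E] 2 by linarith
  then show ?thesis unfolding \<delta>_def distrib_right .
qed

end

section \<open>The greedy run\<close>

text \<open>Closeness of the basis \<open>e\<close> to the span of \<open>z\<close> bounds both
  one-sided distances, one directly and the other by \<open>gap_symmetric_le\<close>.\<close>

lemma projections_close:
  assumes z: "orthonormal r z" and e: "orthonormal r e"
    and le: "\<And>k. k < r \<Longrightarrow> norm (e k - projection r z (e k)) \<le> \<epsilon>" and r: "0 < r"
  shows "norm (projection r z x - projection r e x) \<le> 2 * (real r)\<^sup>2 * \<epsilon> * norm x"
proof -
  note Z = ortho_proj_projection[OF z] and E = ortho_proj_projection[OF e]
  have \<epsilon>: "0 \<le> \<epsilon>" using le[OF r] norm_ge_zero order.trans by blast
  have rr: "real r \<le> (real r)\<^sup>2" using r by (simp add: power2_eq_square)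
  have "norm (projection r e x - projection r z (projection r e x)) \<le> (real r)\<^sup>2 * \<epsilon> * norm x" for x
  proof -
    have "norm (projection r e x - projection r z (projection r e x)) \<le> real r * \<epsilon> * norm (projection r e x)"
      by (rule norm_on_span_le[OF e ortho_proj_linear[OF ortho_proj_compl[OF Z]] le ortho_proj_idem[OF E]])
    also have "\<dots> \<le> (real r)\<^sup>2 * \<epsilon> * norm x"
      by (rule mult_mono[OF mult_right_mono[OF rr \<epsilon>] ortho_proj_norm_le[OF E]]) (use \<epsilon> in auto)
    finally show ?thesis .
  qed
  moreover have "norm (projection r z x - projection r e (projection r z x)) \<le> (real r)\<^sup>2 * \<epsilon> * norm x" for x
  proof -
    have "norm (projection r z x - projection r e (projection r z x)) \<le> (real r)\<^sup>2 * \<epsilon> * norm (projection r z x)"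
      by (rule gap_symmetric_le[OF e z le ortho_proj_idem[OF Z]])
    also have "\<dots> \<le> (real r)\<^sup>2 * \<epsilon> * norm x"
      by (rule mult_left_mono[OF ortho_proj_norm_le[OF Z]]) (use \<epsilon> in auto)
    finally show ?thesis .
  qed
  ultimately have "norm (projection r z x - projection r e x) \<le> 2 * ((real r)\<^sup>2 * \<epsilon>) * norm x"
    by (rule ortho_proj_diff_le[OF Z E])
  then show ?thesis by (simp add: mult.assoc)
qed

text \<open>Gram-Schmidt, skipping vectors that are already in the span.\<close>

lemma orthonormal_basis_exists:
  assumes "finite S"
  shows "\<exists>n f. orthonormal n f \<and> (\<forall>x\<in>S. projection n f x = x)"
  using assms
proof (induction S)
  case empty
  show ?case by (intro exI[of _ 0]) (simp add: orthonormal_def)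
next
  case (insert y S)
  then obtain n f where f: "orthonormal n f" "\<And>x. x \<in> S \<Longrightarrow> projection n f x = x" by blast
  show ?case
  proof (cases "projection n f y = y")
    case True
    then show ?thesis using f by blast
  next
    case False
    define g where "g = y - projection n f y"
    define u where "u = inverse (norm g) *\<^sub>R g"
    have g: "norm g \<noteq> 0" using False by (simp add: g_def)
    have "g \<in> ortho_compl n f" unfolding g_def by (rule ortho_compl_minus_projection[OF f(1)])
    then have "u \<in> ortho_compl n f" unfolding u_def by (rule subspace_scale[OF subspace_ortho_compl])
    then have on: "orthonormal (Suc n) (f(n := u))"
      using g by (intro orthonormal_extend[OF f(1)]) (auto simp: u_def ortho_compl_def)
    have proj: "projection (Suc n) (f(n := u)) x = projection n f x + cinner u x *\<^sub>C u" for x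
      by (simp add: projection_eq)
    have span: "projection (Suc n) (f(n := u)) x = x" if x: "projection n f x = x" for x
    proof -
      have "inner u x = 0 \<and> cinner u x = 0"
      proof -
        have "cinner u x = (\<Sum>k<n. cinner (f k) x * cinner u (f k))"
          by (subst x[symmetric], subst projection_eq) (simp add: cinner_sum_right cinner_scaleC_right)
        also have "\<dots> = 0"
          using \<open>u \<in> ortho_compl n f\<close> by (intro sum.neutral) (auto simp: ortho_compl_def cinner_commute[of u])
        finally show ?thesis by (simp add: inner_cinner)
      qed
      then show ?thesis by (simp add: proj x)
    qed
    have "y = projection n f y + norm g *\<^sub>R (f(n := u)) n"
      using g by (simp add: u_def g_def)
    moreover have "projection (Suc n) (f(n := u)) (projection n f y + norm g *\<^sub>R (f(n := u)) n)
        = projection n f y + norm g *\<^sub>R (f(n := u)) n"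
      by (simp only: clinear_add[OF projection_linear] clinear_scaleR[OF projection_linear]
          projection_basis[OF on lessI] span[OF ortho_proj_idem[OF ortho_proj_projection[OF f(1)]]])
    ultimately have "projection (Suc n) (f(n := u)) y = y" by simp
    then show ?thesis using on span f(2) by blast
  qed
qed

text \<open>Hilbert-Schmidt bound. The squared form matches \<open>gap_symmetric\<close> and the
  Pythagorean differences of the trial projections.\<close>

lemma norm_on_span_square_le:
  assumes e: "orthonormal n e" and T: "clinear T" and x: "projection n e x = x"
  shows "(norm (T x))\<^sup>2 \<le> (norm x)\<^sup>2 * (\<Sum>k<n. (norm (T (e k)))\<^sup>2)"
proof -
  have "T x = (\<Sum>k<n. cinner (e k) x *\<^sub>C T (e k))"
    by (subst x[symmetric], subst projection_eq) (simp add: clinear_sum[OF T] clinear_scaleC[OF T])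
  then have "norm (T x) \<le> (\<Sum>k<n. cmod (cinner (e k) x) * norm (T (e k)))"
    by (metis (no_types, lifting) norm_scaleC norm_sum sum.cong)
  also have "\<dots> \<le> L2_set (\<lambda>k. cmod (cinner (e k) x)) {..<n} * L2_set (\<lambda>k. norm (T (e k))) {..<n}"
    using L2_set_mult_ineq[of "\<lambda>k. cmod (cinner (e k) x)" "\<lambda>k. norm (T (e k))" "{..<n}"] by simp
  finally have "(norm (T x))\<^sup>2 \<le> (L2_set (\<lambda>k. cmod (cinner (e k) x)) {..<n} * L2_set (\<lambda>k. norm (T (e k))) {..<n})\<^sup>2"
    by (rule power_mono) simp
  also have "\<dots> = (norm x)\<^sup>2 * (\<Sum>k<n. (norm (T (e k)))\<^sup>2)"
    using projection_norm[OF e, of x] x by (simp add: L2_set_def power_mult_distrib sum_nonneg)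
  finally show ?thesis .
qed

locale run = setting Am \<theta> D l r K L \<alpha> \<beta>
  for Am :: "'k::finite \<Rightarrow> ell2 \<Rightarrow> ell2" and \<theta> :: "real^'p::finite \<Rightarrow> real^'k"
    and D :: "(real^'p) set" and l r K L \<alpha> \<beta> +
  fixes P :: "nat \<Rightarrow> (real^'p) set" and v :: "real^'p \<Rightarrow> nat \<Rightarrow> ell2" and V :: "nat \<Rightarrow> nat \<Rightarrow> ell2"
    and w :: "nat \<Rightarrow> real^'p \<Rightarrow> nat \<Rightarrow> complex vec" and Lt Kt Kb :: real
  assumes compact_D: "compact D"
    and level: "\<And>j. 1 \<le> j \<Longrightarrow> lp_level Am \<theta> D l r K L \<alpha> \<beta> (P j) v (V j) (w j) Lt Kt Kb"
    and P_Suc: "\<And>j. 1 \<le> j \<Longrightarrow> P j \<subseteq> P (Suc j)"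
    and greedy: "\<And>j. 1 \<le> j \<Longrightarrow> \<exists>\<mu>'\<in>D \<inter> P (Suc j).
      \<forall>\<mu>\<in>D. gap_H Am \<theta> l r (P j) v (V j) (w j) \<mu> \<le> gap_H Am \<theta> l r (P j) v (V j) (w j) \<mu>'"
begin

definition "PV j = projection (trial_dim l (P j) v) (V j)"
definition "PR j \<mu> = projection r (ritz_family l (P j) v (V j) (w j) \<mu>)"

abbreviation "rh j \<equiv> rho Am \<theta> l r (P j) v (V j) (w j)"
abbreviation "bd j \<equiv> lp_bound Am \<theta> l r (P j) v (V j) (w j)"
abbreviation "Hj j \<equiv> gap_H Am \<theta> l r (P j) v (V j) (w j)"

lemma level_base: "1 \<le> j \<Longrightarrow> level Am \<theta> D l r K L \<alpha> \<beta> (P j) v (V j) (w j)"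
  using level lp_level_def by blast

lemma PR_level: "1 \<le> j \<Longrightarrow> PR j = level.PR l r (P j) v (V j) (w j)"
  by (rule ext) (simp add: PR_def level.PR_def[OF level_base])

lemma P_mono:
  assumes j: "1 \<le> j" and ji: "j \<le> i"
  shows "P j \<subseteq> P i"
  using ji
proof (induction i rule: dec_induct)
  case (step n)
  then show ?case using P_Suc[of n] j by auto
qed simp

lemma PV_ortho: "1 \<le> j \<Longrightarrow> ortho_proj (PV j)"
  unfolding PV_def by (rule level.PV_ortho[OF level_base])

lemma PV_linear: "clinear (PV j)"
  unfolding PV_def by (rule projection_linear)

lemma PV_PV:
  assumes j: "1 \<le> j" "j \<le> i"
  shows "PV i (PV j x) = PV j x" and "PV j (PV i x) = PV j x"
proof -
  have i: "1 \<le> i" using j by simp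
  have "trial_space l (P j) v \<subseteq> trial_space l (P i) v"
    unfolding trial_space_def by (rule ell2.span_mono) (use P_mono[OF j] in blast)
  then have *: "PV i (PV j x) = PV j x" for x
    using level.PV_fixes[OF level_base[OF i]] level.PV_fixes[OF level_base[OF j(1)]]
      ortho_proj_idem[OF PV_ortho[OF j(1)]] unfolding PV_def by blast
  then show "PV i (PV j x) = PV j x" .
  have "inner (PV j (PV i x)) y = inner (PV j x) y" for y
    by (simp add: ortho_proj_inner[OF PV_ortho[OF j(1)]] ortho_proj_inner[OF PV_ortho[OF i]] *)
  then show "PV j (PV i x) = PV j x" using vector_eq_rdot by blast
qed

lemma PV_diff_norm:
  assumes j: "1 \<le> j" "j \<le> i"
  shows "(norm (PV i x - PV j x))\<^sup>2 = (norm (PV i x))\<^sup>2 - (norm (PV j x))\<^sup>2"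
  using ortho_proj_pythagoras[OF PV_ortho[OF j(1)], of "PV i x"] by (simp add: PV_PV[OF j])

lemma PV_norm_mono: "1 \<le> j \<Longrightarrow> j \<le> i \<Longrightarrow> norm (PV j x) \<le> norm (PV i x)"
  using ortho_proj_norm_le[OF PV_ortho, of j "PV i x"] by (simp add: PV_PV)

lemma PV_compl_antimono: "1 \<le> j \<Longrightarrow> j \<le> i \<Longrightarrow> norm (x - PV i x) \<le> norm (x - PV j x)"
proof -
  assume j: "1 \<le> j" "j \<le> i"
  then have i: "1 \<le> i" by simp
  have "x - PV i x = (x - PV j x) - PV i (x - PV j x)"
    by (simp add: clinear_diff[OF PV_linear] PV_PV[OF j])
  then show ?thesis by (metis ortho_proj_compl_norm_le[OF PV_ortho[OF i]])
qed

text \<open>A maximizer chosen close to an earlier one has a small residual, and the greedy choice then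
  makes all residuals small.\<close>

lemma residuals_small:
  assumes \<epsilon>: "0 < \<epsilon>"
  shows "\<exists>j\<ge>1. \<forall>\<mu>\<in>D. rh j \<mu> \<le> \<epsilon>"
proof -
  obtain m where m: "\<And>j. 1 \<le> j \<Longrightarrow> m j \<in> D" "\<And>j. 1 \<le> j \<Longrightarrow> m j \<in> P (Suc j)"
    "\<And>j \<mu>. 1 \<le> j \<Longrightarrow> \<mu> \<in> D \<Longrightarrow> Hj j \<mu> \<le> Hj j (m j)"
    using greedy by (metis IntE)
  define C where "C = (Kt * Kb + 2 * K + 1) * (2 / (\<beta> - \<alpha>))"
  interpret L1: lp_level Am \<theta> D l r K L \<alpha> \<beta> "P 1" v "V 1" "w 1" Lt Kt Kb by (rule level) simp
  have pos: "0 < Kt * Kb + 2 * K + 1"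
  proof -
    have "0 \<le> Kt * Kb" using L1.Kt_nonneg[OF m(1)[of 1]] L1.Kb_nonneg by simp
    then show ?thesis using K_nonneg by linarith
  qed
  have C: "0 \<le> C" using pos gap by (simp add: C_def)
  \<comment> \<open>Chosen such that the final bound \<open>(C + 1) * ((Crho + 1) * \<eta>)\<close>
    equals \<epsilon>.\<close>
  define \<eta> where "\<eta> = \<epsilon> / ((C + 1) * (Crho + 1))"
  have \<eta>: "0 < \<eta>" using \<epsilon> C Crho_nonneg by (simp add: \<eta>_def)
  have "\<forall>n. m (Suc n) \<in> D" using m(1) by simp
  \<comment> \<open>By compactness, maximizers of two different levels come close to each
    other.\<close>
  then obtain q s where s: "strict_mono s" "((\<lambda>n. m (Suc n)) \<circ> s) \<longlonglongrightarrow> q"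
    using compact_D unfolding compact_def by metis
  then have "Cauchy ((\<lambda>n. m (Suc n)) \<circ> s)" by (intro LIMSEQ_imp_Cauchy)
  then obtain N where "\<And>i k. N \<le> i \<Longrightarrow> N \<le> k \<Longrightarrow> dist (m (Suc (s i))) (m (Suc (s k))) < \<eta>"
    using \<eta> unfolding Cauchy_def by (metis comp_apply)
  then have d: "dist (m (Suc (s N))) (m (Suc (s (Suc N)))) < \<eta>" by simp
  define a b where "a = Suc (s N)" and "b = Suc (s (Suc N))"
  have ab: "1 \<le> a" "1 \<le> b" "Suc a \<le> b"
    using strict_monoD[OF s(1), of N "Suc N"] by (simp_all add: a_def b_def)
  \<comment> \<open>The earlier maximizer is a sample of the later level, where its residual is
    therefore 0.\<close>
  have ma: "m a \<in> P b" using m(2)[OF ab(1)] P_mono[of "Suc a" b] ab by auto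
  interpret B: lp_level Am \<theta> D l r K L \<alpha> \<beta> "P b" v "V b" "w b" Lt Kt Kb by (rule level[OF ab(2)])
  have "rh b (m b) \<le> rh b (m a) + Crho * norm (m a - m b)"
    by (rule B.rho_lipschitz[OF m(1)[OF ab(1)] m(1)[OF ab(2)]])
  also have "\<dots> \<le> Crho * \<eta>"
    using d Crho_nonneg B.rho_sample[OF ma] by (simp add: a_def b_def dist_norm mult_left_mono)
  finally have mb: "rh b (m b) \<le> Crho * \<eta>" .
  have "rh b \<mu> \<le> \<epsilon>" if \<mu>: "\<mu> \<in> D" for \<mu>
  proof -
    have "(rh b \<mu>)\<^sup>2 \<le> (Kt * Kb + 2 * K + 1) * Hj b \<mu>"
      using B.H_ge[OF \<mu>] pos by (simp add: pos_divide_le_eq mult.commute)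
    also have "\<dots> \<le> (Kt * Kb + 2 * K + 1) * (2 * (rh b (m b))\<^sup>2 / (\<beta> - \<alpha>))"
      using order.trans[OF m(3)[OF ab(2) \<mu>] B.H_le[OF m(1)[OF ab(2)]]] pos by (intro mult_left_mono) auto
    also have "\<dots> = C * (rh b (m b))\<^sup>2" by (simp add: C_def)
    also have "\<dots> \<le> C * (Crho * \<eta>)\<^sup>2"
      by (intro mult_left_mono power_mono mb B.rho_nonneg[OF m(1)[OF ab(2)]] C)
    also have "\<dots> \<le> (C + 1)\<^sup>2 * ((Crho + 1) * \<eta>)\<^sup>2"
    proof (intro mult_mono power_mono)
      have "C \<le> (C + 1) * 1" by simp
      also have "\<dots> \<le> (C + 1)\<^sup>2" using C unfolding power2_eq_square by (intro mult_left_mono) auto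
      finally show "C \<le> (C + 1)\<^sup>2" .
    qed (use \<eta> Crho_nonneg in auto)
    also have "\<dots> = ((C + 1) * ((Crho + 1) * \<eta>))\<^sup>2" by (simp add: power_mult_distrib)
    also have "(C + 1) * ((Crho + 1) * \<eta>) = \<epsilon>"
      using C Crho_nonneg by (simp add: \<eta>_def)
    finally show ?thesis using \<epsilon> by (simp add: power2_le_iff_abs_le)
  qed
  then show ?thesis using ab by blast
qed

text \<open>A uniform residual bound at a single level is enough, since the distance to the trial
  spaces decreases from level to level.\<close>

lemma eigenvectors_in_closure:
  assumes \<mu>: "\<mu> \<in> D" and e: "eigenbasis (A \<mu>) r e" and k: "k < r"
  shows "(\<lambda>j. norm (e k - PV j (e k))) \<longlonglongrightarrow> 0"
proof (rule LIMSEQ_I)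
  fix \<epsilon> :: real assume \<epsilon>: "0 < \<epsilon>"
  define c where "c = (real r)\<^sup>2 * (2 / (\<beta> - \<alpha>))"
  have c: "0 \<le> c" using gap by (simp add: c_def)
  obtain j where j: "1 \<le> j" "\<And>\<mu>. \<mu> \<in> D \<Longrightarrow> rh j \<mu> \<le> \<epsilon> / (c + 1)"
    using residuals_small[of "\<epsilon> / (c + 1)"] \<epsilon> c by auto
  have "norm (e k - PV j (e k)) \<le> c * rh j \<mu>"
    unfolding PV_def c_def by (rule level.eigenvector_near_trial[OF level_base[OF j(1)] \<mu> e k])
  also have "\<dots> \<le> c * (\<epsilon> / (c + 1))" by (intro mult_left_mono j \<mu> c)
  also have "\<dots> < \<epsilon>" using c \<epsilon> by (simp add: field_simps)
  finally have "norm (norm (e k - PV i (e k)) - 0) < \<epsilon>" if "j \<le> i" for i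
    using PV_compl_antimono[OF j(1) that, of "e k"] by simp
  then show "\<exists>N. \<forall>i\<ge>N. norm (norm (e k - PV i (e k)) - 0) < \<epsilon>" by blast
qed

end

section \<open>Multipliers are compensated by residuals\<close>

lemma tendsto_norm_form:
  assumes T: "bounded_linear T" and f: "f \<longlonglongrightarrow> g"
  shows "(\<lambda>n. inner (f n) (T (f n))) \<longlonglongrightarrow> inner g (T g)"
  by (intro tendsto_inner f bounded_linear.tendsto[OF T f])

lemma psd_form_zero:
  assumes T: "clinear T" "self_adjoint T" and psd: "\<And>x. 0 \<le> inner x (T x)" and x: "inner x (T x) = 0"
  shows "T x = 0"
proof -
  have "(inner (T x) (T x))\<^sup>2 \<le> inner (T x) (T (T x)) * inner x (T x)"
    by (rule form_Cauchy_Schwarz[OF T subspace_UNIV]) (simp_all add: psd)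
  then show ?thesis using x by simp
qed

locale blowup = run +
  fixes j :: "nat \<Rightarrow> nat" and \<mu> :: "nat \<Rightarrow> real^'b" and \<mu>\<^sub>0 :: "real^'b"
    and x :: "nat \<Rightarrow> real^'b \<Rightarrow> real" and xl xu :: "nat \<Rightarrow> 'a \<Rightarrow> real" and e :: "nat \<Rightarrow> ell2"
  assumes j: "\<And>n. 1 \<le> j n" and j_lim: "filterlim j at_top sequentially"
    and \<mu>: "\<And>n. \<mu> n \<in> D" and \<mu>\<^sub>0: "\<mu>\<^sub>0 \<in> D" and \<mu>_lim: "\<mu> \<longlonglongrightarrow> \<mu>\<^sub>0"
    and dual: "\<And>n. lp_level.dual Am \<theta> l r (P (j n)) v (V (j n)) (w (j n)) (\<mu> n) (x n) (xl n) (xu n)"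
    and blow: "filterlim (\<lambda>n. (rh (j n) (\<mu> n))\<^sup>2 * sum (x n) (P (j n))) at_top sequentially"
    and e: "eigenbasis (A \<mu>\<^sub>0) r e"
begin

section \<open>Consequences of duality along a blow-up sequence\<close>

definition "X n = sum (x n) (P (j n))"
definition "Q n = PR (j n) (\<mu> n)"
definition "W n = PV (j n)"
definition "R n = rh (j n) (\<mu> n)"
definition "E = projection r e"
definition "S n u = (\<Sum>\<nu>\<in>P (j n). x n \<nu> *\<^sub>R A \<nu> u)"
definition "c2 = Kt * Kb"

lemma lev: "lp_level Am \<theta> D l r K L \<alpha> \<beta> (P (j n)) v (V (j n)) (w (j n)) Lt Kt Kb"
  by (rule level[OF j])

lemma e_on: "orthonormal r e"
  by (rule eigenbasis_orthonormal[OF e])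

lemma E_ortho: "ortho_proj E"
  unfolding E_def by (rule ortho_proj_projection[OF e_on])

lemma E_linear: "clinear E"
  by (rule ortho_proj_linear[OF E_ortho])

lemma Q_on: "orthonormal r (ritz_family l (P (j n)) v (V (j n)) (w (j n)) (\<mu> n))"
proof -
  interpret J: lp_level Am \<theta> D l r K L \<alpha> \<beta> "P (j n)" v "V (j n)" "w (j n)" Lt Kt Kb by (rule lev)
  show ?thesis by (rule J.z[OF \<mu>])
qed

lemma Q_ortho: "ortho_proj (Q n)"
  unfolding Q_def PR_def by (rule ortho_proj_projection[OF Q_on])

lemma Q_linear: "clinear (Q n)"
  by (rule ortho_proj_linear[OF Q_ortho])

lemma W_ortho: "ortho_proj (W n)"
  unfolding W_def by (rule PV_ortho[OF j])

lemma x_nonneg: "\<nu> \<in> P (j n) \<Longrightarrow> 0 \<le> x n \<nu>" and xl_nonneg: "0 \<le> xl n m" and xu_nonneg: "0 \<le> xu n m"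
  using dual[of n] unfolding lp_level.dual_def[OF lev] by auto

lemma \<theta>_dual: "\<theta> (\<mu> n) = (\<Sum>\<nu>\<in>P (j n). x n \<nu> *\<^sub>R \<theta> \<nu>) + (\<Sum>m\<in>UNIV. (xl n m - xu n m) *\<^sub>R axis m 1)"
  and eta_dual: "eta Am \<theta> l r (P (j n)) v (V (j n)) (w (j n)) (\<mu> n) =
    (\<Sum>\<nu>\<in>P (j n). x n \<nu> * bd (j n) (\<mu> n) \<nu>) + (\<Sum>m\<in>UNIV. xl n m * box_lower Am m - xu n m * box_upper Am m)"
  using dual[of n] unfolding lp_level.dual_def[OF lev] by blast+

lemma X_nonneg: "0 \<le> X n"
  unfolding X_def by (intro sum_nonneg x_nonneg)

lemma R_nonneg: "0 \<le> R n" and R_le: "R n \<le> K"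
  unfolding R_def using level.rho_nonneg[OF level_base[OF j] \<mu>] level.rho_le_K[OF level_base[OF j] \<mu>] by auto

lemma X_lim: "filterlim X at_top sequentially"
  unfolding filterlim_at_top
proof
  fix C :: real
  have "\<forall>\<^sub>F n in sequentially. K\<^sup>2 * \<bar>C\<bar> + 1 \<le> (R n)\<^sup>2 * X n"
    using blow unfolding filterlim_at_top R_def X_def by blast
  then show "\<forall>\<^sub>F n in sequentially. C \<le> X n"
  proof (eventually_elim)
    case (elim n)
    have "(R n)\<^sup>2 * X n \<le> K\<^sup>2 * X n"
      by (intro mult_right_mono power_mono R_le R_nonneg X_nonneg)
    with elim have "K\<^sup>2 * \<bar>C\<bar> < K\<^sup>2 * X n" by simp
    then have "\<bar>C\<bar> < X n" by (rule mult_left_less_imp_less) simp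
    then show ?case by simp
  qed
qed

text \<open>The operator family is linear in \<open>\<theta>\<close>, so the dual identity between
  vectors becomes one between operators.\<close>

lemma A_decompose: "A (\<mu> n) u = S n u + (\<Sum>m\<in>UNIV. (xl n m - xu n m) *\<^sub>R Am m u)"
proof -
  have *: "(\<Sum>m\<in>UNIV. (y $ m) *\<^sub>R Am m u) = a" if "y = (\<Sum>\<nu>\<in>P (j n). x n \<nu> *\<^sub>R \<theta> \<nu>) + (\<Sum>m\<in>UNIV. (xl n m - xu n m) *\<^sub>R axis m 1)"
    "a = S n u + (\<Sum>m\<in>UNIV. (xl n m - xu n m) *\<^sub>R Am m u)" for y :: "real^'a" and a
  proof -
    have y: "y $ m = (\<Sum>\<nu>\<in>P (j n). x n \<nu> * \<theta> \<nu> $ m) + (xl n m - xu n m)" for m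
      unfolding that(1) by (simp add: axis_def if_distrib cong: if_cong)
    have "(\<Sum>m\<in>UNIV. (\<Sum>\<nu>\<in>P (j n). x n \<nu> * \<theta> \<nu> $ m) *\<^sub>R Am m u) = S n u"
      unfolding S_def affine_family_def scaleR_sum_left scaleR_sum_right by (subst sum.swap) simp
    then show ?thesis
      unfolding y that(2) by (simp add: scaleR_left_distrib sum.distrib)
  qed
  show ?thesis
    unfolding affine_family_def[of _ _ "\<mu> n"] by (rule *[OF \<theta>_dual refl])
qed

lemma S_form: "inner f (S n u) = (\<Sum>\<nu>\<in>P (j n). x n \<nu> * inner f (A \<nu> u))"
  by (simp add: S_def inner_sum_right)

text \<open>In the dual formula the sample terms, the lower box terms and the upper box terms are
  all nonpositive, and their total, the optimal value, is at least \<open>- c2\<close>. Hence no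
  part of the sum can fall below \<open>- c2\<close>.\<close>

lemma slack_sum:
  shows bound_sum: "- c2 \<le> (\<Sum>\<nu>\<in>P (j n). x n \<nu> * bd (j n) (\<mu> n) \<nu>)"
    and lower_slack: "xl n m * - box_lower Am m \<le> c2"
    and upper_slack: "xu n m * box_upper Am m \<le> c2"
proof -
  interpret J: lp_level Am \<theta> D l r K L \<alpha> \<beta> "P (j n)" v "V (j n)" "w (j n)" Lt Kt Kb by (rule lev)
  have et: "\<bar>J.et (\<mu> n)\<bar> \<le> c2" unfolding c2_def by (rule J.et_abs_le[OF \<mu>])
  note bx = box_bounds(3,4)[of Am, OF compact_Am selfadj_Am]
  have t: "xl n m * box_lower Am m \<le> 0" "0 \<le> xu n m * box_upper Am m" for m
    using xl_nonneg[of n m] xu_nonneg[of n m] bx[of m] by (auto simp: mult_nonneg_nonpos)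
  have b: "(\<Sum>\<nu>\<in>P (j n). x n \<nu> * bd (j n) (\<mu> n) \<nu>) \<le> 0"
    by (intro sum_nonpos mult_nonneg_nonpos x_nonneg J.bnd_nonpos[OF \<mu>])
  have s: "(\<Sum>m\<in>UNIV. xl n m * box_lower Am m - xu n m * box_upper Am m) \<le> xl n m * box_lower Am m - xu n m * box_upper Am m" for m
  proof -
    have "(\<Sum>m\<in>UNIV. xl n m * box_lower Am m - xu n m * box_upper Am m)
      = (xl n m * box_lower Am m - xu n m * box_upper Am m) + (\<Sum>m\<in>UNIV - {m}. xl n m * box_lower Am m - xu n m * box_upper Am m)"
      by (simp add: sum.remove)
    also have "(\<Sum>m\<in>UNIV - {m}. xl n m * box_lower Am m - xu n m * box_upper Am m) \<le> 0"
      using t by (intro sum_nonpos) (meson diff_le_0_iff_le order.trans)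
    finally show ?thesis by simp
  qed
  from et eta_dual[of n] b t[of m] s[of m]
  show "- c2 \<le> (\<Sum>\<nu>\<in>P (j n). x n \<nu> * bd (j n) (\<mu> n) \<nu>)" "xl n m * - box_lower Am m \<le> c2"
    "xu n m * box_upper Am m \<le> c2" by linarith+
qed

lemma c2_nonneg: "0 \<le> c2"
  using upper_slack[of 0] xu_nonneg[of 0] box_bounds(4)[of Am, OF compact_Am selfadj_Am]
  by (meson mult_nonneg_nonneg order.trans)

text \<open>On the complement of the Ritz space each sampled operator is bounded below by its level,
  and the weighted levels add up to at least \<open>- c2\<close>.\<close>

lemma S_lower:
  assumes f: "Q n f = 0"
  shows "- c2 * (norm f)\<^sup>2 \<le> inner f (S n f)"
proof -
  interpret J: lp_level Am \<theta> D l r K L \<alpha> \<beta> "P (j n)" v "V (j n)" "w (j n)" Lt Kt Kb by (rule lev)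
  have "- c2 * (norm f)\<^sup>2 \<le> (\<Sum>\<nu>\<in>P (j n). x n \<nu> * bd (j n) (\<mu> n) \<nu>) * (norm f)\<^sup>2"
    by (intro mult_right_mono bound_sum) simp
  also have "\<dots> = (\<Sum>\<nu>\<in>P (j n). x n \<nu> * (bd (j n) (\<mu> n) \<nu> * (norm f)\<^sup>2))"
    by (simp add: sum_distrib_right mult.assoc)
  also have "\<dots> \<le> inner f (S n f)"
    unfolding S_form
    by (intro sum_mono mult_left_mono x_nonneg J.bnd_le_form[OF \<mu>])
      (use f in \<open>simp_all add: Q_def PR_level[OF j]\<close>)
  finally show ?thesis .
qed

text \<open>All slack terms are nonnegative, so each is bounded by their sum. The operator identity
  and the dual formula express this sum by forms and the optimal value: \<open>K\<close> bounds the
  form of \<open>A (\<mu> n)\<close>, one \<open>c2\<close> comes from \<open>S_lower\<close> and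
  the other from the optimal value.\<close>

lemma box_slack:
  assumes f: "Q n f = 0"
  shows "xl n m * (inner f (Am m f) - box_lower Am m * (norm f)\<^sup>2) \<le> (K + 2 * c2) * (norm f)\<^sup>2"
    and "xu n m * (box_upper Am m * (norm f)\<^sup>2 - inner f (Am m f)) \<le> (K + 2 * c2) * (norm f)\<^sup>2"
proof -
  interpret J: lp_level Am \<theta> D l r K L \<alpha> \<beta> "P (j n)" v "V (j n)" "w (j n)" Lt Kt Kb by (rule lev)
  define F where "F = (norm f)\<^sup>2"
  have F: "0 \<le> F" by (simp add: F_def)
  let ?a = "\<lambda>m. xl n m * (inner f (Am m f) - box_lower Am m * F)"
  let ?b = "\<lambda>m. xu n m * (box_upper Am m * F - inner f (Am m f))"
  have a: "0 \<le> ?a m" and b: "0 \<le> ?b m" for m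
    using box_bounds(1,2)[of Am, OF compact_Am selfadj_Am] xl_nonneg xu_nonneg by (auto simp: F_def)
  have "(\<Sum>m\<in>UNIV. ?a m + ?b m) = (\<Sum>m\<in>UNIV. (xl n m - xu n m) * inner f (Am m f))
      - (\<Sum>m\<in>UNIV. xl n m * box_lower Am m - xu n m * box_upper Am m) * F"
    unfolding sum_distrib_right sum_subtractf[symmetric] by (rule sum.cong) (auto simp: algebra_simps)
  also have "(\<Sum>m\<in>UNIV. (xl n m - xu n m) * inner f (Am m f)) = inner f (A (\<mu> n) f) - inner f (S n f)"
    by (subst A_decompose) (simp add: inner_add_right inner_sum_right)
  also have "(\<Sum>m\<in>UNIV. xl n m * box_lower Am m - xu n m * box_upper Am m)
      = J.et (\<mu> n) - (\<Sum>\<nu>\<in>P (j n). x n \<nu> * bd (j n) (\<mu> n) \<nu>)"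
    using eta_dual[of n] by simp
  finally have sum: "(\<Sum>m\<in>UNIV. ?a m + ?b m) = inner f (A (\<mu> n) f) - inner f (S n f)
      - J.et (\<mu> n) * F + (\<Sum>\<nu>\<in>P (j n). x n \<nu> * bd (j n) (\<mu> n) \<nu>) * F"
    by (simp add: left_diff_distrib)
  have 1: "inner f (A (\<mu> n) f) \<le> K * F" using A_form_le[OF \<mu>[of n], of f] by (simp add: F_def)
  have 2: "- inner f (S n f) \<le> c2 * F" using S_lower[OF f] by (simp add: F_def)
  have 3: "- J.et (\<mu> n) * F \<le> c2 * F"
    using J.et_abs_le[OF \<mu>, of n] by (intro mult_right_mono F) (simp add: c2_def)
  have 4: "(\<Sum>\<nu>\<in>P (j n). x n \<nu> * bd (j n) (\<mu> n) \<nu>) * F \<le> 0"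
    by (intro mult_nonpos_nonneg sum_nonpos mult_nonneg_nonpos x_nonneg J.bnd_nonpos[OF \<mu>] F)
  have le: "(\<Sum>m\<in>UNIV. ?a m + ?b m) \<le> (K + 2 * c2) * F"
    using sum 1 2 3 4 by (simp add: algebra_simps)
  have "?a m + ?b m \<le> (\<Sum>m\<in>UNIV. ?a m + ?b m)"
    by (rule member_le_sum) (use a b in \<open>auto intro: add_nonneg_nonneg\<close>)
  with le a[of m] b[of m]
  show "xl n m * (inner f (Am m f) - box_lower Am m * (norm f)\<^sup>2) \<le> (K + 2 * c2) * (norm f)\<^sup>2"
    "xu n m * (box_upper Am m * (norm f)\<^sup>2 - inner f (Am m f)) \<le> (K + 2 * c2) * (norm f)\<^sup>2"
    unfolding F_def by linarith+
qed

text \<open>This tends to 0, but without a rate; the rate \<open>1 / sqrt (X n)\<close> is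
  established in \<open>Q_close\<close>.\<close>

definition "dist_E n = 2 * (real r)\<^sup>2 * ((1 + 2 * K / (\<beta> - \<alpha>)) * (\<Sum>k<r. norm (e k - W n (e k))))
  + CP * norm (\<mu> n - \<mu>\<^sub>0)"

lemma Q_near_E: "norm (Q n u - E u) \<le> dist_E n * norm u"
proof -
  interpret J: lp_level Am \<theta> D l r K L \<alpha> \<beta> "P (j n)" v "V (j n)" "w (j n)" Lt Kt Kb by (rule lev)
  have C: "0 \<le> 1 + 2 * K / (\<beta> - \<alpha>)" using K_nonneg gap by simp
  have "norm (PR (j n) \<mu>\<^sub>0 u - E u) \<le> 2 * (real r)\<^sup>2 * ((1 + 2 * K / (\<beta> - \<alpha>)) * (\<Sum>k<r. norm (e k - W n (e k)))) * norm u"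
    unfolding PR_def E_def
  proof (rule projections_close[OF J.z[OF \<mu>\<^sub>0] e_on _ r_pos])
    fix k assume k: "k < r"
    have "norm (e k - J.PR \<mu>\<^sub>0 (e k)) \<le> (1 + 2 * K / (\<beta> - \<alpha>)) * norm (e k - J.PV (e k))"
      by (rule J.eigenvector_near_ritz[OF \<mu>\<^sub>0 e k])
    also have "\<dots> \<le> (1 + 2 * K / (\<beta> - \<alpha>)) * (\<Sum>k<r. norm (e k - W n (e k)))"
      unfolding W_def PV_def by (intro mult_left_mono C member_le_sum) (use k in auto)
    finally show "norm (e k - projection r (J.z \<mu>\<^sub>0) (e k)) \<le> (1 + 2 * K / (\<beta> - \<alpha>)) * (\<Sum>k<r. norm (e k - W n (e k)))"
      by (simp add: J.PR_def)
  qed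
  moreover have "norm (Q n u - PR (j n) \<mu>\<^sub>0 u) \<le> CP * norm (\<mu> n - \<mu>\<^sub>0) * norm u"
    unfolding Q_def PR_level[OF j] by (rule J.PR_lipschitz[OF \<mu> \<mu>\<^sub>0])
  moreover have "norm (Q n u - E u) \<le> norm (Q n u - PR (j n) \<mu>\<^sub>0 u) + norm (PR (j n) \<mu>\<^sub>0 u - E u)"
    using norm_triangle_ineq[of "Q n u - PR (j n) \<mu>\<^sub>0 u" "PR (j n) \<mu>\<^sub>0 u - E u"] by simp
  ultimately show ?thesis by (simp add: dist_E_def distrib_right)
qed

lemma dist_E_lim: "dist_E \<longlonglongrightarrow> 0"
proof -
  have "(\<lambda>n. norm (e k - W n (e k))) \<longlonglongrightarrow> 0" if "k < r" for k
    using filterlim_compose[OF eigenvectors_in_closure[OF \<mu>\<^sub>0 e that] j_lim] by (simp add: W_def)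
  then have "(\<lambda>n. \<Sum>k<r. norm (e k - W n (e k))) \<longlonglongrightarrow> (\<Sum>k<r. 0)"
    by (intro tendsto_sum) auto
  then have s: "(\<lambda>n. \<Sum>k<r. norm (e k - W n (e k))) \<longlonglongrightarrow> 0" by simp
  have m: "(\<lambda>n. norm (\<mu> n - \<mu>\<^sub>0)) \<longlonglongrightarrow> 0"
    using \<mu>_lim by (simp add: LIM_zero tendsto_norm_zero)
  show ?thesis
    using tendsto_add[OF tendsto_mult_left[OF tendsto_mult_left[OF s, of "1 + 2 * K / (\<beta> - \<alpha>)"], of "2 * (real r)\<^sup>2"]
      tendsto_mult_left[OF m, of CP]]
    by (simp add: dist_E_def [abs_def])
qed

lemma Q_compl_lim:
  assumes g: "E g = 0"
  shows "(\<lambda>n. g - Q n g) \<longlonglongrightarrow> g"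
proof -
  have "(\<lambda>n. Q n g) \<longlonglongrightarrow> 0"
  proof (rule Lim_null_comparison)
    show "\<forall>\<^sub>F n in sequentially. norm (Q n g) \<le> dist_E n * norm g"
      using Q_near_E[of _ g] g by (intro always_eventually) auto
    show "(\<lambda>n. dist_E n * norm g) \<longlonglongrightarrow> 0"
      using tendsto_mult_right[OF dist_E_lim, of "norm g"] by simp
  qed
  then show ?thesis using tendsto_diff[OF tendsto_const[of g]] by fastforce
qed

lemma Q_compl: "Q n (g - Q n g) = 0"
  by (simp add: clinear_diff[OF Q_linear] ortho_proj_idem[OF Q_ortho])

text \<open>A box multiplier can only blow up if the operator vanishes on the complement of the limiting
  eigenspace: the sign constraint must be active at \<open>0\<close> and the form must vanish there.\<close>

lemma box_multipliers_bounded: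
  "\<exists>B\<ge>0. \<forall>\<^sub>F n in sequentially. \<forall>m. (\<exists>g. E g = 0 \<and> Am m g \<noteq> 0) \<longrightarrow> \<bar>xl n m - xu n m\<bar> \<le> B"
proof -
  \<comment> \<open>One argument for both faces: \<open>T\<close> is the operator and
    \<open>b\<close> minus the lower endpoint, or \<open>T\<close> is the negative of the operator
    and \<open>b\<close> the upper endpoint. For \<open>b > 0\<close> the dual formula bounds
    \<open>y n\<close> directly; for \<open>b = 0\<close> the form of \<open>T\<close> is
    nonnegative, and \<open>T g \<noteq> 0\<close> makes it positive at \<open>g\<close>.\<close>
  have one: "\<exists>B\<ge>0. \<forall>\<^sub>F n in sequentially. y n \<le> B"
    if T: "clinear T" "self_adjoint T" "bounded_linear T" and y: "\<And>n. 0 \<le> y n"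
      and b: "\<And>x. - b * (norm x)\<^sup>2 \<le> inner x (T x)" "0 \<le> b" "\<And>n. y n * b \<le> c2"
      and sl: "\<And>n f. Q n f = 0 \<Longrightarrow> y n * (inner f (T f) + b * (norm f)\<^sup>2) \<le> (K + 2 * c2) * (norm f)\<^sup>2"
      and g: "E g = 0" "T g \<noteq> 0"
    for T y b g
  proof (cases "b = 0")
    case False
    then have "y n \<le> c2 / b" for n
      using b(2) b(3)[of n] by (simp add: pos_le_divide_eq)
    then show ?thesis using b(2) c2_nonneg by (intro exI[of _ "c2 / b"]) auto
  next
    case True
    have "0 \<le> inner g (T g)" using b(1)[of g] True by simp
    moreover have "inner g (T g) \<noteq> 0"
      using psd_form_zero[OF T(1,2), of g] b(1) True g(2) by auto
    ultimately have pos: "0 < inner g (T g)" by simp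
    define \<kappa> where "\<kappa> = inner g (T g) / 2"
    have \<kappa>: "0 < \<kappa>" "\<kappa> < inner g (T g)" using pos by (auto simp: \<kappa>_def)
    \<comment> \<open>The slack estimate requires a vector orthogonal to the Ritz space. Correcting
      \<open>g\<close> accordingly changes the form little, because the Ritz projections converge to
      \<open>E\<close>.\<close>
    have "\<forall>\<^sub>F n in sequentially. \<kappa> < inner (g - Q n g) (T (g - Q n g))"
      by (rule order_tendstoD(1)[OF tendsto_norm_form[OF T(3) Q_compl_lim[OF g(1)]] \<kappa>(2)])
    then have "\<forall>\<^sub>F n in sequentially. y n \<le> (K + 2 * c2) * (norm g)\<^sup>2 / \<kappa>"
    proof eventually_elim
      case (elim n)
      have "y n * \<kappa> \<le> y n * inner (g - Q n g) (T (g - Q n g))"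
        using elim y by (intro mult_left_mono) auto
      also have "\<dots> \<le> (K + 2 * c2) * (norm (g - Q n g))\<^sup>2"
        using sl[OF Q_compl, of n g] True by simp
      also have "\<dots> \<le> (K + 2 * c2) * (norm g)\<^sup>2"
        using ortho_proj_compl_norm_le[OF Q_ortho, of g n] K_nonneg c2_nonneg by (intro mult_left_mono power_mono) auto
      finally show ?case using \<kappa> by (simp add: pos_le_divide_eq)
    qed
    then show ?thesis using K_nonneg c2_nonneg \<kappa> by (intro exI[of _ "(K + 2 * c2) * (norm g)\<^sup>2 / \<kappa>"]) auto
  qed
  have "\<exists>B\<ge>0. \<forall>\<^sub>F n in sequentially. (\<exists>g. E g = 0 \<and> Am m g \<noteq> 0) \<longrightarrow> \<bar>xl n m - xu n m\<bar> \<le> B" for m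
  proof (cases "\<exists>g. E g = 0 \<and> Am m g \<noteq> 0")
    case True
    then obtain g where g: "E g = 0" "Am m g \<noteq> 0" by blast
    note lin = compact_operator_linear[OF compact_Am[of m]]
    obtain Ka where Ka: "\<And>x. norm (Am m x) \<le> Ka * norm x"
      using compact_operator_bounded[OF compact_Am[of m]] by blast
    note bl = clinear_bounded_linear[OF lin Ka]
    note bx = box_bounds[of Am m, OF compact_Am selfadj_Am]
    obtain Bl where Bl: "Bl \<ge> 0" "\<forall>\<^sub>F n in sequentially. xl n m \<le> Bl"
    proof -
      have "\<exists>B\<ge>0. \<forall>\<^sub>F n in sequentially. xl n m \<le> B"
        by (rule one[where T = "Am m" and y = "\<lambda>n. xl n m" and b = "- box_lower Am m" and g = g])
          (use lin selfadj_Am bl xl_nonneg bx lower_slack box_slack(1)[where m = m] g in auto)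
      then show ?thesis using that by blast
    qed
    obtain Bu where Bu: "Bu \<ge> 0" "\<forall>\<^sub>F n in sequentially. xu n m \<le> Bu"
    proof -
      define T where "T = (\<lambda>u. (-1) *\<^sub>R Am m u)"
      have T: "clinear T" "self_adjoint T" "bounded_linear T"
        unfolding T_def self_adjoint_def
        using compact_operator_linear[OF compact_operator_scaleR[OF compact_Am[of m], of "-1"]]
          self_adjoint_cinner[OF selfadj_Am] bounded_linear_const_scaleR[OF bl, of "-1"]
        by (auto simp: cinner_scaleR_left cinner_scaleR_right simp del: scaleR_minus1_left scaleR_minus_left)
      have form: "inner u (T u) = - inner u (Am m u)" for u by (simp add: T_def)
      have "\<exists>B\<ge>0. \<forall>\<^sub>F n in sequentially. xu n m \<le> B"
        by (rule one[where T = T and y = "\<lambda>n. xu n m" and b = "box_upper Am m" and g = g])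
          (use T xu_nonneg bx upper_slack box_slack(2)[where m = m] g in \<open>auto simp: form T_def algebra_simps\<close>)
      then show ?thesis using that by blast
    qed
    have "\<forall>\<^sub>F n in sequentially. (\<exists>g. E g = 0 \<and> Am m g \<noteq> 0) \<longrightarrow> \<bar>xl n m - xu n m\<bar> \<le> Bl + Bu"
      using Bl(2) Bu(2)
    proof eventually_elim
      case (elim n)
      then show ?case using xl_nonneg[of n m] xu_nonneg[of n m] Bl(1) Bu(1) by (simp add: abs_le_iff)
    qed
    then show ?thesis using Bl(1) Bu(1) by (intro exI[of _ "Bl + Bu"]) simp
  next
    case False
    then show ?thesis by (intro exI[of _ 0] conjI always_eventually) auto
  qed
  then have "\<forall>m. \<exists>B. 0 \<le> B \<and> (\<forall>\<^sub>F n in sequentially. (\<exists>g. E g = 0 \<and> Am m g \<noteq> 0) \<longrightarrow> \<bar>xl n m - xu n m\<bar> \<le> B)"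
    by (rule allI)
  then obtain B where "\<forall>m. 0 \<le> B m \<and> (\<forall>\<^sub>F n in sequentially. (\<exists>g. E g = 0 \<and> Am m g \<noteq> 0) \<longrightarrow> \<bar>xl n m - xu n m\<bar> \<le> B m)"
    by (rule choice[THEN exE])
  then have B: "\<And>m. 0 \<le> B m"
    "\<And>m. \<forall>\<^sub>F n in sequentially. (\<exists>g. E g = 0 \<and> Am m g \<noteq> 0) \<longrightarrow> \<bar>xl n m - xu n m\<bar> \<le> B m"
    by simp_all
  have "\<forall>\<^sub>F n in sequentially. \<forall>m. (\<exists>g. E g = 0 \<and> Am m g \<noteq> 0) \<longrightarrow> \<bar>xl n m - xu n m\<bar> \<le> B m"
    by (rule eventually_all_finite[OF B(2)])
  then have "\<forall>\<^sub>F n in sequentially. \<forall>m. (\<exists>g. E g = 0 \<and> Am m g \<noteq> 0) \<longrightarrow> \<bar>xl n m - xu n m\<bar> \<le> sum B UNIV"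
  proof eventually_elim
    case (elim n)
    have "B m \<le> sum B UNIV" for m by (rule member_le_sum) (use B(1) in auto)
    then show ?case using elim order.trans by blast
  qed
  then show ?thesis using B(1) by (intro exI[of _ "sum B UNIV"]) (simp add: sum_nonneg)
qed

text \<open>\<open>S n\<close> differs from the bounded operator \<open>A (\<mu> n)\<close> by the
  box part. An \<open>Am m\<close> without a multiplier bound vanishes on the complement of the
  range of \<open>E\<close>; by symmetry it maps into this range and disappears in the complementary
  component.\<close>

lemma S_compl_bounded:
  "\<exists>B\<ge>0. \<forall>\<^sub>F n in sequentially. \<forall>u. norm (S n u - E (S n u)) \<le> B * norm u"
proof -
  obtain B where B: "B \<ge> 0"
    "\<forall>\<^sub>F n in sequentially. \<forall>m. (\<exists>g. E g = 0 \<and> Am m g \<noteq> 0) \<longrightarrow> \<bar>xl n m - xu n m\<bar> \<le> B"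
    using box_multipliers_bounded by blast
  have "\<exists>Ka>0. \<forall>x. norm (Am m x) \<le> Ka * norm x" for m
    using compact_operator_bounded[OF compact_Am[of m]] by metis
  then obtain Ka where Ka: "\<And>m. Ka m > 0" "\<And>m x. norm (Am m x) \<le> Ka m * norm x" by metis
  note Ec = ortho_proj_compl[OF E_ortho]
  have zero: "Am m u - E (Am m u) = 0" if m: "\<not> (\<exists>g. E g = 0 \<and> Am m g \<noteq> 0)" for m u
  proof -
    define h where "h = Am m u - E (Am m u)"
    have "E h = 0" by (simp add: h_def clinear_diff[OF E_linear] ortho_proj_idem[OF E_ortho])
    then have "Am m h = 0" using m by blast
    have "(norm h)\<^sup>2 = inner h (Am m u)" unfolding h_def by (rule ortho_proj_inner_self[OF Ec, symmetric])
    also have "\<dots> = inner (Am m h) u" by (rule self_adjoint_inner[OF selfadj_Am, symmetric])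
    finally show ?thesis using \<open>Am m h = 0\<close> by (simp add: h_def)
  qed
  have "\<forall>\<^sub>F n in sequentially. \<forall>u. norm (S n u - E (S n u)) \<le> (K + (\<Sum>m\<in>UNIV. B * Ka m)) * norm u"
    using B(2)
  proof eventually_elim
    case (elim n)
    show ?case
    proof
      fix u
      have "S n u = A (\<mu> n) u - (\<Sum>m\<in>UNIV. (xl n m - xu n m) *\<^sub>R Am m u)" by (subst A_decompose) simp
      then have "S n u - E (S n u) = (A (\<mu> n) u - E (A (\<mu> n) u))
          - (\<Sum>m\<in>UNIV. (xl n m - xu n m) *\<^sub>R (Am m u - E (Am m u)))"
        by (simp add: clinear_diff[OF E_linear] clinear_sum[OF E_linear] clinear_scaleR[OF E_linear]
            scaleR_diff_right sum_subtractf)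
      then have "norm (S n u - E (S n u)) \<le> norm (A (\<mu> n) u - E (A (\<mu> n) u))
          + norm (\<Sum>m\<in>UNIV. (xl n m - xu n m) *\<^sub>R (Am m u - E (Am m u)))"
        by (simp only: norm_triangle_ineq4)
      also have "norm (A (\<mu> n) u - E (A (\<mu> n) u)) \<le> K * norm u"
        by (rule order.trans[OF ortho_proj_compl_norm_le[OF E_ortho] A_bounded[OF \<mu>]])
      also have "norm (\<Sum>m\<in>UNIV. (xl n m - xu n m) *\<^sub>R (Am m u - E (Am m u))) \<le> (\<Sum>m\<in>UNIV. B * Ka m * norm u)"
      proof (rule sum_norm_le)
        fix m
        show "norm ((xl n m - xu n m) *\<^sub>R (Am m u - E (Am m u))) \<le> B * Ka m * norm u"
        proof (cases "\<exists>g. E g = 0 \<and> Am m g \<noteq> 0")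
          case True
          have "norm (Am m u - E (Am m u)) \<le> Ka m * norm u"
            by (rule order.trans[OF ortho_proj_compl_norm_le[OF E_ortho] Ka(2)])
          then show ?thesis
            using elim True B(1) Ka(1)[of m] by (auto simp: mult.assoc intro!: mult_mono)
        next
          case False
          then show ?thesis using zero[OF False, of u] B(1) Ka(1)[of m] by simp
        qed
      qed
      finally show "norm (S n u - E (S n u)) \<le> (K + (\<Sum>m\<in>UNIV. B * Ka m)) * norm u"
        by (simp add: distrib_right sum_distrib_right)
    qed
  qed
  moreover have "0 \<le> K + (\<Sum>m\<in>UNIV. B * Ka m)"
    using K_nonneg B(1) Ka(1) by (intro add_nonneg_nonneg sum_nonneg) (auto simp: less_imp_le)
  ultimately show ?thesis by blast
qed

end

lemma eigen_form_le:
  assumes v: "orthonormal n v" and T: "clinear T"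
    and ev: "\<And>k. k < n \<Longrightarrow> \<exists>a\<le>\<alpha>. T (v k) = a *\<^sub>R v k" and p: "projection n v p = p"
  shows "inner p (T p) \<le> \<alpha> * (norm p)\<^sup>2"
proof -
  have "\<forall>k. \<exists>a. k < n \<longrightarrow> a \<le> \<alpha> \<and> T (v k) = a *\<^sub>R v k" using ev by blast
  then obtain a where "\<forall>k. k < n \<longrightarrow> a k \<le> \<alpha> \<and> T (v k) = a k *\<^sub>R v k" by (rule choice[THEN exE])
  then have a: "\<And>k. k < n \<Longrightarrow> a k \<le> \<alpha>" "\<And>k. k < n \<Longrightarrow> T (v k) = a k *\<^sub>R v k" by auto
  have Tp: "T p = (\<Sum>k<n. cinner (v k) p *\<^sub>C (a k *\<^sub>R v k))"
    by (subst p[symmetric], subst projection_eq) (simp add: clinear_sum[OF T] clinear_scaleC[OF T] a)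
  have "cinner p (cinner (v k) p *\<^sub>C (a k *\<^sub>R v k)) = of_real (a k * (cmod (cinner (v k) p))\<^sup>2)" for k
    by (simp add: cinner_scaleC_right cinner_scaleR_right cinner_commute[of p "v k"] complex_norm_square
        del: of_real_power)
  then have "inner p (T p) = (\<Sum>k<n. a k * (cmod (cinner (v k) p))\<^sup>2)"
    unfolding Tp inner_cinner cinner_sum_right by (simp del: of_real_mult of_real_power)
  also have "\<dots> \<le> (\<Sum>k<n. \<alpha> * (cmod (cinner (v k) p))\<^sup>2)"
    by (intro sum_mono mult_right_mono) (auto simp: a)
  also have "\<dots> = \<alpha> * (norm p)\<^sup>2"
    using projection_norm[OF v, of p] by (simp add: p sum_distrib_left)
  finally show ?thesis .
qed

lemma inner_le_of_limit:
  fixes x t :: "'a::real_inner"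
  assumes lim: "(\<lambda>i. T i x) \<longlonglongrightarrow> x" and le: "\<And>i. j \<le> i \<Longrightarrow> \<bar>inner (T i x) t\<bar> \<le> c"
  shows "\<bar>inner x t\<bar> \<le> c"
  by (rule LIMSEQ_le_const2[OF tendsto_rabs[OF tendsto_inner[OF lim tendsto_const]]]) (use le in blast)

section \<open>Convergence of the trial projections\<close>

context run
begin

text \<open>For each vector the norms of its trial projections increase to a limit, and by
  Pythagoras this controls the distance between two projections. Finitely many basis vectors make
  the convergence uniform on the span; the sequence \<open>\<epsilon>\<close> depends on that
  span.\<close>

lemma PV_uniform:
  assumes f: "orthonormal N f"
  shows "\<exists>\<epsilon>. \<epsilon> \<longlonglongrightarrow> 0 \<and> (\<forall>j\<ge>1. \<forall>i\<ge>j. \<forall>t. projection N f t = t \<longrightarrow> norm (PV i t - PV j t) \<le> \<epsilon> j * norm t)"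
proof -
  have "\<exists>s. (\<lambda>i. (norm (PV i x))\<^sup>2) \<longlonglongrightarrow> s \<and> (\<forall>i\<ge>1. (norm (PV i x))\<^sup>2 \<le> s)" for x
  proof -
    \<comment> \<open>The index is shifted because the trial spaces are nested from level 1
      on.\<close>
    have inc: "incseq (\<lambda>i. (norm (PV (Suc i) x))\<^sup>2)"
      by (intro incseq_SucI power_mono PV_norm_mono) auto
    have "\<forall>i. (norm (PV (Suc i) x))\<^sup>2 \<le> (norm x)\<^sup>2"
      using ortho_proj_norm_le[OF PV_ortho] by (auto intro!: power_mono)
    from incseq_convergent[OF inc this]
    obtain s where s: "(\<lambda>i. (norm (PV (Suc i) x))\<^sup>2) \<longlonglongrightarrow> s" "\<forall>i. (norm (PV (Suc i) x))\<^sup>2 \<le> s" .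
    have "(norm (PV i x))\<^sup>2 \<le> s" if "1 \<le> i" for i
      using s(2)[rule_format, of "i - 1"] that by simp
    with LIMSEQ_imp_Suc[OF s(1)] show ?thesis by blast
  qed
  then have "\<forall>x. \<exists>s. (\<lambda>i. (norm (PV i x))\<^sup>2) \<longlonglongrightarrow> s \<and> (\<forall>i\<ge>1. (norm (PV i x))\<^sup>2 \<le> s)" by (rule allI)
  then obtain s where "\<forall>x. (\<lambda>i. (norm (PV i x))\<^sup>2) \<longlonglongrightarrow> s x \<and> (\<forall>i\<ge>1. (norm (PV i x))\<^sup>2 \<le> s x)"
    by (rule choice[THEN exE])
  then have s: "\<And>x. (\<lambda>i. (norm (PV i x))\<^sup>2) \<longlonglongrightarrow> s x" "\<And>x i. 1 \<le> i \<Longrightarrow> (norm (PV i x))\<^sup>2 \<le> s x"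
    by simp_all
  define \<epsilon> where "\<epsilon> j = sqrt (\<Sum>q<N. s (f q) - (norm (PV j (f q)))\<^sup>2)" for j
  have "(\<lambda>j. \<Sum>q<N. s (f q) - (norm (PV j (f q)))\<^sup>2) \<longlonglongrightarrow> (\<Sum>q<N. s (f q) - s (f q))"
    by (intro tendsto_sum tendsto_diff tendsto_const s)
  then have "\<epsilon> \<longlonglongrightarrow> sqrt (\<Sum>q<N. s (f q) - s (f q))"
    unfolding \<epsilon>_def by (rule tendsto_real_sqrt)
  then have lim: "\<epsilon> \<longlonglongrightarrow> 0" by simp
  have "norm (PV i t - PV j t) \<le> \<epsilon> j * norm t" if ij: "1 \<le> j" "j \<le> i" and t: "projection N f t = t" for i j t
  proof -
    have lin: "clinear (\<lambda>t. PV i t - PV j t)"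
      by (rule clinearI) (simp_all add: clinear_add[OF PV_linear] clinear_scaleC[OF PV_linear] ell2.scale_right_diff_distrib)
    have "(norm (PV i t - PV j t))\<^sup>2 \<le> (norm t)\<^sup>2 * (\<Sum>q<N. (norm (PV i (f q) - PV j (f q)))\<^sup>2)"
      by (rule norm_on_span_square_le[OF f lin t])
    also have "\<dots> \<le> (norm t)\<^sup>2 * (\<Sum>q<N. s (f q) - (norm (PV j (f q)))\<^sup>2)"
      unfolding PV_diff_norm[OF ij]
      by (rule mult_left_mono[OF sum_mono[OF diff_right_mono]]) (use s(2) ij in auto)
    finally have "sqrt ((norm (PV i t - PV j t))\<^sup>2) \<le> sqrt ((norm t)\<^sup>2 * (\<Sum>q<N. s (f q) - (norm (PV j (f q)))\<^sup>2))"
      by (rule real_sqrt_le_mono)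
    then show ?thesis by (simp add: real_sqrt_mult \<epsilon>_def mult.commute)
  qed
  with lim show ?thesis by blast
qed

lemma span_in_closure:
  assumes \<mu>: "\<mu> \<in> D" and e: "eigenbasis (A \<mu>) r e" and x: "projection r e x = x"
  shows "(\<lambda>i. PV i x) \<longlonglongrightarrow> x"
proof -
  note on = eigenbasis_orthonormal[OF e]
  have "(\<lambda>i. (norm x)\<^sup>2 * (\<Sum>k<r. (norm (e k - PV i (e k)))\<^sup>2)) \<longlonglongrightarrow> (norm x)\<^sup>2 * (\<Sum>k<r. 0\<^sup>2)"
    by (intro tendsto_mult_left tendsto_sum tendsto_power eigenvectors_in_closure[OF \<mu> e]) simp
  then have lim: "(\<lambda>i. (norm x)\<^sup>2 * (\<Sum>k<r. (norm (e k - PV i (e k)))\<^sup>2)) \<longlonglongrightarrow> 0" by simp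
  have "(norm (x - PV i x))\<^sup>2 \<le> (norm x)\<^sup>2 * (\<Sum>k<r. (norm (e k - PV i (e k)))\<^sup>2)" if "1 \<le> i" for i
    by (rule norm_on_span_square_le[OF on ortho_proj_linear[OF ortho_proj_compl[OF PV_ortho[OF that]]] x])
  then have ev: "\<forall>\<^sub>F i in sequentially. norm ((norm (x - PV i x))\<^sup>2) \<le> (norm x)\<^sup>2 * (\<Sum>k<r. (norm (e k - PV i (e k)))\<^sup>2)"
    unfolding eventually_sequentially by (intro exI[of _ 1]) simp
  have "(\<lambda>i. (norm (x - PV i x))\<^sup>2) \<longlonglongrightarrow> 0"
    by (rule Lim_null_comparison[OF ev lim])
  from tendsto_real_sqrt[OF this] have "(\<lambda>i. norm (x - PV i x)) \<longlonglongrightarrow> 0" by simp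
  then have "(\<lambda>i. x - PV i x) \<longlonglongrightarrow> 0" by (simp add: tendsto_norm_zero_iff)
  from tendsto_diff[OF tendsto_const[of x] this] show ?thesis by simp
qed

end

section \<open>The Ritz space approaches the limiting eigenspace at the rate 1 / sqrt X\<close>

context blowup
begin

lemma \<alpha>_neg: "\<alpha> < 0"
  using gap \<beta>_nonpos[OF \<mu>\<^sub>0] by linarith

text \<open>A sample with level near 0 has its lower eigenspace near the Ritz space, hence near the
  range of \<open>E\<close>, and there its form is nearly at most \<alpha>. The error enters through
  squared distances and is therefore linear in the level, so that its weighted sum is controlled by
  \<open>bound_sum\<close>.\<close>

lemma range_form_le:
  assumes \<nu>: "\<nu> \<in> P (j n)" and u: "E u = u"
  shows "inner u (A \<nu> u) \<le> (\<alpha> + (K - \<alpha>) * (2 * real r * (- bd (j n) (\<mu> n) \<nu> / (\<beta> - \<alpha>) + (dist_E n)\<^sup>2))) * (norm u)\<^sup>2"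
proof -
  interpret J: lp_level Am \<theta> D l r K L \<alpha> \<beta> "P (j n)" v "V (j n)" "w (j n)" Lt Kt Kb by (rule lev)
  have \<nu>D: "\<nu> \<in> D" using \<nu> J.P_subset by auto
  note b = J.sample_basis_r[OF \<nu>]
  note on = eigenbasis_orthonormal[OF b]
  define F where "F = projection r (v \<nu>)"
  have F: "ortho_proj F" unfolding F_def by (rule ortho_proj_projection[OF on])
  define p g where "p = F u" and "g = u - F u"
  have u_eq: "u = p + g" by (simp add: p_def g_def)
  have p: "F p = p" by (simp add: p_def ortho_proj_idem[OF F])
  have Ap: "F (A \<nu> p) = A \<nu> p"
    unfolding F_def by (rule eigenspace_invariant[OF b A_linear]) (use p in \<open>simp add: F_def\<close>)
  have gA: "inner g (A \<nu> p) = 0"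
    using ortho_proj_orthogonal[OF F, of "A \<nu> p" u] Ap by (simp add: g_def inner_commute)
  have pA: "inner p (A \<nu> g) = 0"
    using gA self_adjoint_inner[OF A_selfadj[of \<nu>], of p g] by (simp add: inner_commute)
  have pp: "inner p (A \<nu> p) \<le> \<alpha> * (norm p)\<^sup>2"
  proof (rule eigen_form_le[OF on A_linear])
    show "projection r (v \<nu>) p = p" using p by (simp add: F_def)
    show "\<exists>a\<le>\<alpha>. A \<nu> (v \<nu> k) = a *\<^sub>R v \<nu> k" if "k < r" for k
      using eigenbasis_eigen[OF \<nu>D b that] by blast
  qed
  have gg: "inner g (A \<nu> g) \<le> K * (norm g)\<^sup>2" using A_form_le[OF \<nu>D, of g] by simp
  have pyth: "(norm u)\<^sup>2 = (norm p)\<^sup>2 + (norm g)\<^sup>2"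
    unfolding p_def g_def by (rule ortho_proj_pythagoras[OF F])
  have "inner u (A \<nu> u) = inner p (A \<nu> p) + inner g (A \<nu> g)"
    by (simp add: u_eq clinear_add[OF A_linear] inner_add_left inner_add_right gA pA)
  then have 1: "inner u (A \<nu> u) \<le> \<alpha> * (norm u)\<^sup>2 + (K - \<alpha>) * (norm g)\<^sup>2"
    using pp gg by (simp add: pyth algebra_simps)
  have 2: "(norm (v \<nu> k - E (v \<nu> k)))\<^sup>2 \<le> 2 * (- bd (j n) (\<mu> n) \<nu> / (\<beta> - \<alpha>) + (dist_E n)\<^sup>2)" if k: "k < r" for k
  proof -
    have "norm (v \<nu> k - E (v \<nu> k)) \<le> norm (v \<nu> k - Q n (v \<nu> k)) + norm (Q n (v \<nu> k) - E (v \<nu> k))"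
      using norm_triangle_ineq[of "v \<nu> k - Q n (v \<nu> k)" "Q n (v \<nu> k) - E (v \<nu> k)"] by simp
    also have "norm (Q n (v \<nu> k) - E (v \<nu> k)) \<le> dist_E n"
      using Q_near_E[of n "v \<nu> k"] orthonormal_norm[OF on k] by simp
    finally have "(norm (v \<nu> k - E (v \<nu> k)))\<^sup>2 \<le> (norm (v \<nu> k - Q n (v \<nu> k)) + dist_E n)\<^sup>2"
      by (simp add: power_mono)
    also have "\<dots> \<le> 2 * (norm (v \<nu> k - Q n (v \<nu> k)))\<^sup>2 + 2 * (dist_E n)\<^sup>2"
      using sum_squares_bound[of "norm (v \<nu> k - Q n (v \<nu> k))" "dist_E n"] by (simp add: power2_sum)
    finally have 3: "(norm (v \<nu> k - E (v \<nu> k)))\<^sup>2 \<le> 2 * (norm (v \<nu> k - Q n (v \<nu> k)))\<^sup>2 + 2 * (dist_E n)\<^sup>2" .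
    have "bd (j n) (\<mu> n) \<nu> \<le> - (\<beta> - \<alpha>) * (norm (v \<nu> k - Q n (v \<nu> k)))\<^sup>2"
      unfolding Q_def PR_level[OF j] by (rule J.bnd_le_distance[OF \<mu> \<nu> k])
    then have "(norm (v \<nu> k - Q n (v \<nu> k)))\<^sup>2 * (\<beta> - \<alpha>) \<le> - bd (j n) (\<mu> n) \<nu>"
      by (simp add: algebra_simps)
    then have "(norm (v \<nu> k - Q n (v \<nu> k)))\<^sup>2 \<le> - bd (j n) (\<mu> n) \<nu> / (\<beta> - \<alpha>)"
      by (subst pos_le_divide_eq) (use gap in simp_all)
    with 3 show ?thesis by (simp add: distrib_left)
  qed
  have "(norm g)\<^sup>2 \<le> (norm u)\<^sup>2 * (\<Sum>k<r. (norm (e k - F (e k)))\<^sup>2)"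
    unfolding g_def
    by (rule norm_on_span_square_le[OF e_on ortho_proj_linear[OF ortho_proj_compl[OF F]]])
      (use u in \<open>simp add: E_def\<close>)
  also have "(\<Sum>k<r. (norm (e k - F (e k)))\<^sup>2) = (\<Sum>k<r. (norm (v \<nu> k - E (v \<nu> k)))\<^sup>2)"
    unfolding F_def E_def by (rule gap_symmetric[OF e_on on])
  also have "\<dots> \<le> (\<Sum>k<r. 2 * (- bd (j n) (\<mu> n) \<nu> / (\<beta> - \<alpha>) + (dist_E n)\<^sup>2))"
    by (rule sum_mono) (use 2 in simp)
  also have "\<dots> = 2 * real r * (- bd (j n) (\<mu> n) \<nu> / (\<beta> - \<alpha>) + (dist_E n)\<^sup>2)" by simp
  finally have "(norm g)\<^sup>2 \<le> (norm u)\<^sup>2 * (2 * real r * (- bd (j n) (\<mu> n) \<nu> / (\<beta> - \<alpha>) + (dist_E n)\<^sup>2))"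
    by (simp add: mult_left_mono)
  then have "(K - \<alpha>) * (norm g)\<^sup>2 \<le> (K - \<alpha>) * ((norm u)\<^sup>2 * (2 * real r * (- bd (j n) (\<mu> n) \<nu> / (\<beta> - \<alpha>) + (dist_E n)\<^sup>2)))"
    using K_nonneg \<alpha>_neg by (intro mult_left_mono) auto
  moreover have "(\<alpha> + (K - \<alpha>) * c) * N = \<alpha> * N + (K - \<alpha>) * (N * c)" for c N
    by (simp add: algebra_simps)
  ultimately show ?thesis using 1 by simp
qed

lemma S_range_upper: "\<forall>\<^sub>F n in sequentially. \<forall>u. E u = u \<longrightarrow> inner u (S n u) \<le> \<alpha> / 2 * X n * (norm u)\<^sup>2"
proof -
  define c where "c = (K - \<alpha>) * (2 * real r)"
  define c' where "c' = c * c2 / (\<beta> - \<alpha>)"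
  have c: "0 \<le> c" using K_nonneg \<alpha>_neg by (simp add: c_def)
  have "(\<lambda>n. c * (dist_E n)\<^sup>2) \<longlonglongrightarrow> c * 0\<^sup>2"
    by (intro tendsto_mult_left tendsto_power dist_E_lim)
  then have "\<forall>\<^sub>F n in sequentially. c * (dist_E n)\<^sup>2 < - \<alpha> / 4"
    by (rule order_tendstoD(2)) (use \<alpha>_neg in simp)
  moreover have "\<forall>\<^sub>F n in sequentially. 4 * c' / (- \<alpha>) \<le> X n"
    using X_lim unfolding filterlim_at_top by blast
  ultimately show ?thesis
  proof eventually_elim
    case (elim n)
    \<comment> \<open>Half of the negative term \<open>\<alpha> * X n\<close> is given up, a quarter
      for each of the two errors.\<close>
    have X1: "c' \<le> - \<alpha> / 4 * X n" using elim(2) \<alpha>_neg by (simp add: field_simps)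
    have X2: "c * (dist_E n)\<^sup>2 * X n \<le> - \<alpha> / 4 * X n"
      using elim(1) X_nonneg by (intro mult_right_mono) auto
    show ?case
    proof (intro allI impI)
      fix u assume u: "E u = u"
      have "inner u (S n u) \<le> (\<Sum>\<nu>\<in>P (j n). x n \<nu> *
          ((\<alpha> + (K - \<alpha>) * (2 * real r * (- bd (j n) (\<mu> n) \<nu> / (\<beta> - \<alpha>) + (dist_E n)\<^sup>2))) * (norm u)\<^sup>2))"
        unfolding S_form by (intro sum_mono mult_left_mono x_nonneg range_form_le u)
      also have "\<dots> = (\<Sum>\<nu>\<in>P (j n). (\<alpha> + c * (dist_E n)\<^sup>2) * (norm u)\<^sup>2 * x n \<nu> -
          c / (\<beta> - \<alpha>) * (norm u)\<^sup>2 * (x n \<nu> * bd (j n) (\<mu> n) \<nu>))"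
        by (rule sum.cong) (simp_all add: c_def algebra_simps)
      also have "\<dots> = (\<alpha> + c * (dist_E n)\<^sup>2) * (norm u)\<^sup>2 * X n
          - c / (\<beta> - \<alpha>) * (norm u)\<^sup>2 * (\<Sum>\<nu>\<in>P (j n). x n \<nu> * bd (j n) (\<mu> n) \<nu>)"
        by (simp add: sum_subtractf sum_distrib_left X_def)
      also have "\<dots> \<le> (\<alpha> + c * (dist_E n)\<^sup>2) * (norm u)\<^sup>2 * X n - c / (\<beta> - \<alpha>) * (norm u)\<^sup>2 * (- c2)"
        by (intro diff_left_mono mult_left_mono bound_sum) (use c gap in simp)
      also have "\<dots> = (\<alpha> * X n + c * (dist_E n)\<^sup>2 * X n + c') * (norm u)\<^sup>2"
        by (simp add: c'_def algebra_simps)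
      also have "\<dots> \<le> (\<alpha> / 2 * X n) * (norm u)\<^sup>2"
        by (intro mult_right_mono) (use X1 X2 in simp_all)
      finally show "inner u (S n u) \<le> \<alpha> / 2 * X n * (norm u)\<^sup>2" .
    qed
  qed
qed

lemma S_selfadj: "inner u (S n f) = inner (S n u) f"
  by (simp add: S_def inner_sum_right inner_sum_left self_adjoint_inner[OF A_selfadj])

lemma S_add: "S n (u + f) = S n u + S n f"
  by (simp add: S_def clinear_add[OF A_linear] scaleR_add_right sum.distrib)

text \<open>With \<open>f\<close> orthogonal to the Ritz space and \<open>f = E f + g\<close>, every
  term of the form of \<open>S n\<close> that contains \<open>g\<close> is bounded by
  \<open>S_compl_bounded\<close>. The lower bound on the form at \<open>f\<close> and its upper
  bound on the range of \<open>E\<close> then limit \<open>norm (E f)\<close>.\<close>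

lemma Q_close:
  "\<exists>C\<ge>0. \<forall>\<^sub>F n in sequentially. 0 < X n \<and> (\<forall>u. norm (Q n u - E u) \<le> C / sqrt (X n) * norm u)"
proof -
  obtain B where B: "B \<ge> 0" "\<forall>\<^sub>F n in sequentially. \<forall>u. norm (S n u - E (S n u)) \<le> B * norm u"
    using S_compl_bounded by blast
  define C where "C = 2 * (c2 + 3 * B) / (- \<alpha>)"
  have C: "0 \<le> C" unfolding C_def by (rule divide_nonneg_pos) (use c2_nonneg B(1) \<alpha>_neg in simp_all)
  have "\<forall>\<^sub>F n in sequentially. 1 \<le> X n"
    using X_lim unfolding filterlim_at_top by blast
  with B(2) S_range_upper have "\<forall>\<^sub>F n in sequentially. 0 < X n \<and>
    (\<forall>u. norm (Q n u - E u) \<le> (2 * (real r)\<^sup>2 * sqrt C) / sqrt (X n) * norm u)"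
  proof eventually_elim
    case (elim n)
    define \<delta> where "\<delta> = sqrt (C / X n)"
    have X: "0 < X n" using elim(3) by simp
    have Ef: "norm (E f) \<le> \<delta> * norm f" if f: "Q n f = 0" for f
    proof -
      define u g where "u = E f" and "g = f - E f"
      have Eu: "E u = u" by (simp add: u_def ortho_proj_idem[OF E_ortho])
      have f_eq: "f = u + g" by (simp add: u_def g_def)
      have nu: "norm u \<le> norm f" unfolding u_def by (rule ortho_proj_norm_le[OF E_ortho])
      have ng: "norm g \<le> norm f" unfolding g_def by (rule ortho_proj_compl_norm_le[OF E_ortho])
      have gs: "inner g h = inner g (h - E h)" for h
        using ortho_proj_orthogonal[OF E_ortho, of h f] by (simp add: g_def inner_diff_right inner_commute)
      have gS: "\<bar>inner g (S n h)\<bar> \<le> B * (norm f)\<^sup>2" if "norm h \<le> norm f" for h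
      proof -
        have "\<bar>inner g (S n h)\<bar> \<le> norm g * norm (S n h - E (S n h))"
          by (subst gs) (rule Cauchy_Schwarz_ineq2)
        also have "\<dots> \<le> norm f * (B * norm h)"
          by (intro mult_mono ng) (use elim(1) in auto)
        also have "\<dots> \<le> norm f * (B * norm f)" by (intro mult_left_mono that B(1)) simp
        finally show ?thesis by (simp add: power2_eq_square mult_ac)
      qed
      have "inner f (S n f) = inner u (S n u) + 2 * inner g (S n u) + inner g (S n g)"
        using S_selfadj[of u n g] by (simp add: f_eq S_add inner_add_left inner_add_right inner_commute)
      moreover have "inner u (S n u) \<le> \<alpha> / 2 * X n * (norm u)\<^sup>2" using elim(2) Eu by blast
      ultimately have "- c2 * (norm f)\<^sup>2 \<le> \<alpha> / 2 * X n * (norm u)\<^sup>2 + 3 * B * (norm f)\<^sup>2"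
        using S_lower[OF f] gS[OF nu] gS[OF ng] by linarith
      then have "(norm u)\<^sup>2 * (- \<alpha> * X n) \<le> 2 * (c2 + 3 * B) * (norm f)\<^sup>2" by (simp add: algebra_simps)
      then have "(norm u)\<^sup>2 \<le> 2 * (c2 + 3 * B) * (norm f)\<^sup>2 / (- \<alpha> * X n)"
        by (subst pos_le_divide_eq) (use \<alpha>_neg X in \<open>simp_all add: mult_neg_pos\<close>)
      then have "(norm u)\<^sup>2 \<le> C / X n * (norm f)\<^sup>2" by (simp add: C_def)
      then have "sqrt ((norm u)\<^sup>2) \<le> sqrt (C / X n * (norm f)\<^sup>2)" by (rule real_sqrt_le_mono)
      then show ?thesis by (simp add: real_sqrt_mult real_sqrt_divide \<delta>_def u_def)
    qed
    have "norm (e k - Q n (e k)) \<le> \<delta>" if k: "k < r" for k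
    proof -
      \<comment> \<open>The squared norm of this \<open>f\<close> equals
        \<open>inner (E f) (e k)\<close>, so the estimate of \<open>E f\<close> bounds the distance
        of \<open>e k\<close> from the Ritz space.\<close>
      define f where "f = e k - Q n (e k)"
      have f: "Q n f = 0" unfolding f_def by (rule Q_compl)
      have Ee: "E (e k) = e k" unfolding E_def by (rule projection_basis[OF e_on k])
      have "(norm f)\<^sup>2 = inner f (e k)"
        unfolding f_def by (rule ortho_proj_inner_self[OF ortho_proj_compl[OF Q_ortho], symmetric])
      also have "\<dots> = inner (E f) (e k)" by (simp add: ortho_proj_inner[OF E_ortho] Ee)
      also have "\<dots> \<le> norm (E f) * norm (e k)" by (rule norm_cauchy_schwarz)
      also have "\<dots> \<le> \<delta> * norm f" using Ef[OF f] orthonormal_norm[OF e_on k] by simp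
      finally have "norm f * norm f \<le> \<delta> * norm f" by (simp add: power2_eq_square)
      then show ?thesis
        using C X by (cases "norm f = 0") (auto simp: f_def \<delta>_def)
    qed
    then have "norm (Q n u - E u) \<le> 2 * (real r)\<^sup>2 * \<delta> * norm u" for u
      unfolding Q_def PR_def E_def
      by (intro projections_close[OF Q_on e_on _ r_pos]) (simp add: Q_def PR_def)
    then show ?case using X by (simp add: \<delta>_def real_sqrt_divide)
  qed
  then show ?thesis using C by (intro exI[of _ "2 * (real r)\<^sup>2 * sqrt C"]) simp
qed

end

section \<open>The defect of the limiting eigenspace and the residual\<close>

context blowup
begin

definition "defect n u = A (\<mu> n) u - E (A (\<mu> n) u)"

lemma defect_linear: "clinear (defect n)"
  unfolding defect_def
  by (rule clinearI) (simp_all add: clinear_add[OF A_linear] clinear_scaleC[OF A_linear] clinear_add[OF E_linear]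
      clinear_scaleC[OF E_linear] ell2.scale_right_diff_distrib)

lemma A_le: "norm (A (\<mu> n) u) \<le> K * norm u"
  by (rule A_bounded[OF \<mu>])

lemma defect_le: "norm (defect n u) \<le> K * norm u"
  unfolding defect_def by (rule order.trans[OF ortho_proj_compl_norm_le[OF E_ortho] A_le])

text \<open>By the Ritz condition, \<open>A (\<mu> n) (Q n u)\<close> minus its image under
  \<open>Q n\<close> is orthogonal to the trial space. So \<open>W n\<close> sees only the errors of
  exchanging \<open>E\<close> and \<open>Q n\<close>.\<close>

lemma defect_on_range:
  assumes close: "\<And>u. norm (Q n u - E u) \<le> d * norm u" and d: "0 \<le> d" and u: "E u = u"
  shows "norm (W n (defect n u)) \<le> 2 * K * d * norm u"
proof -
  interpret J: lp_level Am \<theta> D l r K L \<alpha> \<beta> "P (j n)" v "V (j n)" "w (j n)" Lt Kt Kb by (rule lev)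
  have W: "W n = J.PV" by (rule ext) (simp add: W_def PV_def)
  have Q: "Q n = J.PR (\<mu> n)" by (simp add: Q_def PR_level[OF j])
  define a where "a = A (\<mu> n) (Q n u)"
  have W_lin: "clinear (W n)" by (rule ortho_proj_linear[OF W_ortho])
  have "W n a = Q n (W n a)" unfolding a_def W Q by (rule J.PR_invariant[OF \<mu>, symmetric])
  also have "\<dots> = Q n a" unfolding W Q by (rule J.PR_PV[OF \<mu>])
  finally have "W n (a - Q n a) = 0"
    using J.PV_PR[OF \<mu>, of n a] W_lin by (simp add: clinear_diff W Q)
  moreover have "defect n u = (a - Q n a) + ((Q n (A (\<mu> n) u) - E (A (\<mu> n) u))
      + (A (\<mu> n) (u - Q n u) - Q n (A (\<mu> n) (u - Q n u))))"
    by (simp add: defect_def a_def clinear_diff[OF A_linear] clinear_diff[OF Q_linear])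
  ultimately have "W n (defect n u) = W n ((Q n (A (\<mu> n) u) - E (A (\<mu> n) u))
      + (A (\<mu> n) (u - Q n u) - Q n (A (\<mu> n) (u - Q n u))))"
    by (simp only: clinear_add[OF W_lin]) simp
  then have "norm (W n (defect n u)) \<le> norm (Q n (A (\<mu> n) u) - E (A (\<mu> n) u))
      + norm (A (\<mu> n) (u - Q n u) - Q n (A (\<mu> n) (u - Q n u)))"
    using order.trans[OF ortho_proj_norm_le[OF W_ortho] norm_triangle_ineq] by metis
  moreover have "norm (Q n (A (\<mu> n) u) - E (A (\<mu> n) u)) \<le> d * (K * norm u)"
    by (rule order.trans[OF close mult_left_mono[OF A_le d]])
  moreover have "norm (A (\<mu> n) (u - Q n u) - Q n (A (\<mu> n) (u - Q n u))) \<le> K * (d * norm u)"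
  proof -
    have "norm (u - Q n u) \<le> d * norm u" using close[of u] u by (simp add: norm_minus_commute)
    then show ?thesis
      by (meson A_le K_nonneg mult_left_mono order.trans ortho_proj_compl_norm_le[OF Q_ortho])
  qed
  ultimately show ?thesis by (simp add: algebra_simps)
qed

text \<open>On the Ritz space, \<open>Q n\<close> and \<open>E\<close> are exchanged at the cost of
  \<open>K * d\<close>, once for the vector and once for the projection.\<close>

lemma residual_le_defect:
  assumes close: "\<And>u. norm (Q n u - E u) \<le> d * norm u" and d: "0 \<le> d"
    and \<tau>: "\<And>u. E u = u \<Longrightarrow> norm (defect n u) \<le> \<tau> * norm u" "0 \<le> \<tau>"
  shows "R n \<le> \<tau> + 2 * K * d"
proof -
  interpret J: lp_level Am \<theta> D l r K L \<alpha> \<beta> "P (j n)" v "V (j n)" "w (j n)" Lt Kt Kb by (rule lev)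
  have Q: "Q n = J.PR (\<mu> n)" by (simp add: Q_def PR_level[OF j])
  show ?thesis
    unfolding R_def
  proof (rule J.rho_le[OF \<mu>])
    show "0 \<le> \<tau> + 2 * K * d" using \<tau>(2) K_nonneg d by simp
    fix u assume "J.PR (\<mu> n) u = u"
    then have u: "Q n u = u" by (simp add: Q)
    have EE: "E (E u) = E u" by (rule ortho_proj_idem[OF E_ortho])
    have "A (\<mu> n) u - Q n (A (\<mu> n) u) = defect n (E u) + defect n (u - E u) - (Q n (A (\<mu> n) u) - E (A (\<mu> n) u))"
      by (simp add: clinear_diff[OF defect_linear]) (simp add: defect_def)
    then have "norm (A (\<mu> n) u - Q n (A (\<mu> n) u)) \<le> norm (defect n (E u) + defect n (u - E u)) + norm (Q n (A (\<mu> n) u) - E (A (\<mu> n) u))"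
      by (simp only: norm_triangle_ineq4)
    moreover have "norm (defect n (E u) + defect n (u - E u)) \<le> norm (defect n (E u)) + norm (defect n (u - E u))"
      by (rule norm_triangle_ineq)
    moreover have "norm (defect n (E u)) \<le> \<tau> * norm u"
      by (rule order.trans[OF \<tau>(1)[OF EE] mult_left_mono[OF ortho_proj_norm_le[OF E_ortho] \<tau>(2)]])
    moreover have "norm (defect n (u - E u)) \<le> K * (d * norm u)"
      using close[of u] u by (intro order.trans[OF defect_le mult_left_mono[OF _ K_nonneg]]) simp
    moreover have "norm (Q n (A (\<mu> n) u) - E (A (\<mu> n) u)) \<le> d * (K * norm u)"
      by (rule order.trans[OF close mult_left_mono[OF A_le d]])
    ultimately show "norm (A (\<mu> n) u - J.PR (\<mu> n) (A (\<mu> n) u)) \<le> (\<tau> + 2 * K * d) * norm u"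
      unfolding Q[symmetric] by (simp add: algebra_simps)
  qed
qed

text \<open>The operator at \<open>\<mu> n\<close> is a perturbation by at most half of the
  gap.\<close>

lemma form_above_mid:
  assumes near: "L * norm (\<mu> n - \<mu>\<^sub>0) \<le> (\<beta> - \<alpha>) / 2" and g: "E g = 0"
  shows "(\<alpha> + \<beta>) / 2 * (norm g)\<^sup>2 \<le> inner g (A (\<mu> n) g)"
proof -
  have "g \<in> ortho_compl r e"
    using g projection_eq_0_iff[OF e_on, of g] by (simp add: E_def ortho_compl_def)
  from form_above_gap[OF \<mu>\<^sub>0 e this] have 1: "\<beta> * (norm g)\<^sup>2 \<le> inner g (A \<mu>\<^sub>0 g)" .
  have "\<bar>inner g (A (\<mu> n) g - A \<mu>\<^sub>0 g)\<bar> \<le> norm g * norm (A (\<mu> n) g - A \<mu>\<^sub>0 g)"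
    by (rule Cauchy_Schwarz_ineq2)
  also have "\<dots> \<le> norm g * (L * norm (\<mu> n - \<mu>\<^sub>0) * norm g)"
    by (rule mult_left_mono[OF A_lipschitz[OF \<mu> \<mu>\<^sub>0]]) simp
  also have "\<dots> = L * norm (\<mu> n - \<mu>\<^sub>0) * (norm g)\<^sup>2" by (simp add: power2_eq_square)
  also have "\<dots> \<le> (\<beta> - \<alpha>) / 2 * (norm g)\<^sup>2" by (rule mult_right_mono[OF near]) simp
  finally have 2: "\<bar>inner g (A (\<mu> n) g) - inner g (A \<mu>\<^sub>0 g)\<bar> \<le> (\<beta> - \<alpha>) / 2 * (norm g)\<^sup>2"
    by (simp add: inner_diff_right)
  have "(\<alpha> + \<beta>) / 2 * (norm g)\<^sup>2 = \<beta> * (norm g)\<^sup>2 - (\<beta> - \<alpha>) / 2 * (norm g)\<^sup>2" by (simp add: field_simps)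
  with 1 2 show ?thesis by linarith
qed

text \<open>Eigenvectors of \<open>A (\<mu> n)\<close> lie in the closure of the union of the trial spaces, so a defect affects
  them only through its projections to the later trial spaces.\<close>

lemma eigenvector_near_E:
  assumes near: "L * norm (\<mu> n - \<mu>\<^sub>0) \<le> (\<beta> - \<alpha>) / 2"
    and \<omega>: "\<And>i u. j n \<le> i \<Longrightarrow> E u = u \<Longrightarrow> norm (PV i (defect n u)) \<le> \<omega> * norm u" "0 \<le> \<omega>"
    and g: "eigenbasis (A (\<mu> n)) r g" and k: "k < r"
  shows "norm (g k - E (g k)) \<le> 2 * \<omega> / (\<beta> - \<alpha>)"
proof -
  have on: "orthonormal r g" by (rule eigenbasis_orthonormal[OF g])
  obtain a where a: "a \<le> \<alpha>" "A (\<mu> n) (g k) = a *\<^sub>R g k" using eigenbasis_eigen[OF \<mu> g k] by blast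
  define h where "h = g k - E (g k)"
  define u where "u = E (g k)"
  have Eu: "E u = u" by (simp add: u_def ortho_proj_idem[OF E_ortho])
  have Eh: "E h = 0" by (simp add: h_def clinear_diff[OF E_linear] ortho_proj_idem[OF E_ortho])
  have nu: "norm u \<le> 1"
    using ortho_proj_norm_le[OF E_ortho, of "g k"] orthonormal_norm[OF on k] by (simp add: u_def)
  \<comment> \<open>Both \<open>g k\<close> and \<open>u\<close> are limits of their trial
    projections, hence so is \<open>h\<close>. This permits testing with \<open>PV i h\<close> and
    moving the projection onto the defect.\<close>
  have "(\<lambda>i. PV i (g k) - PV i u) \<longlonglongrightarrow> g k - u"
    using span_in_closure[OF \<mu> g projection_basis[OF on k]]
      span_in_closure[OF \<mu>\<^sub>0 e, of u] Eu by (intro tendsto_diff) (simp_all add: E_def)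
  then have lim: "(\<lambda>i. PV i h) \<longlonglongrightarrow> h" by (simp add: h_def u_def clinear_diff[OF PV_linear])
  have "\<bar>inner h (defect n u)\<bar> \<le> norm h * \<omega>"
  proof (rule inner_le_of_limit[where T = PV and x = h, OF lim])
    fix i assume i: "j n \<le> i"
    have i1: "1 \<le> i" using i j[of n] by simp
    have "inner (PV i h) (defect n u) = inner h (PV i (defect n u))"
      by (rule ortho_proj_inner[OF PV_ortho[OF i1]])
    then have "\<bar>inner (PV i h) (defect n u)\<bar> \<le> norm h * norm (PV i (defect n u))"
      by (simp add: Cauchy_Schwarz_ineq2)
    also have "\<dots> \<le> norm h * (\<omega> * norm u)" by (intro mult_left_mono \<omega>(1)[OF i Eu]) simp
    also have "\<dots> \<le> norm h * (\<omega> * 1)" by (intro mult_left_mono nu \<omega>(2)) simp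
    finally show "\<bar>inner (PV i h) (defect n u)\<bar> \<le> norm h * \<omega>" by simp
  qed
  moreover have "inner h (A (\<mu> n) u) = inner h (defect n u)"
    using ortho_proj_orthogonal[OF E_ortho, of "A (\<mu> n) u" "g k"]
    by (simp add: defect_def inner_diff_right h_def inner_commute)
  moreover have "inner h (A (\<mu> n) (g k)) = a * (norm h)\<^sup>2"
    using ortho_proj_inner_self[OF ortho_proj_compl[OF E_ortho], of "g k"] by (simp add: a h_def)
  ultimately have le: "inner h (A (\<mu> n) (g k)) - inner h (A (\<mu> n) (g k - h)) \<le> a * (norm h)\<^sup>2 + \<omega> * norm h"
    by (simp add: h_def u_def mult.commute)
  have "norm h \<le> \<omega> / ((\<alpha> + \<beta>) / 2 - \<alpha>)"
    unfolding h_def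
    by (rule gap_estimate[where Q = "\<lambda>x. x - E x" and T = "A (\<mu> n)" and m = a])
      (use form_above_mid[OF near Eh] le A_linear a gap \<omega>(2) in \<open>simp_all add: h_def\<close>)
  also have "\<dots> = 2 * \<omega> / (\<beta> - \<alpha>)" using gap by (simp add: field_simps)
  finally show ?thesis by (simp add: h_def)
qed

text \<open>The exact eigenspace at \<open>\<mu> n\<close> is invariant, so on it the defect reduces
  to its distance from the range of \<open>E\<close>; equal dimensions make \<open>u\<close> close
  to this eigenspace in turn. Together with \<open>eigenvector_near_E\<close> this closes a loop of
  estimates.\<close>

lemma defect_le_distance:
  assumes g: "eigenbasis (A (\<mu> n)) r g"
    and \<kappa>: "\<And>k. k < r \<Longrightarrow> norm (g k - E (g k)) \<le> \<kappa>" and u: "E u = u"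
  shows "norm (defect n u) \<le> 2 * (real r)\<^sup>2 * \<kappa> * K * norm u"
proof -
  have on: "orthonormal r g" by (rule eigenbasis_orthonormal[OF g])
  have \<kappa>0: "0 \<le> \<kappa>" using \<kappa>[OF r_pos] norm_ge_zero order.trans by blast
  define G where "G = projection r g"
  note G = ortho_proj_projection[OF on, folded G_def]
  have "norm (u - G u) \<le> (real r)\<^sup>2 * \<kappa> * norm u"
    unfolding G_def by (rule gap_symmetric_le[OF on e_on]) (use \<kappa> u in \<open>simp_all add: E_def\<close>)
  then have 1: "norm (defect n (u - G u)) \<le> K * ((real r)\<^sup>2 * \<kappa> * norm u)"
    by (rule order.trans[OF defect_le mult_left_mono[OF _ K_nonneg]])
  have "G (A (\<mu> n) (G u)) = A (\<mu> n) (G u)"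
    unfolding G_def by (rule eigenspace_invariant[OF g A_linear]) (rule ortho_proj_idem[OF G, unfolded G_def])
  then have "norm (defect n (G u)) \<le> real r * \<kappa> * norm (A (\<mu> n) (G u))"
    unfolding defect_def G_def
    by (intro norm_on_span_le[OF on ortho_proj_linear[OF ortho_proj_compl[OF E_ortho]]] \<kappa>)
  also have "\<dots> \<le> (real r)\<^sup>2 * \<kappa> * (K * norm u)"
  proof (intro mult_mono)
    show "real r \<le> (real r)\<^sup>2" using r_pos by (simp add: power2_eq_square)
    show "norm (A (\<mu> n) (G u)) \<le> K * norm u"
      by (rule order.trans[OF A_le mult_left_mono[OF ortho_proj_norm_le[OF G] K_nonneg]])
  qed (use \<kappa>0 in auto)
  finally have 2: "norm (defect n (G u)) \<le> (real r)\<^sup>2 * \<kappa> * (K * norm u)" .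
  have "defect n u = defect n (G u) + defect n (u - G u)" by (simp add: clinear_diff[OF defect_linear])
  then have "norm (defect n u) \<le> norm (defect n (G u)) + norm (defect n (u - G u))"
    by (simp only: norm_triangle_ineq)
  with 1 2 show ?thesis by (simp add: algebra_simps)
qed

text \<open>The parameter enters the operator only through the coefficients \<open>\<theta>\<close>,
  so all defects on the range of \<open>E\<close> are combinations of the finitely many vectors
  \<open>Am m (e k) - E (Am m (e k))\<close>.\<close>

lemma defect_span:
  "\<exists>N f. orthonormal N f \<and> (\<forall>n u. E u = u \<longrightarrow> projection N f (defect n u) = defect n u)"
proof -
  define Z where "Z = (\<lambda>(m, k). Am m (e k) - E (Am m (e k))) ` (UNIV \<times> {..<r})"
  have "finite Z" by (simp add: Z_def)
  from orthonormal_basis_exists[OF this] obtain N f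
    where f: "orthonormal N f" "\<And>x. x \<in> Z \<Longrightarrow> projection N f x = x" by blast
  have fixes_Z: "projection N f (Am m (e k) - E (Am m (e k))) = Am m (e k) - E (Am m (e k))" if "k < r" for m k
    by (rule f(2)) (use that in \<open>auto simp: Z_def\<close>)
  note F = projection_linear[of N f]
  have 1: "projection N f (defect n (e k)) = defect n (e k)" if k: "k < r" for n k
  proof -
    have "defect n (e k) = (\<Sum>m\<in>UNIV. \<theta> (\<mu> n) $ m *\<^sub>R (Am m (e k) - E (Am m (e k))))"
      by (simp add: defect_def affine_family_def clinear_sum[OF E_linear] clinear_scaleR[OF E_linear]
          scaleR_diff_right sum_subtractf)
    then show ?thesis
      by (simp only: clinear_sum[OF F] clinear_scaleR[OF F] fixes_Z[OF k])
  qed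
  have "projection N f (defect n u) = defect n u" if u: "E u = u" for n u
  proof -
    have "defect n u = (\<Sum>k<r. cinner (e k) u *\<^sub>C defect n (e k))"
      by (subst u[symmetric], unfold E_def, subst projection_eq)
        (simp add: clinear_sum[OF defect_linear] clinear_scaleC[OF defect_linear])
    then show ?thesis by (simp add: clinear_sum[OF F] clinear_scaleC[OF F] 1)
  qed
  with f(1) show ?thesis by blast
qed

theorem no_blowup: False
proof -
  obtain C where C: "0 \<le> C"
    "\<forall>\<^sub>F n in sequentially. 0 < X n \<and> (\<forall>u. norm (Q n u - E u) \<le> C / sqrt (X n) * norm u)"
    using Q_close by blast
  obtain N f where f: "orthonormal N f" "\<And>n u. E u = u \<Longrightarrow> projection N f (defect n u) = defect n u"
    using defect_span by blast
  obtain \<epsilon> where \<epsilon>: "\<epsilon> \<longlonglongrightarrow> 0"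
    "\<And>j i t. 1 \<le> j \<Longrightarrow> j \<le> i \<Longrightarrow> projection N f t = t \<Longrightarrow> norm (PV i t - PV j t) \<le> \<epsilon> j * norm t"
    using PV_uniform[OF f(1)] by blast
  \<comment> \<open>\<open>b\<close> is the product of the factors
    \<open>2 / (\<beta> - \<alpha>)\<close> of \<open>eigenvector_near_E\<close> and
    \<open>2 * r^2 * K\<close> of \<open>defect_le_distance\<close>; the factor \<open>r^2\<close>
    in \<open>c\<close> comes from summing over the basis in the definition of
    \<open>\<tau>\<close>.\<close>
  define b where "b = 4 * (real r)\<^sup>2 * K / (\<beta> - \<alpha>)"
  define c where "c = (real r)\<^sup>2 * b"
  have b: "0 \<le> b" using K_nonneg gap by (simp add: b_def)
  have c: "0 \<le> c" using b by (simp add: c_def)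
  have "(\<lambda>n. c * \<bar>\<epsilon> (j n)\<bar>) \<longlonglongrightarrow> c * \<bar>0\<bar>"
    by (intro tendsto_mult_left tendsto_rabs filterlim_compose[OF \<epsilon>(1) j_lim])
  then have ev1: "\<forall>\<^sub>F n in sequentially. c * \<bar>\<epsilon> (j n)\<bar> < 1 / 2"
    by (rule order_tendstoD(2)) simp
  have "(\<lambda>n. L * norm (\<mu> n - \<mu>\<^sub>0)) \<longlonglongrightarrow> L * 0"
    using \<mu>_lim by (intro tendsto_mult_left) (simp add: LIM_zero tendsto_norm_zero)
  then have ev2: "\<forall>\<^sub>F n in sequentially. L * norm (\<mu> n - \<mu>\<^sub>0) < (\<beta> - \<alpha>) / 2"
    by (rule order_tendstoD(2)) (use gap in simp)
  define C' where "C' = (4 * c * K + 2 * K) * C"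
  have ev3: "\<forall>\<^sub>F n in sequentially. (R n)\<^sup>2 * X n \<le> C'\<^sup>2"
    using C(2) ev1 ev2
  proof eventually_elim
    case (elim n)
    define d where "d = C / sqrt (X n)"
    define \<eta> where "\<eta> = \<bar>\<epsilon> (j n)\<bar>"
    have X: "0 < X n" and close: "\<And>u. norm (Q n u - E u) \<le> d * norm u"
      using elim(1) by (auto simp: d_def)
    have d: "0 \<le> d" using C(1) X by (simp add: d_def)
    have near: "L * norm (\<mu> n - \<mu>\<^sub>0) \<le> (\<beta> - \<alpha>) / 2" using elim(3) by simp
    obtain g where g: "eigenbasis (A (\<mu> n)) r g" using eigenbasis_exists[OF \<mu>] by blast
    \<comment> \<open>Any bound \<open>\<tau>\<close> on the defect yields a new one, in which
      \<open>\<tau>\<close> carries the small factor \<open>\<eta>\<close> by which the later trial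
      projections differ on defects.\<close>
    have improve: "norm (defect n u) \<le> b * (2 * K * d + \<eta> * \<tau>) * norm u"
      if \<tau>: "0 \<le> \<tau>" "\<And>u. E u = u \<Longrightarrow> norm (defect n u) \<le> \<tau> * norm u" and u: "E u = u" for \<tau> u
    proof -
      define \<omega> where "\<omega> = 2 * K * d + \<eta> * \<tau>"
      have \<omega>0: "0 \<le> \<omega>" using K_nonneg d \<tau>(1) by (simp add: \<omega>_def \<eta>_def)
      have "norm (PV i (defect n u)) \<le> \<omega> * norm u" if i: "j n \<le> i" and u: "E u = u" for i u
      proof -
        have "norm (PV i (defect n u)) \<le> norm (W n (defect n u)) + norm (PV i (defect n u) - PV (j n) (defect n u))"
          unfolding W_def by (rule norm_triangle_sub)
        moreover have "norm (W n (defect n u)) \<le> 2 * K * d * norm u" by (rule defect_on_range[OF close d u])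
        moreover have "norm (PV i (defect n u) - PV (j n) (defect n u)) \<le> \<eta> * (\<tau> * norm u)"
        proof -
          have "norm (PV i (defect n u) - PV (j n) (defect n u)) \<le> \<epsilon> (j n) * norm (defect n u)"
            by (rule \<epsilon>(2)[OF j i f(2)[OF u]])
          also have "\<dots> \<le> \<eta> * norm (defect n u)" by (rule mult_right_mono) (simp_all add: \<eta>_def)
          also have "\<dots> \<le> \<eta> * (\<tau> * norm u)" by (rule mult_left_mono[OF \<tau>(2)[OF u]]) (simp add: \<eta>_def)
          finally show ?thesis .
        qed
        ultimately show ?thesis by (simp add: \<omega>_def algebra_simps)
      qed
      then have "norm (g k - E (g k)) \<le> 2 * \<omega> / (\<beta> - \<alpha>)" if "k < r" for k
        by (rule eigenvector_near_E[OF near _ \<omega>0 g that])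
      then have "norm (defect n u) \<le> 2 * (real r)\<^sup>2 * (2 * \<omega> / (\<beta> - \<alpha>)) * K * norm u"
        by (rule defect_le_distance[OF g _ u])
      also have "2 * (real r)\<^sup>2 * (2 * \<omega> / (\<beta> - \<alpha>)) * K = b * \<omega>" by (simp add: b_def)
      finally show ?thesis by (simp add: \<omega>_def)
    qed
    \<comment> \<open>This bound is built from the defects of the basis vectors themselves, so
      improving it gives an inequality for \<open>\<tau>\<close> alone.\<close>
    define \<tau> where "\<tau> = real r * (\<Sum>k<r. norm (defect n (e k)))"
    have \<tau>0: "0 \<le> \<tau>" by (simp add: \<tau>_def sum_nonneg)
    have \<tau>: "norm (defect n u) \<le> \<tau> * norm u" if "E u = u" for u
      unfolding \<tau>_def
    proof (rule norm_on_span_le[OF e_on defect_linear])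
      show "norm (defect n (e k)) \<le> (\<Sum>k<r. norm (defect n (e k)))" if "k < r" for k
        by (rule member_le_sum) (use that in auto)
      show "projection r e u = u" using that by (simp add: E_def)
    qed
    have "norm (defect n (e k)) \<le> b * (2 * K * d + \<eta> * \<tau>)" if k: "k < r" for k
    proof -
      have "E (e k) = e k" unfolding E_def by (rule projection_basis[OF e_on k])
      from improve[OF \<tau>0 \<tau> this] show ?thesis by (simp add: orthonormal_norm[OF e_on k])
    qed
    then have "(\<Sum>k<r. norm (defect n (e k))) \<le> (\<Sum>k<r. b * (2 * K * d + \<eta> * \<tau>))"
      by (intro sum_mono) simp
    then have "\<tau> \<le> real r * (\<Sum>k<r. b * (2 * K * d + \<eta> * \<tau>))"
      unfolding \<tau>_def by (rule mult_left_mono) simp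
    also have "\<dots> = c * (2 * K * d) + c * \<eta> * \<tau>" by (simp add: c_def power2_eq_square algebra_simps)
    \<comment> \<open>Absorption: half of \<open>\<tau>\<close> is moved to the left-hand side,
      which leaves a bound of order \<open>d\<close>, that is, of order
      \<open>1 / sqrt (X n)\<close>.\<close>
    also have "c * \<eta> * \<tau> \<le> 1 / 2 * \<tau>"
      by (rule mult_right_mono[OF _ \<tau>0]) (use elim(2) in \<open>simp add: \<eta>_def\<close>)
    finally have "\<tau> \<le> 4 * c * K * d" by (simp add: algebra_simps)
    then have "R n \<le> 4 * c * K * d + 2 * K * d"
      using residual_le_defect[OF close d \<tau> \<tau>0] by linarith
    also have "\<dots> = C' / sqrt (X n)" by (simp add: C'_def d_def algebra_simps add_divide_distrib)
    finally have "(R n)\<^sup>2 \<le> (C' / sqrt (X n))\<^sup>2" by (rule power_mono[OF _ R_nonneg])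
    then have "(R n)\<^sup>2 * X n \<le> (C' / sqrt (X n))\<^sup>2 * X n" by (rule mult_right_mono) (use X in simp)
    then show ?case using X by (simp add: power_divide)
  qed
  have "\<forall>\<^sub>F n in sequentially. C'\<^sup>2 + 1 \<le> (R n)\<^sup>2 * X n"
    using blow unfolding filterlim_at_top R_def X_def by blast
  with ev3 have "\<forall>\<^sub>F n in sequentially. False"
  proof eventually_elim
    case (elim n)
    then show ?case by linarith
  qed
  then show False by simp
qed

end

section \<open>From the excluded blow-up to the uniform Lipschitz bound\<close>

context run
begin

lemma multipliers_bounded:
  "\<exists>C. \<forall>j\<ge>1. \<forall>\<mu>\<in>D. \<exists>x xl xu. lp_level.dual Am \<theta> l r (P j) v (V j) (w j) \<mu> x xl xu \<and>
    (rh j \<mu>)\<^sup>2 * sum x (P j) \<le> C"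
proof (rule ccontr)
  define dl where "dl j = lp_level.dual Am \<theta> l r (P j) v (V j) (w j)" for j
  assume "\<nexists>C. \<forall>j\<ge>1. \<forall>\<mu>\<in>D. \<exists>x xl xu. lp_level.dual Am \<theta> l r (P j) v (V j) (w j) \<mu> x xl xu \<and>
    (rh j \<mu>)\<^sup>2 * sum x (P j) \<le> C"
  then have neg: "\<exists>j\<ge>1. \<exists>\<mu>\<in>D. \<forall>x xl xu. dl j \<mu> x xl xu \<longrightarrow> \<not> (rh j \<mu>)\<^sup>2 * sum x (P j) \<le> C" for C
    unfolding dl_def by blast
  have "\<forall>j. \<exists>C. 1 \<le> j \<longrightarrow> (\<forall>\<mu>\<in>D. \<exists>x xl xu. dl j \<mu> x xl xu \<and> sum x (P j) \<le> C)"
  proof (intro allI)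
    fix j
    show "\<exists>C. 1 \<le> j \<longrightarrow> (\<forall>\<mu>\<in>D. \<exists>x xl xu. dl j \<mu> x xl xu \<and> sum x (P j) \<le> C)"
    proof (cases "1 \<le> j")
      case True
      obtain C where "\<And>\<mu>. \<mu> \<in> D \<Longrightarrow> \<exists>x xl xu. dl j \<mu> x xl xu \<and> sum x (P j) \<le> C"
        unfolding dl_def by (rule lp_level.dual_exists[OF level[OF True]]) blast
      then show ?thesis by blast
    qed simp
  qed
  then obtain C where "\<forall>j. 1 \<le> j \<longrightarrow> (\<forall>\<mu>\<in>D. \<exists>x xl xu. dl j \<mu> x xl xu \<and> sum x (P j) \<le> C j)"
    by (rule choice[THEN exE])
  then have C: "\<And>j \<mu>. 1 \<le> j \<Longrightarrow> \<mu> \<in> D \<Longrightarrow> \<exists>x xl xu. dl j \<mu> x xl xu \<and> sum x (P j) \<le> C j"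
    by blast
  \<comment> \<open>At the chosen point no multipliers at all satisfy the uniform bound, so in
    particular those with sum at most \<open>C j\<close> violate it.\<close>
  define good where "good n j \<mu> x xl xu \<longleftrightarrow> 1 \<le> j \<and> \<mu> \<in> D \<and> dl j \<mu> x xl xu \<and> sum x (P j) \<le> C j \<and>
      real n < (rh j \<mu>)\<^sup>2 * sum x (P j)" for n :: nat and j \<mu> x xl xu
  have "\<forall>n. \<exists>p. case p of (j, \<mu>, x, xl, xu) \<Rightarrow> good n j \<mu> x xl xu"
  proof
    fix n :: nat
    obtain j \<mu> where j: "1 \<le> j" "\<mu> \<in> D"
      and big: "\<And>x xl xu. dl j \<mu> x xl xu \<Longrightarrow> \<not> (rh j \<mu>)\<^sup>2 * sum x (P j) \<le> real n"
      using neg[of "real n"] by blast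
    from C[OF j] obtain x xl xu where x: "dl j \<mu> x xl xu" "sum x (P j) \<le> C j" by blast
    from j x big[OF x(1)] have "good n j \<mu> x xl xu" by (simp add: good_def)
    then show "\<exists>p. case p of (j, \<mu>, x, xl, xu) \<Rightarrow> good n j \<mu> x xl xu" by blast
  qed
  then obtain p where p: "\<forall>n. case p n of (j, \<mu>, x, xl, xu) \<Rightarrow> good n j \<mu> x xl xu"
    by (rule choice[THEN exE])
  define j \<mu> x xl xu where "j n = fst (p n)" and "\<mu> n = fst (snd (p n))" and "x n = fst (snd (snd (p n)))"
    and "xl n = fst (snd (snd (snd (p n))))" and "xu n = snd (snd (snd (snd (p n))))" for n
  have "good n (j n) (\<mu> n) (x n) (xl n) (xu n)" for n
    using p[rule_format, of n] by (simp add: j_def \<mu>_def x_def xl_def xu_def split: prod.splits)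
  then have j1: "1 \<le> j n" and \<mu>: "\<mu> n \<in> D" and dual: "dl (j n) (\<mu> n) (x n) (xl n) (xu n)"
    and xC: "sum (x n) (P (j n)) \<le> C (j n)" and big: "real n < (rh (j n) (\<mu> n))\<^sup>2 * sum (x n) (P (j n))" for n
    by (simp_all add: good_def)
  have j_lim: "filterlim j at_top sequentially"
    unfolding filterlim_at_top
  proof
    fix J :: nat
    \<comment> \<open>Levels below \<open>J\<close> keep the product at most this large, so they
      occur for finitely many \<open>n\<close> only.\<close>
    define B where "B = K\<^sup>2 * (\<Sum>i\<le>J. \<bar>C i\<bar>)"
    have "J \<le> j n" if n: "B \<le> real n" for n
    proof (rule ccontr)
      assume "\<not> J \<le> j n"
      then have jJ: "j n \<le> J" by simp
      have "(rh (j n) (\<mu> n))\<^sup>2 * sum (x n) (P (j n)) \<le> (rh (j n) (\<mu> n))\<^sup>2 * (\<Sum>i\<le>J. \<bar>C i\<bar>)"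
      proof (rule mult_left_mono)
        have "C (j n) \<le> \<bar>C (j n)\<bar>" by simp
        also have "\<dots> \<le> (\<Sum>i\<le>J. \<bar>C i\<bar>)" by (rule member_le_sum) (use jJ in auto)
        finally show "sum (x n) (P (j n)) \<le> (\<Sum>i\<le>J. \<bar>C i\<bar>)" using xC[of n] by simp
      qed simp
      also have "\<dots> \<le> B"
        unfolding B_def
        by (intro mult_right_mono power_mono level.rho_le_K[OF level_base[OF j1] \<mu>]
            level.rho_nonneg[OF level_base[OF j1] \<mu>] sum_nonneg) simp
      finally show False using big[of n] n by simp
    qed
    then show "\<forall>\<^sub>F n in sequentially. J \<le> j n"
      using eventually_mono[OF eventually_ge_at_top[of "nat \<lceil>B\<rceil>"]] by (metis nat_ceiling_le_eq)
  qed
  have blow: "filterlim (\<lambda>n. (rh (j n) (\<mu> n))\<^sup>2 * sum (x n) (P (j n))) at_top sequentially"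
    by (rule filterlim_at_top_mono[OF filterlim_real_sequentially]) (use big less_imp_le in \<open>auto intro!: always_eventually\<close>)
  have "\<forall>n. \<mu> n \<in> D" using \<mu> by simp
  then obtain \<mu>0 s where s: "\<mu>0 \<in> D" "strict_mono s" "(\<mu> \<circ> s) \<longlonglongrightarrow> \<mu>0"
    using compact_D unfolding compact_def by metis
  note sub = filterlim_subseq[OF s(2)]
  obtain e where e: "eigenbasis (A \<mu>0) r e" using eigenbasis_exists[OF s(1)] by blast
  have "blowup Am \<theta> D l r K L \<alpha> \<beta> P v V w Lt Kt Kb (\<lambda>n. j (s n)) (\<lambda>n. \<mu> (s n)) \<mu>0
      (\<lambda>n. x (s n)) (\<lambda>n. xl (s n)) (\<lambda>n. xu (s n)) e"
  proof (rule blowup.intro[OF run_axioms], rule blowup_axioms.intro)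
    show "filterlim (\<lambda>n. j (s n)) at_top sequentially" by (rule filterlim_compose[OF j_lim sub])
    show "filterlim (\<lambda>n. (rh (j (s n)) (\<mu> (s n)))\<^sup>2 * sum (x (s n)) (P (j (s n)))) at_top sequentially"
      by (rule filterlim_compose[OF blow sub])
    show "(\<lambda>n. \<mu> (s n)) \<longlonglongrightarrow> \<mu>0" using s(3) by (simp add: comp_def)
  qed (use j1 \<mu> s(1) e dual in \<open>simp_all add: dl_def\<close>)
  then show False by (rule blowup.no_blowup)
qed

theorem gap_lipschitz: "\<exists>\<gamma>>0. \<forall>j\<ge>1. \<forall>\<mu>\<in>D. \<forall>\<mu>'\<in>D. \<bar>Hj j \<mu>' - Hj j \<mu>\<bar> \<le> \<gamma> * norm (\<mu>' - \<mu>)"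
proof -
  obtain C where C: "\<And>j \<mu>. 1 \<le> j \<Longrightarrow> \<mu> \<in> D \<Longrightarrow> \<exists>x xl xu. lp_level.dual Am \<theta> l r (P j) v (V j) (w j) \<mu> x xl xu \<and>
    (rh j \<mu>)\<^sup>2 * sum x (P j) \<le> C" using multipliers_bounded by blast
  define \<gamma> where "\<gamma> = 4 / (\<beta> - \<alpha>)\<^sup>2 * (K\<^sup>2 * (Lt * Kb + L) + C * (CP * K)) + Crho"
  have *: "\<bar>Hj j \<mu> - Hj j \<mu>'\<bar> \<le> \<gamma> * norm (\<mu> - \<mu>')"
    if j: "1 \<le> j" and \<mu>: "\<mu> \<in> D" "\<mu>' \<in> D"
      and le: "eta Am \<theta> l r (P j) v (V j) (w j) \<mu>' \<le> eta Am \<theta> l r (P j) v (V j) (w j) \<mu>" for j \<mu> \<mu>'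
  proof -
    from C[OF j \<mu>(1)] obtain x xl xu where x: "lp_level.dual Am \<theta> l r (P j) v (V j) (w j) \<mu> x xl xu"
      "(rh j \<mu>)\<^sup>2 * sum x (P j) \<le> C" by blast
    show ?thesis unfolding \<gamma>_def by (rule lp_level.H_diff_le[OF level[OF j] \<mu> x(1) le x(2)])
  qed
  \<comment> \<open>By symmetry the multipliers are taken at the point with the larger optimal
    value. The absolute value and the summand 1 make the constant positive whatever the sign of
    \<open>C\<close>.\<close>
  have "\<bar>Hj j \<mu>' - Hj j \<mu>\<bar> \<le> (\<bar>\<gamma>\<bar> + 1) * norm (\<mu>' - \<mu>)" if j: "1 \<le> j" and \<mu>: "\<mu> \<in> D" "\<mu>' \<in> D" for j \<mu> \<mu>'
  proof -
    have "\<bar>Hj j \<mu>' - Hj j \<mu>\<bar> \<le> \<gamma> * norm (\<mu>' - \<mu>)"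
    proof (rule linorder_le_cases)
      assume "eta Am \<theta> l r (P j) v (V j) (w j) \<mu> \<le> eta Am \<theta> l r (P j) v (V j) (w j) \<mu>'"
      from *[OF j \<mu>(2,1) this] show ?thesis .
    next
      assume "eta Am \<theta> l r (P j) v (V j) (w j) \<mu>' \<le> eta Am \<theta> l r (P j) v (V j) (w j) \<mu>"
      from *[OF j \<mu> this] show ?thesis by (simp add: abs_minus_commute norm_minus_commute)
    qed
    also have "\<dots> \<le> (\<bar>\<gamma>\<bar> + 1) * norm (\<mu>' - \<mu>)" by (intro mult_right_mono) auto
    finally show ?thesis .
  qed
  then show ?thesis by (intro exI[of _ "\<bar>\<gamma>\<bar> + 1"]) simp
qed

end

section \<open>Analytic functions on compact sets\<close>

text \<open>Staying within half the radius absorbs the exponent: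
  \<open>k * (s / 2) ^ (k - 1)\<close> is at most \<open>s ^ (k - 1)\<close>. The quotient
  \<open>s ^ k / s\<close> covers \<open>k = 0\<close> as well.\<close>

lemma power_diff_le:
  fixes u v s :: real
  assumes s: "0 < s" and u: "\<bar>u\<bar> \<le> s / 2" and v: "\<bar>v\<bar> \<le> s / 2"
  shows "\<bar>u ^ k - v ^ k\<bar> \<le> s ^ k / s * \<bar>u - v\<bar>"
proof (induction k)
  case (Suc k)
  show ?case
  proof (cases "k = 0")
    case True
    then show ?thesis using s by simp
  next
    case False
    have "(1/2 :: real) ^ k \<le> (1/2) ^ 1" by (rule power_decreasing) (use False in auto)
    then have half: "(s / 2) ^ k \<le> s ^ k / 2" using s by (simp add: power_divide field_simps)
    have "\<bar>v ^ k\<bar> \<le> (s / 2) ^ k" using v by (simp add: power_abs power_mono)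
    with half have vk: "\<bar>v ^ k\<bar> \<le> s ^ k / 2" by linarith
    have "u ^ Suc k - v ^ Suc k = u * (u ^ k - v ^ k) + (u - v) * v ^ k" by (simp add: algebra_simps)
    then have "\<bar>u ^ Suc k - v ^ Suc k\<bar> \<le> \<bar>u\<bar> * \<bar>u ^ k - v ^ k\<bar> + \<bar>u - v\<bar> * \<bar>v ^ k\<bar>"
      by (metis abs_mult abs_triangle_ineq)
    also have "\<dots> \<le> s / 2 * (s ^ k / s * \<bar>u - v\<bar>) + \<bar>u - v\<bar> * (s ^ k / 2)"
      by (intro add_mono mult_mono Suc.IH u vk) (use s in auto)
    also have "\<dots> = s ^ Suc k / s * \<bar>u - v\<bar>" using s by (simp add: field_simps)
    finally show ?thesis .
  qed
qed (use s in simp)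

lemma prod_power_diff_le:
  fixes u v :: "'i \<Rightarrow> real"
  assumes s: "0 < s" and I: "finite I" and u: "\<And>i. \<bar>u i\<bar> \<le> s / 2" and v: "\<And>i. \<bar>v i\<bar> \<le> s / 2"
  shows "\<bar>(\<Prod>i\<in>I. u i ^ \<alpha> i) - (\<Prod>i\<in>I. v i ^ \<alpha> i)\<bar> \<le> (\<Prod>i\<in>I. s ^ \<alpha> i) / s * (\<Sum>i\<in>I. \<bar>u i - v i\<bar>)"
  using I
proof (induction I)
  case (insert a I)
  have le: "\<bar>x ^ k\<bar> \<le> s ^ k" if "\<bar>x\<bar> \<le> s / 2" for x k
    using that s by (simp add: power_abs power_mono)
  have pu: "\<bar>\<Prod>i\<in>I. u i ^ \<alpha> i\<bar> \<le> (\<Prod>i\<in>I. s ^ \<alpha> i)"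
    unfolding abs_prod by (intro prod_mono) (use le u in auto)
  have "\<bar>(\<Prod>i\<in>insert a I. u i ^ \<alpha> i) - (\<Prod>i\<in>insert a I. v i ^ \<alpha> i)\<bar>
      = \<bar>(u a ^ \<alpha> a - v a ^ \<alpha> a) * (\<Prod>i\<in>I. u i ^ \<alpha> i) + v a ^ \<alpha> a * ((\<Prod>i\<in>I. u i ^ \<alpha> i) - (\<Prod>i\<in>I. v i ^ \<alpha> i))\<bar>"
    using insert.hyps by (simp add: algebra_simps)
  also have "\<dots> \<le> \<bar>u a ^ \<alpha> a - v a ^ \<alpha> a\<bar> * \<bar>\<Prod>i\<in>I. u i ^ \<alpha> i\<bar>
      + \<bar>v a ^ \<alpha> a\<bar> * \<bar>(\<Prod>i\<in>I. u i ^ \<alpha> i) - (\<Prod>i\<in>I. v i ^ \<alpha> i)\<bar>"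
    unfolding abs_mult[symmetric] by (rule abs_triangle_ineq)
  also have "\<dots> \<le> (s ^ \<alpha> a / s * \<bar>u a - v a\<bar>) * (\<Prod>i\<in>I. s ^ \<alpha> i)
      + s ^ \<alpha> a * ((\<Prod>i\<in>I. s ^ \<alpha> i) / s * (\<Sum>i\<in>I. \<bar>u i - v i\<bar>))"
    by (intro add_mono mult_mono power_diff_le[OF s u v] pu le v insert.IH) (use s in auto)
  also have "\<dots> = (\<Prod>i\<in>insert a I. s ^ \<alpha> i) / s * (\<Sum>i\<in>insert a I. \<bar>u i - v i\<bar>)"
    using insert.hyps by (simp add: algebra_simps)
  finally show ?case .
qed simp

text \<open>Absolute convergence at the corner \<open>a + (s, ..., s)\<close> gives a summable
  majorant for the Lipschitz constants of the single terms on a smaller ball.\<close>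

lemma real_analytic_lipschitz_ball:
  fixes f :: "real^'p \<Rightarrow> real"
  assumes "real_analytic f"
  shows "\<exists>u>0. \<exists>L. L-lipschitz_on (cball a u) f"
proof -
  obtain e and c :: "('p \<Rightarrow> nat) \<Rightarrow> real" where e: "0 < e"
    "\<And>x. x \<in> ball a e \<Longrightarrow> ((\<lambda>\<alpha>. c \<alpha> * (\<Prod>i\<in>UNIV. (x $ i - a $ i) ^ \<alpha> i)) has_sum f x) UNIV"
    using assms unfolding real_analytic_def by blast
  define N where "N = real CARD('p)"
  have N: "0 < N" by (simp add: N_def)
  \<comment> \<open>The corner point then has distance at most \<open>N * s = e / 2\<close> from
    \<open>a\<close>.\<close>
  define s where "s = e / (2 * N)"
  have s: "0 < s" using e(1) N by (simp add: s_def)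
  have "norm (\<chi> i. s :: real^'p) \<le> (\<Sum>i\<in>(UNIV :: 'p set). \<bar>s\<bar>)"
    using norm_le_l1_cart[of "\<chi> i. s :: real^'p"] by simp
  also have "\<dots> < e" using e(1) N by (simp add: s_def N_def)
  finally have "a + (\<chi> i. s) \<in> ball a e" by (simp add: dist_norm)
  from e(2)[OF this] have "(\<lambda>\<alpha>. c \<alpha> * (\<Prod>i\<in>UNIV. s ^ \<alpha> i)) summable_on UNIV"
    by (auto simp: summable_on_def)
  \<comment> \<open>Unordered summability of real families is absolute.\<close>
  from iffD1[OF summable_on_iff_abs_summable_on_real this]
  have "(\<lambda>\<alpha>. \<bar>c \<alpha> * (\<Prod>i\<in>UNIV. s ^ \<alpha> i)\<bar>) summable_on UNIV"
    by (simp only: real_norm_def)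
  then obtain M where M: "((\<lambda>\<alpha>. \<bar>c \<alpha> * (\<Prod>i\<in>UNIV. s ^ \<alpha> i)\<bar>) has_sum M) UNIV"
    by (auto simp: summable_on_def)
  have M0: "0 \<le> M" by (rule has_sum_nonneg[OF M]) simp
  define u where "u = min (s / 2) (e / 2)"
  have u: "0 < u" "u \<le> s / 2" "u < e" using s e(1) by (auto simp: u_def)
  have le: "f x - f y \<le> M / s * N * dist x y" if x: "x \<in> cball a u" and y: "y \<in> cball a u" for x y
  proof -
    have comp: "\<bar>z $ i - a $ i\<bar> \<le> s / 2" if "z \<in> cball a u" for z i
      using component_le_norm_cart[of "z - a" i] that u by (simp add: dist_norm norm_minus_commute)
    have "x \<in> ball a e" "y \<in> ball a e" using x y u by auto
    from has_sum_add[OF e(2)[OF this(1)] has_sum_uminusI[OF e(2)[OF this(2)]]]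
    have 1: "((\<lambda>\<alpha>. c \<alpha> * (\<Prod>i\<in>UNIV. (x $ i - a $ i) ^ \<alpha> i) + - (c \<alpha> * (\<Prod>i\<in>UNIV. (y $ i - a $ i) ^ \<alpha> i)))
        has_sum (f x + - f y)) UNIV" .
    have "f x + - f y \<le> M * ((\<Sum>i\<in>UNIV. \<bar>x $ i - y $ i\<bar>) / s)"
    proof (rule has_sum_mono[OF 1 has_sum_cmult_left[OF M]])
      fix \<alpha> :: "'p \<Rightarrow> nat"
      have "c \<alpha> * (\<Prod>i\<in>UNIV. (x $ i - a $ i) ^ \<alpha> i) + - (c \<alpha> * (\<Prod>i\<in>UNIV. (y $ i - a $ i) ^ \<alpha> i))
          = c \<alpha> * ((\<Prod>i\<in>UNIV. (x $ i - a $ i) ^ \<alpha> i) - (\<Prod>i\<in>UNIV. (y $ i - a $ i) ^ \<alpha> i))"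
        by (simp add: right_diff_distrib)
      also have "\<dots> \<le> \<bar>c \<alpha>\<bar> * \<bar>(\<Prod>i\<in>UNIV. (x $ i - a $ i) ^ \<alpha> i) - (\<Prod>i\<in>UNIV. (y $ i - a $ i) ^ \<alpha> i)\<bar>"
        unfolding abs_mult[symmetric] by (rule abs_ge_self)
      also have "\<dots> \<le> \<bar>c \<alpha>\<bar> * ((\<Prod>i\<in>UNIV. s ^ \<alpha> i) / s * (\<Sum>i\<in>UNIV. \<bar>(x $ i - a $ i) - (y $ i - a $ i)\<bar>))"
        by (intro mult_left_mono prod_power_diff_le[OF s] comp x y) simp_all
      also have "\<dots> = \<bar>c \<alpha> * (\<Prod>i\<in>UNIV. s ^ \<alpha> i)\<bar> * ((\<Sum>i\<in>UNIV. \<bar>x $ i - y $ i\<bar>) / s)"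
        using s by (simp add: abs_mult abs_prod power_abs)
      finally show "c \<alpha> * (\<Prod>i\<in>UNIV. (x $ i - a $ i) ^ \<alpha> i) + - (c \<alpha> * (\<Prod>i\<in>UNIV. (y $ i - a $ i) ^ \<alpha> i))
          \<le> \<bar>c \<alpha> * (\<Prod>i\<in>UNIV. s ^ \<alpha> i)\<bar> * ((\<Sum>i\<in>UNIV. \<bar>x $ i - y $ i\<bar>) / s)" .
    qed
    also have "\<dots> \<le> M * ((\<Sum>i\<in>(UNIV :: 'p set). dist x y) / s)"
    proof (intro mult_left_mono divide_right_mono sum_mono M0)
      show "\<bar>x $ i - y $ i\<bar> \<le> dist x y" for i
        using component_le_norm_cart[of "x - y" i] by (simp add: dist_norm)
    qed (use s in simp)
    also have "\<dots> = M / s * N * dist x y" by (simp add: N_def)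
    finally show ?thesis by simp
  qed
  have "(M / s * N)-lipschitz_on (cball a u) f"
  proof (rule lipschitz_onI)
    fix x y assume xy: "x \<in> cball a u" "y \<in> cball a u"
    then show "dist (f x) (f y) \<le> M / s * N * dist x y"
      using le[OF xy] le[OF xy(2,1)] by (simp add: dist_real_def dist_commute abs_le_iff)
  qed (use M0 s N in simp)
  then show ?thesis using u(1) by blast
qed

lemma real_analytic_lipschitz:
  fixes f :: "real^'p \<Rightarrow> real"
  assumes f: "real_analytic f" and D: "compact D"
  shows "\<exists>L. L-lipschitz_on D f"
proof -
  \<comment> \<open>A dummy time with the single value 0; compactness then turns local Lipschitz
    constants into a global one.\<close>
  have "local_lipschitz {0::real} D (\<lambda>_. f)"
  proof (rule local_lipschitzI)
    fix t x
    obtain u L where u: "0 < u" "L-lipschitz_on (cball x u) f"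
      using real_analytic_lipschitz_ball[OF f] by blast
    then show "\<exists>u>0. \<exists>L. \<forall>t\<in>cball t u \<inter> {0::real}. L-lipschitz_on (cball x u \<inter> D) f"
      by (meson inf_le1 lipschitz_on_subset)
  qed
  from local_lipschitz_compact_implies_lipschitz[OF this D compact_sing continuous_on_const]
  obtain L where "\<And>t::real. t \<in> {0} \<Longrightarrow> L-lipschitz_on D f" by blast
  then show ?thesis by blast
qed

lemma real_analytic_vec_lipschitz:
  fixes \<theta> :: "real^'p \<Rightarrow> real^'k"
  assumes \<theta>: "\<And>m. real_analytic (\<lambda>\<mu>. \<theta> \<mu> $ m)" and D: "compact D"
  shows "\<exists>L\<ge>0. \<forall>\<mu>\<in>D. \<forall>\<mu>'\<in>D. norm (\<theta> \<mu> - \<theta> \<mu>') \<le> L * norm (\<mu> - \<mu>')"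
proof -
  have "\<forall>m. \<exists>L. L-lipschitz_on D (\<lambda>\<mu>. \<theta> \<mu> $ m)"
    using real_analytic_lipschitz[OF \<theta> D] by blast
  then obtain L where L: "\<forall>m. (L m)-lipschitz_on D (\<lambda>\<mu>. \<theta> \<mu> $ m)" by (rule choice[THEN exE])
  have "norm (\<theta> \<mu> - \<theta> \<mu>') \<le> (\<Sum>m\<in>UNIV. L m) * norm (\<mu> - \<mu>')" if "\<mu> \<in> D" "\<mu>' \<in> D" for \<mu> \<mu>'
  proof -
    have "norm (\<theta> \<mu> - \<theta> \<mu>') \<le> (\<Sum>m\<in>UNIV. \<bar>(\<theta> \<mu> - \<theta> \<mu>') $ m\<bar>)" by (rule norm_le_l1_cart)
    also have "\<dots> \<le> (\<Sum>m\<in>UNIV. L m * norm (\<mu> - \<mu>'))"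
    proof (rule sum_mono)
      fix m
      show "\<bar>(\<theta> \<mu> - \<theta> \<mu>') $ m\<bar> \<le> L m * norm (\<mu> - \<mu>')"
        using lipschitz_onD[OF L[rule_format, of m] that] by (simp add: dist_norm)
    qed
    finally show ?thesis by (simp add: sum_distrib_right)
  qed
  moreover have "0 \<le> (\<Sum>m\<in>UNIV. L m)"
    using L by (intro sum_nonneg) (auto dest: lipschitz_on_nonneg)
  ultimately show ?thesis by blast
qed

section \<open>The Lipschitz bound for the greedy procedure\<close>

lemma kth_eigenvalue_ge:
  assumes T: "is_kth_eigenvalue T k t" and K: "\<And>x. norm (T x) \<le> K * norm x"
  shows "- K \<le> t"
proof -
  have "1 \<le> k" "eigenvalues_le T k t" using T by (auto simp: is_kth_eigenvalue_def)
  then obtain v where on: "orthonormal k v" and ev: "\<And>i. i < k \<Longrightarrow> \<exists>s\<le>t. T (v i) = s *\<^sub>R v i"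
    unfolding eigenvalues_le_def by blast
  obtain s where v: "s \<le> t" "T (v 0) = s *\<^sub>R v 0" using ev[of 0] \<open>1 \<le> k\<close> by auto
  have "norm (v 0) = 1" using orthonormal_norm[OF on] \<open>1 \<le> k\<close> by simp
  then have "\<bar>s\<bar> \<le> K" using K[of "v 0"] v(2) by simp
  then show ?thesis using v(1) by linarith
qed

lemma family_bounds:
  fixes Am :: "'k::finite \<Rightarrow> ell2 \<Rightarrow> ell2" and \<theta> :: "real^'p::finite \<Rightarrow> real^'k"
  assumes c: "\<And>m. compact_operator (Am m)"
  shows "\<exists>S\<ge>0. \<forall>y x. norm (\<Sum>m\<in>UNIV. (y $ m) *\<^sub>R Am m x) \<le> S * norm y * norm x"
proof -
  have "\<forall>m. \<exists>K. 0 < K \<and> (\<forall>x. norm (Am m x) \<le> K * norm x)"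
  proof
    fix m
    obtain K where "0 < K" "\<And>x. norm (Am m x) \<le> K * norm x" 
      using compact_operator_bounded[OF c[of m]] by blast
    then show "\<exists>K. 0 < K \<and> (\<forall>x. norm (Am m x) \<le> K * norm x)" by blast
  qed
  then obtain Ka where Ka: "\<forall>m. 0 < Ka m \<and> (\<forall>x. norm (Am m x) \<le> Ka m * norm x)" by (rule choice[THEN exE])
  have "norm (\<Sum>m\<in>UNIV. (y $ m) *\<^sub>R Am m x) \<le> (\<Sum>m\<in>UNIV. Ka m) * norm y * norm x" for y :: "real^'k" and x
  proof -
    have "norm (\<Sum>m\<in>UNIV. (y $ m) *\<^sub>R Am m x) \<le> (\<Sum>m\<in>UNIV. norm y * (Ka m * norm x))"
    proof (rule sum_norm_le)
      fix m
      have "\<bar>y $ m\<bar> * norm (Am m x) \<le> norm y * (Ka m * norm x)"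
        by (rule mult_mono) (use Ka component_le_norm_cart[of y m] in auto)
      then show "norm ((y $ m) *\<^sub>R Am m x) \<le> norm y * (Ka m * norm x)" by simp
    qed
    then show ?thesis by (simp add: sum_distrib_left sum_distrib_right mult_ac)
  qed
  moreover have "0 \<le> (\<Sum>m\<in>UNIV. Ka m)" using Ka by (intro sum_nonneg) (auto simp: less_imp_le)
  ultimately show ?thesis by blast
qed

lemma box_norm_le: "y \<in> box Am \<Longrightarrow> norm y \<le> (\<Sum>m\<in>UNIV. \<bar>box_lower Am m\<bar> + \<bar>box_upper Am m\<bar>)"
proof -
  assume y: "y \<in> box Am"
  have "norm y \<le> (\<Sum>m\<in>UNIV. \<bar>y $ m\<bar>)" by (rule norm_le_l1_cart)
  also have "\<dots> \<le> (\<Sum>m\<in>UNIV. \<bar>box_lower Am m\<bar> + \<bar>box_upper Am m\<bar>)"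
  proof (rule sum_mono)
    fix m
    have "box_lower Am m \<le> y $ m" "y $ m \<le> box_upper Am m" using y by (auto simp: box_def)
    then show "\<bar>y $ m\<bar> \<le> \<bar>box_lower Am m\<bar> + \<bar>box_upper Am m\<bar>" by linarith
  qed
  finally show ?thesis .
qed

lemma greedy_run_points:
  assumes "greedy_run Am \<theta> D l r P v V w" and j: "1 \<le> j"
  shows "finite (P j) \<and> P j \<subseteq> D \<and> P 1 \<subseteq> P j"
  using j
proof (induction j rule: dec_induct)
  case base
  then show ?case using assms(1) by (simp add: greedy_run_def)
next
  case (step j)
  have "\<exists>\<mu>'\<in>D. P (Suc j) = insert \<mu>' (P j)"
    using assms(1) step.hyps(1) unfolding greedy_run_def by blast
  then show ?case using step.IH by auto
qed

theorem theorem9: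
  fixes Am :: "'k::finite \<Rightarrow> ell2 \<Rightarrow> ell2"
    and \<theta> :: "real^'p::finite \<Rightarrow> real^'k"
    and D :: "(real^'p) set"
    and l r :: nat
    and \<zeta> :: real
  assumes "compact D"
    and "\<And>m. compact_operator (Am m)" and "\<And>m. self_adjoint (Am m)"
    and "\<And>m. real_analytic (\<lambda>\<mu>. \<theta> \<mu> $ m)"
    and "\<And>\<mu>. \<mu> \<in> D \<Longrightarrow> \<exists>t<0. is_eigenvalue (affine_family Am \<theta> \<mu>) t"
    and "1 \<le> r" and "r < l"
    and "\<And>\<mu>. \<mu> \<in> D \<Longrightarrow> \<exists>t. is_kth_eigenvalue (affine_family Am \<theta> \<mu>) (r + 1) t"
    and "(INF \<mu>\<in>D. kth_eigenvalue (affine_family Am \<theta> \<mu>) (r + 1))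
          - (SUP \<mu>\<in>D. kth_eigenvalue (affine_family Am \<theta> \<mu>) r) > 0"
    and "\<zeta> > 0"
  shows "\<exists>h\<^sub>0>0. \<forall>P v V w y \<Theta>.
    greedy_run Am \<theta> D l r P v V w \<longrightarrow>
    uniform_grid D h\<^sub>0 (P 1) \<longrightarrow>
    (\<forall>j\<ge>1. \<forall>\<mu>\<in>D. lp_vertex Am \<theta> l r (P j) v (V j) (w j) \<mu> (y j \<mu>) (\<Theta> j \<mu>)) \<longrightarrow>
    (\<forall>j\<ge>1. \<forall>\<mu>\<in>D. sigma_min (\<Theta> j \<mu>) > \<zeta>) \<longrightarrow>
    (\<exists>\<gamma>>0. \<forall>j\<ge>1. \<forall>\<mu>\<in>D. \<forall>\<mu>'\<in>D.
      \<bar>gap_H Am \<theta> l r (P j) v (V j) (w j) \<mu>' - gap_H Am \<theta> l r (P j) v (V j) (w j) \<mu>\<bar>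
        \<le> \<gamma> * norm (\<mu>' - \<mu>))"
proof -
  let ?A = "affine_family Am \<theta>"
  obtain Lt where Lt: "0 \<le> Lt" "\<And>\<mu> \<mu>'. \<mu> \<in> D \<Longrightarrow> \<mu>' \<in> D \<Longrightarrow> norm (\<theta> \<mu> - \<theta> \<mu>') \<le> Lt * norm (\<mu> - \<mu>')"
    using real_analytic_vec_lipschitz[of \<theta>, OF assms(4,1)] by blast
  obtain Kt where Kt: "0 \<le> Kt" "\<And>\<mu>. \<mu> \<in> D \<Longrightarrow> norm (\<theta> \<mu>) \<le> Kt"
  proof -
    have "Lt-lipschitz_on D \<theta>" using Lt by (auto intro!: lipschitz_onI simp: dist_norm)
    from compact_imp_bounded[OF compact_continuous_image[OF lipschitz_on_continuous_on[OF this] assms(1)]]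
    obtain B where "\<forall>\<mu>\<in>D. norm (\<theta> \<mu>) \<le> B" unfolding bounded_iff by blast
    then show ?thesis by (intro that[of "\<bar>B\<bar>"]) (auto intro: order.trans)
  qed
  obtain S where S: "0 \<le> S" "\<And>y x. norm (\<Sum>m\<in>UNIV. (y $ m) *\<^sub>R Am m x) \<le> S * norm y * norm x"
    using family_bounds[of Am, OF assms(2)] by blast
  define K L Kb where "K = S * Kt" and "L = S * Lt"
    and "Kb = (\<Sum>m\<in>UNIV. \<bar>box_lower Am m\<bar> + \<bar>box_upper Am m\<bar>)"
  define \<alpha> \<beta> where "\<alpha> = (SUP \<mu>\<in>D. kth_eigenvalue (?A \<mu>) r)" and "\<beta> = (INF \<mu>\<in>D. kth_eigenvalue (?A \<mu>) (r + 1))"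
  have nonneg: "0 \<le> K" "0 \<le> L" "0 \<le> Kb"
    using S(1) Kt(1) Lt(1) by (simp_all add: K_def L_def Kb_def sum_nonneg)
  have A_le: "norm (?A \<mu> x) \<le> K * norm x" if "\<mu> \<in> D" for \<mu> x
  proof -
    have "norm (?A \<mu> x) \<le> S * norm (\<theta> \<mu>) * norm x" unfolding affine_family_def by (rule S(2))
    also have "\<dots> \<le> S * Kt * norm x" by (intro mult_right_mono mult_left_mono Kt(2) that S(1)) simp
    finally show ?thesis by (simp add: K_def)
  qed
  have A_lip: "norm (?A \<mu> x - ?A \<mu>' x) \<le> L * norm (\<mu> - \<mu>') * norm x" if "\<mu> \<in> D" "\<mu>' \<in> D" for \<mu> \<mu>' x
  proof -
    have "?A \<mu> x - ?A \<mu>' x = (\<Sum>m\<in>UNIV. ((\<theta> \<mu> - \<theta> \<mu>') $ m) *\<^sub>R Am m x)"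
      by (simp add: affine_family_def scaleR_left_diff_distrib sum_subtractf)
    also have "norm \<dots> \<le> S * norm (\<theta> \<mu> - \<theta> \<mu>') * norm x" by (rule S(2))
    also have "\<dots> \<le> S * (Lt * norm (\<mu> - \<mu>')) * norm x"
      by (intro mult_right_mono mult_left_mono Lt(2) that S(1)) simp
    finally show ?thesis by (simp add: L_def mult_ac)
  qed
  have A_op: "compact_operator (?A \<mu>)" "self_adjoint (?A \<mu>)" for \<mu>
  proof -
    show "compact_operator (?A \<mu>)"
      unfolding affine_family_def[abs_def] by (intro compact_operator_sum compact_operator_scaleR assms) simp
    show "self_adjoint (?A \<mu>)"
      unfolding self_adjoint_def affine_family_def
      by (simp add: cinner_sum_left cinner_sum_right cinner_scaleR_left cinner_scaleR_right self_adjoint_cinner[OF assms(3)])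
  qed
  have kth: "is_kth_eigenvalue (?A \<mu>) k (kth_eigenvalue (?A \<mu>) k)" if \<mu>: "\<mu> \<in> D" and "1 \<le> k" "k \<le> r + 1" for \<mu> k
    using assms(8)[OF \<mu>] is_kth_eigenvalue_below[OF A_op] that(2,3) by blast
  \<comment> \<open>Supremum and infimum over \<open>D\<close> are bounds because these eigenvalues
    lie between \<open>- K\<close> and 0.\<close>
  have below: "kth_eigenvalue (?A \<mu>) r \<le> \<alpha>" if "\<mu> \<in> D" for \<mu>
    unfolding \<alpha>_def
  proof (rule cSUP_upper[OF that bdd_aboveI2])
    show "kth_eigenvalue (?A \<mu>) r \<le> 0" if "\<mu> \<in> D" for \<mu>
      by (rule kth_eigenvalue_nonpos[OF A_op kth[OF that]]) (use assms(6) in auto)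
  qed
  have above: "\<beta> \<le> kth_eigenvalue (?A \<mu>) (Suc r)" if "\<mu> \<in> D" for \<mu>
  proof -
    have "bdd_below ((\<lambda>\<mu>. kth_eigenvalue (?A \<mu>) (r + 1)) ` D)"
    proof (rule bdd_belowI2)
      show "- K \<le> kth_eigenvalue (?A \<mu>) (r + 1)" if "\<mu> \<in> D" for \<mu>
        by (rule kth_eigenvalue_ge[OF kth[OF that] A_le[OF that]]) auto
    qed
    from cINF_lower[OF this that] show ?thesis by (simp add: \<beta>_def)
  qed
  interpret setting Am \<theta> D l r K L \<alpha> \<beta>
  proof
    show "\<alpha> < \<beta>" using assms(9) by (simp add: \<alpha>_def \<beta>_def)
  qed (use assms(2,3,6,7,8) nonneg A_le A_lip below above in auto)
  \<comment> \<open>The sum of the three costs in \<open>gap_lower\<close>; it also dominates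
    \<open>L\<close>, so the same grid serves the density required for the Ritz values.\<close>
  define c where "c = L + Lt * Kb + CP * K"
  have c: "0 \<le> c" "L \<le> c" using nonneg Lt(1) CP_nonneg by (simp_all add: c_def)
  \<comment> \<open>Every point has a grid point within \<open>h / 2\<close> in each coordinate,
    hence within \<open>CARD('p) * h / 2\<close> in norm, and \<open>c\<close> times this is at most
    half of the gap. The summand 1 keeps the denominator positive. No data of the run enter.\<close>
  define h where "h = (\<beta> - \<alpha>) / (c * real CARD('p) + 1)"
  have h: "0 < h" using gap c by (simp add: h_def add_nonneg_pos)
  have lipschitz: "\<exists>\<gamma>>0. \<forall>j\<ge>1. \<forall>\<mu>\<in>D. \<forall>\<mu>'\<in>D.
      \<bar>gap_H Am \<theta> l r (P j) v (V j) (w j) \<mu>' - gap_H Am \<theta> l r (P j) v (V j) (w j) \<mu>\<bar> \<le> \<gamma> * norm (\<mu>' - \<mu>)"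
    if gr: "greedy_run Am \<theta> D l r P v V w" and grid: "uniform_grid D h (P 1)"
      and lp: "\<And>j \<mu>. 1 \<le> j \<Longrightarrow> \<mu> \<in> D \<Longrightarrow> lp_vertex Am \<theta> l r (P j) v (V j) (w j) \<mu> (y j \<mu>) (\<Theta> j \<mu>)"
    for P v V w y \<Theta>
  proof -
    note pts = greedy_run_points[OF gr]
    have fine: "\<exists>\<nu>\<in>P 1. c * norm (\<mu> - \<nu>) \<le> (\<beta> - \<alpha>) / 2" if \<mu>: "\<mu> \<in> D" for \<mu>
    proof -
      obtain \<nu> where \<nu>: "\<nu> \<in> P 1" "\<And>i. \<bar>\<mu> $ i - \<nu> $ i\<bar> \<le> h / 2"
        using grid \<mu> unfolding uniform_grid_def by blast
      have "norm (\<mu> - \<nu>) \<le> (\<Sum>i\<in>UNIV. \<bar>(\<mu> - \<nu>) $ i\<bar>)" by (rule norm_le_l1_cart)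
      also have "\<dots> \<le> (\<Sum>i\<in>(UNIV :: 'p set). h / 2)" by (rule sum_mono) (use \<nu>(2) in simp)
      also have "\<dots> = real CARD('p) * h / 2" by simp
      finally have "c * norm (\<mu> - \<nu>) \<le> c * (real CARD('p) * h / 2)" by (rule mult_left_mono[OF _ c(1)])
      also have "\<dots> \<le> (c * real CARD('p) + 1) * h / 2" using h by (simp add: algebra_simps)
      also have "\<dots> = (\<beta> - \<alpha>) / 2"
      proof -
        have "0 < c * real CARD('p) + 1" using c(1) by (simp add: add_nonneg_pos)
        then show ?thesis by (simp add: h_def)
      qed
      finally show ?thesis using \<nu>(1) by blast
    qed
    have sample: "\<And>j \<nu>. 1 \<le> j \<Longrightarrow> \<nu> \<in> P j \<Longrightarrow> (\<exists>t. is_kth_eigenvalue (?A \<nu>) (l + 1) t) \<and> eigenbasis (?A \<nu>) l (v \<nu>)"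
      and trial: "\<And>j. 1 \<le> j \<Longrightarrow> trial_basis l (P j) v (V j)"
      and ritz: "\<And>j \<mu>. 1 \<le> j \<Longrightarrow> \<mu> \<in> D \<Longrightarrow> mat_eigenbasis (ritz_matrix Am \<theta> l (P j) v (V j) \<mu>) r (w j \<mu>)"
      and next_point: "\<And>j. 1 \<le> j \<Longrightarrow> \<exists>\<mu>'\<in>D.
        (\<forall>\<mu>\<in>D. gap_H Am \<theta> l r (P j) v (V j) (w j) \<mu> \<le> gap_H Am \<theta> l r (P j) v (V j) (w j) \<mu>') \<and>
        P (Suc j) = insert \<mu>' (P j)"
      using gr unfolding greedy_run_def by blast+
    have "run Am \<theta> D l r K L \<alpha> \<beta> P v V w Lt Kt Kb"
    proof (rule run.intro[OF setting_axioms], rule run_axioms.intro)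
      fix j :: nat assume j: "1 \<le> j"
      show "lp_level Am \<theta> D l r K L \<alpha> \<beta> (P j) v (V j) (w j) Lt Kt Kb"
      proof (rule lp_level.intro)
        show "level Am \<theta> D l r K L \<alpha> \<beta> (P j) v (V j) (w j)"
        proof (rule level.intro[OF setting_axioms], rule level_axioms.intro)
          show "\<exists>\<nu>\<in>P j. L * norm (\<mu> - \<nu>) \<le> (\<beta> - \<alpha>) / 2" if "\<mu> \<in> D" for \<mu>
          proof -
            from fine[OF that] obtain \<nu> where "\<nu> \<in> P 1" "c * norm (\<mu> - \<nu>) \<le> (\<beta> - \<alpha>) / 2" by blast
            moreover have "L * norm (\<mu> - \<nu>) \<le> c * norm (\<mu> - \<nu>)" by (rule mult_right_mono[OF c(2)]) simp
            ultimately show ?thesis using pts[OF j] by (meson order.trans subsetD)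
          qed
        qed (use pts[OF j] sample[OF j] trial[OF j] ritz[OF j] in auto)
        show "lp_level_axioms Am \<theta> D l r K L \<alpha> \<beta> (P j) v (V j) (w j) Lt Kt Kb"
        proof
          show "\<exists>y\<in>Y_LB Am \<theta> l r (P j) v (V j) (w j) \<mu>. \<forall>y'\<in>Y_LB Am \<theta> l r (P j) v (V j) (w j) \<mu>. \<theta> \<mu> \<bullet> y \<le> \<theta> \<mu> \<bullet> y'"
            if "\<mu> \<in> D" for \<mu>
            using lp[OF j that] unfolding lp_vertex_def by blast
          show "\<exists>\<nu>\<in>P j. (L + Lt * Kb + CP * K) * norm (\<mu> - \<nu>) \<le> (\<beta> - \<alpha>) / 2" if "\<mu> \<in> D" for \<mu>
            using fine[OF that] pts[OF j] unfolding c_def by blast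
          show "norm y \<le> Kb" if "y \<in> box Am" for y
            unfolding Kb_def by (rule box_norm_le[OF that])
        qed (use Lt Kt in auto)
      qed
      show "P j \<subseteq> P (Suc j)" using next_point[OF j] by auto
      show "\<exists>\<mu>'\<in>D \<inter> P (Suc j).
          \<forall>\<mu>\<in>D. gap_H Am \<theta> l r (P j) v (V j) (w j) \<mu> \<le> gap_H Am \<theta> l r (P j) v (V j) (w j) \<mu>'"
        using next_point[OF j] by auto
    qed (rule assms(1))
    then show ?thesis by (rule run.gap_lipschitz)
  qed
  show ?thesis
  proof (rule exI[of _ h], intro conjI allI impI h)
    fix P v V w y \<Theta>
    assume gr: "greedy_run Am \<theta> D l r P v V w" and grid: "uniform_grid D h (P 1)"
      and "\<forall>j\<ge>1. \<forall>\<mu>\<in>D. lp_vertex Am \<theta> l r (P j) v (V j) (w j) \<mu> (y j \<mu>) (\<Theta> j \<mu>)"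
    then have lp: "\<And>j \<mu>. 1 \<le> j \<Longrightarrow> \<mu> \<in> D \<Longrightarrow>
        lp_vertex Am \<theta> l r (P j) v (V j) (w j) \<mu> (y j \<mu>) (\<Theta> j \<mu>)" by blast
    show "\<exists>\<gamma>>0. \<forall>j\<ge>1. \<forall>\<mu>\<in>D. \<forall>\<mu>'\<in>D.
      \<bar>gap_H Am \<theta> l r (P j) v (V j) (w j) \<mu>' - gap_H Am \<theta> l r (P j) v (V j) (w j) \<mu>\<bar> \<le> \<gamma> * norm (\<mu>' - \<mu>)"
      by (rule lipschitz[OF gr grid lp])
  qed
qed

end
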